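(* Let $1<p,q<\infty$ and $-1<\gamma<\infty$, and let $\omega$ be a radial weight. Let $p',q'$ be the conjugate exponents of $p,q$, and let $$\sigma=\sigma_{v_\gamma,\omega,p}=\left(\frac{v_\gamma}{\omega^{1/p}}\right)^{p'}=\frac{v_\gamma^{\frac{p}{p-1}}}{\omega^{\frac1{p-1}}}.$$ Then the following statements are equivalent: (i) $P_\gamma:L^q_p(\omega)\to AL^q_p(\omega)$ is bounded; (ii) $P^+_\gamma:L^q_p(\omega)\to L^q_p(\omega)$ is bounded; (iii) $\displaystyle D_p(\gamma,\omega)=\sup_{n\in\mathbb{N}\cup\{0\}}\frac{(\omega_{np+1})^{\frac1p}(\sigma_{np'+1})^{\frac1{p'}}}{\gamma_{2n+1}}<\infty$; (iv) the Bekoll\'e-Bonami type condition $$B_p(\gamma,\omega)=\sup_{0\le r<1}\frac{\left(\int_r^1\omega(t)t\,dt\right)^{\frac1p}\left(\int_r^1\sigma(t)t\,dt\right)^{\frac1{p'}}}{\int_r^1v_\gamma(t)t\,dt}<\infty$$ holds; (v) $(AL^q_p(\omega))^\star\simeq AL^{q'}_{p'}(\sigma)$ via the $A^2_\gamma$-pairing with equivalence of norms; (vi) $(AT^q_p(\omega))^\star\simeq AT^{q'}_{p'}(\sigma)$ via the $A^2_\gamma$-pairing with equivalence of norms; (vii) $P_\gamma:T^q_p(\omega)\to AT^q_p(\omega)$ is bounded.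
   Context: $\mathbb{D}$ is the open unit disc, $\mathbb{T}=\partial\mathbb{D}$, $\mathcal{H}(\mathbb{D})$ is the space of analytic functions in $\mathbb{D}$, and $dA=\frac{dx\,dy}{\pi}$. A weight is a function $\omega:\mathbb{D}\to[0,\infty)$ integrable over $\mathbb{D}$; it is radial if $\omega(z)=\omega(|z|)$ for all $z\in\mathbb{D}$. Throughout, it is assumed that $\widehat{\omega}(z)=\int_{|z|}^1\omega(s)\,ds>0$ for all $z\in\mathbb{D}$. For $-1<\gamma<\infty$, $v_\gamma(z)=(\gamma+1)(1-|z|^2)^\gamma$ is the standard radial weight, and $L^1_\gamma=\{f:\int_{\mathbb{D}}|f|v_\gamma\,dA<\infty\}$. For $f\in L^1_\gamma$ and $z\in\mathbb{D}$, $$P_\gamma(f)(z)=(\gamma+1)\int_{\mathbb{D}}\frac{f(\zeta)}{(1-\overline{\zeta}z)^{2+\gamma}}(1-|\zeta|^2)^\gamma\,dA(\zeta),\quad P^+_\gamma(f)(z)=(\gamma+1)\int_{\mathbb{D}}\frac{f(\zeta)}{|1-\overline{\zeta}z|^{2+\gamma}}(1-|\zeta|^2)^\gamma\,dA(\zeta).$$ Moments: $\omega_x=\int_0^1r^x\omega(r)\,dr$, similarly $\sigma_x=\int_0^1r^x\sigma(r)\,dr$, and $\gamma_x=\int_0^1r^xv_\gamma(r)\,dr$. For $\xi\in\overline{\mathbb{D}}$, $\Gamma(\xi)=\{z\in\mathbb{D}:|\arg z-\arg\xi|<|\xi|-|z|\}$ (difference of arguments modulo $2\pi$). For $0<p,q<\infty$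 and a nonnegative radial function $\nu$ on $\mathbb{D}$ (in particular $\nu=\omega$ or $\nu=\sigma$), $L^q_p(\nu)$ and $T^q_p(\nu)$ consist of the complex-valued measurable functions $f$ on $\mathbb{D}$ such that, respectively, $$\|f\|_{L^q_p(\nu)}=\left(\frac1{2\pi}\int_0^{2\pi}\left(\int_0^1|f(re^{i\theta})|^p\nu(r)r\,dr\right)^{q/p}d\theta\right)^{1/q}<\infty,$$ $$\|f\|_{T^q_p(\nu)}=\left(\int_{\mathbb{T}}\left(\int_{\Gamma(\xi)}|f(z)|^p\nu(z)\frac{dA(z)}{1-|z|}\right)^{q/p}|d\xi|\right)^{1/q}<\infty.$$ Set $AL^q_p(\nu)=L^q_p(\nu)\cap\mathcal{H}(\mathbb{D})$ and $AT^q_p(\nu)=T^q_p(\nu)\cap\mathcal{H}(\mathbb{D})$, with the inherited norms. The $A^2_\gamma$-pairing is $\langle f,g\rangle_{A^2_\gamma}=\int_{\mathbb{D}}f\,\overline{g}\,v_\gamma\,dA$. For a space $X$ of analytic functions, $X^\star$ is its dual, and $X^\star\simeq Y$ via the $A^2_\gamma$-pairing with equivalence of norms means that the bounded linear functionals on $X$ are precisely the functionals $L_g(f)=\langle f,g\rangle_{A^2_\gamma}$ with $g\in Y$, and $\|L_g\|_{X^\star}$ and $\|g\|_Y$ are comparable. *)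

theory Defs
  imports "HOL-Analysis.Analysis"
begin

text \<open>
  Functions on the unit disc are total functions on \<^typ>\<open>complex\<close>; only their values on
  \<open>ball 0 1\<close> matter. Norms are extended nonnegative reals, so that membership in a space is
  finiteness of the norm. "Measurable" means Lebesgue measurable.
\<close>

abbreviation unit_disc :: "complex set" where
  "unit_disc \<equiv> ball 0 1"

text \<open>The normalised area measure \<open>dx dy / \<pi>\<close> on the disc.\<close>

definition dA :: "complex measure" where
  "dA = density (lebesgue_on unit_disc) (\<lambda>_. ennreal (1 / pi))"

text \<open>Powers with a positive exponent only: the case of infinite base would be wrong otherwise.\<close>

definition epowr :: "ennreal \<Rightarrow> real \<Rightarrow> ennreal" where
  "epowr x a = (if x = \<infinity> then \<infinity> else ennreal (enn2real x powr a))"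

definition conj_exponent :: "real \<Rightarrow> real" where
  "conj_exponent p = p / (p - 1)"

definition weight :: "(complex \<Rightarrow> real) \<Rightarrow> bool" where
  "weight \<omega> \<longleftrightarrow> (\<forall>z\<in>unit_disc. 0 \<le> \<omega> z) \<and> integrable dA \<omega>"

definition radial :: "(complex \<Rightarrow> real) \<Rightarrow> bool" where
  "radial \<omega> \<longleftrightarrow> (\<forall>z\<in>unit_disc. \<omega> z = \<omega> (of_real (cmod z)))"

definition weight_tail :: "(complex \<Rightarrow> real) \<Rightarrow> complex \<Rightarrow> ennreal" where
  "weight_tail \<omega> z = (\<integral>\<^sup>+s\<in>{cmod z..<1}. ennreal (\<omega> (of_real s)) \<partial>lebesgue)"

definition std_weight :: "real \<Rightarrow> complex \<Rightarrow> real" where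
  "std_weight \<gamma> z = (\<gamma> + 1) * (1 - (cmod z)\<^sup>2) powr \<gamma>"

text \<open>
  The dual weight takes extended values: it is \<open>\<infinity>\<close>, not \<open>0\<close>, where \<open>\<omega>\<close> vanishes.
\<close>

definition dual_weight :: "real \<Rightarrow> (complex \<Rightarrow> real) \<Rightarrow> real \<Rightarrow> complex \<Rightarrow> ennreal" where
  "dual_weight \<gamma> \<omega> p z =
     epowr (ennreal (std_weight \<gamma> z) / ennreal (\<omega> z powr (1 / p))) (conj_exponent p)"

definition moment :: "(complex \<Rightarrow> ennreal) \<Rightarrow> real \<Rightarrow> ennreal" where
  "moment \<nu> x = (\<integral>\<^sup>+r\<in>{0..<1}. ennreal (r powr x) * \<nu> (of_real r) \<partial>lebesgue)"

definition D_const :: "real \<Rightarrow> real \<Rightarrow> (complex \<Rightarrow> real) \<Rightarrow> ennreal" where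
  "D_const p \<gamma> \<omega> =
     (SUP n::nat.
        epowr (moment (\<lambda>z. ennreal (\<omega> z)) (real n * p + 1)) (1 / p)
        * epowr (moment (dual_weight \<gamma> \<omega> p) (real n * conj_exponent p + 1)) (1 / conj_exponent p)
        / moment (\<lambda>z. ennreal (std_weight \<gamma> z)) (2 * real n + 1))"

definition radial_tail :: "(complex \<Rightarrow> ennreal) \<Rightarrow> real \<Rightarrow> ennreal" where
  "radial_tail \<nu> r = (\<integral>\<^sup>+t\<in>{r..<1}. \<nu> (of_real t) * ennreal t \<partial>lebesgue)"

definition B_const :: "real \<Rightarrow> real \<Rightarrow> (complex \<Rightarrow> real) \<Rightarrow> ennreal" where
  "B_const p \<gamma> \<omega> =
     (SUP r\<in>{0..<1}.
        epowr (radial_tail (\<lambda>z. ennreal (\<omega> z)) r) (1 / p)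
        * epowr (radial_tail (dual_weight \<gamma> \<omega> p) r) (1 / conj_exponent p)
        / radial_tail (\<lambda>z. ennreal (std_weight \<gamma> z)) r)"

text \<open>
  Arguments are compared modulo \<open>2 \<pi>\<close>. The library sets \<open>Arg 0 = 0\<close>, which affects the region
  in at most the single point \<open>0\<close> when \<open>\<xi> \<noteq> 0\<close>.
\<close>

definition tent_region :: "complex \<Rightarrow> complex set" where
  "tent_region \<xi> =
     {z \<in> unit_disc. \<exists>k::int. \<bar>Arg z - Arg \<xi> + 2 * pi * of_int k\<bar> < cmod \<xi> - cmod z}"

text \<open>In the norms and spaces below, \<open>p\<close> is the inner (lower) and \<open>q\<close> the outer (upper) index.\<close>

definition L_norm :: "real \<Rightarrow> real \<Rightarrow> (complex \<Rightarrow> ennreal) \<Rightarrow> (complex \<Rightarrow> complex) \<Rightarrow> ennreal" where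
  "L_norm p q \<nu> f =
     epowr
       (ennreal (1 / (2 * pi)) *
        (\<integral>\<^sup>+\<theta>\<in>{0..2 * pi}.
           epowr (\<integral>\<^sup>+r\<in>{0..<1}. ennreal (cmod (f (of_real r * cis \<theta>)) powr p)
                     * \<nu> (of_real r) * ennreal r \<partial>lebesgue) (q / p) \<partial>lebesgue))
       (1 / q)"

definition T_norm :: "real \<Rightarrow> real \<Rightarrow> (complex \<Rightarrow> ennreal) \<Rightarrow> (complex \<Rightarrow> complex) \<Rightarrow> ennreal" where
  "T_norm p q \<nu> f =
     epowr
       (\<integral>\<^sup>+\<theta>\<in>{0..2 * pi}.
           epowr (\<integral>\<^sup>+z\<in>tent_region (cis \<theta>). ennreal (cmod (f z) powr p)
                     * \<nu> z / ennreal (1 - cmod z) \<partial>dA) (q / p) \<partial>lebesgue)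
       (1 / q)"

definition L_space :: "real \<Rightarrow> real \<Rightarrow> (complex \<Rightarrow> ennreal) \<Rightarrow> (complex \<Rightarrow> complex) set" where
  "L_space p q \<nu> = {f \<in> borel_measurable (lebesgue_on unit_disc). L_norm p q \<nu> f < \<infinity>}"

definition T_space :: "real \<Rightarrow> real \<Rightarrow> (complex \<Rightarrow> ennreal) \<Rightarrow> (complex \<Rightarrow> complex) set" where
  "T_space p q \<nu> = {f \<in> borel_measurable (lebesgue_on unit_disc). T_norm p q \<nu> f < \<infinity>}"

definition AL_space :: "real \<Rightarrow> real \<Rightarrow> (complex \<Rightarrow> ennreal) \<Rightarrow> (complex \<Rightarrow> complex) set" where
  "AL_space p q \<nu> = L_space p q \<nu> \<inter> {f. f holomorphic_on unit_disc}"

definition AT_space :: "real \<Rightarrow> real \<Rightarrow> (complex \<Rightarrow> ennreal) \<Rightarrow> (complex \<Rightarrow> complex) set" where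
  "AT_space p q \<nu> = T_space p q \<nu> \<inter> {f. f holomorphic_on unit_disc}"

definition L1_space :: "real \<Rightarrow> (complex \<Rightarrow> complex) set" where
  "L1_space \<gamma> = {f \<in> borel_measurable (lebesgue_on unit_disc).
     (\<integral>\<^sup>+z. ennreal (cmod (f z) * std_weight \<gamma> z) \<partial>dA) < \<infinity>}"

text \<open>
  The complex power is the principal branch, which is analytic on the right half-plane, where
  \<open>1 - cnj \<zeta> * z\<close> lies for \<open>\<zeta>\<close> and \<open>z\<close> in the disc.
\<close>

definition Bergman_proj :: "real \<Rightarrow> (complex \<Rightarrow> complex) \<Rightarrow> complex \<Rightarrow> complex" where
  "Bergman_proj \<gamma> f z =
     of_real (\<gamma> + 1) *
     (\<integral>\<zeta>. f \<zeta> / (1 - cnj \<zeta> * z) powr of_real (2 + \<gamma>)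
           * of_real ((1 - (cmod \<zeta>)\<^sup>2) powr \<gamma>) \<partial>dA)"

definition max_Bergman_proj :: "real \<Rightarrow> (complex \<Rightarrow> complex) \<Rightarrow> complex \<Rightarrow> complex" where
  "max_Bergman_proj \<gamma> f z =
     of_real (\<gamma> + 1) *
     (\<integral>\<zeta>. f \<zeta> / of_real (cmod (1 - cnj \<zeta> * z) powr (2 + \<gamma>))
           * of_real ((1 - (cmod \<zeta>)\<^sup>2) powr \<gamma>) \<partial>dA)"

text \<open>
  Boundedness of an integral operator \<open>T\<close> whose natural domain is \<open>L1_space \<gamma>\<close>. The inclusion
  of \<open>X\<close> in that domain is part of the definition: outside it the Bochner integrals defining the
  operator would silently take the value \<open>0\<close>.
\<close>

definition bounded_operator ::
  "real \<Rightarrow> ((complex \<Rightarrow> complex) \<Rightarrow> complex \<Rightarrow> complex)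
   \<Rightarrow> (complex \<Rightarrow> complex) set \<Rightarrow> ((complex \<Rightarrow> complex) \<Rightarrow> ennreal)
   \<Rightarrow> (complex \<Rightarrow> complex) set \<Rightarrow> ((complex \<Rightarrow> complex) \<Rightarrow> ennreal) \<Rightarrow> bool" where
  "bounded_operator \<gamma> T X normX Y normY \<longleftrightarrow>
     X \<subseteq> L1_space \<gamma> \<and> (\<forall>f\<in>X. T f \<in> Y) \<and>
     (\<exists>C::real. \<forall>f\<in>X. normY (T f) \<le> ennreal C * normX f)"

definition pairing :: "real \<Rightarrow> (complex \<Rightarrow> complex) \<Rightarrow> (complex \<Rightarrow> complex) \<Rightarrow> complex" where
  "pairing \<gamma> f g = (\<integral>z. f z * cnj (g z) * of_real (std_weight \<gamma> z) \<partial>dA)"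

definition bounded_functional ::
  "(complex \<Rightarrow> complex) set \<Rightarrow> ((complex \<Rightarrow> complex) \<Rightarrow> ennreal)
   \<Rightarrow> ((complex \<Rightarrow> complex) \<Rightarrow> complex) \<Rightarrow> bool" where
  "bounded_functional X normX L \<longleftrightarrow>
     (\<forall>f\<in>X. \<forall>g\<in>X. L (\<lambda>z. f z + g z) = L f + L g) \<and>
     (\<forall>c. \<forall>f\<in>X. L (\<lambda>z. c * f z) = c * L f) \<and>
     (\<exists>C::real. \<forall>f\<in>X. ennreal (cmod (L f)) \<le> ennreal C * normX f)"

definition functional_norm ::
  "(complex \<Rightarrow> complex) set \<Rightarrow> ((complex \<Rightarrow> complex) \<Rightarrow> ennreal)
   \<Rightarrow> ((complex \<Rightarrow> complex) \<Rightarrow> complex) \<Rightarrow> ennreal" where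
  "functional_norm X normX L = (SUP f\<in>{f \<in> X. normX f \<le> 1}. ennreal (cmod (L f)))"

text \<open>
  \<open>X\<^sup>\<star> \<simeq> Y\<close> via the pairing, with equivalence of norms. The first conjunct says that the pairing
  converges absolutely on \<open>X \<times> Y\<close>, so that the functionals \<open>pairing \<gamma> _ g\<close> are meaningful.
\<close>

definition dual_via_pairing ::
  "real \<Rightarrow> (complex \<Rightarrow> complex) set \<Rightarrow> ((complex \<Rightarrow> complex) \<Rightarrow> ennreal)
   \<Rightarrow> (complex \<Rightarrow> complex) set \<Rightarrow> ((complex \<Rightarrow> complex) \<Rightarrow> ennreal) \<Rightarrow> bool" where
  "dual_via_pairing \<gamma> X normX Y normY \<longleftrightarrow>
     (\<forall>f\<in>X. \<forall>g\<in>Y. integrable dA (\<lambda>z. f z * cnj (g z) * of_real (std_weight \<gamma> z))) \<and>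
     (\<forall>g\<in>Y. bounded_functional X normX (\<lambda>f. pairing \<gamma> f g)) \<and>
     (\<forall>L. bounded_functional X normX L \<longrightarrow> (\<exists>g\<in>Y. \<forall>f\<in>X. L f = pairing \<gamma> f g)) \<and>
     (\<exists>C::real. \<forall>g\<in>Y.
        functional_norm X normX (\<lambda>f. pairing \<gamma> f g) \<le> ennreal C * normY g \<and>
        normY g \<le> ennreal C * functional_norm X normX (\<lambda>f. pairing \<gamma> f g))"

definition all_equivalent :: "bool list \<Rightarrow> bool" where
  "all_equivalent Ps \<longleftrightarrow> (\<forall>P\<in>set Ps. \<forall>Q\<in>set Ps. P \<longleftrightarrow> Q)"

end

theory Submission
  imports Defs "HOL-Complex_Analysis.Complex_Analysis"
begin

text \<open>
  Every norm is written in polar coordinates as an iterated \<open>L\<^sup>q(L\<^sup>p)\<close> norm with extended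
  nonnegative values. Testing \<open>P\<^sub>\<gamma>\<close> on functions \<open>h(r) e\<^sup>i\<^sup>n\<^sup>\<theta>\<close>, or the duality on Taylor
  coefficient functionals, gives the moment condition; since \<open>r\<^sup>n\<close> is comparable with 1 for
  \<open>1 - r < 1/(2n)\<close>, that condition implies the Bekolle-Bonami condition. Conversely, the latter yields
  reverse doubling of the tails of both weights. After a dyadic decomposition of the radius the maximal
  operator \<open>P\<^sub>\<gamma>\<^sup>+\<close> is then dominated by geometrically decaying shifts in the radius combined with
  averages over arcs, which are controlled by the maximal function on the circle. On a tent, \<open>P\<^sub>\<gamma>\<^sup>+ f\<close>
  is comparable with its value on the axis, so the tent norm and the \<open>L\<^sup>q(L\<^sup>p)\<close> norm agree on analytic
  functions, which satisfy \<open>f = P\<^sub>\<gamma> f\<close>. A functional is represented by the power series built from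
  its values on monomials, whose norm is estimated by testing against \<open>P\<^sub>\<gamma> h\<close> with \<open>h\<close> supported in
  a smaller disc.
\<close>

text \<open>With different inner and outer exponents a Schur test on the disc does not reach the
  norm. For \<open>p \<le> q\<close> the p-th power of the inner norm is tested against functions of
  the angle in the dual of L^(q/p): the angular kernel then falls on the test function, where the
  scalar maximal theorem suffices. The case q < p follows by duality, since the model kernel is
  symmetric. The radial sum converges because of a factor l^|j-k|. Hoelder bounds the standard mass
  of one dyadic interval by the masses of both weights there, and the Bekolle-Bonami condition
  bounds the product of the tails by the same quantity, so a fixed share of each tail sits in its
  first interval. The dual weight may be infinite and finiteness of most norms is a conclusion, so
  the computations run in [0,\<infinity>] and the converse of Hoelder's inequality is applied to
  bounded truncations. In the duality, density of polynomials is replaced by cutting f at a radius R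
  < 1: the projection of the inner part has coefficients of order R^n times a power of n, and that
  of the outer part is small by dominated convergence.\<close>

abbreviation "borel_fun \<equiv> borel_measurable borel"

section \<open>Mixed norms of extended nonnegative functions\<close>

lemma epowr_ennreal: "0 \<le> x \<Longrightarrow> epowr (ennreal x) a = ennreal (x powr a)"
  by (simp add: epowr_def)

lemma epowr_top [simp]: "epowr top a = top"
  by (simp add: epowr_def)

lemma epowr_0 [simp]: "epowr 0 a = 0"
  by (simp add: epowr_def)

lemma epowr_eq_0_iff [simp]: "epowr x a = 0 \<longleftrightarrow> x = 0"
  by (cases x) (auto simp: epowr_def ennreal_eq_0_iff order_antisym_conv)

lemma epowr_eq_top_iff [simp]: "epowr x a = top \<longleftrightarrow> x = top"
  by (cases x) (auto simp: epowr_def)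

lemma epowr_less_top_iff [simp]: "epowr x a < top \<longleftrightarrow> x < top"
  by (simp add: less_top[symmetric])

lemma epowr_one [simp]: "epowr x 1 = x"
  by (cases x) (auto simp: epowr_def)

lemma epowr_of_one [simp]: "epowr 1 a = 1"
  by (simp add: epowr_def)

text \<open>For every sign of the exponent the power is 0 at 0 and \<infinity> at \<infinity>, so
  both sides follow the convention 0 * \<infinity> = 0.\<close>

lemma epowr_mult: "epowr (x * y) a = epowr x a * epowr y a"
proof (cases x; cases y)
  fix r s assume "x = ennreal r" "0 \<le> r" "y = ennreal s" "0 \<le> s"
  then show ?thesis
    by (simp add: epowr_ennreal powr_mult flip: ennreal_mult)
next
  fix r assume "x = ennreal r" "0 \<le> r" "y = top"
  then show ?thesis by (cases "r = 0") (auto simp: ennreal_mult_top)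
next
  fix r assume "y = ennreal r" "0 \<le> r" "x = top"
  then show ?thesis by (cases "r = 0") (auto simp: ennreal_top_mult)
qed auto

lemma epowr_epowr: "epowr (epowr x a) b = epowr x (a * b)"
  by (cases x) (auto simp: epowr_ennreal powr_powr)

text \<open>This covers exponents of opposite sign, again because the powers of 0 and \<infinity>
  are 0 and \<infinity>. The extremal function for the mixed norm contains the exponent q - p, which
  may be negative.\<close>

lemma epowr_add: "epowr x (a + b) = epowr x a * epowr x b"
  by (cases x) (auto simp: epowr_ennreal powr_add simp flip: ennreal_mult)

lemma epowr_mono: "0 \<le> a \<Longrightarrow> x \<le> y \<Longrightarrow> epowr x a \<le> epowr y a"
  by (cases x; cases y) (auto simp: epowr_ennreal top_unique intro!: ennreal_leI powr_mono2)

lemma epowr_measurable [measurable]: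
  assumes [measurable]: "f \<in> borel_measurable M"
  shows "(\<lambda>x. epowr (f x) a) \<in> borel_measurable M"
proof -
  have [measurable]: "{x \<in> space M. f x = \<infinity>} \<in> sets M"
    using measurable_sets[OF assms, of "{\<infinity>}"] by (simp add: vimage_def Int_def conj_commute)
  show ?thesis unfolding epowr_def by measurable
qed

lemma epowr_inverse: "a \<noteq> 0 \<Longrightarrow> epowr (epowr x a) (1 / a) = x"
  "a \<noteq> 0 \<Longrightarrow> epowr (epowr x (1 / a)) a = x"
  by (simp_all add: epowr_epowr)

lemma epowr_le_iff: "0 < a \<Longrightarrow> epowr x a \<le> y \<longleftrightarrow> x \<le> epowr y (1 / a)"
  using epowr_mono[of "1 / a" "epowr x a" y] epowr_mono[of a x "epowr y (1 / a)"]
  by (auto simp: epowr_inverse)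

text \<open>By \<open>epowr_le_iff\<close> a positive power is an order isomorphism of
  [0,\<infinity>], and such maps commute with suprema.\<close>

lemma epowr_SUP:
  assumes "0 < a"
  shows "epowr (SUP i\<in>I. f i) a = (SUP i\<in>I. epowr (f i) a)"
proof (rule antisym)
  have "f i \<le> epowr (SUP i\<in>I. epowr (f i) a) (1 / a)" if "i \<in> I" for i
    using that assms by (subst epowr_le_iff[symmetric]) (auto intro: SUP_upper)
  then show "epowr (SUP i\<in>I. f i) a \<le> (SUP i\<in>I. epowr (f i) a)"
    using assms by (subst epowr_le_iff) (auto intro: SUP_least)
  show "(SUP i\<in>I. epowr (f i) a) \<le> epowr (SUP i\<in>I. f i) a"
    using assms by (intro SUP_least epowr_mono) (auto intro: SUP_upper)
qed

lemma conj_exponent: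
  assumes "1 < p"
  shows conj_exponent_gt_1: "1 < conj_exponent p"
    and conj_exponent_inverse: "1 / p + 1 / conj_exponent p = 1"
    and conj_exponent_conj: "conj_exponent (conj_exponent p) = p"
    and conj_exponent_mult: "(p - 1) * conj_exponent p = p"
    and conj_exponent_div: "p / conj_exponent p = p - 1"
  using assms by (auto simp: conj_exponent_def field_simps)

lemma Youngs_ennreal:
  assumes "1 < p"
  shows "x * y \<le> ennreal (1 / p) * epowr x p + ennreal (1 / conj_exponent p) * epowr y (conj_exponent p)"
    (is "_ \<le> ?R")
proof (cases x; cases y)
  fix r s assume *: "x = ennreal r" "0 \<le> r" "y = ennreal s" "0 \<le> s"
  have "r * s \<le> r powr p / p + s powr conj_exponent p / conj_exponent p"
    using * assms conj_exponent[OF assms] by (intro Youngs_inequality) auto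
  then have "ennreal (r * s) \<le> ennreal (1 / p * r powr p + 1 / conj_exponent p * s powr conj_exponent p)"
    by (intro ennreal_leI) simp
  also have "\<dots> = ?R"
    using * assms conj_exponent_gt_1[OF assms]
    by (subst ennreal_plus) (auto simp: epowr_ennreal simp flip: ennreal_mult)
  finally show ?thesis using * by (simp add: ennreal_mult)
qed (use assms conj_exponent_gt_1[OF assms] in \<open>auto simp: ennreal_mult_top\<close>)

section \<open>L^p norms with values in [0,\<infinity>] and Hoelder's inequality\<close>

definition elp :: "'a measure \<Rightarrow> real \<Rightarrow> ('a \<Rightarrow> ennreal) \<Rightarrow> ennreal" where
  "elp M p f = epowr (\<integral>\<^sup>+x. epowr (f x) p \<partial>M) (1 / p)"

lemma epowr_elp: "p \<noteq> 0 \<Longrightarrow> epowr (elp M p f) p = (\<integral>\<^sup>+x. epowr (f x) p \<partial>M)"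
  by (simp add: elp_def epowr_inverse)

lemma elp_mono_AE: "0 < p \<Longrightarrow> AE x in M. f x \<le> g x \<Longrightarrow> elp M p f \<le> elp M p g"
  unfolding elp_def by (intro epowr_mono nn_integral_mono_AE) (auto elim!: eventually_mono intro: epowr_mono)

lemma elp_mono: "0 < p \<Longrightarrow> (\<And>x. x \<in> space M \<Longrightarrow> f x \<le> g x) \<Longrightarrow> elp M p f \<le> elp M p g"
  by (rule elp_mono_AE) auto

lemma elp_cong_AE: "AE x in M. f x = g x \<Longrightarrow> elp M p f = elp M p g"
  unfolding elp_def by (intro arg_cong2[where f=epowr] nn_integral_cong_AE) (auto elim!: eventually_mono)

lemma elp_cong: "(\<And>x. x \<in> space M \<Longrightarrow> f x = g x) \<Longrightarrow> elp M p f = elp M p g"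
  by (rule elp_cong_AE) auto

lemma elp_cmult:
  "p \<noteq> 0 \<Longrightarrow> f \<in> borel_measurable M \<Longrightarrow> elp M p (\<lambda>x. c * f x) = c * elp M p f"
  by (simp add: elp_def epowr_mult nn_integral_cmult epowr_inverse)

lemma elp_epowr: "elp M p (\<lambda>x. epowr (f x) a) = epowr (elp M (a * p) f) a" if "a \<noteq> 0"
  using that by (simp add: elp_def epowr_epowr)

lemma elp_SUP:
  assumes "0 < p" "incseq f" "\<And>i. f i \<in> borel_measurable M"
  shows "elp M p (\<lambda>x. SUP i. f i x) = (SUP i. elp M p (f i))"
proof -
  have "(\<integral>\<^sup>+x. (SUP i. epowr (f i x) p) \<partial>M) = (SUP i. \<integral>\<^sup>+x. epowr (f i x) p \<partial>M)"
    using assms by (intro nn_integral_monotone_convergence_SUP)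
      (auto simp: incseq_def le_fun_def intro: epowr_mono)
  then show ?thesis using assms by (simp add: elp_def epowr_SUP)
qed

lemma elp_eq_0_AE:
  assumes "elp M p f = 0" "f \<in> borel_measurable M"
  shows "AE x in M. f x = 0"
  using assms by (simp add: elp_def nn_integral_0_iff_AE)

lemma elp_Holder:
  assumes p: "1 < p" and [measurable]: "f \<in> borel_measurable M" "g \<in> borel_measurable M"
  shows "(\<integral>\<^sup>+x. f x * g x \<partial>M) \<le> elp M p f * elp M (conj_exponent p) g"
proof -
  let ?p' = "conj_exponent p"
  have p': "1 < ?p'" using conj_exponent_gt_1[OF p] .
  \<comment> \<open>A vanishing norm is split off first: the right-hand side is then 0 even if the
    other norm is infinite, and the product of the functions vanishes almost everywhere.\<close>
  show ?thesis
  proof (cases "elp M p f = 0 \<or> elp M ?p' g = 0")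
    case True
    then have "AE x in M. f x * g x = 0"
      using elp_eq_0_AE[of M p f] elp_eq_0_AE[of M ?p' g] by (auto elim!: eventually_mono)
    then have "(\<integral>\<^sup>+x. f x * g x \<partial>M) = (\<integral>\<^sup>+x. 0 \<partial>M)" by (intro nn_integral_cong_AE) auto
    then show ?thesis by simp
  next
    case nz: False
    show ?thesis
    proof (cases "elp M p f = top \<or> elp M ?p' g = top")
    case True
    then show ?thesis using nz by (auto simp: ennreal_mult_top ennreal_top_mult)
  next
    case False
    obtain a where a: "0 \<le> a" "elp M p f = ennreal a"
      using False by (cases "elp M p f") auto
    obtain b where b: "0 \<le> b" "elp M ?p' g = ennreal b"
      using False by (cases "elp M ?p' g") auto
    have 3: "0 < a" "0 < b" "elp M p f = ennreal a" "elp M ?p' g = ennreal b"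
      using a b nz by (auto simp: order_less_le)
    define A where "A = (\<lambda>x. ennreal (1 / a) * f x)"
    define B where "B = (\<lambda>x. ennreal (1 / b) * g x)"
    have [measurable]: "A \<in> borel_measurable M" "B \<in> borel_measurable M"
      unfolding A_def B_def by auto
    have "elp M p A = ennreal (1 / a) * ennreal a"
      unfolding A_def using p 3 by (subst elp_cmult) auto
    then have A: "(\<integral>\<^sup>+x. epowr (A x) p \<partial>M) = 1"
      using p 3 by (subst epowr_elp[symmetric]) (auto simp flip: ennreal_mult)
    have "elp M ?p' B = ennreal (1 / b) * ennreal b"
      unfolding B_def using p' 3 by (subst elp_cmult) auto
    then have B: "(\<integral>\<^sup>+x. epowr (B x) ?p' \<partial>M) = 1"
      using p' 3 by (subst epowr_elp[symmetric]) (auto simp flip: ennreal_mult)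
    have "(\<integral>\<^sup>+x. A x * B x \<partial>M) \<le>
      (\<integral>\<^sup>+x. ennreal (1 / p) * epowr (A x) p + ennreal (1 / ?p') * epowr (B x) ?p' \<partial>M)"
      by (intro nn_integral_mono Youngs_ennreal p)
    also have "\<dots> = ennreal (1 / p) + ennreal (1 / ?p')"
      by (simp add: nn_integral_add nn_integral_cmult A B)
    also have "\<dots> = 1"
      using conj_exponent_inverse[OF p] p p' by (simp flip: ennreal_plus)
    finally have *: "(\<integral>\<^sup>+x. A x * B x \<partial>M) \<le> 1" .
    have "f x * g x = (ennreal a * ennreal b) * (A x * B x)" for x
    proof -
      have "(ennreal a * ennreal b) * (A x * B x) =
          (ennreal a * ennreal (1 / a)) * (ennreal b * ennreal (1 / b)) * (f x * g x)"
        by (simp add: A_def B_def mult_ac)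
      then show ?thesis using 3 by (simp flip: ennreal_mult)
    qed
    then have "(\<integral>\<^sup>+x. f x * g x \<partial>M) = (ennreal a * ennreal b) * (\<integral>\<^sup>+x. A x * B x \<partial>M)"
      by (simp add: nn_integral_cmult)
    also have "\<dots> \<le> (ennreal a * ennreal b) * 1" by (intro mult_left_mono *) auto
    finally show ?thesis using 3 by simp
  qed
  qed
qed

text \<open>Here A stands for the q-th power of a norm. Testing against the extremal function yields
  A \<le> C A^(1/q'), and since 1/q + 1/q' = 1 the bound follows on dividing by A^(1/q'). The
  division is why A must be finite, and hence why the converse of Hoelder's inequality is proved for
  functions of finite norm first.\<close>

lemma le_epowr_conj_imp:
  assumes q: "1 < q" and A: "A < top" and le: "A \<le> C * epowr A (1 / conj_exponent q)"
  shows "epowr A (1 / q) \<le> C"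
proof (cases "A = 0")
  case False
  then obtain a where a: "A = ennreal a" "0 < a"
    using A by (cases A) (auto simp: order_less_le)
  have "epowr A (1 / q) * epowr A (1 / conj_exponent q) = A"
    using conj_exponent_inverse[OF q] by (simp flip: epowr_add)
  then have "epowr A (1 / q) * epowr A (1 / conj_exponent q) \<le> C * epowr A (1 / conj_exponent q)"
    using le by simp
  then have "epowr A (1 / q) * epowr A (1 / conj_exponent q) / epowr A (1 / conj_exponent q)
       \<le> C * epowr A (1 / conj_exponent q) / epowr A (1 / conj_exponent q)"
    by (intro divide_right_mono_ennreal)
  moreover have "epowr A (1 / conj_exponent q) \<noteq> 0" "epowr A (1 / conj_exponent q) \<noteq> top"
    using a by auto
  ultimately show ?thesis
    by (simp add: ennreal_mult_divide_eq)
qed simp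

section \<open>Mixed norms and their duality\<close>

definition elp2 :: "'b measure \<Rightarrow> 'a measure \<Rightarrow> real \<Rightarrow> real \<Rightarrow> ('b \<Rightarrow> 'a \<Rightarrow> ennreal) \<Rightarrow> ennreal" where
  "elp2 N M p q F = elp N q (\<lambda>y. elp M p (F y))"

lemma borel_measurable_case_prodD:
  assumes "case_prod F \<in> borel_measurable (N \<Otimes>\<^sub>M M)"
  shows "(\<lambda>z. F (fst z) (snd z)) \<in> borel_measurable (N \<Otimes>\<^sub>M M)"
    and "y \<in> space N \<Longrightarrow> F y \<in> borel_measurable M"
  using assms measurable_Pair2[OF assms, of y] by (simp_all add: case_prod_beta')

lemma (in sigma_finite_measure) elp_measurable [measurable (raw)]:
  assumes "case_prod F \<in> borel_measurable (N \<Otimes>\<^sub>M M)"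
  shows "(\<lambda>y. elp M p (F y)) \<in> borel_measurable N"
proof -
  note borel_measurable_case_prodD(1)[OF assms, measurable]
  show ?thesis unfolding elp_def by measurable
qed

lemma elp2_mono_AE:
  "0 < p \<Longrightarrow> 0 < q \<Longrightarrow> AE y in N. AE x in M. F y x \<le> G y x \<Longrightarrow> elp2 N M p q F \<le> elp2 N M p q G"
  unfolding elp2_def by (intro elp_mono_AE) (auto elim!: eventually_mono intro: elp_mono_AE)

lemma elp2_mono:
  "0 < p \<Longrightarrow> 0 < q \<Longrightarrow> (\<And>y x. F y x \<le> G y x) \<Longrightarrow> elp2 N M p q F \<le> elp2 N M p q G"
  by (rule elp2_mono_AE) auto

lemma elp2_cong_AE:
  "AE y in N. AE x in M. F y x = G y x \<Longrightarrow> elp2 N M p q F = elp2 N M p q G"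
  unfolding elp2_def by (intro elp_cong_AE) (auto elim!: eventually_mono intro: elp_cong_AE)

context sigma_finite_measure
begin

lemma elp2_cmult:
  assumes "0 < p" "0 < q" and F [measurable]: "case_prod F \<in> borel_measurable (N \<Otimes>\<^sub>M M)"
  shows "elp2 N M p q (\<lambda>y x. c * F y x) = c * elp2 N M p q F"
proof -
  note borel_measurable_case_prodD[OF F, measurable]
  have "elp2 N M p q (\<lambda>y x. c * F y x) = elp N q (\<lambda>y. c * elp M p (F y))"
    unfolding elp2_def using assms by (intro elp_cong elp_cmult) auto
  then show ?thesis using assms by (simp add: elp2_def elp_cmult)
qed

lemma elp2_SUP:
  assumes "0 < p" "0 < q" "incseq F"
    and F [measurable]: "\<And>i. case_prod (F i) \<in> borel_measurable (N \<Otimes>\<^sub>M M)"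
  shows "elp2 N M p q (\<lambda>y x. SUP i. F i y x) = (SUP i. elp2 N M p q (F i))"
proof -
  note borel_measurable_case_prodD[OF F, measurable]
  have mono: "incseq (\<lambda>i. F i y)" for y
    using assms(3) by (auto simp: incseq_def le_fun_def)
  have "elp2 N M p q (\<lambda>y x. SUP i. F i y x) = elp N q (\<lambda>y. SUP i. elp M p (F i y))"
    unfolding elp2_def using assms mono by (intro elp_cong elp_SUP) auto
  also have "\<dots> = (SUP i. elp2 N M p q (F i))"
    unfolding elp2_def using assms mono
    by (intro elp_SUP) (auto simp: incseq_def le_fun_def intro!: elp_mono)
  finally show ?thesis .
qed

lemma elp2_Holder:
  assumes "1 < p" "1 < q"
    and F [measurable]: "case_prod F \<in> borel_measurable (N \<Otimes>\<^sub>M M)"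
    and G [measurable]: "case_prod G \<in> borel_measurable (N \<Otimes>\<^sub>M M)"
  shows "(\<integral>\<^sup>+y. \<integral>\<^sup>+x. F y x * G y x \<partial>M \<partial>N)
     \<le> elp2 N M p q F * elp2 N M (conj_exponent p) (conj_exponent q) G"
proof -
  note borel_measurable_case_prodD[OF F, measurable] borel_measurable_case_prodD[OF G, measurable]
  have "(\<integral>\<^sup>+y. \<integral>\<^sup>+x. F y x * G y x \<partial>M \<partial>N)
     \<le> (\<integral>\<^sup>+y. elp M p (F y) * elp M (conj_exponent p) (G y) \<partial>N)"
    using assms by (intro nn_integral_mono elp_Holder) auto
  also have "\<dots> \<le> elp2 N M p q F * elp2 N M (conj_exponent p) (conj_exponent q) G"
    unfolding elp2_def using assms by (intro elp_Holder) auto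
  finally show ?thesis .
qed

text \<open>The extremal function is \<open>H y x = F y x ^ (p - 1) * n y ^ (q - p)\<close>, where \<open>n y\<close> is the
  \<open>L\<^sup>p\<close>-norm of \<open>F y\<close>.\<close>

lemma elp2_converse_Holder_finite:
  assumes p: "1 < p" and q: "1 < q"
    and F [measurable]: "case_prod F \<in> borel_measurable (N \<Otimes>\<^sub>M M)"
    and fin: "elp2 N M p q F < top"
    and le: "\<And>H. case_prod H \<in> borel_measurable (N \<Otimes>\<^sub>M M) \<Longrightarrow>
      (\<integral>\<^sup>+y. \<integral>\<^sup>+x. F y x * H y x \<partial>M \<partial>N) \<le> C * elp2 N M (conj_exponent p) (conj_exponent q) H"
  shows "elp2 N M p q F \<le> C"
proof -
  let ?p' = "conj_exponent p" and ?q' = "conj_exponent q"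
  note borel_measurable_case_prodD[OF F, measurable]
  note pp = conj_exponent[OF p] and qq = conj_exponent[OF q]
  define n where "n = (\<lambda>y. elp M p (F y))"
  have [measurable]: "n \<in> borel_measurable N" unfolding n_def by measurable
  define H where "H = (\<lambda>y x. epowr (n y) (q - p) * epowr (F y x) (p - 1))"
  have H [measurable]: "case_prod H \<in> borel_measurable (N \<Otimes>\<^sub>M M)" unfolding H_def by measurable
  define A where "A = (\<integral>\<^sup>+y. epowr (n y) q \<partial>N)"
  have np: "epowr (n y) p = (\<integral>\<^sup>+x. epowr (F y x) p \<partial>M)" for y
    using p by (simp add: n_def epowr_elp)
  have "(\<integral>\<^sup>+x. F y x * H y x \<partial>M) = epowr (n y) q" if "y \<in> space N" for y
  proof -
    have "F y x * H y x = epowr (n y) (q - p) * epowr (F y x) p" for x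
      unfolding H_def using epowr_add[of "F y x" "p - 1" 1] by (simp add: mult_ac)
    then have "(\<integral>\<^sup>+x. F y x * H y x \<partial>M) = epowr (n y) (q - p) * epowr (n y) p"
      using that by (simp add: nn_integral_cmult np)
    then show ?thesis by (simp flip: epowr_add)
  qed
  then have 1: "(\<integral>\<^sup>+y. \<integral>\<^sup>+x. F y x * H y x \<partial>M \<partial>N) = A"
    unfolding A_def by (intro nn_integral_cong) auto
  have "elp M ?p' (H y) = epowr (n y) (q - 1)" if "y \<in> space N" for y
  proof -
    have "elp M ?p' (H y) = epowr (n y) (q - p) * elp M ?p' (\<lambda>x. epowr (F y x) (p - 1))"
      unfolding H_def using pp that by (subst elp_cmult) auto
    also have "elp M ?p' (\<lambda>x. epowr (F y x) (p - 1)) = epowr (n y) (p - 1)"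
      using p pp by (simp add: elp_epowr n_def)
    finally show ?thesis by (simp flip: epowr_add)
  qed
  then have "elp2 N M ?p' ?q' H = elp N ?q' (\<lambda>y. epowr (n y) (q - 1))"
    unfolding elp2_def by (intro elp_cong) auto
  also have "\<dots> = epowr A (1 / ?q')"
    using q qq by (simp add: elp_def A_def epowr_epowr)
  finally have 2: "elp2 N M ?p' ?q' H = epowr A (1 / ?q')" .
  have A: "elp2 N M p q F = epowr A (1 / q)"
    by (simp add: elp2_def n_def A_def elp_def)
  have "epowr A (1 / q) \<le> C"
    using le[OF H] fin by (intro le_epowr_conj_imp[OF q]) (auto simp: 1 2 A)
  then show ?thesis by (simp add: A)
qed

text \<open>Truncations \<open>F i\<close> supply the finite norms that the extremal argument
  requires; monotone convergence then carries the uniform bound over to their supremum, whose norm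
  is not known to be finite beforehand.\<close>

lemma elp2_converse_Holder:
  assumes p: "1 < p" and q: "1 < q" and inc: "incseq F"
    and F [measurable]: "\<And>i::nat. case_prod (F i) \<in> borel_measurable (N \<Otimes>\<^sub>M M)"
    and fin: "\<And>i. elp2 N M p q (F i) < top"
    and le: "\<And>i H. case_prod H \<in> borel_measurable (N \<Otimes>\<^sub>M M) \<Longrightarrow>
      (\<integral>\<^sup>+y. \<integral>\<^sup>+x. F i y x * H y x \<partial>M \<partial>N) \<le> C * elp2 N M (conj_exponent p) (conj_exponent q) H"
  shows "elp2 N M p q (\<lambda>y x. SUP i. F i y x) \<le> C"
  using assms by (subst elp2_SUP) (auto intro!: SUP_least elp2_converse_Holder_finite)

end

text \<open>The extremal function is f^(p-1): its product with f is f^p, and so is its own power of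
  exponent p'.\<close>

lemma elp_converse_Holder_finite:
  assumes p: "1 < p" and [measurable]: "f \<in> borel_measurable M"
    and fin: "elp M p f < top"
    and le: "\<And>h. h \<in> borel_measurable M \<Longrightarrow> (\<integral>\<^sup>+x. f x * h x \<partial>M) \<le> C * elp M (conj_exponent p) h"
  shows "elp M p f \<le> C"
proof -
  note pp = conj_exponent[OF p]
  define A where "A = (\<integral>\<^sup>+x. epowr (f x) p \<partial>M)"
  have 1: "(\<integral>\<^sup>+x. f x * epowr (f x) (p - 1) \<partial>M) = A"
    unfolding A_def using epowr_add[of "f _" 1 "p - 1"] by (intro nn_integral_cong) simp
  have 2: "elp M (conj_exponent p) (\<lambda>x. epowr (f x) (p - 1)) = epowr A (1 / conj_exponent p)"
    using p pp by (simp add: elp_def A_def epowr_epowr)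
  have A: "elp M p f = epowr A (1 / p)" by (simp add: elp_def A_def)
  have "A \<le> C * epowr A (1 / conj_exponent p)"
    using le[of "\<lambda>x. epowr (f x) (p - 1)"] by (simp add: 1 2)
  then show ?thesis using fin by (simp add: A le_epowr_conj_imp[OF p])
qed

lemma elp_bounded_finite:
  assumes "finite_measure M" "0 < p" "\<And>x. x \<in> space M \<Longrightarrow> f x \<le> c" "c < top"
  shows "elp M p f < top"
proof -
  interpret finite_measure M by fact
  have "(\<integral>\<^sup>+x. epowr (f x) p \<partial>M) \<le> (\<integral>\<^sup>+x. epowr c p \<partial>M)"
    using assms by (intro nn_integral_mono epowr_mono) auto
  also have "(\<integral>\<^sup>+x. epowr c p \<partial>M) = epowr c p * emeasure M (space M)" by simp
  also have "\<dots> < top"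
    using assms(4) emeasure_finite[of "space M"]
    by (auto simp: ennreal_mult_eq_top_iff less_top[symmetric])
  finally show ?thesis using assms(2) by (simp add: elp_def)
qed

lemma elp2_bounded_finite:
  assumes "finite_measure M" "finite_measure N" "0 < p" "0 < q" "\<And>y x. F y x \<le> c" "c < top"
  shows "elp2 N M p q F < top"
  unfolding elp2_def
proof (rule elp_bounded_finite)
  show "elp M p (F y) \<le> elp M p (\<lambda>_. c)" for y
    using assms by (intro elp_mono) auto
  show "elp M p (\<lambda>_. c) < top" using assms by (intro elp_bounded_finite) auto
qed (use assms in auto)

text \<open>Hoelder with the kernel split as k = k^(1/p') k^(1/p). A kernel of mass at most c acts
  like c times an average, so the p-th power moves under the integral at the price c^(p-1).\<close>

lemma nn_integral_kernel_power_le: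
  assumes p: "1 < p" and [measurable]: "k \<in> borel_measurable M" "f \<in> borel_measurable M"
    and c: "(\<integral>\<^sup>+x. k x \<partial>M) \<le> c"
  shows "epowr (\<integral>\<^sup>+x. k x * f x \<partial>M) p \<le> epowr c (p - 1) * (\<integral>\<^sup>+x. k x * epowr (f x) p \<partial>M)"
proof -
  note pp = conj_exponent[OF p]
  let ?p' = "conj_exponent p"
  have "k x * f x = epowr (k x) (1 / ?p') * (epowr (k x) (1 / p) * f x)" for x
    using pp(2) by (simp add: epowr_add[symmetric] mult.assoc[symmetric] add.commute)
  then have "(\<integral>\<^sup>+x. k x * f x \<partial>M) \<le>
      elp M ?p' (\<lambda>x. epowr (k x) (1 / ?p')) * elp M p (\<lambda>x. epowr (k x) (1 / p) * f x)"
    using elp_Holder[OF pp(1), of "\<lambda>x. epowr (k x) (1 / ?p')" M "\<lambda>x. epowr (k x) (1 / p) * f x"]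
    by (simp add: pp)
  also have "elp M ?p' (\<lambda>x. epowr (k x) (1 / ?p')) = epowr (\<integral>\<^sup>+x. k x \<partial>M) (1 / ?p')"
    using pp by (simp add: elp_def epowr_epowr)
  also have "\<dots> \<le> epowr c (1 / ?p')" using c pp by (intro epowr_mono) auto
  also have "elp M p (\<lambda>x. epowr (k x) (1 / p) * f x) = epowr (\<integral>\<^sup>+x. k x * epowr (f x) p \<partial>M) (1 / p)"
    using p by (simp add: elp_def epowr_mult epowr_epowr)
  finally have "epowr (\<integral>\<^sup>+x. k x * f x \<partial>M) p \<le>
     epowr (epowr c (1 / ?p') * epowr (\<integral>\<^sup>+x. k x * epowr (f x) p \<partial>M) (1 / p)) p"
    using p by (intro epowr_mono) (auto simp: mult_right_mono)
  also have "\<dots> = epowr c (p - 1) * (\<integral>\<^sup>+x. k x * epowr (f x) p \<partial>M)"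
    using p pp by (simp add: epowr_mult epowr_epowr)
  finally show ?thesis .
qed

section \<open>The maximal function on the circle\<close>

text \<open>The circle is represented by angles in the interval [0, 2\<pi>]. Using a density on the
  whole line, and not a restricted space, lets Borel functions of a real angle be used as they
  are.\<close>

definition TM :: "real measure" where
  "TM = density lborel (indicator {0..2 * pi})"

lemma sets_TM [measurable_cong, simp]: "sets TM = sets borel"
  by (simp add: TM_def)

lemma space_TM [simp]: "space TM = UNIV"
  by (simp add: TM_def)

lemma nn_integral_TM:
  "f \<in> borel_fun \<Longrightarrow> (\<integral>\<^sup>+t. f t \<partial>TM) = (\<integral>\<^sup>+t. f t * indicator {0..2 * pi} t \<partial>lborel)"
  by (simp add: TM_def nn_integral_density mult.commute)

lemma AE_TM: "(AE t in TM. P t) \<longleftrightarrow> (AE t in lborel. t \<in> {0..2 * pi} \<longrightarrow> P t)"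
proof -
  have "(AE t in TM. P t) \<longleftrightarrow> (AE t in lborel. 0 < (indicator {0..2 * pi} t :: ennreal) \<longrightarrow> P t)"
    unfolding TM_def by (rule AE_density) simp
  moreover have "(0 < (indicator {0..2 * pi} t :: ennreal)) \<longleftrightarrow> t \<in> {0..2 * pi}" for t :: real
    by (auto simp: indicator_def)
  ultimately show ?thesis by (simp only:)
qed

lemma AE_TM_range: "AE t in TM. t \<in> {0..2 * pi}"
  by (simp add: AE_TM)

lemma emeasure_TM: "A \<in> sets borel \<Longrightarrow> emeasure TM A = emeasure lborel (A \<inter> {0..2 * pi})"
  unfolding TM_def by (subst emeasure_density) (auto simp: Int_commute simp flip: indicator_inter_arith)

lemma finite_measure_TM: "finite_measure TM"
  by standard (simp add: emeasure_TM)

interpretation TM: finite_measure TM by (rule finite_measure_TM)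

lemma cis_measurable [measurable]: "cis \<in> borel_fun"
  by (intro borel_measurable_continuous_onI continuous_intros)

lemma dist_cis: "dist (cis a) (cis b) = 2 * \<bar>sin ((a - b) / 2)\<bar>"
proof -
  have "(cos a - cos b)\<^sup>2 + (sin a - sin b)\<^sup>2 =
    ((cos a)\<^sup>2 + (sin a)\<^sup>2) + ((cos b)\<^sup>2 + (sin b)\<^sup>2) - 2 * (cos a * cos b + sin a * sin b)"
    by (simp add: power2_eq_square algebra_simps)
  also have "\<dots> = 2 - 2 * cos (a - b)" by (simp add: cos_diff)
  also have "cos (a - b) = 1 - 2 * (sin ((a - b) / 2))\<^sup>2"
  proof -
    have *: "2 * ((a - b) / 2) = a - b" by (simp add: field_simps)
    show ?thesis using cos_double_sin[of "(a - b) / 2"] by (simp only: *)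
  qed
  finally have "(cos a - cos b)\<^sup>2 + (sin a - sin b)\<^sup>2 = (2 * \<bar>sin ((a - b) / 2)\<bar>)\<^sup>2"
    by (simp add: power_mult_distrib)
  moreover have "dist (cis a) (cis b) = sqrt ((cos a - cos b)\<^sup>2 + (sin a - sin b)\<^sup>2)"
    by (simp add: dist_norm cmod_def)
  ultimately show ?thesis by (simp only: real_sqrt_abs)
qed

lemma dist_cis_le: "dist (cis a) (cis b) \<le> \<bar>a - b\<bar>"
  using abs_sin_x_le_abs_x[of "(a - b) / 2"] by (simp add: dist_cis)

lemma dist_cis_le_period: "dist (cis a) (cis b) \<le> \<bar>a - b + 2 * pi * of_int k\<bar>"
proof -
  have "cis (a + 2 * pi * of_int k) = cis a"
    by (simp flip: cis_mult)
  then show ?thesis using dist_cis_le[of "a + 2 * pi * of_int k" b] by (simp add: algebra_simps)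
qed

text \<open>A weak form of Jordan's inequality: x - sin x is at most x^3/6, and x^2 \<le> 4 on the
  interval, so at most two thirds of x are lost.\<close>

lemma sin_ge_third: "0 \<le> x \<Longrightarrow> x \<le> pi / 2 \<Longrightarrow> x / 3 \<le> sin x"
proof -
  assume x: "0 \<le> x" "x \<le> pi / 2"
  have "\<bar>sin x - x\<bar> \<le> x ^ 3 / 6"
    using Maclaurin_sin_bound[of x 3] x by (simp add: numeral_eq_Suc sin_coeff_def fact_reduce)
  moreover have "x * x \<le> 2 * 2" using x pi_less_4 by (intro mult_mono) auto
  then have "x * (x * x) \<le> x * 4" using x by (intro mult_left_mono) auto
  ultimately show ?thesis unfolding power3_eq_cube mult.assoc by linarith
qed

text \<open>Two angles in [0, 2\<pi>] differ, after a shift by at most one period, by some x with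
  |x| \<le> \<pi>. The chord is then 2 sin(|x|/2), which is at least |x|/3.\<close>

lemma chord_imp_arc:
  assumes "s \<in> {0..2 * pi}" "t \<in> {0..2 * pi}" "dist (cis s) (cis t) < \<rho>"
  shows "\<exists>k\<in>{-1, 0, 1 :: int}. \<bar>t - s + 2 * pi * of_int k\<bar> < 3 * \<rho>"
proof -
  obtain k :: int where k: "k \<in> {-1, 0, 1}" "\<bar>t - s + 2 * pi * of_int k\<bar> \<le> pi"
  proof (cases "t - s > pi"; cases "t - s < - pi")
    assume "t - s > pi" "\<not> t - s < - pi" then show thesis using assms by (intro that[of "-1"]) auto
  next
    assume "\<not> t - s > pi" "t - s < - pi" then show thesis using assms by (intro that[of 1]) auto
  next
    assume "t - s > pi" "t - s < - pi" then show thesis using pi_gt_zero by linarith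
  next
    assume "\<not> t - s > pi" "\<not> t - s < - pi" then show thesis by (intro that[of 0]) auto
  qed
  define x where "x = t - s + 2 * pi * of_int k"
  have sin_abs: "\<bar>sin (y / 2)\<bar> = \<bar>sin (\<bar>y\<bar> / 2)\<bar>" for y :: real
    by (cases "y \<ge> 0") (simp_all add: abs_of_neg minus_divide_left[symmetric] del: minus_divide_left)
  have "cis (t + 2 * pi * of_int k) = cis t" by (simp flip: cis_mult)
  then have "dist (cis s) (cis t) = 2 * \<bar>sin (x / 2)\<bar>"
    using dist_cis[of "t + 2 * pi * of_int k" s] by (simp add: dist_commute algebra_simps x_def)
  moreover have "\<bar>x\<bar> / 2 / 3 \<le> sin (\<bar>x\<bar> / 2)" using k by (intro sin_ge_third) (auto simp: x_def)
  ultimately have "\<bar>x\<bar> < 3 * \<rho>" using sin_abs[of x] assms(3) by linarith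
  then show ?thesis using k by (auto simp: x_def)
qed

lemma emeasure_TM_arc_le:
  assumes "0 \<le> \<rho>" "A \<in> sets borel"
    "\<And>t. t \<in> A \<Longrightarrow> t \<in> {0..2 * pi} \<Longrightarrow> \<exists>k\<in>{-1, 0, 1 :: int}. \<bar>t - s + 2 * pi * of_int k\<bar> < \<rho>"
  shows "emeasure TM A \<le> ennreal (6 * \<rho>)"
proof -
  let ?I = "\<lambda>k::int. {s - 2 * pi * of_int k - \<rho> .. s - 2 * pi * of_int k + \<rho>}"
  have "A \<inter> {0..2 * pi} \<subseteq> (\<Union>k\<in>{-1, 0, 1}. ?I k)"
  proof
    fix t assume "t \<in> A \<inter> {0..2 * pi}"
    then obtain k :: int where "k \<in> {-1, 0, 1}" "\<bar>t - s + 2 * pi * of_int k\<bar> < \<rho>"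
      using assms(3)[of t] by blast
    then show "t \<in> (\<Union>k\<in>{-1, 0, 1}. ?I k)" by (intro UN_I[of k]) auto
  qed
  then have "emeasure lborel (A \<inter> {0..2 * pi}) \<le> emeasure lborel (\<Union>k\<in>{-1, 0, 1}. ?I k)"
    by (intro emeasure_mono) auto
  also have "\<dots> \<le> (\<Sum>k\<in>{-1, 0, 1}. emeasure lborel (?I k))"
    by (intro emeasure_subadditive_finite) auto
  also have "\<dots> = (\<Sum>k\<in>{-1, 0, 1 :: int}. ennreal (2 * \<rho>))" using assms(1) by simp
  also have "\<dots> = ennreal (\<Sum>k\<in>{-1, 0, 1 :: int}. 2 * \<rho>)" using assms(1) by (intro sum_ennreal) simp
  also have "\<dots> = ennreal (6 * \<rho>)" by simp
  finally show ?thesis using assms by (simp add: emeasure_TM)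
qed

text \<open>The constant is 6 times 3: a chord below \<rho> means an arc below 3\<rho>, and three
  translates of an interval of half-length 3\<rho> cover all such angles in [0, 2\<pi>].\<close>

lemma emeasure_TM_chord_le:
  assumes "s \<in> {0..2 * pi}" "0 \<le> \<rho>"
  shows "emeasure TM {t. dist (cis s) (cis t) < \<rho>} \<le> ennreal (18 * \<rho>)"
  using emeasure_TM_arc_le[of "3 * \<rho>" "{t. dist (cis s) (cis t) < \<rho>}" s] assms chord_imp_arc[OF assms(1)]
  by auto

text \<open>The first radius 4 exceeds the diameter of the circle, so every pair of points is within
  the first radius, and \<open>maxrad (m + 2)\<close> is exactly the dyadic scale 1/2^m of the
  kernels below.\<close>

definition maxrad :: "nat \<Rightarrow> real" where "maxrad n = 4 / 2 ^ n"

lemma maxrad_pos [simp]: "0 < maxrad n" and maxrad_nonneg [simp]: "0 \<le> maxrad n"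
  and maxrad_neq_0 [simp]: "maxrad n \<noteq> 0"
  by (simp_all add: maxrad_def)

definition chord_mass :: "(real \<Rightarrow> ennreal) \<Rightarrow> real \<Rightarrow> real \<Rightarrow> ennreal" where
  "chord_mass g s \<rho> = (\<integral>\<^sup>+t. indicator {t. dist (cis s) (cis t) < \<rho>} t * g t \<partial>TM)"

lemma chord_mass_measurable [measurable]:
  assumes [measurable]: "g \<in> borel_fun"
  shows "(\<lambda>s. chord_mass g s \<rho>) \<in> borel_fun"
proof -
  have "(\<lambda>s. \<integral>\<^sup>+t. (if dist (cis s) (cis t) < \<rho> then 1 else 0) * g t \<partial>TM) \<in> borel_fun"
    by measurable
  then show ?thesis by (simp add: chord_mass_def indicator_def)
qed

text \<open>The centred Hardy-Littlewood maximal function with respect to chords. Dyadic radii make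
  the supremum countable, hence measurable; the masses are divided by the radius, which is
  comparable with the length of the arc.\<close>

definition maxfun :: "(real \<Rightarrow> ennreal) \<Rightarrow> real \<Rightarrow> ennreal" where
  "maxfun g s = (SUP n. ennreal (1 / maxrad n) * chord_mass g s (maxrad n))"

lemma maxfun_measurable [measurable]:
  "g \<in> borel_fun \<Longrightarrow> maxfun g \<in> borel_fun"
  unfolding maxfun_def by measurable

text \<open>Vitali's covering lemma is applied in the plane to balls around the points
  \<open>cis s\<close>, with radii at which the mass is large. The selected balls are disjoint, so
  their masses add up to at most the integral of g, while the balls enlarged five times cover A. The
  constant is 18 * 5.\<close>

lemma maxfun_weak_type:
  assumes g [measurable]: "g \<in> borel_fun" and l: "0 < l"
    and A: "A \<in> sets borel" "A \<subseteq> {0..2 * pi}"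
      "\<And>s. s \<in> A \<Longrightarrow> \<exists>n. ennreal (l * maxrad n) \<le> chord_mass g s (maxrad n)"
  shows "ennreal l * emeasure TM A \<le> 90 * (\<integral>\<^sup>+t. g t \<partial>TM)"
proof -
  obtain n where n: "\<And>s. s \<in> A \<Longrightarrow> ennreal (l * maxrad (n s)) \<le> chord_mass g s (maxrad (n s))"
    using A(3) by metis
  define r where "r = (\<lambda>s. maxrad (n s))"
  have rpos: "0 < r s" and r4: "r s \<le> 4" for s by (auto simp: r_def maxrad_def field_simps)
  have "cis ` A \<subseteq> (\<Union>s\<in>A. ball (cis s) (r s))" using rpos by fastforce
  then obtain C where C: "countable C" "C \<subseteq> A"
      "pairwise (\<lambda>i j. disjnt (ball (cis i) (r i)) (ball (cis j) (r j))) C"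
      "cis ` A \<subseteq> (\<Union>i\<in>C. ball (cis i) (5 * r i))"
    by (rule Vitali_covering_lemma_balls[where a=cis and r=r and K=A and B=4]) (use rpos r4 in auto)
  have "ennreal l * emeasure TM A = (\<integral>\<^sup>+t. ennreal l * indicator A t \<partial>TM)"
    using A by (simp add: nn_integral_cmult)
  also have "\<dots> \<le> (\<integral>\<^sup>+t. \<integral>\<^sup>+i. ennreal l * indicator {t. dist (cis i) (cis t) < 5 * r i} t \<partial>count_space C \<partial>TM)"
  proof (intro nn_integral_mono)
    fix t
    show "ennreal l * indicator A t \<le> (\<integral>\<^sup>+i. ennreal l * indicator {t. dist (cis i) (cis t) < 5 * r i} t \<partial>count_space C)"
    proof (cases "t \<in> A")
      case True
      then obtain i where i: "i \<in> C" "dist (cis i) (cis t) < 5 * r i" using C(4) by fastforce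
      have "(\<integral>\<^sup>+j. ennreal l * indicator {i} j \<partial>count_space C)
          \<le> (\<integral>\<^sup>+i. ennreal l * indicator {t. dist (cis i) (cis t) < 5 * r i} t \<partial>count_space C)"
        using i by (intro nn_integral_mono) (auto simp: indicator_def)
      also have "(\<integral>\<^sup>+j. ennreal l * indicator {i} j \<partial>count_space C) = ennreal l"
        using i by (subst nn_integral_cmult_indicator) auto
      finally show ?thesis using True by simp
    qed simp
  qed
  also have "\<dots> = (\<integral>\<^sup>+i. \<integral>\<^sup>+t. ennreal l * indicator {t. dist (cis i) (cis t) < 5 * r i} t \<partial>TM \<partial>count_space C)"
    using C(1) by (intro nn_integral_count_space_nn_integral) auto
  also have "\<dots> \<le> (\<integral>\<^sup>+i. 90 * (\<integral>\<^sup>+t. indicator {t. dist (cis i) (cis t) < r i} t * g t \<partial>TM) \<partial>count_space C)"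
  proof (intro nn_integral_mono)
    fix i assume "i \<in> space (count_space C)"
    then have i: "i \<in> A" using C by auto
    have "(\<integral>\<^sup>+t. ennreal l * indicator {t. dist (cis i) (cis t) < 5 * r i} t \<partial>TM)
        = ennreal l * emeasure TM {t. dist (cis i) (cis t) < 5 * r i}"
      by (simp add: nn_integral_cmult)
    also have "\<dots> \<le> ennreal l * ennreal (18 * (5 * r i))"
      using i A(2) rpos[of i] by (intro mult_left_mono emeasure_TM_chord_le) auto
    also have "\<dots> = 90 * ennreal (l * r i)"
      using l rpos[of i] by (simp flip: ennreal_mult ennreal_numeral add: ac_simps)
    also have "\<dots> \<le> 90 * chord_mass g i (r i)"
      using n[OF i] by (intro mult_left_mono) (auto simp: r_def)
    finally show "(\<integral>\<^sup>+t. ennreal l * indicator {t. dist (cis i) (cis t) < 5 * r i} t \<partial>TM)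
       \<le> 90 * (\<integral>\<^sup>+t. indicator {t. dist (cis i) (cis t) < r i} t * g t \<partial>TM)"
      by (simp add: chord_mass_def)
  qed
  also have "\<dots> = 90 * (\<integral>\<^sup>+i. (\<integral>\<^sup>+t. indicator {t. dist (cis i) (cis t) < r i} t * g t \<partial>TM) \<partial>count_space C)"
    by (simp add: nn_integral_cmult)
  also have "(\<integral>\<^sup>+i. (\<integral>\<^sup>+t. indicator {t. dist (cis i) (cis t) < r i} t * g t \<partial>TM) \<partial>count_space C)
     = (\<integral>\<^sup>+t. \<integral>\<^sup>+i. indicator {t. dist (cis i) (cis t) < r i} t * g t \<partial>count_space C \<partial>TM)"
    using C(1) by (intro nn_integral_count_space_nn_integral[symmetric]) auto
  also have "\<dots> \<le> (\<integral>\<^sup>+t. g t \<partial>TM)"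
  proof (intro nn_integral_mono)
    fix t
    show "(\<integral>\<^sup>+i. indicator {t. dist (cis i) (cis t) < r i} t * g t \<partial>count_space C) \<le> g t"
    proof (cases "\<exists>i\<in>C. dist (cis i) (cis t) < r i")
      case True
      then obtain i where i: "i \<in> C" "dist (cis i) (cis t) < r i" by blast
      have "\<not> dist (cis j) (cis t) < r j" if "j \<in> C" "j \<noteq> i" for j
        using C(3) i that unfolding pairwise_def disjnt_def by (auto simp: disjoint_iff)
      then have "(\<integral>\<^sup>+i. indicator {t. dist (cis i) (cis t) < r i} t * g t \<partial>count_space C)
        \<le> (\<integral>\<^sup>+j. g t * indicator {i} j \<partial>count_space C)"
        by (intro nn_integral_mono) (auto simp: indicator_def)
      also have "\<dots> = g t" using i by (subst nn_integral_cmult_indicator) auto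
      finally show ?thesis .
    next
      case False
      then have "(\<integral>\<^sup>+i. indicator {t. dist (cis i) (cis t) < r i} t * g t \<partial>count_space C) = (\<integral>\<^sup>+i. 0 \<partial>count_space C)"
        by (intro nn_integral_cong) (auto simp: indicator_def)
      then show ?thesis by simp
    qed
  qed
  finally show ?thesis by (simp add: mult_left_mono)
qed

text \<open>The layer-cake formula for a single value x. Integrated over a further variable and
  combined with Fubini, it turns estimates of level sets into estimates of r-th powers. At x =
  \<infinity> the integral dominates its values at x = n^(1/r), hence all n.\<close>

lemma nn_integral_powr_less:
  assumes r: "0 < r"
  shows "(\<integral>\<^sup>+l. indicator {0<..} l * (if ennreal l < x then 1 else 0) * ennreal (r * l powr (r - 1)) \<partial>lborel)
     = epowr x r" (is "?I x = _")
proof -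
  have fin: "?I (ennreal a) = ennreal (a powr r)" if a: "0 \<le> a" for a
  proof -
    have "((\<lambda>x. x powr (r - 1)) has_integral (a powr r / r)) {0..a}"
      using has_integral_powr_from_0[of "r - 1" a] r a by simp
    then have "((\<lambda>x. r * x powr (r - 1)) has_integral (r * (a powr r / r))) {0..a}"
      by (rule has_integral_mult_right)
    then have "(\<integral>\<^sup>+l. ennreal (r * l powr (r - 1)) * indicator {0..a} l \<partial>lborel) = ennreal (r * (a powr r / r))"
      using r by (intro nn_integral_has_integral_lebesgue') auto
    then have "(\<integral>\<^sup>+l. indicator {0..a} l * ennreal (r * l powr (r - 1)) \<partial>lborel) = ennreal (a powr r)"
      using r by (simp add: mult.commute)
    moreover have "?I (ennreal a) = (\<integral>\<^sup>+l. indicator {0..a} l * ennreal (r * l powr (r - 1)) \<partial>lborel)"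
    proof (intro nn_integral_cong_AE)
      show "AE l in lborel. indicator {0<..} l * (if ennreal l < ennreal a then 1 else 0) * ennreal (r * l powr (r - 1)) = indicator {0..a} l * ennreal (r * l powr (r - 1))"
        using AE_lborel_singleton[of 0] AE_lborel_singleton[of a]
        by eventually_elim (use a in \<open>auto simp: indicator_def ennreal_less_iff\<close>)
    qed
    ultimately show ?thesis by simp
  qed
  show ?thesis
  proof (cases x)
    case (real a) then show ?thesis using fin by (simp add: epowr_ennreal)
  next
    case top
    have "ennreal (real n) \<le> ?I top" for n
    proof -
      have "ennreal (real n) = ?I (ennreal (real n powr (1 / r)))"
        using r by (subst fin) (auto simp: powr_powr)
      also have "\<dots> \<le> ?I top" by (intro nn_integral_mono mult_right_mono mult_left_mono) auto
      finally show ?thesis .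
    qed
    then have "?I top = top"
      using ennreal_Ex_less_of_nat[of "?I top"]
      by (auto simp: ennreal_of_nat_eq_real_of_nat simp flip: less_top not_less)
    then show ?thesis using top by simp
  qed
qed

lemma le_add_half_imp: "ennreal a \<le> X + ennreal (a / 2) \<Longrightarrow> ennreal (a / 2) \<le> X" if "0 \<le> a"
  using that by (cases X) (auto simp flip: ennreal_plus)

text \<open>The weak type bound is applied to the part of g above the height l/36 only. The rest of
  g has mass at most (l/36) * 18\<rho> = l\<rho>/2 in any ball of radius \<rho>, so where the
  maximal function exceeds l, that of the upper part is still at least l/2. Halving the level
  doubles the constant 90.\<close>

lemma maxfun_level_set:
  assumes [measurable]: "g \<in> borel_fun" and l: "0 < l"
  shows "ennreal l * emeasure TM {t. ennreal l < maxfun g t}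
    \<le> 180 * (\<integral>\<^sup>+t. (if ennreal l < 36 * g t then 1 else 0) * g t \<partial>TM)"
proof -
  define g' where "g' = (\<lambda>t. (if ennreal l < 36 * g t then 1 else 0) * g t)"
  have [measurable]: "g' \<in> borel_fun" unfolding g'_def by measurable
  have gle: "g t \<le> g' t + ennreal (l / 36)" for t
  proof (cases "ennreal l < 36 * g t")
    case True then show ?thesis by (simp add: g'_def)
  next
    case False
    then have "36 * g t \<le> 36 * ennreal (l / 36)"
      using l by (simp add: not_less flip: ennreal_numeral ennreal_mult)
    then have "g t \<le> ennreal (l / 36)" by (subst (asm) ennreal_mult_le_mult_iff) auto
    then show ?thesis by (simp add: add_increasing)
  qed
  let ?A = "{t. ennreal l < maxfun g t}"
  have "ennreal (l / 2) * emeasure TM (?A \<inter> {0..2 * pi}) \<le> 90 * (\<integral>\<^sup>+t. g' t \<partial>TM)"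
  proof (rule maxfun_weak_type)
    fix s assume s: "s \<in> ?A \<inter> {0..2 * pi}"
    then obtain n where n: "ennreal l < ennreal (1 / maxrad n) * chord_mass g s (maxrad n)"
      by (auto simp: maxfun_def less_SUP_iff)
    let ?\<rho> = "maxrad n"
    have \<rho>: "0 < ?\<rho>" by simp
    have "ennreal (l * ?\<rho>) = ennreal ?\<rho> * ennreal l"
      using l \<rho> by (simp add: mult.commute flip: ennreal_mult)
    also have "\<dots> \<le> ennreal ?\<rho> * (ennreal (1 / ?\<rho>) * chord_mass g s ?\<rho>)"
      using n by (intro mult_left_mono) auto
    also have "\<dots> = chord_mass g s ?\<rho>"
      using \<rho> by (simp add: mult.assoc[symmetric] flip: ennreal_mult)
    also have "\<dots> \<le> (\<integral>\<^sup>+t. indicator {t. dist (cis s) (cis t) < ?\<rho>} t * g' t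
         + ennreal (l / 36) * indicator {t. dist (cis s) (cis t) < ?\<rho>} t \<partial>TM)"
      unfolding chord_mass_def
    proof (intro nn_integral_mono)
      fix t show "indicator {t. dist (cis s) (cis t) < ?\<rho>} t * g t \<le>
        indicator {t. dist (cis s) (cis t) < ?\<rho>} t * g' t
         + ennreal (l / 36) * indicator {t. dist (cis s) (cis t) < ?\<rho>} t"
        using gle[of t] by (auto simp: indicator_def)
    qed
    also have "\<dots> = chord_mass g' s ?\<rho> + ennreal (l / 36) * emeasure TM {t. dist (cis s) (cis t) < ?\<rho>}"
      by (simp add: nn_integral_add nn_integral_cmult chord_mass_def)
    also have "\<dots> \<le> chord_mass g' s ?\<rho> + ennreal (l / 36) * ennreal (18 * ?\<rho>)"
      using s \<rho> by (intro add_left_mono mult_left_mono emeasure_TM_chord_le) auto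
    also have "ennreal (l / 36) * ennreal (18 * ?\<rho>) = ennreal (l * ?\<rho> / 2)"
      using l \<rho> by (simp flip: ennreal_mult)
    finally have "ennreal (l * ?\<rho> / 2) \<le> chord_mass g' s ?\<rho>"
      using l \<rho> by (intro le_add_half_imp) auto
    then show "\<exists>n. ennreal (l / 2 * maxrad n) \<le> chord_mass g' s (maxrad n)"
      by (intro exI[of _ n]) simp
  qed (use l in auto)
  then have "2 * (ennreal (l / 2) * emeasure TM (?A \<inter> {0..2 * pi})) \<le> 2 * (90 * (\<integral>\<^sup>+t. g' t \<partial>TM))"
    by (rule mult_left_mono) simp
  moreover have "emeasure TM (?A \<inter> {0..2 * pi}) = emeasure TM ?A" by (simp add: emeasure_TM)
  moreover have "2 * ennreal (l / 2) = ennreal l" using l by (simp flip: ennreal_numeral ennreal_mult)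
  moreover have "2 * (90 * x) = 180 * x" for x :: ennreal by (simp flip: mult.assoc)
  ultimately show ?thesis by (simp add: g'_def flip: mult.assoc)
qed

lemma maxfun_strong_type:
  assumes r: "1 < r"
  obtains C :: real where "0 \<le> C"
    "\<And>g. g \<in> borel_fun \<Longrightarrow> elp TM r (maxfun g) \<le> ennreal C * elp TM r g"
proof -
  \<comment> \<open>The factor 180 comes from the level sets, r/(r-1) from replacing r l^(r-2) by
    the density (r-1) l^(r-2) of the exponent r - 1, and 36^(r-1) from the height at which g is
    cut.\<close>
  define K where "K = 180 * (r / (r - 1)) * 36 powr (r - 1)"
  have K: "0 \<le> K" using r by (simp add: K_def)
  have main: "(\<integral>\<^sup>+t. epowr (maxfun g t) r \<partial>TM) \<le> ennreal K * (\<integral>\<^sup>+t. epowr (g t) r \<partial>TM)"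
    if [measurable]: "g \<in> borel_fun" for g
  proof -
    interpret L: sigma_finite_measure "lborel :: real measure" by (rule lborel.sigma_finite_measure_axioms)
    interpret P: pair_sigma_finite "lborel :: real measure" TM ..
    define U where "U = (\<lambda>l t. indicator {0<..} l * (if ennreal l < maxfun g t then 1 else 0) * ennreal (r * l powr (r - 1)))"
    define V where "V = (\<lambda>l t. indicator {0<..} l * (if ennreal l < 36 * g t then 1 else 0) * ennreal ((r - 1) * l powr (r - 1 - 1)))"
    have [measurable]: "(\<lambda>z. U (fst z) (snd z)) \<in> borel_measurable (lborel \<Otimes>\<^sub>M TM)"
      "(\<lambda>z. V (fst z) (snd z)) \<in> borel_measurable (lborel \<Otimes>\<^sub>M TM)"
      unfolding U_def V_def by measurable
    have "(\<integral>\<^sup>+t. epowr (maxfun g t) r \<partial>TM) = (\<integral>\<^sup>+t. \<integral>\<^sup>+l. U l t \<partial>lborel \<partial>TM)"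
      using r by (simp add: U_def nn_integral_powr_less)
    also have "\<dots> = (\<integral>\<^sup>+l. \<integral>\<^sup>+t. U l t \<partial>TM \<partial>lborel)"
      by (rule P.Fubini') (simp add: case_prod_beta')
    also have "\<dots> \<le> (\<integral>\<^sup>+l. ennreal (180 * (r / (r - 1))) * (\<integral>\<^sup>+t. V l t * g t \<partial>TM) \<partial>lborel)"
    proof (intro nn_integral_mono)
      fix l :: real
      show "(\<integral>\<^sup>+t. U l t \<partial>TM) \<le> ennreal (180 * (r / (r - 1))) * (\<integral>\<^sup>+t. V l t * g t \<partial>TM)"
      proof (cases "0 < l")
        case False then show ?thesis by (simp add: U_def)
      next
        case True
        have "(\<integral>\<^sup>+t. U l t \<partial>TM) = (\<integral>\<^sup>+t. ennreal (r * l powr (r - 1)) * indicator {t. ennreal l < maxfun g t} t \<partial>TM)"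
          using True by (intro nn_integral_cong) (auto simp: U_def indicator_def)
        also have "\<dots> = ennreal (r * l powr (r - 1)) * emeasure TM {t. ennreal l < maxfun g t}"
          by (simp add: nn_integral_cmult)
        also have "r * l powr (r - 1) = (r * l powr (r - 1 - 1)) * l"
          using True powr_add[of l "r - 1 - 1" 1] by simp
        also have "ennreal \<dots> = ennreal (r * l powr (r - 1 - 1)) * ennreal l"
          using True r by (intro ennreal_mult) auto
        also have "\<dots> * emeasure TM {t. ennreal l < maxfun g t} \<le> ennreal (r * l powr (r - 1 - 1)) *
            (180 * (\<integral>\<^sup>+t. (if ennreal l < 36 * g t then 1 else 0) * g t \<partial>TM))"
          unfolding mult.assoc using maxfun_level_set[OF that True] by (intro mult_left_mono) auto
        also have "\<dots> = ennreal (180 * (r / (r - 1))) * (ennreal ((r - 1) * l powr (r - 1 - 1)) *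
            (\<integral>\<^sup>+t. (if ennreal l < 36 * g t then 1 else 0) * g t \<partial>TM))"
          using r by (simp add: mult.assoc[symmetric] flip: ennreal_mult ennreal_numeral) (simp add: field_simps)
        also have "(ennreal ((r - 1) * l powr (r - 1 - 1)) *
            (\<integral>\<^sup>+t. (if ennreal l < 36 * g t then 1 else 0) * g t \<partial>TM)) = (\<integral>\<^sup>+t. V l t * g t \<partial>TM)"
          using True by (subst nn_integral_cmult[symmetric]) (auto simp: V_def mult_ac intro!: nn_integral_cong)
        finally show ?thesis .
      qed
    qed
    also have "\<dots> = ennreal (180 * (r / (r - 1))) * (\<integral>\<^sup>+l. \<integral>\<^sup>+t. V l t * g t \<partial>TM \<partial>lborel)"
      by (simp add: nn_integral_cmult)
    also have "(\<integral>\<^sup>+l. \<integral>\<^sup>+t. V l t * g t \<partial>TM \<partial>lborel) = (\<integral>\<^sup>+t. \<integral>\<^sup>+l. V l t * g t \<partial>lborel \<partial>TM)"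
      by (rule P.Fubini'[symmetric]) (simp add: case_prod_beta')
    also have "\<dots> = (\<integral>\<^sup>+t. ennreal (36 powr (r - 1)) * epowr (g t) r \<partial>TM)"
    proof (intro nn_integral_cong)
      fix t
      have [measurable]: "(\<lambda>l. V l t) \<in> borel_measurable lborel" unfolding V_def by measurable
      have "(\<integral>\<^sup>+l. V l t * g t \<partial>lborel) = epowr (36 * g t) (r - 1) * g t"
      proof -
        have "(\<integral>\<^sup>+l. V l t \<partial>lborel) = epowr (36 * g t) (r - 1)"
          unfolding V_def using r by (intro nn_integral_powr_less) simp
        then show ?thesis by (simp add: nn_integral_multc)
      qed
      also have "\<dots> = epowr 36 (r - 1) * (epowr (g t) (r - 1) * epowr (g t) 1)"
        by (simp add: epowr_mult mult_ac)
      also have "\<dots> = ennreal (36 powr (r - 1)) * epowr (g t) r"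
        using epowr_ennreal[of 36 "r - 1"] epowr_add[of "g t" "r - 1" 1] by simp
      finally show "(\<integral>\<^sup>+l. V l t * g t \<partial>lborel) = ennreal (36 powr (r - 1)) * epowr (g t) r" .
    qed
    also have "\<dots> = ennreal (36 powr (r - 1)) * (\<integral>\<^sup>+t. epowr (g t) r \<partial>TM)"
      by (simp add: nn_integral_cmult)
    also have "ennreal (180 * (r / (r - 1))) * \<dots> = ennreal K * (\<integral>\<^sup>+t. epowr (g t) r \<partial>TM)"
      using r by (simp add: K_def mult.assoc[symmetric] flip: ennreal_mult)
    finally show ?thesis .
  qed
  show thesis
  proof (rule that)
    fix g :: "real \<Rightarrow> ennreal" assume "g \<in> borel_fun"
    from main[OF this] have "elp TM r (maxfun g) \<le> epowr (ennreal K * (\<integral>\<^sup>+t. epowr (g t) r \<partial>TM)) (1 / r)"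
      unfolding elp_def using r by (intro epowr_mono) auto
    also have "\<dots> = ennreal (K powr (1 / r)) * elp TM r g"
      using K by (simp add: epowr_mult elp_def epowr_ennreal)
    finally show "elp TM r (maxfun g) \<le> ennreal (K powr (1 / r)) * elp TM r g" .
  qed simp
qed

text \<open>A Poisson-type kernel at scale 1/2^m, with decay of order 1 + \<beta> in the chord and
  mass bounded uniformly in m. With \<beta> = 1 + \<gamma> it is the angular shape of the Bergman
  kernel between two dyadic annuli.\<close>

definition ckernel :: "real \<Rightarrow> nat \<Rightarrow> real \<Rightarrow> real \<Rightarrow> real" where
  "ckernel \<beta> m s t = (1 / 2 ^ m) powr \<beta> * (1 / 2 ^ m + dist (cis s) (cis t)) powr - (1 + \<beta>)"

lemma ckernel_nonneg [simp]: "0 \<le> ckernel \<beta> m s t"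
  by (simp add: ckernel_def)

lemma ckernel_commute: "ckernel \<beta> m s t = ckernel \<beta> m t s"
  by (simp add: ckernel_def dist_commute)

lemma ckernel_measurable [measurable]:
  "(\<lambda>z. ckernel \<beta> m (fst z) (snd z)) \<in> borel_measurable (borel \<Otimes>\<^sub>M borel)"
  "(\<lambda>t. ckernel \<beta> m s t) \<in> borel_fun"
  unfolding ckernel_def by measurable

definition cker_const :: "real \<Rightarrow> real" where
  "cker_const \<beta> = 2 powr (1 + \<beta>) / (1 - 2 powr (-\<beta>))"

text \<open>Take the largest n \<le> m + 2 for which the chord is below \<open>maxrad n\<close>; n =
  0 always qualifies. If n < m + 2, the chord is also at least half of that radius, and the kernel
  is at most the n-th term: each doubling of the radius beyond the scale 1/2^m gains a factor
  2^(-\<beta>). If n = m + 2, the kernel is bounded by its value on the diagonal.\<close>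

lemma ckernel_le_sum:
  assumes b: "0 < \<beta>"
  shows "ckernel \<beta> m s t \<le> (\<Sum>n\<le>m + 2. 2 powr (1 + \<beta>) * (2 powr (-\<beta>)) ^ (m + 2 - n) *
     (1 / maxrad n * (if dist (cis s) (cis t) < maxrad n then 1 else 0)))" (is "_ \<le> (\<Sum>n\<le>_. ?f n)")
proof -
  let ?d = "dist (cis s) (cis t)"
  have d2: "?d \<le> 2" using norm_triangle_ineq4[of "cis s" "cis t"] by (simp add: dist_norm)
  let ?N = "{n. n \<le> m + 2 \<and> ?d < maxrad n}"
  define n where "n = Max ?N"
  have "0 \<in> ?N" using d2 by (simp add: maxrad_def)
  then have "n \<in> ?N" unfolding n_def by (intro Max_in) auto
  then have n: "n \<le> m + 2" "?d < maxrad n" by auto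
  have "ckernel \<beta> m s t \<le> ?f n"
  proof (cases "n = m + 2")
    case True
    have "ckernel \<beta> m s t \<le> (1 / 2 ^ m) powr \<beta> * (1 / 2 ^ m) powr - (1 + \<beta>)"
      unfolding ckernel_def using b by (intro mult_left_mono powr_mono2') auto
    also have "\<dots> = 2 ^ m"
      by (simp add: powr_add[symmetric] powr_minus_divide)
    also have "\<dots> \<le> 2 powr (1 + \<beta>) * 2 ^ m" using b by (simp add: ge_one_powr_ge_zero)
    also have "\<dots> = ?f n" using n by (simp add: True maxrad_def power_add)
    finally show ?thesis .
  next
    case False
    then have "Suc n \<le> m + 2" using n by simp
    moreover have "Suc n \<notin> ?N" using Max_ge[of ?N "Suc n"] unfolding n_def by fastforce
    ultimately have "maxrad n / 2 \<le> ?d" by (auto simp: maxrad_def)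
    then have "ckernel \<beta> m s t \<le> (1 / 2 ^ m) powr \<beta> * (maxrad n / 2) powr - (1 + \<beta>)"
      unfolding ckernel_def using b maxrad_pos[of n] by (intro mult_left_mono powr_mono2') (auto simp: add_increasing)
    also have "\<dots> = 2 powr (1 + \<beta>) * (2 powr (-\<beta>)) ^ (m + 2 - n) * (1 / maxrad n)"
    proof -
      have m: "maxrad n = 2 powr (2 - real n)" by (simp add: maxrad_def powr_diff powr_realpow)
      have m2: "maxrad n / 2 = 2 powr (1 - real n)" by (simp add: maxrad_def powr_diff powr_realpow)
      have 1: "(1 / 2 ^ m) = 2 powr (- real m)" by (simp add: powr_minus powr_realpow field_simps)
      have 2: "(2 powr (-\<beta>)) ^ (m + 2 - n) = 2 powr (- \<beta> * real (m + 2 - n))"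
        by (simp add: powr_power mult.commute)
      have 3: "1 / maxrad n = 2 powr (real n - 2)" by (simp add: maxrad_def powr_diff powr_realpow)
      show ?thesis unfolding m2 1 2 3 powr_powr powr_add[symmetric]
        using n by (simp add: of_nat_diff algebra_simps)
    qed
    finally show ?thesis using n by simp
  qed
  also have "\<dots> \<le> (\<Sum>n\<le>m + 2. ?f n)"
    using n by (intro member_le_sum) (auto simp: maxrad_def)
  finally show ?thesis .
qed

lemma cker_const_nonneg: "0 < \<beta> \<Longrightarrow> 0 \<le> cker_const \<beta>"
  using powr_less_mono[of "-\<beta>" 0 2] by (simp add: cker_const_def)

text \<open>Every term of the dyadic sum is the normalised mass of a ball that competes in the
  supremum defining \<open>maxfun\<close>. The weights form a geometric series, so the bound does
  not depend on the scale m.\<close>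

lemma ckernel_integral_le_maxfun:
  assumes b: "0 < \<beta>" and [measurable]: "g \<in> borel_fun"
  shows "(\<integral>\<^sup>+t. ennreal (ckernel \<beta> m s t) * g t \<partial>TM) \<le> ennreal (cker_const \<beta>) * maxfun g s"
proof -
  define N where "N = m + 2"
  define c where "c = (\<lambda>n. 2 powr (1 + \<beta>) * (2 powr (-\<beta>)) ^ (N - n))"
  have c: "0 \<le> c n" for n by (simp add: c_def)
  have x: "2 powr (-\<beta>) < 1" using powr_less_mono[of "-\<beta>" 0 2] b by simp
  have "(\<integral>\<^sup>+t. ennreal (ckernel \<beta> m s t) * g t \<partial>TM) \<le>
    (\<integral>\<^sup>+t. (\<Sum>n\<le>N. ennreal (c n) * (ennreal (1 / maxrad n) * (indicator {t. dist (cis s) (cis t) < maxrad n} t * g t))) \<partial>TM)"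
  proof (intro nn_integral_mono)
    fix t
    have "ennreal (ckernel \<beta> m s t) \<le> ennreal (\<Sum>n\<le>N. c n * (1 / maxrad n * (if dist (cis s) (cis t) < maxrad n then 1 else 0)))"
      unfolding c_def N_def by (intro ennreal_leI ckernel_le_sum b)
    also have "\<dots> = (\<Sum>n\<le>N. ennreal (c n) * (ennreal (1 / maxrad n) * indicator {t. dist (cis s) (cis t) < maxrad n} t))"
    proof (subst sum_ennreal[symmetric])
      show "0 \<le> c n * (1 / maxrad n * (if dist (cis s) (cis t) < maxrad n then 1 else 0))" for n
        using c[of n] by simp
      show "(\<Sum>n\<le>N. ennreal (c n * (1 / maxrad n * (if dist (cis s) (cis t) < maxrad n then 1 else 0)))) =
        (\<Sum>n\<le>N. ennreal (c n) * (ennreal (1 / maxrad n) * indicator {t. dist (cis s) (cis t) < maxrad n} t))"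
      proof (rule sum.cong[OF refl])
        fix n
        show "ennreal (c n * (1 / maxrad n * (if dist (cis s) (cis t) < maxrad n then 1 else 0))) =
          ennreal (c n) * (ennreal (1 / maxrad n) * indicator {t. dist (cis s) (cis t) < maxrad n} t)"
          using ennreal_mult[OF c[of n], of "1 / maxrad n"] by (simp add: indicator_def)
      qed
    qed
    finally have "ennreal (ckernel \<beta> m s t) * g t \<le> (\<Sum>n\<le>N. ennreal (c n) * (ennreal (1 / maxrad n) * indicator {t. dist (cis s) (cis t) < maxrad n} t)) * g t"
      by (rule mult_right_mono) simp
    then show "ennreal (ckernel \<beta> m s t) * g t \<le> (\<Sum>n\<le>N. ennreal (c n) * (ennreal (1 / maxrad n) * (indicator {t. dist (cis s) (cis t) < maxrad n} t * g t)))"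
      by (simp only: sum_distrib_right mult.assoc)
  qed
  also have "\<dots> = (\<Sum>n\<le>N. ennreal (c n) * (ennreal (1 / maxrad n) * chord_mass g s (maxrad n)))"
    by (simp add: nn_integral_sum nn_integral_cmult chord_mass_def)
  also have "\<dots> \<le> (\<Sum>n\<le>N. ennreal (c n) * maxfun g s)"
    unfolding maxfun_def by (intro sum_mono mult_left_mono SUP_upper) auto
  also have "\<dots> = ennreal (\<Sum>n\<le>N. c n) * maxfun g s"
    using c by (simp flip: sum_distrib_right)
  also have "(\<Sum>n\<le>N. c n) \<le> cker_const \<beta>"
  proof -
    have "(\<Sum>n\<le>N. c n) = 2 powr (1 + \<beta>) * (\<Sum>n\<le>N. (2 powr (-\<beta>)) ^ (N - n))"
      by (simp add: c_def sum_distrib_left)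
    also have "(\<Sum>n\<le>N. (2 powr (-\<beta>)) ^ (N - n)) = (\<Sum>n\<le>N. (2 powr (-\<beta>)) ^ n)"
      using sum.atLeastAtMost_rev[of "\<lambda>n. (2 powr (-\<beta>)) ^ n" 0 N] by (simp add: atMost_atLeast0)
    also have "\<dots> \<le> (\<Sum>n. (2 powr (-\<beta>)) ^ n)"
      using x by (intro sum_le_suminf) (auto intro!: summable_geometric)
    also have "\<dots> = 1 / (1 - 2 powr (-\<beta>))" using x by (intro suminf_geometric) auto
    finally show ?thesis by (simp add: cker_const_def)
  qed
  finally show ?thesis by (simp add: mult_right_mono ennreal_leI)
qed

text \<open>The maximal function of the constant 1 is at most 18, the constant in the measure of
  arcs.\<close>

lemma ckernel_mass_le:
  assumes b: "0 < \<beta>" and s: "s \<in> {0..2 * pi}"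
  shows "(\<integral>\<^sup>+t. ennreal (ckernel \<beta> m s t) \<partial>TM) \<le> ennreal (18 * cker_const \<beta>)"
proof -
  have "maxfun (\<lambda>_. 1) s \<le> ennreal 18"
    unfolding maxfun_def
  proof (intro SUP_least)
    fix n
    have "chord_mass (\<lambda>_. 1) s (maxrad n) \<le> ennreal (18 * maxrad n)"
      using emeasure_TM_chord_le[OF s, of "maxrad n"] by (simp add: chord_mass_def order_less_imp_le)
    then have "ennreal (1 / maxrad n) * chord_mass (\<lambda>_. 1) s (maxrad n) \<le> ennreal (1 / maxrad n) * ennreal (18 * maxrad n)"
      by (rule mult_left_mono) simp
    also have "\<dots> = ennreal 18" using maxrad_pos[of n] by (simp add: order_less_imp_le flip: ennreal_mult)
    finally show "ennreal (1 / maxrad n) * chord_mass (\<lambda>_. 1) s (maxrad n) \<le> ennreal 18" .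
  qed
  then have "ennreal (cker_const \<beta>) * maxfun (\<lambda>_. 1) s \<le> ennreal (cker_const \<beta>) * ennreal 18"
    by (rule mult_left_mono) simp
  then have "ennreal (cker_const \<beta>) * maxfun (\<lambda>_. 1) s \<le> ennreal (18 * cker_const \<beta>)"
    using cker_const_nonneg[OF b] ennreal_mult[of "cker_const \<beta>" 18] by (simp add: mult.commute)
  then show ?thesis using ckernel_integral_le_maxfun[OF b, of "\<lambda>_. 1" m s] by simp
qed

section \<open>A dyadic model operator\<close>

lemma ennreal_eq_top_if_of_nat_le: "(\<And>n::nat. of_nat n \<le> x) \<Longrightarrow> x = (top :: ennreal)"
  using ennreal_Ex_less_of_nat[of x] by (meson leD less_top)

text \<open>Truncation in height together with restriction to sets that eventually contain y. This
  is the device by which a function of unknown norm is exhausted by bounded ones before the converse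
  of Hoelder's inequality is used.\<close>

lemma SUP_truncate:
  assumes "\<And>N. n0 \<le> N \<Longrightarrow> y \<in> A N"
  shows "(SUP N. min x (of_nat N) * indicator (A N) y) = (x :: ennreal)"
proof (rule antisym)
  show "(SUP N. min x (of_nat N) * indicator (A N) y) \<le> x"
    by (intro SUP_least) (auto simp: indicator_def)
  let ?S = "SUP N. min x (of_nat N) * indicator (A N) y"
  have *: "min x (of_nat N) \<le> ?S" if "n0 \<le> N" for N
    using assms[OF that] by (intro SUP_upper2[of N]) auto
  show "x \<le> ?S"
  proof (cases "x = top")
    case True
    have "of_nat n \<le> ?S" for n :: nat
      using *[of "max n n0"] True by (auto intro: order_trans[rotated])
    then have "?S = top" by (rule ennreal_eq_top_if_of_nat_le)
    then show ?thesis by (simp only: top_greatest)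
  next
    case False
    then obtain n :: nat where "x < of_nat n" using ennreal_Ex_less_of_nat by (auto simp: less_top)
    then have "x \<le> of_nat (max n n0)" by (auto intro: order_trans[OF less_imp_le])
    then show ?thesis using *[of "max n n0"] by (simp add: min_absorb1)
  qed
qed

lemma min_of_nat_mono: "m \<le> n \<Longrightarrow> min x (of_nat m) \<le> min x (of_nat n :: ennreal)"
  by (intro min.mono) auto

abbreviation CM :: "nat measure" where "CM \<equiv> count_space UNIV"

interpretation CM: sigma_finite_measure CM
  by (rule sigma_finite_measure_count_space)

interpretation TC: pair_sigma_finite TM CM ..

definition idist :: "nat \<Rightarrow> nat \<Rightarrow> nat" where "idist j k = max j k - min j k"

lemma idist_sum_le:
  assumes "0 \<le> l" "l < 1"
  shows "(\<integral>\<^sup>+k. ennreal (l ^ idist j k) \<partial>CM) \<le> ennreal (2 / (1 - l))"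
proof -
  let ?f = "\<lambda>k. l ^ idist j k"
  have sh: "?f (k + j) = l ^ k" for k by (simp add: idist_def)
  have sm: "summable ?f"
    using summable_iff_shift[of ?f j] assms by (simp add: sh summable_geometric)
  have "(\<Sum>k. ?f k) = (\<Sum>k. l ^ k) + (\<Sum>k<j. ?f k)"
    using suminf_split_initial_segment[OF sm, of j] by (simp add: sh)
  also have "(\<Sum>k<j. ?f k) = (\<Sum>k<j. l ^ Suc k)"
    by (subst sum.nat_diff_reindex[symmetric]) (auto intro!: sum.cong simp: idist_def)
  also have "\<dots> \<le> (\<Sum>k<j. l ^ k)"
    using assms by (intro sum_mono) (auto simp: mult_left_le_one_le)
  also have "\<dots> \<le> (\<Sum>k. l ^ k)"
    using assms by (intro sum_le_suminf) (auto intro: summable_geometric)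
  also have "(\<Sum>k. l ^ k) = 1 / (1 - l)" using assms by (intro suminf_geometric) auto
  finally have "(\<Sum>k. ?f k) \<le> 2 / (1 - l)" by (simp add: add_divide_distrib[symmetric])
  then show ?thesis
    using assms sm by (simp add: nn_integral_count_space_nat suminf_ennreal2 ennreal_leI)
qed

lemma fst_TM_measurable [measurable]: "fst \<in> borel_measurable (TM \<Otimes>\<^sub>M N)"
  using measurable_fst[of TM N] measurable_cong_sets[OF refl sets_TM, of "TM \<Otimes>\<^sub>M N"] by blast

text \<open>A point (t, k) stands for the k-th dyadic annulus in direction t. The kernel averages in
  the angle at the coarser of the two scales and loses a factor l for each annulus between source
  and target.\<close>

definition dyker :: "real \<Rightarrow> real \<Rightarrow> real \<times> nat \<Rightarrow> real \<times> nat \<Rightarrow> ennreal" where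
  "dyker \<beta> l z w = ennreal (l ^ idist (snd z) (snd w)) *
     ennreal (ckernel \<beta> (min (snd z) (snd w)) (fst z) (fst w))"

lemma dyker_commute: "dyker \<beta> l z w = dyker \<beta> l w z"
  by (simp add: dyker_def idist_def max.commute min.commute ckernel_commute)

lemma dyker_measurable [measurable]:
  assumes [measurable]: "f \<in> M \<rightarrow>\<^sub>M (TM \<Otimes>\<^sub>M CM)" "g \<in> M \<rightarrow>\<^sub>M (TM \<Otimes>\<^sub>M CM)"
  shows "(\<lambda>x. dyker \<beta> l (f x) (g x)) \<in> borel_measurable M"
proof -
  have "(\<lambda>x. (snd (f x), snd (g x))) \<in> M \<rightarrow>\<^sub>M CM \<Otimes>\<^sub>M CM" by measurable
  then have pr: "(\<lambda>x. (snd (f x), snd (g x))) \<in> M \<rightarrow>\<^sub>M count_space (UNIV :: (nat \<times> nat) set)"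
    by (simp add: pair_measure_countable)
  have [measurable]: "(\<lambda>x. h (snd (f x)) (snd (g x))) \<in> borel_measurable M" for h :: "nat \<Rightarrow> nat \<Rightarrow> real"
    using measurable_compose[OF pr, of "\<lambda>p. h (fst p) (snd p)" borel] by simp
  have [measurable]: "(\<lambda>x. l ^ idist (snd (f x)) (snd (g x))) \<in> borel_measurable M"
    "(\<lambda>x. 1 / 2 ^ min (snd (f x)) (snd (g x)) :: real) \<in> borel_measurable M"
    by measurable
  have [measurable]: "(\<lambda>x. fst (f x)) \<in> borel_measurable M" "(\<lambda>x. fst (g x)) \<in> borel_measurable M"
    using measurable_compose[OF assms(1) measurable_fst] measurable_compose[OF assms(2) measurable_fst]
      measurable_cong_sets[OF refl sets_TM, of M] by blast+
  show ?thesis unfolding dyker_def ckernel_def by measurable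
qed

lemma dyker_measurable1 [measurable]:
  assumes "g \<in> M \<rightarrow>\<^sub>M (TM \<Otimes>\<^sub>M CM)"
  shows "(\<lambda>x. dyker \<beta> l w (g x)) \<in> borel_measurable M" "(\<lambda>x. dyker \<beta> l (g x) w) \<in> borel_measurable M"
  by (rule dyker_measurable[OF measurable_const assms] dyker_measurable[OF assms measurable_const],
      simp add: space_pair_measure)+

lemma sigma_finite_TC: "sigma_finite_measure (TM \<Otimes>\<^sub>M CM)"
  by (rule TC.sigma_finite_measure_axioms)

interpretation TC2: pair_sigma_finite "TM \<Otimes>\<^sub>M CM" "TM \<Otimes>\<^sub>M CM"
  unfolding pair_sigma_finite_def using sigma_finite_TC by simp

definition dyop :: "real \<Rightarrow> real \<Rightarrow> (real \<times> nat \<Rightarrow> ennreal) \<Rightarrow> real \<times> nat \<Rightarrow> ennreal" where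
  "dyop \<beta> l f z = (\<integral>\<^sup>+w. dyker \<beta> l z w * f w \<partial>(TM \<Otimes>\<^sub>M CM))"

lemma dyop_measurable [measurable]:
  assumes [measurable]: "f \<in> borel_measurable (TM \<Otimes>\<^sub>M CM)"
  shows "dyop \<beta> l f \<in> borel_measurable (TM \<Otimes>\<^sub>M CM)"
  unfolding dyop_def by measurable

text \<open>The angular integrals are bounded by the same c at every scale, so only the two-sided
  geometric series in the index is left.\<close>

lemma dyker_weighted_mass:
  assumes b: "0 < \<beta>" and l: "0 \<le> l" "l < 1" and [measurable]: "g \<in> borel_fun"
    and le: "\<And>m. (\<integral>\<^sup>+s. ennreal (ckernel \<beta> m (fst w) s) * g s \<partial>TM) \<le> c"
  shows "(\<integral>\<^sup>+z. dyker \<beta> l w z * g (fst z) \<partial>(TM \<Otimes>\<^sub>M CM)) \<le> ennreal (2 / (1 - l)) * c"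
proof -
  have "(\<integral>\<^sup>+z. dyker \<beta> l w z * g (fst z) \<partial>(TM \<Otimes>\<^sub>M CM)) =
     (\<integral>\<^sup>+k. \<integral>\<^sup>+s. dyker \<beta> l w (s, k) * g s \<partial>TM \<partial>CM)"
    by (subst TC.nn_integral_snd[symmetric]) auto
  also have "\<dots> = (\<integral>\<^sup>+k. ennreal (l ^ idist (snd w) k) *
       (\<integral>\<^sup>+s. ennreal (ckernel \<beta> (min (snd w) k) (fst w) s) * g s \<partial>TM) \<partial>CM)"
    by (subst nn_integral_cmult[symmetric]) (auto simp: dyker_def mult.assoc)
  also have "\<dots> \<le> (\<integral>\<^sup>+k. ennreal (l ^ idist (snd w) k) * c \<partial>CM)"
    by (intro nn_integral_mono mult_left_mono le) auto
  also have "\<dots> \<le> ennreal (2 / (1 - l)) * c"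
    using idist_sum_le[OF l] by (simp add: nn_integral_multc mult_right_mono)
  finally show ?thesis .
qed

text \<open>Fubini reduces the \<open>p\<close>-th power of the vector-valued operator, tested against \<open>g\<close>, to the
  maximal function of \<open>g\<close>.\<close>

lemma dyop_power_tested:
  assumes b: "0 < \<beta>" and l: "0 \<le> l" "l < 1" and p: "1 < p"
    and c0: "0 \<le> c0" "\<And>z. fst z \<in> {0..2 * pi} \<Longrightarrow> (\<integral>\<^sup>+w. dyker \<beta> l z w \<partial>(TM \<Otimes>\<^sub>M CM)) \<le> ennreal c0"
    and f [measurable]: "f \<in> borel_measurable (TM \<Otimes>\<^sub>M CM)"
    and g [measurable]: "g \<in> borel_fun" and h [measurable]: "h \<in> borel_fun"
    and gh: "\<And>m s. s \<in> {0..2 * pi} \<Longrightarrow> (\<integral>\<^sup>+t. ennreal (ckernel \<beta> m s t) * g t \<partial>TM) \<le> h s"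
  shows "(\<integral>\<^sup>+s. (\<integral>\<^sup>+k. epowr (dyop \<beta> l f (s, k)) p \<partial>CM) * g s \<partial>TM)
    \<le> ennreal (c0 powr (p - 1) * (2 / (1 - l))) * (\<integral>\<^sup>+t. (\<integral>\<^sup>+j. epowr (f (t, j)) p \<partial>CM) * h t \<partial>TM)"
proof -
  let ?P = "TM \<Otimes>\<^sub>M CM"
  have range: "AE z in ?P. fst z \<in> {0..2 * pi}"
  proof (rule TC.AE_pair_measure)
    show "{x \<in> space ?P. fst x \<in> {0..2 * pi}} \<in> sets ?P" by measurable
    show "AE x in TM. AE y in CM. fst (x, y) \<in> {0..2 * pi}"
      using AE_TM_range by eventually_elim simp
  qed
  have [measurable]: "(\<lambda>z. dyop \<beta> l f (fst z, snd z)) \<in> borel_measurable ?P" by simp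
  have "(\<integral>\<^sup>+s. (\<integral>\<^sup>+k. epowr (dyop \<beta> l f (s, k)) p \<partial>CM) * g s \<partial>TM)
    = (\<integral>\<^sup>+s. \<integral>\<^sup>+k. epowr (dyop \<beta> l f (s, k)) p * g s \<partial>CM \<partial>TM)"
    by (intro nn_integral_cong nn_integral_multc[symmetric]) auto
  also have "\<dots> = (\<integral>\<^sup>+z. epowr (dyop \<beta> l f z) p * g (fst z) \<partial>?P)"
    using CM.nn_integral_fst[of "\<lambda>z. epowr (dyop \<beta> l f z) p * g (fst z)" TM] by simp
  also have "\<dots> \<le> (\<integral>\<^sup>+z. (ennreal (c0 powr (p - 1)) * (\<integral>\<^sup>+w. dyker \<beta> l z w * epowr (f w) p \<partial>?P)) * g (fst z) \<partial>?P)"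
  proof (rule nn_integral_mono_AE)
    show "AE z in ?P. epowr (dyop \<beta> l f z) p * g (fst z) \<le>
       (ennreal (c0 powr (p - 1)) * (\<integral>\<^sup>+w. dyker \<beta> l z w * epowr (f w) p \<partial>?P)) * g (fst z)"
      using range
    proof eventually_elim
      case (elim z)
      have "epowr (dyop \<beta> l f z) p \<le> epowr (ennreal c0) (p - 1) * (\<integral>\<^sup>+w. dyker \<beta> l z w * epowr (f w) p \<partial>?P)"
        unfolding dyop_def using c0(2)[OF elim] by (intro nn_integral_kernel_power_le p) auto
      then show ?case using c0(1) by (intro mult_right_mono) (auto simp: epowr_ennreal)
    qed
  qed
  also have "\<dots> = ennreal (c0 powr (p - 1)) * (\<integral>\<^sup>+z. (\<integral>\<^sup>+w. dyker \<beta> l z w * epowr (f w) p \<partial>?P) * g (fst z) \<partial>?P)"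
    by (simp add: nn_integral_cmult mult.assoc)
  also have "(\<integral>\<^sup>+z. (\<integral>\<^sup>+w. dyker \<beta> l z w * epowr (f w) p \<partial>?P) * g (fst z) \<partial>?P) =
      (\<integral>\<^sup>+z. (\<integral>\<^sup>+w. dyker \<beta> l z w * epowr (f w) p * g (fst z) \<partial>?P) \<partial>?P)"
    by (intro nn_integral_cong nn_integral_multc[symmetric]) measurable
  also have "(\<integral>\<^sup>+z. (\<integral>\<^sup>+w. dyker \<beta> l z w * epowr (f w) p * g (fst z) \<partial>?P) \<partial>?P)
     = (\<integral>\<^sup>+w. (\<integral>\<^sup>+z. dyker \<beta> l z w * epowr (f w) p * g (fst z) \<partial>?P) \<partial>?P)"
    by (rule TC2.Fubini'[symmetric]) measurable
  also have "\<dots> = (\<integral>\<^sup>+w. epowr (f w) p * (\<integral>\<^sup>+z. dyker \<beta> l w z * g (fst z) \<partial>?P) \<partial>?P)"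
    by (subst nn_integral_cmult[symmetric]) (auto simp: dyker_commute mult_ac intro!: nn_integral_cong)
  also have "\<dots> \<le> (\<integral>\<^sup>+w. epowr (f w) p * (ennreal (2 / (1 - l)) * h (fst w)) \<partial>?P)"
  proof (rule nn_integral_mono_AE)
    show "AE w in ?P. epowr (f w) p * (\<integral>\<^sup>+z. dyker \<beta> l w z * g (fst z) \<partial>?P)
        \<le> epowr (f w) p * (ennreal (2 / (1 - l)) * h (fst w))"
      using range
      by eventually_elim (intro mult_left_mono dyker_weighted_mass b l g gh, auto)
  qed
  also have "\<dots> = ennreal (2 / (1 - l)) * (\<integral>\<^sup>+w. epowr (f w) p * h (fst w) \<partial>?P)"
    by (subst nn_integral_cmult[symmetric]) (auto simp: mult_ac)
  also have "(\<integral>\<^sup>+w. epowr (f w) p * h (fst w) \<partial>?P) = (\<integral>\<^sup>+t. \<integral>\<^sup>+j. epowr (f (t, j)) p * h t \<partial>CM \<partial>TM)"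
    using CM.nn_integral_fst[of "\<lambda>z. epowr (f z) p * h (fst z)" TM] by simp
  also have "\<dots> = (\<integral>\<^sup>+t. (\<integral>\<^sup>+j. epowr (f (t, j)) p \<partial>CM) * h t \<partial>TM)"
    by (intro nn_integral_cong nn_integral_multc) auto
  finally show ?thesis
    using c0(1) l by (subst ennreal_mult) (auto simp: mult.assoc mult_left_mono)
qed

lemma elp2_eq_power:
  assumes "0 < p" "0 < q"
  shows "elp2 TM CM p q F = epowr (elp TM (q / p) (\<lambda>t. \<integral>\<^sup>+k. epowr (F t k) p \<partial>CM)) (1 / p)"
  using assms elp_epowr[of "1 / p" TM q "\<lambda>t. \<integral>\<^sup>+k. epowr (F t k) p \<partial>CM"]
  by (simp add: elp2_def elp_def[of CM])

text \<open>The inner p-th powers \<open>X f\<close> and \<open>Y f\<close> are functions of the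
  angle to be compared in L^(q/p), where q/p \<ge> 1. For q = p the single test function 1 and the
  mass of the kernel suffice. For q > p one tests against all g in the dual space:
  \<open>dyop_power_tested\<close> replaces g by a multiple of its maximal function, which is
  bounded because the dual exponent of q/p is finite and above 1.\<close>

lemma dyop_bounded_ge:
  assumes b: "0 < \<beta>" and l: "0 \<le> l" "l < 1" and p: "1 < p" and pq: "p \<le> q"
  obtains C :: real where "0 \<le> C"
    "\<And>f. f \<in> borel_measurable (TM \<Otimes>\<^sub>M CM) \<Longrightarrow>
       elp2 TM CM p q (curry (dyop \<beta> l f)) \<le> ennreal C * elp2 TM CM p q (curry f)"
proof -
  let ?P = "TM \<Otimes>\<^sub>M CM"
  define c0 where "c0 = 2 / (1 - l) * (18 * cker_const \<beta>)"
  have c0: "0 \<le> c0" using l cker_const_nonneg[OF b] by (simp add: c0_def)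
  have mass: "(\<integral>\<^sup>+w. dyker \<beta> l z w \<partial>?P) \<le> ennreal c0" if "fst z \<in> {0..2 * pi}" for z
  proof -
    have "(\<integral>\<^sup>+w. dyker \<beta> l z w * 1 \<partial>?P) \<le> ennreal (2 / (1 - l)) * ennreal (18 * cker_const \<beta>)"
      using ckernel_mass_le[OF b that] by (intro dyker_weighted_mass[OF b l]) simp_all
    also have "\<dots> = ennreal c0"
      unfolding c0_def using l cker_const_nonneg[OF b] by (intro ennreal_mult[symmetric]) auto
    finally show ?thesis by simp
  qed
  define K where "K = c0 powr (p - 1) * (2 / (1 - l))"
  have K: "0 \<le> K" using l by (simp add: K_def)
  define M1 where "M1 = 18 * cker_const \<beta>"
  have M1: "0 \<le> M1" using cker_const_nonneg[OF b] by (simp add: M1_def)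
  define M2 where "M2 = cker_const \<beta>"
  have M2: "0 \<le> M2" using cker_const_nonneg[OF b] by (simp add: M2_def)
  note tested = dyop_power_tested[OF b l p c0 mass, folded K_def]
  define X where "X = (\<lambda>f s. \<integral>\<^sup>+k. epowr (dyop \<beta> l f (s, k)) p \<partial>CM)"
  define Y where "Y = (\<lambda>(f :: real \<times> nat \<Rightarrow> ennreal) (t :: real). \<integral>\<^sup>+j. epowr (f (t, j)) p \<partial>CM)"
  have Xm: "X f \<in> borel_fun" if [measurable]: "f \<in> borel_measurable ?P" for f
  proof -
    have "(\<lambda>s. \<integral>\<^sup>+k. epowr (dyop \<beta> l f (s, k)) p \<partial>CM) \<in> borel_measurable TM" by measurable
    then show ?thesis by (simp add: X_def)
  qed
  have Ym: "Y f \<in> borel_fun" if [measurable]: "f \<in> borel_measurable ?P" for f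
  proof -
    have "(\<lambda>t. \<integral>\<^sup>+k. epowr (f (t, k)) p \<partial>CM) \<in> borel_measurable TM" by measurable
    then show ?thesis by (simp add: Y_def)
  qed
  have "\<exists>C. 0 \<le> C \<and> (\<forall>f \<in> borel_measurable ?P. elp TM (q / p) (X f) \<le> ennreal C * elp TM (q / p) (Y f))"
  proof (cases "q = p")
    case True
    have h: "(\<integral>\<^sup>+t. ennreal (ckernel \<beta> m s t) * 1 \<partial>TM) \<le> ennreal M1" if "s \<in> {0..2 * pi}" for m s
      using ckernel_mass_le[OF b that] by (simp add: M1_def)
    have "elp TM (q / p) (X f) \<le> ennreal (K * M1) * elp TM (q / p) (Y f)"
      if f: "f \<in> borel_measurable ?P" for f
    proof -
      note [measurable] = Xm[OF f] Ym[OF f]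
      have "(\<integral>\<^sup>+s. X f s * 1 \<partial>TM) \<le> ennreal (K) * (\<integral>\<^sup>+t. Y f t * ennreal M1 \<partial>TM)"
        unfolding X_def Y_def by (rule tested[OF _ f _ _ h]) auto
      also have "(\<integral>\<^sup>+t. Y f t * ennreal M1 \<partial>TM) = ennreal M1 * (\<integral>\<^sup>+t. Y f t \<partial>TM)"
        by (subst nn_integral_cmult[symmetric]) (measurable, simp add: mult.commute)
      finally show ?thesis
        using True p K M1 by (simp add: elp_def ennreal_mult mult_ac)
    qed
    then show ?thesis using K M1
      by (intro exI[of _ "K * M1"]) auto
  next
    case False
    define r where "r = q / p"
    have r: "1 < r" using False pq p by (simp add: r_def)
    note rr = conj_exponent[OF r]
    obtain CM1 where CM1: "0 \<le> CM1"
      "\<And>g. g \<in> borel_fun \<Longrightarrow> elp TM (conj_exponent r) (maxfun g) \<le> ennreal CM1 * elp TM (conj_exponent r) g"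
      using maxfun_strong_type[OF rr(1)] by blast
    define C where "C = K * M2 * CM1"
    have "elp TM r (X f) \<le> ennreal C * elp TM r (Y f)" if f: "f \<in> borel_measurable ?P" for f
    proof -
      note [measurable] = Xm[OF f] Ym[OF f]
      have tst: "(\<integral>\<^sup>+s. X f s * g s \<partial>TM) \<le> (ennreal C * elp TM r (Y f)) * elp TM (conj_exponent r) g"
        if [measurable]: "g \<in> borel_fun" for g
      proof -
        have "(\<integral>\<^sup>+s. X f s * g s \<partial>TM) \<le> ennreal (K) *
            (\<integral>\<^sup>+t. Y f t * (ennreal M2 * maxfun g t) \<partial>TM)"
          unfolding X_def Y_def
          by (rule tested[OF _ f that _ ckernel_integral_le_maxfun[OF b that, folded M2_def]]) auto
        also have "(\<integral>\<^sup>+t. Y f t * (ennreal M2 * maxfun g t) \<partial>TM) = ennreal M2 * (\<integral>\<^sup>+t. Y f t * maxfun g t \<partial>TM)"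
          by (subst nn_integral_cmult[symmetric]) (auto simp: mult_ac)
        also have "(\<integral>\<^sup>+t. Y f t * maxfun g t \<partial>TM) \<le> elp TM r (Y f) * elp TM (conj_exponent r) (maxfun g)"
          by (rule elp_Holder[OF r]) auto
        also have "elp TM (conj_exponent r) (maxfun g) \<le> ennreal CM1 * elp TM (conj_exponent r) g"
          by (rule CM1(2)) fact
        finally have "(\<integral>\<^sup>+s. X f s * g s \<partial>TM) \<le>
            ennreal K * (ennreal M2 * (elp TM r (Y f) * (ennreal CM1 * elp TM (conj_exponent r) g)))"
          by (simp add: mult_left_mono)
        also have "\<dots> = ennreal C * elp TM r (Y f) * elp TM (conj_exponent r) g"
          using K M2 CM1(1) by (simp add: C_def ennreal_mult mult_ac)
        finally show ?thesis .
      qed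
      \<comment> \<open>The norm of \<open>X f\<close> is not yet known to be finite, so the
        converse of Hoelder's inequality is applied to its truncations.\<close>
      have trunc: "X f = (\<lambda>t. SUP N. min (X f t) (of_nat N))"
        using SUP_truncate[of 0 _ "\<lambda>_. UNIV"] by (intro ext) simp
      have "elp TM r (X f) = (SUP N. elp TM r (\<lambda>t. min (X f t) (of_nat N)))"
        by (subst trunc, rule elp_SUP) (use r in \<open>auto simp: incseq_def le_fun_def simp del: min.bounded_iff intro!: min_of_nat_mono\<close>)
      also have "\<dots> \<le> ennreal C * elp TM r (Y f)"
      proof (intro SUP_least elp_converse_Holder_finite[OF r])
        fix N :: nat
        show "elp TM r (\<lambda>t. min (X f t) (of_nat N)) < top"
          using r by (intro elp_bounded_finite[where c="of_nat N"] finite_measure_TM) (auto simp: of_nat_less_top)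
        fix g :: "real \<Rightarrow> ennreal" assume g: "g \<in> borel_measurable TM"
        have "(\<integral>\<^sup>+t. min (X f t) (of_nat N) * g t \<partial>TM) \<le> (\<integral>\<^sup>+t. X f t * g t \<partial>TM)"
          by (intro nn_integral_mono mult_right_mono) auto
        also have "\<dots> \<le> ennreal C * elp TM r (Y f) * elp TM (conj_exponent r) g"
          using g by (intro tst) simp
        finally show "(\<integral>\<^sup>+t. min (X f t) (of_nat N) * g t \<partial>TM) \<le> ennreal C * elp TM r (Y f) * elp TM (conj_exponent r) g" .
      qed auto
      finally show ?thesis .
    qed
    moreover have "0 \<le> C" using K M2 CM1(1) by (simp add: C_def)
    ultimately show ?thesis unfolding r_def by blast
  qed
  then obtain C where C: "0 \<le> C" "\<And>f. f \<in> borel_measurable ?P \<Longrightarrow> elp TM (q / p) (X f) \<le> ennreal C * elp TM (q / p) (Y f)"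
    by blast
  show thesis
  proof (rule that)
    fix f :: "real \<times> nat \<Rightarrow> ennreal" assume f: "f \<in> borel_measurable ?P"
    have "elp2 TM CM p q (curry (dyop \<beta> l f)) = epowr (elp TM (q / p) (X f)) (1 / p)"
      using p pq by (simp add: elp2_eq_power X_def curry_def)
    also have "\<dots> \<le> epowr (ennreal C * elp TM (q / p) (Y f)) (1 / p)"
      using C(2)[OF f] p by (intro epowr_mono) auto
    also have "\<dots> = ennreal (C powr (1 / p)) * elp2 TM CM p q (curry f)"
      using C(1) p pq by (simp add: elp2_eq_power Y_def curry_def epowr_mult epowr_ennreal)
    finally show "elp2 TM CM p q (curry (dyop \<beta> l f)) \<le> ennreal (C powr (1 / p)) * elp2 TM CM p q (curry f)" .
  qed simp
qed

lemma dyop_bounded: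
  assumes b: "0 < \<beta>" and l: "0 \<le> l" "l < 1" and p: "1 < p" and q: "1 < q"
  obtains C :: real where "0 \<le> C"
    "\<And>f. f \<in> borel_measurable (TM \<Otimes>\<^sub>M CM) \<Longrightarrow>
       elp2 TM CM p q (curry (dyop \<beta> l f)) \<le> ennreal C * elp2 TM CM p q (curry f)"
proof (cases "p \<le> q")
  case True
  then show thesis using dyop_bounded_ge[OF b l p True] that by blast
next
  case False
  let ?P = "TM \<Otimes>\<^sub>M CM"
  note pp = conj_exponent[OF p] and qq = conj_exponent[OF q]
  let ?p' = "conj_exponent p" and ?q' = "conj_exponent q"
  \<comment> \<open>Conjugation reverses the order of the exponents, so the case already settled
    applies to p' and q'. Since \<open>dyker\<close> is symmetric, the operator is its own adjoint
    and the bound dualises back.\<close>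
  have "?p' \<le> ?q'" using False p q by (simp add: conj_exponent_def field_simps)
  then obtain C where C: "0 \<le> C" "\<And>f. f \<in> borel_measurable ?P \<Longrightarrow>
       elp2 TM CM ?p' ?q' (curry (dyop \<beta> l f)) \<le> ennreal C * elp2 TM CM ?p' ?q' (curry f)"
    using dyop_bounded_ge[OF b l pp(1)] by blast
  show thesis
  proof (rule that[OF C(1)])
    fix f :: "real \<times> nat \<Rightarrow> ennreal" assume f [measurable]: "f \<in> borel_measurable ?P"
    let ?g = "curry (dyop \<beta> l f)"
    \<comment> \<open>Truncation in height alone would not give a finite inner norm, because
      counting measure is infinite; the index is cut off as well.\<close>
    define F where "F = (\<lambda>N t k. min (?g t k) (of_nat N) * indicator {..N} k)"
    have Fle: "F N t k \<le> ?g t k" for N t k by (auto simp: F_def indicator_def)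
    have Fm: "case_prod (F N) \<in> borel_measurable ?P" for N
    proof -
      have "(\<lambda>x. min (dyop \<beta> l f x) (of_nat N) * (if snd x \<le> N then 1 else 0)) \<in> borel_measurable ?P"
        by measurable
      moreover have "case_prod (F N) = (\<lambda>x. min (dyop \<beta> l f x) (of_nat N) * (if snd x \<le> N then 1 else 0))"
        by (auto simp: F_def indicator_def)
      ultimately show ?thesis by simp
    qed
    have "elp2 TM CM p q (\<lambda>t k. SUP N. F N t k) \<le> ennreal C * elp2 TM CM p q (curry f)"
    proof (rule CM.elp2_converse_Holder[OF p q])
      show "incseq F" unfolding F_def incseq_def le_fun_def
        by (auto intro!: mult_mono min_of_nat_mono simp: indicator_def simp del: min.bounded_iff min_le_iff_disj)
      show "elp2 TM CM p q (F N) < top" for N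
        unfolding elp2_def
      proof (rule elp_bounded_finite[OF finite_measure_TM])
        let ?c = "\<lambda>k. of_nat N * indicator {..N} k :: ennreal"
        show "elp CM p (F N t) \<le> elp CM p ?c" for t
          using p by (intro elp_mono) (auto simp: F_def intro!: mult_right_mono)
        have "(\<integral>\<^sup>+k. epowr (?c k) p \<partial>CM) = (\<integral>\<^sup>+k. epowr (of_nat N) p * indicator {..N} k \<partial>CM)"
          by (intro nn_integral_cong) (auto simp: indicator_def)
        also have "\<dots> < top" by (simp add: nn_integral_cmult_indicator ennreal_mult_less_top ennreal_mult_eq_top_iff less_top[symmetric])
        finally show "elp CM p ?c < top" using p by (simp add: elp_def)
      qed (use q in auto)
      fix N :: nat and H :: "real \<Rightarrow> nat \<Rightarrow> ennreal" assume H: "case_prod H \<in> borel_measurable ?P"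
      have [measurable]: "(\<lambda>z. H (fst z) (snd z)) \<in> borel_measurable ?P" using H by (simp add: case_prod_beta')
      define H' where "H' = (\<lambda>z. H (fst z) (snd z))"
      have [measurable]: "H' \<in> borel_measurable ?P" by (simp add: H'_def)
      have "(\<integral>\<^sup>+t. \<integral>\<^sup>+k. F N t k * H t k \<partial>CM \<partial>TM) \<le> (\<integral>\<^sup>+t. \<integral>\<^sup>+k. dyop \<beta> l f (t, k) * H' (t, k) \<partial>CM \<partial>TM)"
        using Fle by (intro nn_integral_mono mult_mono) (auto simp: H'_def)
      also have "\<dots> = (\<integral>\<^sup>+z. dyop \<beta> l f z * H' z \<partial>?P)"
        by (rule CM.nn_integral_fst) measurable
      also have "\<dots> = (\<integral>\<^sup>+z. \<integral>\<^sup>+w. dyker \<beta> l z w * f w * H' z \<partial>?P \<partial>?P)"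
        by (subst nn_integral_multc) (auto simp: dyop_def)
      also have "\<dots> = (\<integral>\<^sup>+w. \<integral>\<^sup>+z. dyker \<beta> l z w * f w * H' z \<partial>?P \<partial>?P)"
        by (rule TC2.Fubini'[symmetric]) measurable
      also have "\<dots> = (\<integral>\<^sup>+w. f w * dyop \<beta> l H' w \<partial>?P)"
        unfolding dyop_def
        by (subst nn_integral_cmult[symmetric]) (auto simp: dyker_commute mult_ac intro!: nn_integral_cong)
      also have "\<dots> = (\<integral>\<^sup>+t. \<integral>\<^sup>+k. f (t, k) * dyop \<beta> l H' (t, k) \<partial>CM \<partial>TM)"
        by (rule CM.nn_integral_fst[symmetric]) measurable
      also have "\<dots> \<le> elp2 TM CM p q (curry f) * elp2 TM CM ?p' ?q' (curry (dyop \<beta> l H'))"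
        using CM.elp2_Holder[OF p q, of "curry f" TM "curry (dyop \<beta> l H')"] by simp
      also have "\<dots> \<le> elp2 TM CM p q (curry f) * (ennreal C * elp2 TM CM ?p' ?q' (curry H'))"
        by (intro mult_left_mono C(2)) auto
      also have "curry H' = H" by (simp add: H'_def curry_def)
      finally show "(\<integral>\<^sup>+t. \<integral>\<^sup>+k. F N t k * H t k \<partial>CM \<partial>TM)
        \<le> ennreal C * elp2 TM CM p q (curry f) * elp2 TM CM ?p' ?q' H"
        by (simp add: mult_ac curry_def)
    qed (rule Fm)
    moreover have "(\<lambda>t k. SUP N. F N t k) = ?g"
      unfolding F_def by (intro ext SUP_truncate) auto
    ultimately show "elp2 TM CM p q ?g \<le> ennreal C * elp2 TM CM p q (curry f)" by simp
  qed
qed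

section \<open>The maximal Bergman projection\<close>

text \<open>The measure r dr on [0,1), again as a density on the line. Together with
  \<open>TM\<close> it is the area measure in polar coordinates, and since the origin has measure 0,
  pointwise facts are needed for 0 < r < 1 only.\<close>

definition RM :: "real measure" where
  "RM = density lborel (\<lambda>r. indicator {0..<1} r * ennreal r)"

lemma sets_RM [measurable_cong, simp]: "sets RM = sets borel"
  by (simp add: RM_def)

lemma space_RM [simp]: "space RM = UNIV"
  by (simp add: RM_def)

lemma nn_integral_RM:
  assumes [measurable]: "f \<in> borel_fun"
  shows "(\<integral>\<^sup>+r. f r \<partial>RM) = (\<integral>\<^sup>+r. f r * ennreal r * indicator {0..<1} r \<partial>lborel)"
  unfolding RM_def by (subst nn_integral_density) (auto simp: mult_ac)

lemma AE_RM: "(AE r in RM. P r) \<longleftrightarrow> (AE r in lborel. r \<in> {0<..<1} \<longrightarrow> P r)"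
proof -
  have "(AE r in RM. P r) \<longleftrightarrow> (AE r in lborel. 0 < (indicator {0..<1} r * ennreal r) \<longrightarrow> P r)"
    unfolding RM_def by (rule AE_density) simp
  moreover have "(0 < (indicator {0..<1} r * ennreal r)) \<longleftrightarrow> r \<in> {0<..<1}" for r :: real
    by (auto simp: indicator_def)
  ultimately show ?thesis by (simp only:)
qed

lemma AE_RM_range: "AE r in RM. r \<in> {0<..<1}"
  by (simp add: AE_RM)

lemma finite_measure_RM: "finite_measure RM"
proof
  have "emeasure RM (space RM) = (\<integral>\<^sup>+r. 1 \<partial>RM)" by simp
  also have "\<dots> \<le> (\<integral>\<^sup>+r. indicator {0..<1::real} r \<partial>lborel)"
  proof (subst nn_integral_RM)
    show "(\<integral>\<^sup>+r. 1 * ennreal r * indicator {0..<1} r \<partial>lborel) \<le> (\<integral>\<^sup>+r. indicator {0..<1::real} r \<partial>lborel)"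
      by (intro nn_integral_mono) (auto simp: indicator_def)
  qed simp
  also have "\<dots> = 1" by simp
  finally show "emeasure RM (space RM) \<noteq> \<infinity>" by (auto simp: top_unique)
qed

interpretation RM: finite_measure RM by (rule finite_measure_RM)
interpretation TR: pair_sigma_finite TM RM ..

abbreviation polar_measurable :: "(real \<Rightarrow> real \<Rightarrow> 'a::topological_space) \<Rightarrow> bool" where
  "polar_measurable F \<equiv> case_prod F \<in> borel_measurable (TM \<Otimes>\<^sub>M RM)"

abbreviation polar_int :: "(real \<Rightarrow> real \<Rightarrow> ennreal) \<Rightarrow> ennreal" where
  "polar_int F \<equiv> \<integral>\<^sup>+t. \<integral>\<^sup>+r. F t r \<partial>RM \<partial>TM"

abbreviation "disc_measurable \<equiv> borel_measurable (lebesgue_on unit_disc)"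

definition vweight :: "real \<Rightarrow> real \<Rightarrow> real" where
  "vweight \<gamma> r = (\<gamma> + 1) * (1 - r\<^sup>2) powr \<gamma>"

lemma vweight_measurable [measurable]: "vweight \<gamma> \<in> borel_fun"
  unfolding vweight_def by measurable

lemma vweight_pos: "-1 < \<gamma> \<Longrightarrow> r \<in> {0<..<1} \<Longrightarrow> 0 < vweight \<gamma> r"
  by (auto simp: vweight_def abs_square_eq_1)

lemma vweight_nonneg: "-1 < \<gamma> \<Longrightarrow> 0 \<le> vweight \<gamma> r"
  by (simp add: vweight_def)

lemma vweight_integral:
  assumes g: "-1 < \<gamma>" and ab: "0 \<le> a" "a \<le> b" "b \<le> 1"
  shows "(\<integral>\<^sup>+r. ennreal (vweight \<gamma> r) * indicator {a..<b} r \<partial>RM)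
    = ennreal (((1 - a\<^sup>2) powr (\<gamma> + 1) - (1 - b\<^sup>2) powr (\<gamma> + 1)) / 2)"
proof -
  let ?F = "\<lambda>r. - ((1 - r\<^sup>2) powr (\<gamma> + 1)) / 2"
  have "((\<lambda>r. vweight \<gamma> r * r) has_integral (?F b - ?F a)) {a..b}"
  proof (rule fundamental_theorem_of_calculus_interior)
    show "continuous_on {a..b} ?F"
      using g ab by (intro continuous_intros continuous_on_powr') (auto simp: power_le_one)
    fix x assume x: "x \<in> {a<..<b}"
    then have "0 < 1 - x\<^sup>2" using ab by (simp add: abs_square_less_1)
    then have "(?F has_real_derivative vweight \<gamma> x * x) (at x)"
      by (auto intro!: derivative_eq_intros simp: vweight_def powr_diff field_simps)
    then show "(?F has_vector_derivative vweight \<gamma> x * x) (at x)"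
      by (simp add: has_real_derivative_iff_has_vector_derivative)
  qed (use ab in simp)
  then have "(\<integral>\<^sup>+r. ennreal (vweight \<gamma> r * r) * indicator {a..b} r \<partial>lborel) = ennreal (?F b - ?F a)"
    using g ab by (intro nn_integral_has_integral_lebesgue') (auto simp: vweight_nonneg)
  moreover have "(\<integral>\<^sup>+r. ennreal (vweight \<gamma> r * r) * indicator {a..b} r \<partial>lborel) =
      (\<integral>\<^sup>+r. ennreal (vweight \<gamma> r) * indicator {a..<b} r * ennreal r * indicator {0..<1} r \<partial>lborel)"
  proof (rule nn_integral_cong_AE)
    show "AE r in lborel. ennreal (vweight \<gamma> r * r) * indicator {a..b} r =
      ennreal (vweight \<gamma> r) * indicator {a..<b} r * ennreal r * indicator {0..<1} r"
      using AE_lborel_singleton[of b]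
      by eventually_elim (use ab g in \<open>auto simp: indicator_def vweight_nonneg ennreal_mult\<close>)
  qed
  ultimately show ?thesis by (subst nn_integral_RM) (auto simp: field_simps)
qed

section \<open>Dyadic decomposition of the radius\<close>

definition dyp :: "nat \<Rightarrow> real" where "dyp k = 1 - 1 / 2 ^ k"

definition dyint :: "nat \<Rightarrow> real set" where "dyint k = {dyp k..<dyp (Suc k)}"

lemma dyp_simps [simp]: "0 \<le> dyp k" "dyp k < 1" "dyp k \<le> 1" "dyp 0 = 0"
  by (auto simp: dyp_def field_simps)

lemma dyp_sq [simp]: "(dyp k)\<^sup>2 < 1"
  by (simp add: abs_square_less_1)

lemma dyp_sq_neq [simp]: "(dyp k)\<^sup>2 \<noteq> 1"
  using dyp_sq[of k] by linarith

lemma less_dyp_imp_less_1: "x < dyp k \<Longrightarrow> x < 1"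
  by (meson dyp_simps(2) less_trans)

lemma dyp_mono: "j \<le> k \<Longrightarrow> dyp j \<le> dyp k"
  by (simp add: dyp_def frac_le)

lemma dyint_sets [measurable]: "dyint k \<in> sets borel" by (simp add: dyint_def)

lemma ex1_dyint:
  assumes "r \<in> {0..<1}"
  shows "\<exists>!k. r \<in> dyint k"
proof (rule ex_ex1I)
  obtain n where "(1 / 2) ^ n < 1 - r" using real_arch_pow_inv[of "1 - r" "1 / 2"] assms by auto
  then have ex: "r < dyp n" by (simp add: dyp_def power_divide)
  define k where "k = (LEAST n. r < dyp n)"
  have k: "r < dyp k" unfolding k_def by (rule LeastI[of "\<lambda>n. r < dyp n"]) (rule ex)
  then obtain j where j: "k = Suc j" using assms by (cases k) auto
  then have "\<not> r < dyp j" using not_less_Least[of j "\<lambda>n. r < dyp n"] by (simp add: k_def)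
  then show "\<exists>k. r \<in> dyint k" using k j by (intro exI[of _ j]) (auto simp: dyint_def)
next
  fix j k assume jk: "r \<in> dyint j" "r \<in> dyint k"
  then have "\<not> Suc j \<le> k" "\<not> Suc k \<le> j"
    using dyp_mono[of "Suc j" k] dyp_mono[of "Suc k" j] by (auto simp: dyint_def)
  then show "j = k" by simp
qed

lemma dyint_cases:
  assumes "r \<in> {0..<1}"
  obtains j where "r \<in> dyint j" "\<And>k. r \<in> dyint k \<Longrightarrow> k = j"
  using ex1_dyint[OF assms] by metis

lemma nn_integral_RM_dyadic:
  assumes [measurable]: "f \<in> borel_fun"
  shows "(\<integral>\<^sup>+r. f r \<partial>RM) = (\<integral>\<^sup>+k. \<integral>\<^sup>+r. f r * indicator (dyint k) r \<partial>RM \<partial>CM)"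
proof -
  have "(\<integral>\<^sup>+k. \<integral>\<^sup>+r. f r * indicator (dyint k) r \<partial>RM \<partial>CM) =
      (\<integral>\<^sup>+r. \<integral>\<^sup>+k. f r * indicator (dyint k) r \<partial>CM \<partial>RM)"
    by (rule nn_integral_count_space_nn_integral[symmetric]) auto
  also have "\<dots> = (\<integral>\<^sup>+r. f r \<partial>RM)"
  proof (rule nn_integral_cong_AE)
    show "AE r in RM. (\<integral>\<^sup>+k. f r * indicator (dyint k) r \<partial>CM) = f r"
      using AE_RM_range
    proof eventually_elim
      case (elim r)
      then have "r \<in> {0..<1}" by simp
      then obtain j where j: "r \<in> dyint j" "\<And>k. r \<in> dyint k \<Longrightarrow> k = j"
        using dyint_cases by metis
      have "(\<integral>\<^sup>+k. f r * indicator (dyint k) r \<partial>CM) = (\<integral>\<^sup>+k. f r * indicator {j} k \<partial>CM)"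
      proof (rule nn_integral_cong)
        fix k
        have "r \<in> dyint k \<longleftrightarrow> k = j" using j(1) j(2)[of k] by blast
        then show "f r * indicator (dyint k) r = f r * indicator {j} k" by (simp add: indicator_def)
      qed
      also have "\<dots> = f r" by (subst nn_integral_cmult_indicator) auto
      finally show ?case .
    qed
  qed
  finally show ?thesis by simp
qed

text \<open>This is |1 - cnj \<zeta> z|^-(2+\<gamma>) for z = r cis \<theta> and \<zeta> = s cis
  t.\<close>

definition Pkernel :: "real \<Rightarrow> real \<Rightarrow> real \<Rightarrow> real \<Rightarrow> real \<Rightarrow> real" where
  "Pkernel \<gamma> \<theta> r t s = norm (1 - of_real (r * s) * cis (\<theta> - t)) powr - (2 + \<gamma>)"

lemma Pkernel_measurable [measurable]:
  assumes [measurable]: "a \<in> borel_measurable M" "b \<in> borel_measurable M" "c \<in> borel_measurable M" "d \<in> borel_measurable M"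
  shows "(\<lambda>x. Pkernel \<gamma> (a x) (b x) (c x) (d x)) \<in> borel_measurable M"
  unfolding Pkernel_def by measurable

lemma Pkernel_nonneg [simp]: "0 \<le> Pkernel \<gamma> \<theta> r t s" by (simp add: Pkernel_def)

text \<open>The maximal projection in polar coordinates, multiplied by \<pi>. It acts on functions
  with values in [0,\<infinity>], so that no integrability has to be established before it can be
  estimated.\<close>

definition Pplus :: "real \<Rightarrow> (real \<Rightarrow> real \<Rightarrow> ennreal) \<Rightarrow> real \<Rightarrow> real \<Rightarrow> ennreal" where
  "Pplus \<gamma> F \<theta> r = polar_int (\<lambda>t s. ennreal (Pkernel \<gamma> \<theta> r t s) * (ennreal (vweight \<gamma> s) * F t s))"

lemma one_minus_le_norm:
  assumes "0 \<le> \<rho>"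
  shows "1 - \<rho> \<le> norm (1 - of_real \<rho> * cis x)"
  using norm_triangle_ineq2[of 1 "of_real \<rho> * cis x"] assms by (simp add: norm_mult)

text \<open>Moving the point \<rho> e^(ix) out to the circle changes its distance from 1 by at most
  1 - \<rho>, and 1 - \<rho> is itself at most that distance.\<close>

lemma chord_le_norm:
  assumes "0 \<le> \<rho>" "\<rho> \<le> 1"
  shows "dist (cis a) (cis b) \<le> 2 * norm (1 - of_real \<rho> * cis (a - b))"
proof -
  have "cis a - cis b = cis b * (cis (a - b) - 1)"
    by (simp add: algebra_simps cis_mult)
  then have "dist (cis a) (cis b) = norm (1 - cis (a - b))"
    by (simp add: dist_norm norm_mult norm_minus_commute)
  also have "1 - cis (a - b) = (1 - of_real \<rho> * cis (a - b)) - of_real (1 - \<rho>) * cis (a - b)"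
    by (simp add: algebra_simps)
  also have "norm \<dots> \<le> norm (1 - of_real \<rho> * cis (a - b)) + norm (of_real (1 - \<rho>) * cis (a - b))"
    by (rule norm_triangle_ineq4)
  also have "norm (of_real (1 - \<rho>) * cis (a - b)) = 1 - \<rho>"
    using assms by (simp add: norm_mult del: of_real_diff)
  also have "\<dots> \<le> norm (1 - of_real \<rho> * cis (a - b))" using assms(1) by (rule one_minus_le_norm)
  finally show ?thesis by simp
qed

text \<open>Twice the modulus |1 - r s e^(i(\<theta>-t))| dominates the chord, and also 1/2^m with m
  = min j k, because 1 - r s is at least the larger of 1 - r and 1 - s. Hence the modulus is at
  least a quarter of the sum of the two, which explains the factor 4^(2+\<gamma>). The power
  2^(m(1+\<gamma>)) compensates the normalisation of \<open>ckernel\<close>.\<close>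

lemma Pkernel_le_ckernel:
  assumes g: "-1 < \<gamma>" and rs: "r \<in> dyint k" "s \<in> dyint j"
  shows "Pkernel \<gamma> \<theta> r t s \<le> 4 powr (2 + \<gamma>) * ((2 ^ min j k) powr (1 + \<gamma>) * ckernel (1 + \<gamma>) (min j k) \<theta> t)"
proof -
  define m where "m = min j k"
  let ?X = "norm (1 - of_real (r * s) * cis (\<theta> - t))" and ?d = "dist (cis \<theta>) (cis t)"
  have dy: "dyp k \<le> r" "r < dyp (Suc k)" "dyp j \<le> s" "s < dyp (Suc j)"
    using rs by (auto simp: dyint_def)
  have r: "0 \<le> r" "r < 1" "1 - r > 1 / 2 ^ Suc k" and s: "0 \<le> s" "s < 1" "1 - s > 1 / 2 ^ Suc j"
    using dy order_trans[OF dyp_simps(1) dy(1)] order_trans[OF dyp_simps(1) dy(3)]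
      less_dyp_imp_less_1[OF dy(2)] less_dyp_imp_less_1[OF dy(4)]
    by (simp_all add: dyp_def)
  have rs1: "0 \<le> r * s" "r * s \<le> r" "r * s \<le> s" using r s by (auto simp: mult_left_le mult_left_le_one_le)
  have "1 / 2 ^ m \<le> 2 * (1 - r * s)"
    using r s rs1 by (cases "j \<le> k") (auto simp: m_def min_def)
  also have "\<dots> \<le> 2 * ?X" using one_minus_le_norm[OF rs1(1), of "\<theta> - t"] by (intro mult_left_mono) auto
  finally have 1: "1 / 2 ^ m \<le> 2 * ?X" .
  have "?d \<le> 2 * ?X" using rs1 r by (intro chord_le_norm) auto
  then have 2: "(1 / 2 ^ m + ?d) / 4 \<le> ?X" using 1 by simp
  have pos: "0 < 1 / 2 ^ m + ?d" by (simp add: add_pos_nonneg)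
  have "Pkernel \<gamma> \<theta> r t s \<le> ((1 / 2 ^ m + ?d) / 4) powr - (2 + \<gamma>)"
    unfolding Pkernel_def using 2 pos g by (intro powr_mono2') auto
  also have "\<dots> = 4 powr (2 + \<gamma>) * (1 / 2 ^ m + ?d) powr - (1 + (1 + \<gamma>))"
  proof -
    have "((1 / 2 ^ m + ?d) / 4) powr - (2 + \<gamma>) = (1 / 2 ^ m + ?d) powr - (2 + \<gamma>) / 4 powr - (2 + \<gamma>)"
      by (rule powr_divide)
    also have "\<dots> = (1 / 2 ^ m + ?d) powr - (2 + \<gamma>) * 4 powr (2 + \<gamma>)"
      by (simp only: powr_minus divide_inverse inverse_inverse_eq)
    finally show ?thesis by (simp add: mult.commute)
  qed
  also have "(1 / 2 ^ m + ?d) powr - (1 + (1 + \<gamma>)) =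
      ((2 ^ m) powr (1 + \<gamma>) * (1 / 2 ^ m) powr (1 + \<gamma>)) * (1 / 2 ^ m + ?d) powr - (1 + (1 + \<gamma>))"
    by (simp add: powr_mult[symmetric])
  finally show ?thesis by (simp add: ckernel_def m_def mult.assoc)
qed

section \<open>Tails of the weights and reverse doubling\<close>

definition wtail :: "(real \<Rightarrow> ennreal) \<Rightarrow> real \<Rightarrow> ennreal" where
  "wtail w r = (\<integral>\<^sup>+t. w t * indicator {r..<1} t \<partial>RM)"

lemma polar_measurableD:
  assumes "polar_measurable F"
  shows "a \<in> borel_measurable M \<Longrightarrow> b \<in> borel_measurable M \<Longrightarrow> (\<lambda>x. F (a x) (b x)) \<in> borel_measurable (M :: 'a measure)"
proof -
  assume "a \<in> borel_measurable M" "b \<in> borel_measurable M"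
  then have "(\<lambda>x. (a x, b x)) \<in> M \<rightarrow>\<^sub>M TM \<Otimes>\<^sub>M RM"
    using measurable_cong_sets[OF refl sets_TM, of M] measurable_cong_sets[OF refl sets_RM, of M]
    by (intro measurable_Pair) auto
  from measurable_compose[OF this assms] show "(\<lambda>x. F (a x) (b x)) \<in> borel_measurable M" by simp
qed

lemma polar_measurable_iff:
  "polar_measurable F \<longleftrightarrow> case_prod F \<in> borel_measurable (borel \<Otimes>\<^sub>M borel)"
  by (intro arg_cong2[where f="(\<in>)"] refl measurable_cong_sets sets_pair_measure_cong) simp_all

lemma Pplus_measurable:
  assumes F: "polar_measurable F"
  shows "polar_measurable (Pplus \<gamma> F)"
proof -
  note polar_measurableD[OF F, measurable]
  have "(\<lambda>x. \<integral>\<^sup>+t. \<integral>\<^sup>+s. ennreal (Pkernel \<gamma> (fst x) (snd x) t s) * (ennreal (vweight \<gamma> s) * F t s) \<partial>RM \<partial>TM) \<in> borel_measurable (borel \<Otimes>\<^sub>M borel)"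
    by measurable
  then show ?thesis unfolding polar_measurable_iff by (simp add: Pplus_def case_prod_beta')
qed

text \<open>The radial profiles of \<omega> and \<sigma>. The tail of the standard weight is (1 -
  r^2)^(\<gamma>+1)/2, so the last assumption is the Bekolle-Bonami condition with the factor 1/2
  absorbed in B. The assumptions are symmetric under exchanging (p, w) with (p', s), which transfers
  every result to the dual side.\<close>

locale dual_weights =
  fixes p \<gamma> B :: real and w s :: "real \<Rightarrow> ennreal"
  assumes p: "1 < p" and g: "-1 < \<gamma>" and B: "0 < B"
    and w [measurable]: "w \<in> borel_fun"
    and s [measurable]: "s \<in> borel_fun"
    and ws: "AE r in RM. epowr (w r) (1 / p) * epowr (s r) (1 / conj_exponent p) = ennreal (vweight \<gamma> r)"
    and Bekolle: "\<And>r. r \<in> {0..<1} \<Longrightarrow>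
      epowr (wtail w r) (1 / p) * epowr (wtail s r) (1 / conj_exponent p) \<le> ennreal (B * (1 - r\<^sup>2) powr (\<gamma> + 1))"

lemma dual_weights_commute:
  assumes "dual_weights p \<gamma> B w s"
  shows "dual_weights (conj_exponent p) \<gamma> B s w"
proof -
  interpret dual_weights p \<gamma> B w s by fact
  note pp = conj_exponent[OF p]
  show ?thesis using pp g B ws Bekolle by unfold_locales (auto simp: mult.commute)
qed

context dual_weights
begin

abbreviation "p' \<equiv> conj_exponent p"
lemmas pp = conj_exponent[OF p]

lemma wtail_measurable_pos: "0 < wtail w 0"
proof -
  have "wtail w 0 \<noteq> 0"
  proof
    assume "wtail w 0 = 0"
    then have "AE r in RM. w r * indicator {0..<1} r = 0"
      unfolding wtail_def by (subst (asm) nn_integral_0_iff_AE) auto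
    with ws AE_RM_range have "AE r in RM. False"
    proof eventually_elim
      case (elim r)
      then have "w r = 0" by (auto simp: indicator_def split: if_splits)
      then show ?case using elim vweight_pos[OF g, of r] by (auto simp: ennreal_eq_0_iff)
    qed
    then have "AE r in lborel. r \<notin> {0<..<1::real}" by (simp add: AE_RM)
    then have "emeasure lborel {0<..<1::real} = 0"
      by (subst (asm) AE_iff_measurable[of "{0<..<1}"]) auto
    then show False by simp
  qed
  then show ?thesis by (simp add: zero_less_iff_neq_zero)
qed

end

lemma wtail_antimono: "a \<le> b \<Longrightarrow> wtail w b \<le> wtail w a"
  unfolding wtail_def by (intro nn_integral_mono) (auto simp: indicator_def)

context dual_weights
begin

text \<open>At r = 0 the product of the two tails is finite and neither factor vanishes, so neither
  can be infinite.\<close>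

lemma wtail_finite: "wtail w 0 < top" and wtail_s_pos: "0 < wtail s 0"
proof -
  interpret D: dual_weights p' \<gamma> B s w by (rule dual_weights_commute) (rule dual_weights_axioms)
  show s0: "0 < wtail s 0" by (rule D.wtail_measurable_pos)
  have "epowr (wtail w 0) (1 / p) * epowr (wtail s 0) (1 / p') < top"
    using Bekolle[of 0] by (auto simp: less_top[symmetric] top_unique)
  then show "wtail w 0 < top"
    using s0 by (auto simp: zero_less_iff_neq_zero less_top[symmetric] ennreal_top_mult split: if_splits)
qed

lemma ws_integral_le:
  assumes [measurable]: "A \<in> sets borel"
  shows "(\<integral>\<^sup>+r. ennreal (vweight \<gamma> r) * indicator A r \<partial>RM) \<le>
    epowr (\<integral>\<^sup>+r. w r * indicator A r \<partial>RM) (1 / p) * epowr (\<integral>\<^sup>+r. s r * indicator A r \<partial>RM) (1 / p')"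
proof -
  have "(\<integral>\<^sup>+r. ennreal (vweight \<gamma> r) * indicator A r \<partial>RM) =
    (\<integral>\<^sup>+r. (epowr (w r) (1 / p) * indicator A r) * (epowr (s r) (1 / p') * indicator A r) \<partial>RM)"
    using ws by (intro nn_integral_cong_AE) (auto elim!: eventually_mono simp: indicator_def)
  also have "\<dots> \<le> elp RM p (\<lambda>r. epowr (w r) (1 / p) * indicator A r) * elp RM p' (\<lambda>r. epowr (s r) (1 / p') * indicator A r)"
    by (rule elp_Holder[OF p]) auto
  also have "elp RM p (\<lambda>r. epowr (w r) (1 / p) * indicator A r) = epowr (\<integral>\<^sup>+r. w r * indicator A r \<partial>RM) (1 / p)"
    unfolding elp_def using p
    by (intro arg_cong2[where f=epowr] nn_integral_cong) (auto simp: indicator_def epowr_inverse)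
  also have "elp RM p' (\<lambda>r. epowr (s r) (1 / p') * indicator A r) = epowr (\<integral>\<^sup>+r. s r * indicator A r \<partial>RM) (1 / p')"
    unfolding elp_def using pp
    by (intro arg_cong2[where f=epowr] nn_integral_cong) (auto simp: indicator_def epowr_inverse)
  finally show ?thesis .
qed

lemma wtail_dyp_pos: "0 < wtail w (dyp k)"
proof -
  have "(1 - (dyp k)\<^sup>2) powr (\<gamma> + 1) > 0" by simp
  then have "(\<integral>\<^sup>+r. ennreal (vweight \<gamma> r) * indicator {dyp k..<1} r \<partial>RM) \<noteq> 0"
    using g by (subst vweight_integral) (auto simp: ennreal_eq_0_iff)
  then show ?thesis
    using ws_integral_le[of "{dyp k..<1}"] by (auto simp: wtail_def zero_less_iff_neq_zero)
qed

text \<open>The Hoelder inequality on a dyadic interval, compared with the Bekolle-Bonami condition, gives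
  a reverse doubling property of the tails.\<close>

lemma tail_decay:
  obtains l where "0 \<le> l" "l < 1"
    "\<And>k. epowr (wtail w (dyp (Suc k))) (1 / p) \<le> ennreal l * epowr (wtail w (dyp k)) (1 / p)"
proof -
  \<comment> \<open>Between consecutive dyadic points 1 - r^2 shrinks at least by the factor 3/4, so
    \<open>dyint k\<close> carries at least c V of the standard mass, V being (1 - r^2)^(\<gamma>+1)
    at r = \<open>dyp k\<close>. Hoelder gives c V \<le> D^(1/p) z, where D is the mass of w on the
    interval and z the root of the tail of s, while Bekolle-Bonami gives W^(1/p) z \<le> B V.
    Eliminating z leaves e W \<le> D with e = (c/B)^p.\<close>
  define c where "c = (1 - (3 / 4) powr (\<gamma> + 1)) / 2"
  have "(3 / 4 :: real) powr (\<gamma> + 1) < 1 powr (\<gamma> + 1)"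
    using g by (intro powr_less_mono2) auto
  then have c: "0 < c" by (simp add: c_def)
  define e where "e = (c / B) powr p"
  have e: "0 < e" using c B by (simp add: e_def)
  have main: "\<exists>W W'. 0 < W \<and> 0 \<le> W' \<and> wtail w (dyp k) = ennreal W \<and> wtail w (dyp (Suc k)) = ennreal W' \<and> W' \<le> (1 - e) * W" for k
  proof -
    let ?D = "\<integral>\<^sup>+r. w r * indicator (dyint k) r \<partial>RM"
    let ?V = "(1 - (dyp k)\<^sup>2) powr (\<gamma> + 1)" and ?V' = "(1 - (dyp (Suc k))\<^sup>2) powr (\<gamma> + 1)"
    define x :: real where "x = 1 / 2 ^ k"
    have x: "0 < x" "x \<le> 1" by (auto simp: x_def)
    have dx: "dyp k = 1 - x" "dyp (Suc k) = 1 - x / 2" by (auto simp: dyp_def x_def)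
    have V: "0 < ?V" by simp
    have "1 - (dyp (Suc k))\<^sup>2 \<le> 3 / 4 * (1 - (dyp k)\<^sup>2)"
      using mult_right_mono[OF x(2), of x] x unfolding dx by (simp add: power2_eq_square algebra_simps)
    then have "?V' \<le> (3 / 4 * (1 - (dyp k)\<^sup>2)) powr (\<gamma> + 1)"
      using g by (intro powr_mono2) (auto simp: power_le_one)
    also have "\<dots> = (3 / 4) powr (\<gamma> + 1) * ?V" by (rule powr_mult)
    finally have "?V' \<le> (3 / 4) powr (\<gamma> + 1) * ?V" .
    moreover have "c * ?V = (?V - (3 / 4) powr (\<gamma> + 1) * ?V) / 2"
      by (simp add: c_def left_diff_distrib)
    ultimately have "c * ?V \<le> (?V - ?V') / 2"
      by (metis diff_left_mono divide_right_mono zero_le_numeral)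
    then have "ennreal (c * ?V) \<le> (\<integral>\<^sup>+r. ennreal (vweight \<gamma> r) * indicator (dyint k) r \<partial>RM)"
      unfolding dyint_def using g dyp_mono[of k "Suc k"] by (subst vweight_integral) (auto intro: ennreal_leI)
    also have "\<dots> \<le> epowr ?D (1 / p) * epowr (\<integral>\<^sup>+r. s r * indicator (dyint k) r \<partial>RM) (1 / p')"
      by (rule ws_integral_le) simp
    also have "\<dots> \<le> epowr ?D (1 / p) * epowr (wtail s (dyp k)) (1 / p')"
      unfolding wtail_def using pp dyp_simps(2)[of "Suc k"]
      by (intro mult_left_mono epowr_mono nn_integral_mono) (auto simp: dyint_def indicator_def dest: less_dyp_imp_less_1)
    finally have h1: "ennreal (c * ?V) \<le> epowr ?D (1 / p) * epowr (wtail s (dyp k)) (1 / p')" .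
    have split: "wtail w (dyp k) = ?D + wtail w (dyp (Suc k))"
      unfolding wtail_def
    proof (subst nn_integral_add[symmetric])
      show "(\<integral>\<^sup>+t. w t * indicator {dyp k..<1} t \<partial>RM) =
          (\<integral>\<^sup>+x. w x * indicator (dyint k) x + w x * indicator {dyp (Suc k)..<1} x \<partial>RM)"
        using dyp_mono[of k "Suc k"] dyp_simps(2)[of "Suc k"]
        by (intro nn_integral_cong) (auto simp: dyint_def indicator_def not_le dest: less_dyp_imp_less_1)
    qed auto
    have "wtail w (dyp k) < top" using wtail_finite wtail_antimono[of 0 "dyp k" w] by (simp add: order_le_less_trans)
    then obtain W where W: "0 \<le> W" "wtail w (dyp k) = ennreal W" by (cases "wtail w (dyp k)") auto
    have W0: "0 < W" using W wtail_dyp_pos[of k] by auto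
    obtain D where D: "0 \<le> D" "?D = ennreal D"
      using split W by (cases ?D) auto
    obtain W' where W': "0 \<le> W'" "wtail w (dyp (Suc k)) = ennreal W'"
      using split W by (cases "wtail w (dyp (Suc k))") auto
    have sum: "W = D + W'" using split W D W' by (simp flip: ennreal_plus)
    have h2: "ennreal (W powr (1 / p)) * epowr (wtail s (dyp k)) (1 / p') \<le> ennreal (B * ?V)"
      using Bekolle[of "dyp k"] W by (simp add: epowr_ennreal)
    then obtain z where z: "0 \<le> z" "epowr (wtail s (dyp k)) (1 / p') = ennreal z"
      using W0 by (cases "epowr (wtail s (dyp k)) (1 / p')") (auto simp: ennreal_mult_top top_unique)
    have h1': "c * ?V \<le> D powr (1 / p) * z"
      using h1 D z by (simp add: epowr_ennreal flip: ennreal_mult)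
    have h2': "W powr (1 / p) * z \<le> B * ?V"
      using h2 z W B by (simp flip: ennreal_mult)
    have "W powr (1 / p) * (c * ?V) \<le> D powr (1 / p) * (W powr (1 / p) * z)"
      using mult_left_mono[OF h1', of "W powr (1 / p)"] by (simp add: mult_ac)
    also have "\<dots> \<le> D powr (1 / p) * (B * ?V)" by (intro mult_left_mono h2') auto
    finally have "(W powr (1 / p) * c) * ?V \<le> (D powr (1 / p) * B) * ?V" by (simp add: mult_ac)
    then have "W powr (1 / p) * c \<le> D powr (1 / p) * B" using V by (simp only: mult_le_cancel_right_pos)
    then have "c / B * W powr (1 / p) \<le> D powr (1 / p)" using B by (simp add: field_simps)
    then have "(c / B * W powr (1 / p)) powr p \<le> (D powr (1 / p)) powr p"
      using c B p by (intro powr_mono2) auto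
    also have "(c / B * W powr (1 / p)) powr p = e * W"
    proof -
      have "(c / B * W powr (1 / p)) powr p = (c / B) powr p * (W powr (1 / p)) powr p" by (rule powr_mult)
      then show ?thesis using p W0 by (simp add: powr_powr e_def)
    qed
    also have "(D powr (1 / p)) powr p = D" using p D by (simp add: powr_powr)
    finally have "W' \<le> (1 - e) * W" using sum by (simp add: algebra_simps)
    then show ?thesis using W W0 W' by blast
  qed
  have e1: "e \<le> 1"
  proof -
    obtain W W' where "0 < W" "0 \<le> W'" "W' \<le> (1 - e) * W" using main[of 0] by blast
    then have "0 \<le> (1 - e) * W" by linarith
    then show ?thesis using \<open>0 < W\<close> by (simp add: zero_le_mult_iff)
  qed
  show thesis
  proof (rule that[of "(1 - e) powr (1 / p)"])
    have "(1 - e) powr (1 / p) < 1 powr (1 / p)" using p e e1 by (intro powr_less_mono2) auto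
    then show "(1 - e) powr (1 / p) < 1" by simp
    fix k
    obtain W W' where W: "0 < W" "0 \<le> W'" "wtail w (dyp k) = ennreal W" "wtail w (dyp (Suc k)) = ennreal W'" "W' \<le> (1 - e) * W"
      using main[of k] by blast
    have "W' powr (1 / p) \<le> ((1 - e) * W) powr (1 / p)" using W p by (intro powr_mono2) auto
    also have "\<dots> = (1 - e) powr (1 / p) * W powr (1 / p)" by (rule powr_mult)
    finally show "epowr (wtail w (dyp (Suc k))) (1 / p) \<le> ennreal ((1 - e) powr (1 / p)) * epowr (wtail w (dyp k)) (1 / p)"
      using W by (simp add: epowr_ennreal ennreal_leI flip: ennreal_mult)
  qed simp
qed

lemma tail_product_le:
  "ennreal ((2 ^ m) powr (1 + \<gamma>)) * (epowr (wtail w (dyp m)) (1 / p) * epowr (wtail s (dyp m)) (1 / p'))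
     \<le> ennreal (B * 2 powr (1 + \<gamma>))"
proof -
  define x :: real where "x = 1 / 2 ^ m"
  have x: "0 < x" "x \<le> 1" by (auto simp: x_def)
  have "1 - (dyp m)\<^sup>2 \<le> 2 * x"
    using x by (simp add: dyp_def flip: x_def) (simp add: power2_eq_square algebra_simps)
  then have "(1 - (dyp m)\<^sup>2) powr (\<gamma> + 1) \<le> (2 * x) powr (\<gamma> + 1)"
    using g by (intro powr_mono2) (auto simp: less_imp_le)
  then have "(2 ^ m) powr (1 + \<gamma>) * (B * (1 - (dyp m)\<^sup>2) powr (\<gamma> + 1)) \<le>
      (2 ^ m) powr (1 + \<gamma>) * (B * (2 * x) powr (\<gamma> + 1))"
    using B by (intro mult_left_mono) auto
  also have "\<dots> = B * ((2 ^ m) * (2 * x)) powr (1 + \<gamma>)"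
    by (simp add: powr_mult add.commute)
  also have "(2 ^ m) * (2 * x) = 2" by (simp add: x_def)
  finally have le: "(2 ^ m) powr (1 + \<gamma>) * (B * (1 - (dyp m)\<^sup>2) powr (\<gamma> + 1)) \<le> B * 2 powr (1 + \<gamma>)" .
  have "ennreal ((2 ^ m) powr (1 + \<gamma>)) * (epowr (wtail w (dyp m)) (1 / p) * epowr (wtail s (dyp m)) (1 / p'))
     \<le> ennreal ((2 ^ m) powr (1 + \<gamma>)) * ennreal (B * (1 - (dyp m)\<^sup>2) powr (\<gamma> + 1))"
    by (intro mult_left_mono Bekolle) auto
  also have "\<dots> = ennreal ((2 ^ m) powr (1 + \<gamma>) * (B * (1 - (dyp m)\<^sup>2) powr (\<gamma> + 1)))"
    using B by (intro ennreal_mult[symmetric]) auto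
  also have "\<dots> \<le> ennreal (B * 2 powr (1 + \<gamma>))" by (intro ennreal_leI le)
  finally show ?thesis .
qed

text \<open>The tail with the larger index is traced back to the smaller index, each step gaining a
  factor l; at the common index m the product of the tails is at most a constant times
  2^(-m(1+\<gamma>)) by Bekolle-Bonami. Both weights must have the decay, since either index can be
  the larger one.\<close>

lemma tail_product_decay:
  obtains l where "0 \<le> l" "l < 1"
    "\<And>j k. epowr (wtail w (dyp k)) (1 / p) * (ennreal ((2 ^ min j k) powr (1 + \<gamma>)) * epowr (wtail s (dyp j)) (1 / p'))
       \<le> ennreal (l ^ idist j k) * ennreal (B * 2 powr (1 + \<gamma>))"
proof -
  interpret D: dual_weights p' \<gamma> B s w by (rule dual_weights_commute) (rule dual_weights_axioms)
  let ?w = "\<lambda>k. epowr (wtail w (dyp k)) (1 / p)" and ?s = "\<lambda>k. epowr (wtail s (dyp k)) (1 / p')"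
  obtain l1 where l1: "0 \<le> l1" "l1 < 1" "\<And>k. ?w (Suc k) \<le> ennreal l1 * ?w k"
    using tail_decay by blast
  obtain l2 where l2: "0 \<le> l2" "l2 < 1" "\<And>k. ?s (Suc k) \<le> ennreal l2 * ?s k"
    using D.tail_decay by blast
  define l where "l = max l1 l2"
  have l: "0 \<le> l" "l < 1" using l1 l2 by (auto simp: l_def)
  have iter: "h (j + n) \<le> ennreal (l ^ n) * h j"
    if h: "\<And>k. h (Suc k) \<le> ennreal l' * h k" and l': "0 \<le> l'" "l' \<le> l" for h :: "nat \<Rightarrow> ennreal" and l' j n
  proof (induction n)
    case (Suc n)
    have "h (j + Suc n) \<le> ennreal l' * h (j + n)" using h by simp
    also have "\<dots> \<le> ennreal l * (ennreal (l ^ n) * h j)"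
      using l' Suc by (intro mult_mono ennreal_leI) auto
    also have "\<dots> = ennreal (l ^ Suc n) * h j" using l by (simp add: ennreal_mult mult.assoc)
    finally show ?case .
  qed simp
  have main: "?w k * (ennreal ((2 ^ min j k) powr (1 + \<gamma>)) * ?s j) \<le> ennreal (l ^ idist j k) * ennreal (B * 2 powr (1 + \<gamma>))" for j k
  proof (cases "j \<le> k")
    case True
    have "?w k \<le> ennreal (l ^ (k - j)) * ?w j"
      using iter[of ?w l1 j "k - j"] l1 True by (simp add: l_def)
    then have "?w k * (ennreal ((2 ^ j) powr (1 + \<gamma>)) * ?s j) \<le> (ennreal (l ^ (k - j)) * ?w j) * (ennreal ((2 ^ j) powr (1 + \<gamma>)) * ?s j)"
      by (rule mult_right_mono) simp
    also have "\<dots> = ennreal (l ^ (k - j)) * (ennreal ((2 ^ j) powr (1 + \<gamma>)) * (?w j * ?s j))" by (simp only: mult_ac)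
    also have "\<dots> \<le> ennreal (l ^ (k - j)) * ennreal (B * 2 powr (1 + \<gamma>))"
      by (intro mult_left_mono tail_product_le) simp
    finally show ?thesis using True by (simp add: idist_def min_absorb1 max_absorb2)
  next
    case False
    then have "?s j \<le> ennreal (l ^ (j - k)) * ?s k"
      using iter[of ?s l2 k "j - k"] l2 by (simp add: l_def)
    then have "?w k * (ennreal ((2 ^ k) powr (1 + \<gamma>)) * ?s j) \<le> ?w k * (ennreal ((2 ^ k) powr (1 + \<gamma>)) * (ennreal (l ^ (j - k)) * ?s k))"
      by (intro mult_left_mono) auto
    also have "\<dots> = ennreal (l ^ (j - k)) * (ennreal ((2 ^ k) powr (1 + \<gamma>)) * (?w k * ?s k))" by (simp only: mult_ac)
    also have "\<dots> \<le> ennreal (l ^ (j - k)) * ennreal (B * 2 powr (1 + \<gamma>))"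
      by (intro mult_left_mono tail_product_le) simp
    finally show ?thesis using False by (simp add: idist_def min_absorb2 max_absorb1)
  qed
  show thesis by (rule that[OF l main])
qed

text \<open>Hoelder with v = w^(1/p) s^(1/p'). After this step F enters only through its weighted
  norms over dyadic intervals, which form the input of the model operator.\<close>

lemma weighted_dyadic_le:
  assumes [measurable]: "F \<in> borel_fun"
  shows "(\<integral>\<^sup>+r. ennreal (vweight \<gamma> r) * F r * indicator (dyint j) r \<partial>RM)
    \<le> elp RM p (\<lambda>r. F r * epowr (w r) (1 / p) * indicator (dyint j) r) * epowr (wtail s (dyp j)) (1 / p')"
proof -
  have "(\<integral>\<^sup>+r. ennreal (vweight \<gamma> r) * F r * indicator (dyint j) r \<partial>RM) =
    (\<integral>\<^sup>+r. (F r * epowr (w r) (1 / p) * indicator (dyint j) r) * (epowr (s r) (1 / p') * indicator (dyint j) r) \<partial>RM)"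
  proof (rule nn_integral_cong_AE)
    show "AE r in RM. ennreal (vweight \<gamma> r) * F r * indicator (dyint j) r =
      (F r * epowr (w r) (1 / p) * indicator (dyint j) r) * (epowr (s r) (1 / p') * indicator (dyint j) r)"
      using ws by eventually_elim (auto simp: indicator_def mult_ac)
  qed
  also have "\<dots> \<le> elp RM p (\<lambda>r. F r * epowr (w r) (1 / p) * indicator (dyint j) r) * elp RM p' (\<lambda>r. epowr (s r) (1 / p') * indicator (dyint j) r)"
    by (rule elp_Holder[OF p]) auto
  also have "elp RM p' (\<lambda>r. epowr (s r) (1 / p') * indicator (dyint j) r) \<le> epowr (wtail s (dyp j)) (1 / p')"
    unfolding elp_def wtail_def using pp
    by (intro epowr_mono nn_integral_mono)
      (auto simp: indicator_def epowr_inverse dyint_def dest: less_dyp_imp_less_1)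
  finally show ?thesis by (simp add: mult_left_mono)
qed

text \<open>Let f(t, j) be the weighted norm of F(t, .) over the j-th dyadic interval. On the k-th
  interval the maximal projection, times the root of the tail of w, is at most a constant times
  \<open>dyop\<close> applied to f. Integrating the p-th power against w over that interval costs at
  most the tail of w, so the root cancels; and summing f(t, j)^p over j restores the norm of F(t,
  .).\<close>

lemma Pplus_bounded:
  assumes q: "1 < q"
  obtains C :: real where "0 \<le> C"
    "\<And>F. polar_measurable F \<Longrightarrow>
       elp2 TM RM p q (\<lambda>\<theta> r. Pplus \<gamma> F \<theta> r * epowr (w r) (1 / p))
       \<le> ennreal C * elp2 TM RM p q (\<lambda>\<theta> r. F \<theta> r * epowr (w r) (1 / p))"
proof -
  obtain l where l: "0 \<le> l" "l < 1"
    "\<And>j k. epowr (wtail w (dyp k)) (1 / p) * (ennreal ((2 ^ min j k) powr (1 + \<gamma>)) * epowr (wtail s (dyp j)) (1 / p'))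
       \<le> ennreal (l ^ idist j k) * ennreal (B * 2 powr (1 + \<gamma>))"
    using tail_product_decay by blast
  have b: "0 < 1 + \<gamma>" using g by simp
  obtain C0 where C0: "0 \<le> C0"
    "\<And>f. f \<in> borel_measurable (TM \<Otimes>\<^sub>M CM) \<Longrightarrow>
       elp2 TM CM p q (curry (dyop (1 + \<gamma>) l f)) \<le> ennreal C0 * elp2 TM CM p q (curry f)"
    using dyop_bounded[OF b l(1,2) p q] by blast
  define C1 where "C1 = B * 2 powr (1 + \<gamma>)"
  define C2 where "C2 = 4 powr (2 + \<gamma>)"
  have C12: "0 \<le> C1" "0 \<le> C2" using B by (auto simp: C1_def C2_def)
  let ?W = "\<lambda>k. epowr (wtail w (dyp k)) (1 / p)" and ?S = "\<lambda>k. epowr (wtail s (dyp k)) (1 / p')"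
  show thesis
  proof (rule that[of "C1 * C2 * C0"])
    show "0 \<le> C1 * C2 * C0" using C12 C0 by simp
    fix F :: "real \<Rightarrow> real \<Rightarrow> ennreal" assume F: "polar_measurable F"
    let ?n = "elp2 TM RM p q (\<lambda>\<theta> r. F \<theta> r * epowr (w r) (1 / p))" and ?g = "\<lambda>\<theta> r. epowr (Pplus \<gamma> F \<theta> r * epowr (w r) (1 / p)) p"
    note polar_measurableD[OF F, measurable] polar_measurableD[OF Pplus_measurable[OF F], measurable]
    have Ft: "F t \<in> borel_fun" for t by measurable
    have [measurable]: "(\<lambda>k. dyp k) \<in> borel_measurable CM" "(\<lambda>k. dyp (Suc k)) \<in> borel_measurable CM" by simp_all
    define f where "f = (\<lambda>z. elp RM p (\<lambda>r. F (fst z) r * epowr (w r) (1 / p) * indicator (dyint (snd z)) r))"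
    have f [measurable]: "f \<in> borel_measurable (TM \<Otimes>\<^sub>M CM)"
      unfolding f_def
    proof (rule RM.elp_measurable)
      have "(\<lambda>x. F (fst (fst x)) (snd x) * epowr (w (snd x)) (1 / p) *
          (if dyp (snd (fst x)) \<le> snd x \<and> snd x < dyp (Suc (snd (fst x))) then 1 else 0))
          \<in> borel_measurable ((TM \<Otimes>\<^sub>M CM) \<Otimes>\<^sub>M RM)" by measurable
      then show "(\<lambda>(z, r). F (fst z) r * epowr (w r) (1 / p) * indicator (dyint (snd z)) r) \<in> borel_measurable ((TM \<Otimes>\<^sub>M CM) \<Otimes>\<^sub>M RM)"
        by (simp add: case_prod_beta' dyint_def indicator_def)
    qed
    have ptw: "?W k * Pplus \<gamma> F \<theta> r \<le> ennreal (C1 * C2) * dyop (1 + \<gamma>) l f (\<theta>, k)"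
      if r: "r \<in> dyint k" for \<theta> r k
    proof -
      let ?c = "\<lambda>t j. C2 * ((2 ^ min j k) powr (1 + \<gamma>) * ckernel (1 + \<gamma>) (min j k) \<theta> t)"
      have c0: "0 \<le> ?c t j" for t j using C12 by simp
      have inner: "(\<integral>\<^sup>+s. ennreal (Pkernel \<gamma> \<theta> r t s) * (ennreal (vweight \<gamma> s) * F t s) \<partial>RM)
         \<le> (\<integral>\<^sup>+j. ennreal (?c t j) * (f (t, j) * ?S j) \<partial>CM)" for t
      proof -
        have "(\<integral>\<^sup>+s. ennreal (Pkernel \<gamma> \<theta> r t s) * (ennreal (vweight \<gamma> s) * F t s) \<partial>RM) =
          (\<integral>\<^sup>+j. \<integral>\<^sup>+s. ennreal (Pkernel \<gamma> \<theta> r t s) * (ennreal (vweight \<gamma> s) * F t s) * indicator (dyint j) s \<partial>RM \<partial>CM)"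
          by (rule nn_integral_RM_dyadic) measurable
        also have "\<dots> \<le> (\<integral>\<^sup>+j. ennreal (?c t j) * (f (t, j) * ?S j) \<partial>CM)"
        proof (intro nn_integral_mono)
          fix j
          have "(\<integral>\<^sup>+s. ennreal (Pkernel \<gamma> \<theta> r t s) * (ennreal (vweight \<gamma> s) * F t s) * indicator (dyint j) s \<partial>RM)
            \<le> (\<integral>\<^sup>+s. ennreal (?c t j) * (ennreal (vweight \<gamma> s) * F t s * indicator (dyint j) s) \<partial>RM)"
          proof (intro nn_integral_mono)
            fix s
            show "ennreal (Pkernel \<gamma> \<theta> r t s) * (ennreal (vweight \<gamma> s) * F t s) * indicator (dyint j) s
              \<le> ennreal (?c t j) * (ennreal (vweight \<gamma> s) * F t s * indicator (dyint j) s)"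
            proof (cases "s \<in> dyint j")
              case True
              then have "ennreal (Pkernel \<gamma> \<theta> r t s) \<le> ennreal (?c t j)"
                unfolding C2_def using r g by (intro ennreal_leI Pkernel_le_ckernel) auto
              then show ?thesis using True by (simp add: mult_right_mono)
            qed simp
          qed
          also have "\<dots> = ennreal (?c t j) * (\<integral>\<^sup>+s. ennreal (vweight \<gamma> s) * F t s * indicator (dyint j) s \<partial>RM)"
            by (rule nn_integral_cmult) measurable
          also have "\<dots> \<le> ennreal (?c t j) * (f (t, j) * ?S j)"
            using weighted_dyadic_le[OF Ft, of t j] by (intro mult_left_mono) (auto simp: f_def)
          finally show "(\<integral>\<^sup>+s. ennreal (Pkernel \<gamma> \<theta> r t s) * (ennreal (vweight \<gamma> s) * F t s) * indicator (dyint j) s \<partial>RM)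
            \<le> ennreal (?c t j) * (f (t, j) * ?S j)" .
        qed
        finally show ?thesis .
      qed
      have "Pplus \<gamma> F \<theta> r \<le> (\<integral>\<^sup>+t. \<integral>\<^sup>+j. ennreal (?c t j) * (f (t, j) * ?S j) \<partial>CM \<partial>TM)"
        unfolding Pplus_def by (intro nn_integral_mono inner)
      then have "?W k * Pplus \<gamma> F \<theta> r \<le> ?W k * (\<integral>\<^sup>+t. \<integral>\<^sup>+j. ennreal (?c t j) * (f (t, j) * ?S j) \<partial>CM \<partial>TM)"
        by (rule mult_left_mono) simp
      also have "\<dots> = ?W k * (\<integral>\<^sup>+j. \<integral>\<^sup>+t. ennreal (?c t j) * (f (t, j) * ?S j) \<partial>TM \<partial>CM)"
        by (subst nn_integral_count_space_nn_integral) auto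
      also have "\<dots> = (\<integral>\<^sup>+j. \<integral>\<^sup>+t. ?W k * (ennreal (?c t j) * (f (t, j) * ?S j)) \<partial>TM \<partial>CM)"
        by (simp add: nn_integral_cmult)
      also have "\<dots> \<le> (\<integral>\<^sup>+j. \<integral>\<^sup>+t. ennreal (C1 * C2) * (dyker (1 + \<gamma>) l (\<theta>, k) (t, j) * f (t, j)) \<partial>TM \<partial>CM)"
      proof (intro nn_integral_mono)
        fix j t
        let ?K = "ennreal (ckernel (1 + \<gamma>) (min j k) \<theta> t)" and ?P = "ennreal ((2 ^ min j k) powr (1 + \<gamma>))"
        have "ennreal (?c t j) = ennreal C2 * (?P * ?K)"
          using C12 by (simp add: ennreal_mult)
        then have "?W k * (ennreal (?c t j) * (f (t, j) * ?S j)) =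
           ennreal C2 * ?K * f (t, j) * (?W k * (?P * ?S j))"
          by (simp only: mult_ac)
        also have "\<dots> \<le> ennreal C2 * ?K * f (t, j) * (ennreal (l ^ idist j k) * ennreal C1)"
          unfolding C1_def by (intro mult_left_mono l(3)) simp
        also have "\<dots> = (ennreal C1 * ennreal C2) * (ennreal (l ^ idist j k) * ?K * f (t, j))"
          by (simp only: mult_ac)
        also have "\<dots> = ennreal (C1 * C2) * (dyker (1 + \<gamma>) l (\<theta>, k) (t, j) * f (t, j))"
          using C12 by (simp add: ennreal_mult dyker_def idist_def max.commute min.commute)
        finally show "?W k * (ennreal (?c t j) * (f (t, j) * ?S j)) \<le> ennreal (C1 * C2) * (dyker (1 + \<gamma>) l (\<theta>, k) (t, j) * f (t, j))" .
      qed
      also have "\<dots> = (\<integral>\<^sup>+z. ennreal (C1 * C2) * (dyker (1 + \<gamma>) l (\<theta>, k) z * f z) \<partial>(TM \<Otimes>\<^sub>M CM))"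
        by (rule TC.nn_integral_snd) measurable
      also have "\<dots> = ennreal (C1 * C2) * dyop (1 + \<gamma>) l f (\<theta>, k)"
        unfolding dyop_def by (rule nn_integral_cmult) measurable
      finally show ?thesis .
    qed
    have radial: "elp RM p (\<lambda>r. Pplus \<gamma> F \<theta> r * epowr (w r) (1 / p)) \<le>
        elp CM p (\<lambda>k. ennreal (C1 * C2) * dyop (1 + \<gamma>) l f (\<theta>, k))" for \<theta>
    proof -
      let ?X = "\<lambda>k. ennreal (C1 * C2) * dyop (1 + \<gamma>) l f (\<theta>, k)"
      have "(\<integral>\<^sup>+r. ?g \<theta> r \<partial>RM) =
        (\<integral>\<^sup>+k. \<integral>\<^sup>+r. ?g \<theta> r * indicator (dyint k) r \<partial>RM \<partial>CM)"
        by (rule nn_integral_RM_dyadic) measurable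
      also have "\<dots> \<le> (\<integral>\<^sup>+k. epowr (?X k) p \<partial>CM)"
      proof (intro nn_integral_mono)
        fix k
        have "wtail w (dyp k) < top" using wtail_finite wtail_antimono[of 0 "dyp k" w] by (simp add: order_le_less_trans)
        \<comment> \<open>The root of the tail is a positive real number, so the pointwise bound
          \<open>ptw\<close> may be divided by it.\<close>
        then obtain a where a: "0 < a" "?W k = ennreal a" "wtail w (dyp k) = ennreal (a powr p)"
        proof -
          assume fin: "wtail w (dyp k) < top" and th: "\<And>a. 0 < a \<Longrightarrow> ?W k = ennreal a \<Longrightarrow> wtail w (dyp k) = ennreal (a powr p) \<Longrightarrow> thesis"
          obtain x where x: "0 \<le> x" "wtail w (dyp k) = ennreal x" using fin by (cases "wtail w (dyp k)") auto
          have "0 < x" using x wtail_dyp_pos[of k] by auto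
          then show thesis using x p by (intro th[of "x powr (1 / p)"]) (auto simp: epowr_ennreal powr_powr)
        qed
        have P: "Pplus \<gamma> F \<theta> r \<le> ennreal (1 / a) * ?X k" if "r \<in> dyint k" for r
        proof -
          have "Pplus \<gamma> F \<theta> r = (ennreal (1 / a) * ennreal a) * Pplus \<gamma> F \<theta> r"
            using a(1) by (simp flip: ennreal_mult)
          also have "\<dots> = ennreal (1 / a) * (?W k * Pplus \<gamma> F \<theta> r)" by (simp only: a(2) mult.assoc)
          also have "\<dots> \<le> ennreal (1 / a) * ?X k" by (intro mult_left_mono ptw that) simp
          finally show ?thesis .
        qed
        have "(\<integral>\<^sup>+r. ?g \<theta> r * indicator (dyint k) r \<partial>RM) \<le>
           (\<integral>\<^sup>+r. epowr (ennreal (1 / a) * ?X k) p * (w r * indicator {dyp k..<1} r) \<partial>RM)"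
        proof (intro nn_integral_mono)
          fix r
          show "?g \<theta> r * indicator (dyint k) r \<le> epowr (ennreal (1 / a) * ?X k) p * (w r * indicator {dyp k..<1} r)"
          proof (cases "r \<in> dyint k")
            case True
            then have "r \<in> {dyp k..<1}" by (auto simp: dyint_def dest: less_dyp_imp_less_1)
            then show ?thesis
              using p True P[OF True] by (simp add: epowr_mult epowr_inverse) (intro mult_right_mono, simp_all add: epowr_mono flip: epowr_mult)
          qed simp
        qed
        also have "\<dots> = epowr (ennreal (1 / a) * ?X k) p * wtail w (dyp k)"
          unfolding wtail_def by (rule nn_integral_cmult) measurable
        also have "\<dots> = epowr (ennreal (1 / a) * ?X k) p * epowr (ennreal a) p" using a by (simp add: epowr_ennreal)
        also have "\<dots> = epowr ((ennreal (1 / a) * ennreal a) * ?X k) p" by (simp only: epowr_mult mult_ac)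
        also have "ennreal (1 / a) * ennreal a = 1" using a(1) by (simp flip: ennreal_mult)
        finally show "(\<integral>\<^sup>+r. ?g \<theta> r * indicator (dyint k) r \<partial>RM) \<le> epowr (?X k) p"
          by simp
      qed
      finally show ?thesis unfolding elp_def using p by (intro epowr_mono) auto
    qed
    have fF: "elp CM p (\<lambda>k. f (t, k)) = elp RM p (\<lambda>r. F t r * epowr (w r) (1 / p))" for t
    proof -
      have "(\<integral>\<^sup>+k. epowr (f (t, k)) p \<partial>CM) =
         (\<integral>\<^sup>+k. \<integral>\<^sup>+r. epowr (F t r * epowr (w r) (1 / p)) p * indicator (dyint k) r \<partial>RM \<partial>CM)"
        using p by (auto simp: f_def epowr_elp indicator_def intro!: nn_integral_cong)
      also have "\<dots> = (\<integral>\<^sup>+r. epowr (F t r * epowr (w r) (1 / p)) p \<partial>RM)"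
        by (rule nn_integral_RM_dyadic[symmetric]) measurable
      finally show ?thesis by (simp add: elp_def)
    qed
    have "elp2 TM RM p q (\<lambda>\<theta> r. Pplus \<gamma> F \<theta> r * epowr (w r) (1 / p)) \<le>
        elp2 TM CM p q (\<lambda>\<theta> k. ennreal (C1 * C2) * curry (dyop (1 + \<gamma>) l f) \<theta> k)"
      unfolding elp2_def using q radial by (intro elp_mono) auto
    also have "\<dots> = ennreal (C1 * C2) * elp2 TM CM p q (curry (dyop (1 + \<gamma>) l f))"
      using p q by (intro CM.elp2_cmult) auto
    also have "\<dots> \<le> ennreal (C1 * C2) * (ennreal C0 * elp2 TM CM p q (curry f))"
      by (intro mult_left_mono C0 f) simp
    also have "elp2 TM CM p q (curry f) = ?n"
      unfolding elp2_def by (simp add: curry_def fF)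
    also have "ennreal (C1 * C2) * (ennreal C0 * ?n)
       = ennreal (C1 * C2 * C0) * ?n"
      using C12 C0(1) by (simp add: ennreal_mult mult.assoc)
    finally show "elp2 TM RM p q (\<lambda>\<theta> r. Pplus \<gamma> F \<theta> r * epowr (w r) (1 / p))
       \<le> ennreal (C1 * C2 * C0) * ?n" .
  qed
qed

end

section \<open>Polar coordinates\<close>

lemma lborel_complex_eq:
  "(lborel :: complex measure) = distr (lborel \<Otimes>\<^sub>M lborel) borel (\<lambda>z. Complex (fst z) (snd z))"
proof (rule lborel_eqI)
  have [measurable]: "(\<lambda>z. Complex (fst z) (snd z)) \<in> borel_measurable (lborel \<Otimes>\<^sub>M (lborel :: real measure))"
    by (simp add: Complex_eq)
  fix l u :: complex
  assume le: "\<And>b. b \<in> Basis \<Longrightarrow> l \<bullet> b \<le> u \<bullet> b"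
  have 1: "Re l \<le> Re u" "Im l \<le> Im u"
    using le[of 1] le[of \<i>] by (auto simp: Basis_complex_def)
  have "(\<lambda>z. Complex (fst z) (snd z)) -` box l u = {Re l<..<Re u} \<times> {Im l<..<Im u}"
    by (auto simp: in_box_complex_iff)
  then have "emeasure (distr (lborel \<Otimes>\<^sub>M lborel) borel (\<lambda>z. Complex (fst z) (snd z))) (box l u)
     = emeasure (lborel \<Otimes>\<^sub>M lborel) ({Re l<..<Re u} \<times> {Im l<..<Im u})"
    by (subst emeasure_distr) (auto simp: space_pair_measure)
  also have "\<dots> = ennreal (Re u - Re l) * ennreal (Im u - Im l)"
    using 1 by (subst lborel.emeasure_pair_measure_Times) auto
  also have "\<dots> = ennreal (\<Prod>b\<in>Basis. (u - l) \<bullet> b)"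
    using 1 by (simp add: Basis_complex_def ennreal_mult)
  finally show "emeasure (distr (lborel \<Otimes>\<^sub>M lborel) borel (\<lambda>z. Complex (fst z) (snd z))) (box l u) = ennreal (\<Prod>b\<in>Basis. (u - l) \<bullet> b)" .
qed simp

lemma Complex_measurable [measurable]:
  "f \<in> borel_measurable M \<Longrightarrow> g \<in> borel_measurable M \<Longrightarrow> (\<lambda>x. Complex (f x) (g x)) \<in> borel_measurable M"
  by (simp add: Complex_eq)

lemma nn_integral_lborel_complex:
  assumes [measurable]: "f \<in> borel_fun"
  shows "(\<integral>\<^sup>+z. f z \<partial>lborel) = (\<integral>\<^sup>+x. \<integral>\<^sup>+y. f (Complex x y) \<partial>lborel \<partial>lborel)"
proof -
  have "(\<integral>\<^sup>+z. f z \<partial>lborel) = (\<integral>\<^sup>+z. f (Complex (fst z) (snd z)) \<partial>(lborel \<Otimes>\<^sub>M lborel))"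
    by (subst lborel_complex_eq, subst nn_integral_distr) auto
  also have "\<dots> = (\<integral>\<^sup>+x. \<integral>\<^sup>+y. f (Complex x y) \<partial>lborel \<partial>lborel)"
    by (subst lborel.nn_integral_fst[symmetric]) auto
  finally show ?thesis .
qed

text \<open>A rotation with \<open>cos \<theta> \<noteq> 0\<close> is a composition of two shears with reciprocal Jacobians.\<close>

lemma nn_integral_rotate:
  assumes [measurable]: "f \<in> borel_fun" and c: "cos \<theta> \<noteq> 0"
  shows "(\<integral>\<^sup>+z. f (z * cis \<theta>) \<partial>lborel) = (\<integral>\<^sup>+z. f z \<partial>lborel)"
proof -
  let ?c = "cos \<theta>" and ?s = "sin \<theta>"
  have [measurable]: "(\<lambda>z. f (z * cis \<theta>)) \<in> borel_fun" by measurable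
  have cs: "?s * ?s = 1 - ?c * ?c" using sin_cos_squared_add[of \<theta>] by (simp add: power2_eq_square)
  have "(\<integral>\<^sup>+z. f (z * cis \<theta>) \<partial>lborel) = (\<integral>\<^sup>+x. \<integral>\<^sup>+y. f (Complex (x * ?c - y * ?s) (x * ?s + y * ?c)) \<partial>lborel \<partial>lborel)"
    by (subst nn_integral_lborel_complex)
      (auto simp: complex_eq_iff intro!: nn_integral_cong arg_cong[where f=f])
  also have "\<dots> = (\<integral>\<^sup>+y. \<integral>\<^sup>+x. f (Complex (x * ?c - y * ?s) (x * ?s + y * ?c)) \<partial>lborel \<partial>lborel)"
    by (rule lborel_pair.Fubini'[symmetric]) measurable
  also have "\<dots> = (\<integral>\<^sup>+y. \<bar>1 / ?c\<bar> * (\<integral>\<^sup>+x. f (Complex x (x * ?s / ?c + y / ?c)) \<partial>lborel) \<partial>lborel)"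
  proof (rule nn_integral_cong)
    fix y :: real
    have "(\<integral>\<^sup>+x. f (Complex (x * ?c - y * ?s) (x * ?s + y * ?c)) \<partial>lborel) =
      \<bar>1 / ?c\<bar> * (\<integral>\<^sup>+x. f (Complex ((y * ?s / ?c + 1 / ?c * x) * ?c - y * ?s) ((y * ?s / ?c + 1 / ?c * x) * ?s + y * ?c)) \<partial>lborel)"
      using c by (intro nn_integral_real_affine) auto
    moreover have "(y * ?s / ?c + 1 / ?c * x) * ?c - y * ?s = x" for x using c by (simp add: field_simps)
    moreover have "(y * ?s / ?c + 1 / ?c * x) * ?s + y * ?c = x * ?s / ?c + y / ?c" for x
    proof -
      have "(y * ?s / ?c + 1 / ?c * x) * ?s + y * ?c = x * ?s / ?c + y * (?s * ?s + ?c * ?c) / ?c"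
        using c by (simp add: field_simps del: sin_cos_squared_add3)
      also have "?s * ?s + ?c * ?c = 1" using cs by simp
      finally show ?thesis by simp
    qed
    ultimately show "(\<integral>\<^sup>+x. f (Complex (x * ?c - y * ?s) (x * ?s + y * ?c)) \<partial>lborel) =
       \<bar>1 / ?c\<bar> * (\<integral>\<^sup>+x. f (Complex x (x * ?s / ?c + y / ?c)) \<partial>lborel)" by simp
  qed
  also have "\<dots> = \<bar>1 / ?c\<bar> * (\<integral>\<^sup>+y. \<integral>\<^sup>+x. f (Complex x (x * ?s / ?c + y / ?c)) \<partial>lborel \<partial>lborel)"
    by (rule nn_integral_cmult) measurable
  also have "(\<integral>\<^sup>+y. \<integral>\<^sup>+x. f (Complex x (x * ?s / ?c + y / ?c)) \<partial>lborel \<partial>lborel) =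
     (\<integral>\<^sup>+x. \<integral>\<^sup>+y. f (Complex x (x * ?s / ?c + y / ?c)) \<partial>lborel \<partial>lborel)"
    by (rule lborel_pair.Fubini') measurable
  also have "\<dots> = (\<integral>\<^sup>+x. \<bar>?c\<bar> * (\<integral>\<^sup>+y. f (Complex x y) \<partial>lborel) \<partial>lborel)"
  proof (rule nn_integral_cong)
    fix x :: real
    have "(\<integral>\<^sup>+y. f (Complex x (x * ?s / ?c + y / ?c)) \<partial>lborel) =
      \<bar>?c\<bar> * (\<integral>\<^sup>+y. f (Complex x (x * ?s / ?c + (- x * ?s + ?c * y) / ?c)) \<partial>lborel)"
      using c by (intro nn_integral_real_affine) auto
    moreover have "x * ?s / ?c + (- x * ?s + ?c * y) / ?c = y" for y using c by (simp add: field_simps)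
    ultimately show "(\<integral>\<^sup>+y. f (Complex x (x * ?s / ?c + y / ?c)) \<partial>lborel) = \<bar>?c\<bar> * (\<integral>\<^sup>+y. f (Complex x y) \<partial>lborel)" by simp
  qed
  also have "\<dots> = \<bar>?c\<bar> * (\<integral>\<^sup>+z. f z \<partial>lborel)"
    by (subst nn_integral_cmult) (auto simp: nn_integral_lborel_complex)
  also have "ennreal \<bar>1 / ?c\<bar> * (ennreal \<bar>?c\<bar> * (\<integral>\<^sup>+z. f z \<partial>lborel)) = (\<integral>\<^sup>+z. f z \<partial>lborel)"
    using c by (simp add: mult.assoc[symmetric] flip: ennreal_mult)
  finally show ?thesis .
qed

lemma unit_disc_borel [measurable, simp]: "unit_disc \<in> sets borel"
  by (rule borel_open) simp

lemma emeasure_density_indicator: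
  assumes [measurable]: "S \<in> sets M" "A \<in> sets M"
  shows "emeasure (density M (indicator S)) A = emeasure M (S \<inter> A)"
proof -
  have "emeasure (density M (indicator S)) A = (\<integral>\<^sup>+x. indicator S x * indicator A x \<partial>M)"
    by (rule emeasure_density) measurable
  also have "\<dots> = (\<integral>\<^sup>+x. indicator (S \<inter> A) x \<partial>M)"
    by (intro nn_integral_cong) (auto simp: indicator_def)
  finally show ?thesis by simp
qed

text \<open>The radial half of polar coordinates. Both measures are compared on half-lines: on one
  side stands the area of an annulus, known from volumes of balls, on the other an elementary
  integral.\<close>

lemma distr_cmod_disc:
  "distr (density lborel (indicator unit_disc)) borel cmod = density RM (\<lambda>_. ennreal (2 * pi))" (is "?M = ?N")
proof (rule measure_eqI_lessThan)
  fix x :: real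
  have M: "emeasure ?M {x<..} = emeasure lborel (unit_disc - cball 0 x)"
  proof -
    have "emeasure ?M {x<..} = emeasure (density lborel (indicator unit_disc)) {z. x < cmod z}"
      by (subst emeasure_distr) (auto simp: vimage_def)
    also have "\<dots> = emeasure lborel (unit_disc \<inter> {z. x < cmod z})"
      by (rule emeasure_density_indicator) auto
    also have "unit_disc \<inter> {z. x < cmod z} = unit_disc - cball 0 x" by auto
    finally show ?thesis .
  qed
  then show "emeasure ?M {x<..} < \<infinity>"
    using emeasure_lborel_ball_finite[of "0 :: complex" 1] emeasure_mono[of "unit_disc - cball 0 x" unit_disc lborel]
    by (auto intro: order_le_less_trans)
  \<comment> \<open>Clipping to [0,1] makes one formula serve for all x. For x < 0 the two sets
    differ only by the origin, since a ball of negative radius is empty.\<close>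
  define y where "y = max 0 (min 1 x)"
  have y: "0 \<le> y" "y \<le> 1" by (auto simp: y_def)
  have "emeasure lborel (unit_disc - cball 0 x) = emeasure lborel (unit_disc - cball 0 y :: complex set)"
  proof (cases "x < 0")
    case True
    then have "y = 0" by (simp add: y_def)
    have "emeasure lborel (unit_disc - {0} :: complex set) = emeasure lborel (unit_disc :: complex set)"
      by (intro emeasure_Diff_null_set) auto
    then show ?thesis using True \<open>y = 0\<close> by simp
  next
    case False
    then have "unit_disc - cball 0 x = unit_disc - cball 0 (y :: real) \<or> (unit_disc - cball (0::complex) x = {} \<and> unit_disc - cball (0::complex) y = {})"
      by (cases "x \<le> 1") (auto simp: y_def)
    then show ?thesis by (elim disjE conjE) (simp_all only:)
  qed
  also have "\<dots> = emeasure lborel (unit_disc :: complex set) - emeasure lborel (cball 0 y \<inter> unit_disc :: complex set)"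
  proof -
    have "emeasure lborel (cball 0 y \<inter> unit_disc :: complex set) \<le> emeasure lborel (unit_disc :: complex set)"
      by (intro emeasure_mono) auto
    then have "emeasure lborel (cball 0 y \<inter> unit_disc :: complex set) \<noteq> \<infinity>"
      using emeasure_lborel_ball_finite[of "0 :: complex" 1] by (auto simp: top_unique)
    moreover have "unit_disc - cball 0 y = unit_disc - (cball 0 y \<inter> unit_disc :: complex set)" by auto
    ultimately show ?thesis by (simp only: ) (intro emeasure_Diff, auto)
  qed
  also have "emeasure lborel (cball 0 y \<inter> unit_disc :: complex set) = ennreal (pi * y\<^sup>2)"
  proof (cases "y = 1")
    case True
    then have "cball 0 y \<inter> unit_disc = (ball 0 y :: complex set)" by auto
    then show ?thesis using y by (simp add: emeasure_ball unit_ball_vol_2 del: One_nat_def)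
  next
    case False
    then have "cball 0 y \<inter> unit_disc = (cball 0 y :: complex set)" using y by auto
    then show ?thesis using y by (simp add: emeasure_cball unit_ball_vol_2)
  qed
  also have "emeasure lborel (unit_disc :: complex set) = ennreal pi"
    by (simp add: emeasure_ball unit_ball_vol_2)
  also have "ennreal pi - ennreal (pi * y\<^sup>2) = ennreal (pi * (1 - y\<^sup>2))"
    using y by (subst ennreal_minus) (auto simp: algebra_simps)
  finally have M': "emeasure ?M {x<..} = ennreal (pi * (1 - y\<^sup>2))" using M by simp
  \<comment> \<open>For \<gamma> = 0 the standard weight is 1, so \<open>vweight_integral\<close>
    evaluates the integral of r over [y,1).\<close>
  have "emeasure RM {x<..} = (\<integral>\<^sup>+r. ennreal (vweight 0 r) * indicator {y..<1} r \<partial>RM)"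
  proof -
    have "emeasure RM {x<..} = (\<integral>\<^sup>+r. indicator {x<..} r \<partial>RM)" by simp
    also have "\<dots> = (\<integral>\<^sup>+r. ennreal (vweight 0 r) * indicator {y..<1} r \<partial>RM)"
    proof (rule nn_integral_cong_AE)
      have "AE r in RM. r \<noteq> y" using AE_lborel_singleton[of y] by (auto simp: AE_RM)
      with AE_RM_range show "AE r in RM. indicator {x<..} r = ennreal (vweight 0 r) * indicator {y..<1} r"
      proof eventually_elim
        case (elim r)
        then have "r\<^sup>2 \<noteq> 1" by (auto simp: power2_eq_1_iff)
        then show ?case using elim by (auto simp: indicator_def vweight_def y_def)
      qed
    qed
    finally show ?thesis .
  qed
  also have "\<dots> = ennreal ((1 - y\<^sup>2) / 2)"
    using y by (subst vweight_integral) (auto simp: power_le_one)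
  finally have "emeasure ?N {x<..} = ennreal (2 * pi) * ennreal ((1 - y\<^sup>2) / 2)"
    by (subst emeasure_density) (auto simp: nn_integral_cmult)
  also have "\<dots> = ennreal (pi * (1 - y\<^sup>2))"
    using y by (subst ennreal_mult[symmetric]) (auto simp: power_le_one)
  finally show "emeasure ?M {x<..} = emeasure ?N {x<..}" using M' by simp
qed simp_all

lemma nn_integral_radial_disc:
  assumes [measurable]: "\<phi> \<in> borel_fun"
  shows "(\<integral>\<^sup>+z. \<phi> (cmod z) * indicator unit_disc z \<partial>lborel) = ennreal (2 * pi) * (\<integral>\<^sup>+r. \<phi> r \<partial>RM)"
proof -
  have "(\<integral>\<^sup>+z. \<phi> (cmod z) * indicator unit_disc z \<partial>lborel) = (\<integral>\<^sup>+r. \<phi> r \<partial>distr (density lborel (indicator unit_disc)) borel cmod)"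
  proof -
    have "(\<integral>\<^sup>+r. \<phi> r \<partial>distr (density lborel (indicator unit_disc)) borel cmod) =
        (\<integral>\<^sup>+z. \<phi> (cmod z) \<partial>density lborel (indicator unit_disc))"
      by (rule nn_integral_distr) auto
    also have "\<dots> = (\<integral>\<^sup>+z. indicator unit_disc z * \<phi> (cmod z) \<partial>lborel)"
      by (rule nn_integral_density) measurable
    finally show ?thesis by (simp add: mult.commute)
  qed
  also have "\<dots> = ennreal (2 * pi) * (\<integral>\<^sup>+r. \<phi> r \<partial>RM)"
    by (subst distr_cmod_disc) (auto simp: nn_integral_density nn_integral_cmult)
  finally show ?thesis .
qed

lemma nn_integral_TM_shift:
  assumes [measurable]: "f \<in> borel_fun" and per: "\<And>t. f (t + 2 * pi) = f t"
    and \<phi>: "0 \<le> \<phi>" "\<phi> \<le> 2 * pi"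
  shows "(\<integral>\<^sup>+t. f (t + \<phi>) \<partial>TM) = (\<integral>\<^sup>+t. f t \<partial>TM)"
proof -
  have split: "(\<integral>\<^sup>+t. f t * indicator {a..c} t \<partial>lborel) =
      (\<integral>\<^sup>+t. f t * indicator {a..b} t \<partial>lborel) + (\<integral>\<^sup>+t. f t * indicator {b..c} t \<partial>lborel)"
    if "a \<le> b" "b \<le> c" for a b c
  proof -
    have "(\<integral>\<^sup>+t. f t * indicator {a..c} t \<partial>lborel) = (\<integral>\<^sup>+t. f t * indicator {a..b} t + f t * indicator {b..c} t \<partial>lborel)"
    proof (rule nn_integral_cong_AE)
      show "AE t in lborel. f t * indicator {a..c} t = f t * indicator {a..b} t + f t * indicator {b..c} t"
        using AE_lborel_singleton[of b] by eventually_elim (use that in \<open>auto simp: indicator_def\<close>)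
    qed
    also have "\<dots> = (\<integral>\<^sup>+t. f t * indicator {a..b} t \<partial>lborel) + (\<integral>\<^sup>+t. f t * indicator {b..c} t \<partial>lborel)"
      by (rule nn_integral_add) measurable
    finally show ?thesis .
  qed
  have shift: "(\<integral>\<^sup>+t. f (t + d) * indicator {a..b} t \<partial>lborel) = (\<integral>\<^sup>+t. f t * indicator {a + d..b + d} t \<partial>lborel)" for a b d
    using nn_integral_real_affine[of "\<lambda>t. f t * indicator {a + d..b + d} t" 1 d]
    by (auto simp: add.commute indicator_def intro!: nn_integral_cong)
  have "(\<integral>\<^sup>+t. f (t + \<phi>) \<partial>TM) = (\<integral>\<^sup>+t. f t * indicator {\<phi>..2 * pi + \<phi>} t \<partial>lborel)"
    by (subst nn_integral_TM) (auto simp: shift)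
  also have "\<dots> = (\<integral>\<^sup>+t. f t * indicator {\<phi>..2 * pi} t \<partial>lborel) + (\<integral>\<^sup>+t. f t * indicator {2 * pi..2 * pi + \<phi>} t \<partial>lborel)"
    using \<phi> by (intro split) auto
  also have "(\<integral>\<^sup>+t. f t * indicator {2 * pi..2 * pi + \<phi>} t \<partial>lborel) = (\<integral>\<^sup>+t. f t * indicator {0..\<phi>} t \<partial>lborel)"
    using shift[of "2 * pi" 0 \<phi>] by (simp add: per add.commute)
  also have "(\<integral>\<^sup>+t. f t * indicator {\<phi>..2 * pi} t \<partial>lborel) + \<dots> = (\<integral>\<^sup>+t. f t * indicator {0..2 * pi} t \<partial>lborel)"
    using split[of 0 \<phi> "2 * pi"] \<phi> by (simp add: add.commute)
  also have "\<dots> = (\<integral>\<^sup>+t. f t \<partial>TM)" by (simp add: nn_integral_TM)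
  finally show ?thesis .
qed

lemma AE_TM_cos: "AE t in TM. cos t \<noteq> 0"
proof -
  have "t \<in> (\<lambda>n::int. of_int n * (pi / 2)) ` {0..4}" if t: "0 \<le> t" "t \<le> 2 * pi" "cos t = 0" for t
  proof -
    obtain n :: int where n: "t = of_int n * (pi / 2)" using t(3) unfolding cos_zero_iff_int by blast
    have "0 * (pi / 2) \<le> of_int n * (pi / 2)" using t(1) n by simp
    then have "0 \<le> n" by (subst (asm) mult_le_cancel_right_pos) auto
    have "of_int n * (pi / 2) \<le> 4 * (pi / 2)" using t(2) n by simp
    then have "n \<le> 4" by (subst (asm) mult_le_cancel_right_pos) auto
    with \<open>0 \<le> n\<close> n show ?thesis by auto
  qed
  then have "{t. t \<in> {0..2 * pi} \<and> cos t = 0} \<subseteq> (\<lambda>n::int. of_int n * (pi / 2)) ` {0..4}" by fastforce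
  then have "finite {t. t \<in> {0..2 * pi} \<and> cos t = 0}" by (rule finite_subset) simp
  then have "{t. t \<in> {0..2 * pi} \<and> cos t = 0} \<in> null_sets lborel" by (rule finite_imp_null_set_lborel)
  then show ?thesis unfolding AE_TM by (rule AE_I') auto
qed

text \<open>Area is invariant under rotation, so 2\<pi> times the integral is the integral over all
  rotation angles of the rotated function. For fixed z the mean over rotations depends on |z| only,
  and |z| has the distribution 2\<pi> r dr on the disc; the factor 2\<pi> cancels. Angles with
  vanishing cosine, excluded in \<open>nn_integral_rotate\<close>, form a null set.\<close>

theorem nn_integral_polar:
  assumes h [measurable]: "h \<in> borel_fun"
  shows "(\<integral>\<^sup>+z. h z * indicator unit_disc z \<partial>lborel) = polar_int (\<lambda>t r. h (of_real r * cis t))"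
proof -
  define k where "k = (\<lambda>z. h z * indicator unit_disc z)"
  have [measurable]: "k \<in> borel_fun" unfolding k_def by measurable
  interpret LT: pair_sigma_finite "lborel :: complex measure" TM ..
  have "(\<integral>\<^sup>+t. \<integral>\<^sup>+z. k (z * cis t) \<partial>lborel \<partial>TM) = (\<integral>\<^sup>+t. \<integral>\<^sup>+z. k z \<partial>lborel \<partial>TM)"
    using AE_TM_cos by (intro nn_integral_cong_AE) (auto elim!: eventually_mono simp: nn_integral_rotate)
  also have "\<dots> = ennreal (2 * pi) * (\<integral>\<^sup>+z. k z \<partial>lborel)"
    by (simp add: emeasure_TM mult.commute)
  finally have 1: "ennreal (2 * pi) * (\<integral>\<^sup>+z. k z \<partial>lborel) = (\<integral>\<^sup>+t. \<integral>\<^sup>+z. k (z * cis t) \<partial>lborel \<partial>TM)" by simp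
  also have "\<dots> = (\<integral>\<^sup>+z. \<integral>\<^sup>+t. k (z * cis t) \<partial>TM \<partial>lborel)"
    by (rule LT.Fubini') measurable
  also have "\<dots> = (\<integral>\<^sup>+z. \<integral>\<^sup>+t. k (of_real (cmod z) * cis t) \<partial>TM \<partial>lborel)"
  proof (rule nn_integral_cong)
    fix z :: complex
    define \<phi> where "\<phi> = Arg2pi z"
    have \<phi>: "0 \<le> \<phi>" "\<phi> \<le> 2 * pi" using Arg2pi_ge_0[of z] Arg2pi_lt_2pi[of z] by (auto simp: \<phi>_def)
    have z: "z = of_real (cmod z) * cis \<phi>"
      using Arg2pi_eq[of z] by (simp add: \<phi>_def cis_conv_exp mult.commute)
    have "(\<integral>\<^sup>+t. k (z * cis t) \<partial>TM) = (\<integral>\<^sup>+t. k (of_real (cmod z) * cis (t + \<phi>)) \<partial>TM)"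
      by (subst z) (simp add: cis_mult mult.assoc add.commute)
    also have "\<dots> = (\<integral>\<^sup>+t. k (of_real (cmod z) * cis t) \<partial>TM)"
      using \<phi> by (intro nn_integral_TM_shift[of "\<lambda>t. k (of_real (cmod z) * cis t)"]) (auto simp flip: cis_mult)
    finally show "(\<integral>\<^sup>+t. k (z * cis t) \<partial>TM) = (\<integral>\<^sup>+t. k (of_real (cmod z) * cis t) \<partial>TM)" .
  qed
  also have "\<dots> = (\<integral>\<^sup>+t. \<integral>\<^sup>+z. k (of_real (cmod z) * cis t) \<partial>lborel \<partial>TM)"
    by (rule LT.Fubini'[symmetric]) measurable
  also have "\<dots> = (\<integral>\<^sup>+t. ennreal (2 * pi) * (\<integral>\<^sup>+r. h (of_real r * cis t) \<partial>RM) \<partial>TM)"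
  proof (rule nn_integral_cong)
    fix t :: real
    have "(\<integral>\<^sup>+z. k (of_real (cmod z) * cis t) \<partial>lborel) = (\<integral>\<^sup>+z. h (of_real (cmod z) * cis t) * indicator unit_disc z \<partial>lborel)"
      by (intro nn_integral_cong) (auto simp: k_def indicator_def norm_mult)
    also have "\<dots> = ennreal (2 * pi) * (\<integral>\<^sup>+r. h (of_real r * cis t) \<partial>RM)"
      by (rule nn_integral_radial_disc) measurable
    finally show "(\<integral>\<^sup>+z. k (of_real (cmod z) * cis t) \<partial>lborel) = ennreal (2 * pi) * (\<integral>\<^sup>+r. h (of_real r * cis t) \<partial>RM)" .
  qed
  also have "\<dots> = ennreal (2 * pi) * polar_int (\<lambda>t r. h (of_real r * cis t))"
    by (rule nn_integral_cmult) measurable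
  finally show ?thesis
    by (subst (asm) ennreal_mult_cancel_left) (auto simp: k_def)
qed

definition pol :: "real \<times> real \<Rightarrow> complex" where "pol x = of_real (snd x) * cis (fst x)"

lemma pol_measurable [measurable]: "pol \<in> borel_measurable (TM \<Otimes>\<^sub>M RM)"
  unfolding pol_def by measurable

lemma distr_pol: "distr (TM \<Otimes>\<^sub>M RM) borel pol = density lborel (indicator unit_disc)"
proof (rule measure_eqI)
  fix A assume "A \<in> sets (distr (TM \<Otimes>\<^sub>M RM) borel pol)"
  then have A [measurable]: "A \<in> sets borel" by simp
  have "emeasure (distr (TM \<Otimes>\<^sub>M RM) borel pol) A = (\<integral>\<^sup>+x. indicator A (pol x) \<partial>(TM \<Otimes>\<^sub>M RM))"
    using nn_integral_distr[OF pol_measurable, of "indicator A"] by simp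
  also have "\<dots> = polar_int (\<lambda>t r. indicator A (of_real r * cis t))"
    by (subst RM.nn_integral_fst[symmetric]) (auto simp: pol_def)
  also have "\<dots> = (\<integral>\<^sup>+z. indicator A z * indicator unit_disc z \<partial>lborel)"
    by (rule nn_integral_polar[symmetric]) measurable
  also have "\<dots> = emeasure (density lborel (indicator unit_disc)) A"
    by (subst emeasure_density) (auto simp: mult.commute)
  finally show "emeasure (distr (TM \<Otimes>\<^sub>M RM) borel pol) A = emeasure (density lborel (indicator unit_disc)) A" .
qed simp

section \<open>Transfer between the area measure and polar coordinates\<close>

lemma AE_dA: "(AE z in dA. P z) \<longleftrightarrow> (AE z in lborel. z \<in> unit_disc \<longrightarrow> P z)"
proof -
  have "(AE z in dA. P z) \<longleftrightarrow> (AE z in lebesgue_on unit_disc. P z)"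
    unfolding dA_def by (subst AE_density) auto
  also have "\<dots> \<longleftrightarrow> (AE z in lebesgue. z \<in> unit_disc \<longrightarrow> P z)"
    by (subst AE_restrict_space_iff) auto
  also have "\<dots> \<longleftrightarrow> (AE z in lborel. z \<in> unit_disc \<longrightarrow> P z)"
    by (rule AE_completion_iff)
  finally show ?thesis .
qed

text \<open>The exceptional set is enlarged to a Borel null set, whose indicator integrates to 0 in
  polar coordinates; hence almost every ray meets it in a null set.\<close>

lemma AE_dA_polar:
  assumes "AE z in dA. P z"
  shows "AE t in TM. AE r in RM. P (of_real r * cis t)"
proof -
  have "AE z in lborel. z \<in> unit_disc \<longrightarrow> P z" using assms by (simp only: AE_dA)
  then obtain N where N: "N \<in> null_sets lborel" "{z \<in> space lborel. \<not> (z \<in> unit_disc \<longrightarrow> P z)} \<subseteq> N"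
    unfolding eventually_ae_filter by (elim bexE) (rule that)
  then have [measurable]: "N \<in> sets borel" by auto
  have "polar_int (\<lambda>t r. indicator N (of_real r * cis t)) = (\<integral>\<^sup>+z. indicator N z * indicator unit_disc z \<partial>lborel)"
    by (rule nn_integral_polar[symmetric]) measurable
  also have "\<dots> = (\<integral>\<^sup>+z. 0 \<partial>(lborel :: complex measure))"
  proof (rule nn_integral_cong_AE)
    show "AE z in lborel. indicator N z * indicator unit_disc z = (0 :: ennreal)"
      using AE_not_in[OF N(1)] by eventually_elim simp
  qed
  also have "\<dots> = 0" by simp
  finally have "AE t in TM. (\<integral>\<^sup>+r. indicator N (of_real r * cis t) \<partial>RM) = 0"
    by (subst (asm) nn_integral_0_iff_AE) auto
  then show ?thesis
  proof eventually_elim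
    case (elim t)
    then have "AE r in RM. (indicator N (of_real r * cis t) :: ennreal) = 0"
      by (subst (asm) nn_integral_0_iff_AE) auto
    with AE_RM_range show ?case
    proof eventually_elim
      case (elim r)
      then have "of_real r * cis t \<notin> N" "of_real r * cis t \<in> unit_disc"
        by (auto simp: indicator_def norm_mult split: if_splits)
      then show ?case using N(2) by auto
    qed
  qed
qed

lemma AE_RM_imp_AE_dA:
  assumes "AE r in RM. P r"
  shows "AE z in dA. P (cmod z)"
proof -
  obtain N where N: "N \<in> null_sets RM" "{r \<in> space RM. \<not> P r} \<subseteq> N"
    using assms unfolding eventually_ae_filter by blast
  then have [measurable]: "N \<in> sets borel" by auto
  have "(\<integral>\<^sup>+z. indicator N (cmod z) * indicator unit_disc z \<partial>lborel) = ennreal (2 * pi) * (\<integral>\<^sup>+r. indicator N r \<partial>RM)"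
    by (rule nn_integral_radial_disc) measurable
  also have "\<dots> = 0" using N(1) by (simp add: null_setsD1)
  finally have "AE z in lborel. indicator N (cmod z) * indicator unit_disc z = (0 :: ennreal)"
    by (subst (asm) nn_integral_0_iff_AE) auto
  then show ?thesis
    unfolding AE_dA by eventually_elim (use N(2) in \<open>auto simp: indicator_def split: if_splits\<close>)
qed

lemma space_dA: "space dA = unit_disc"
  by (simp add: dA_def space_restrict_space)

lemma measurable_dA_iff: "f \<in> borel_measurable dA \<longleftrightarrow> f \<in> disc_measurable"
  by (simp add: dA_def)

lemma borel_measurable_lebesgue_on_borel:
  "f \<in> borel_fun \<Longrightarrow> f \<in> borel_measurable (lebesgue_on A)"
  by (intro measurable_restrict_space1 measurable_completion) simp

lemma nn_integral_dA:
  assumes f [measurable]: "f \<in> borel_fun"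
  shows "(\<integral>\<^sup>+z. f z \<partial>dA) = ennreal (1 / pi) * polar_int (\<lambda>t r. f (of_real r * cis t))"
proof -
  have "(\<integral>\<^sup>+z. f z \<partial>dA) = (\<integral>\<^sup>+z. ennreal (1 / pi) * f z \<partial>lebesgue_on unit_disc)"
    unfolding dA_def by (rule nn_integral_density) (auto intro: borel_measurable_lebesgue_on_borel)
  also have "\<dots> = ennreal (1 / pi) * (\<integral>\<^sup>+z. f z \<partial>lebesgue_on unit_disc)"
    by (rule nn_integral_cmult) (auto intro: borel_measurable_lebesgue_on_borel)
  also have "(\<integral>\<^sup>+z. f z \<partial>lebesgue_on unit_disc) = (\<integral>\<^sup>+z. f z * indicator unit_disc z \<partial>lborel)"
    by (subst nn_integral_restrict_space) (auto simp: nn_integral_completion)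
  finally show ?thesis by (simp add: nn_integral_polar)
qed

lemma integrable_dA_iff:
  fixes f :: "complex \<Rightarrow> complex"
  assumes [measurable]: "f \<in> borel_fun"
  shows "integrable dA f \<longleftrightarrow> integrable (TM \<Otimes>\<^sub>M RM) (\<lambda>x. f (pol x))"
proof -
  have "(\<integral>\<^sup>+z. ennreal (cmod (f z)) \<partial>dA) = ennreal (1 / pi) * (\<integral>\<^sup>+x. ennreal (cmod (f (pol x))) \<partial>(TM \<Otimes>\<^sub>M RM))"
    by (subst RM.nn_integral_fst[symmetric]) (auto simp: nn_integral_dA pol_def)
  then show ?thesis
    by (auto simp: integrable_iff_bounded measurable_dA_iff borel_measurable_lebesgue_on_borel ennreal_mult_less_top)
qed

lemma integral_dA:
  fixes f :: "complex \<Rightarrow> complex"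
  assumes f [measurable]: "f \<in> borel_fun"
  shows "(\<integral>z. f z \<partial>dA) = (\<integral>x. f (pol x) \<partial>(TM \<Otimes>\<^sub>M RM)) / of_real pi"
proof -
  have "(\<integral>z. f z \<partial>dA) = (\<integral>z. (1 / pi) *\<^sub>R f z \<partial>lebesgue_on unit_disc)"
    unfolding dA_def by (rule integral_density) (auto intro: borel_measurable_lebesgue_on_borel)
  also have "\<dots> = (1 / pi) *\<^sub>R (\<integral>z. f z \<partial>lebesgue_on unit_disc)" by simp
  also have "(\<integral>z. f z \<partial>lebesgue_on unit_disc) = (\<integral>z. indicator unit_disc z *\<^sub>R f z \<partial>lebesgue)"
    by (rule integral_restrict_space) simp
  also have "\<dots> = (\<integral>z. indicator unit_disc z *\<^sub>R f z \<partial>lborel)"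
    by (rule integral_completion) measurable
  also have "\<dots> = (\<integral>z. f z \<partial>density lborel (indicator unit_disc))"
  proof -
    have "density lborel (indicator unit_disc) = density (lborel :: complex measure) (\<lambda>z. ennreal (indicator unit_disc z))"
      by (intro arg_cong[where f="density lborel"]) (auto simp: indicator_def)
    then show ?thesis by (simp add: integral_density)
  qed
  also have "\<dots> = (\<integral>z. f z \<partial>distr (TM \<Otimes>\<^sub>M RM) borel pol)" by (simp add: distr_pol)
  also have "\<dots> = (\<integral>x. f (pol x) \<partial>(TM \<Otimes>\<^sub>M RM))" by (rule integral_distr) measurable
  finally show ?thesis by (simp add: scaleR_conv_of_real)
qed

text \<open>Members of the spaces are Lebesgue measurable only, a property that does not pass to
  polar coordinates by composition. Each is therefore exchanged for a Borel function that agrees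
  with it almost everywhere.\<close>

lemma lebesgue_on_disc_borel_version:
  fixes f :: "complex \<Rightarrow> complex"
  assumes f: "f \<in> disc_measurable"
  obtains F where "F \<in> borel_fun" "AE z in dA. f z = F z"
proof -
  define g where "g = (\<lambda>z. indicator unit_disc z *\<^sub>R f z)"
  have g: "g \<in> borel_measurable lebesgue"
    unfolding g_def using f by (subst (asm) borel_measurable_restrict_space_iff) auto
  have "(\<lambda>z. Re (g z)) \<in> borel_measurable (completion lborel)" "(\<lambda>z. Im (g z)) \<in> borel_measurable (completion lborel)"
    using g by measurable
  then obtain a b where ab: "a \<in> borel_measurable lborel" "AE z in lborel. Re (g z) = a z"
      "b \<in> borel_measurable lborel" "AE z in lborel. Im (g z) = b z"
    using completion_ex_borel_measurable_real by metis
  show thesis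
  proof (rule that[of "\<lambda>z. Complex (a z) (b z)"])
    show "(\<lambda>z. Complex (a z) (b z)) \<in> borel_fun" using ab by simp
    show "AE z in dA. f z = Complex (a z) (b z)"
      unfolding AE_dA using ab(2,4)
      by eventually_elim (auto simp: g_def complex_eq_iff)
  qed
qed

section \<open>Tent spaces\<close>

text \<open>The weight is multiplied into the function as w^(1/p) and the measure is kept fixed. In
  this form w and s meet in Hoelder's inequality as w^(1/p) s^(1/p') = v, and infinite values of the
  weights cause no trouble.\<close>

definition Ln :: "real \<Rightarrow> real \<Rightarrow> (real \<Rightarrow> ennreal) \<Rightarrow> (real \<Rightarrow> real \<Rightarrow> ennreal) \<Rightarrow> ennreal" where
  "Ln p q w F = elp2 TM RM p q (\<lambda>\<theta> r. F \<theta> r * epowr (w r) (1 / p))"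

text \<open>The indicator of the tent at \<open>cis \<theta>\<close> in polar coordinates, valued in
  [0,\<infinity>]. At a fixed radius it is symmetric in the two angles, which is what the averaging
  arguments below exploit.\<close>

definition tind :: "real \<Rightarrow> real \<Rightarrow> real \<Rightarrow> ennreal" where
  "tind \<theta> t r = (if \<exists>k::int. \<bar>t - \<theta> + 2 * pi * of_int k\<bar> < 1 - r then 1 else 0)"

definition Tn :: "real \<Rightarrow> real \<Rightarrow> (real \<Rightarrow> ennreal) \<Rightarrow> (real \<Rightarrow> real \<Rightarrow> ennreal) \<Rightarrow> ennreal" where
  "Tn p q w F = elp TM q (\<lambda>\<theta>. epowr (polar_int (\<lambda>t r. tind \<theta> t r * (epowr (F t r) p * (w r * ennreal (1 / (1 - r)))))) (1 / p))"

lemma tind_measurable [measurable]: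
  assumes [measurable]: "a \<in> borel_measurable M" "b \<in> borel_measurable M" "c \<in> borel_measurable M"
  shows "(\<lambda>x. tind (a x) (b x) (c x)) \<in> borel_measurable M"
  unfolding tind_def by measurable

lemma tind_commute: "tind \<theta> t r = tind t \<theta> r"
proof -
  have "\<exists>k::int. \<bar>\<theta> - t + 2 * pi * of_int k\<bar> < 1 - r" if "\<bar>t - \<theta> + 2 * pi * of_int k\<bar> < 1 - r" for k :: int and t \<theta>
    using that by (intro exI[of _ "- k"]) (auto simp: abs_minus_commute algebra_simps abs_if split: if_splits)
  then show ?thesis unfolding tind_def by metis
qed

lemma tind_self: "r < 1 \<Longrightarrow> tind \<theta> \<theta> r = 1"
  unfolding tind_def by (auto intro!: exI[of _ 0])

lemma tind_mass_le:
  assumes \<theta>: "\<theta> \<in> {0..2 * pi}" and r: "r \<in> {0<..<1}"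
  shows "(\<integral>\<^sup>+t. tind \<theta> t r \<partial>TM) \<le> ennreal (6 * (1 - r))"
proof -
  let ?A = "{t. \<exists>k::int. \<bar>t - \<theta> + 2 * pi * of_int k\<bar> < 1 - r}"
  have [measurable]: "?A \<in> sets borel" by measurable
  have "(\<integral>\<^sup>+t. tind \<theta> t r \<partial>TM) = emeasure TM ?A"
  proof -
    have "(\<integral>\<^sup>+t. tind \<theta> t r \<partial>TM) = (\<integral>\<^sup>+t. indicator ?A t \<partial>TM)"
      by (intro nn_integral_cong) (simp add: tind_def indicator_def)
    then show ?thesis by simp
  qed
  also have "\<dots> \<le> ennreal (6 * (1 - r))"
  proof (rule emeasure_TM_arc_le)
    fix t assume t: "t \<in> ?A" "t \<in> {0..2 * pi}"
    then obtain k :: int where k: "\<bar>t - \<theta> + 2 * pi * of_int k\<bar> < 1 - r" by blast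
    have "\<bar>2 * pi * of_int k\<bar> < 2 * pi * 2"
      using k t \<theta> r pi_gt3 by auto
    then have "2 * pi * \<bar>of_int k :: real\<bar> < 2 * pi * 2" by (simp add: abs_mult)
    then have "\<bar>of_int k :: real\<bar> < 2" by (subst (asm) mult_less_cancel_left_pos) auto
    then have "k \<in> {-1, 0, 1}" by auto
    then show "\<exists>k\<in>{-1, 0, 1 :: int}. \<bar>t - \<theta> + 2 * pi * of_int k\<bar> < 1 - r" using k by blast
  qed (use r in auto)
  finally show ?thesis .
qed

text \<open>The tent section around \<theta> may leave [0, 2\<pi>], but one of its halves stays
  inside: the right one if \<theta> \<le> \<pi>, the left one otherwise. Each half has length 1 -
  r.\<close>

lemma tind_mass_ge:
  assumes \<theta>: "\<theta> \<in> {0..2 * pi}" and r: "r \<in> {0<..<1}"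
  shows "ennreal (1 - r) \<le> (\<integral>\<^sup>+t. tind \<theta> t r \<partial>TM)"
proof -
  define a where "a = (if \<theta> \<le> pi then \<theta> else \<theta> - (1 - r))"
  have a: "{a<..<a + (1 - r)} \<subseteq> {0..2 * pi}"
    using \<theta> r pi_gt3 by (auto simp: a_def)
  have "ennreal (1 - r) = emeasure TM {a<..<a + (1 - r)}"
    using r a by (simp add: emeasure_TM Int_absorb2)
  also have "\<dots> = (\<integral>\<^sup>+t. indicator {a<..<a + (1 - r)} t \<partial>TM)" by simp
  also have "\<dots> \<le> (\<integral>\<^sup>+t. tind \<theta> t r \<partial>TM)"
  proof (intro nn_integral_mono)
    fix t
    have "t \<in> {a<..<a + (1 - r)} \<Longrightarrow> \<bar>t - \<theta> + 2 * pi * of_int 0\<bar> < 1 - r"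
      by (auto simp: a_def split: if_splits)
    then show "indicator {a<..<a + (1 - r)} t \<le> tind \<theta> t r"
      unfolding tind_def indicator_def by (auto simp del: of_int_0)
  qed
  finally show ?thesis .
qed

lemma polar_in_tent_region:
  assumes r: "r \<in> {0<..<1}"
  shows "of_real r * cis t \<in> tent_region (cis \<theta>) \<longleftrightarrow> (\<exists>k::int. \<bar>t - \<theta> + 2 * pi * of_int k\<bar> < 1 - r)"
proof -
  have arg: "\<exists>k::int. Arg (of_real x * cis s) = s + 2 * pi * of_int k" if "0 < x" for x s :: real
  proof -
    have "cis (Arg (of_real x * cis s)) = cis s"
      using that by (subst cis_Arg) (auto simp: sgn_mult sgn_of_real)
    then have "sin (Arg (of_real x * cis s)) = sin s \<and> cos (Arg (of_real x * cis s)) = cos s"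
      by (simp add: complex_eq_iff)
    then show ?thesis unfolding sin_cos_eq_iff by (auto simp: mult_ac)
  qed
  obtain m :: int where m: "Arg (of_real r * cis t) = t + 2 * pi * of_int m" using arg[of r t] r by auto
  obtain n :: int where n: "Arg (cis \<theta>) = \<theta> + 2 * pi * of_int n" using arg[of 1 \<theta>] by auto
  have "(\<exists>k::int. \<bar>Arg (of_real r * cis t) - Arg (cis \<theta>) + 2 * pi * of_int k\<bar> < 1 - r) \<longleftrightarrow>
     (\<exists>k::int. \<bar>t - \<theta> + 2 * pi * of_int k\<bar> < 1 - r)"
  proof safe
    fix k :: int assume "\<bar>Arg (of_real r * cis t) - Arg (cis \<theta>) + 2 * pi * of_int k\<bar> < 1 - r"
    then show "\<exists>k::int. \<bar>t - \<theta> + 2 * pi * of_int k\<bar> < 1 - r"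
      unfolding m n by (intro exI[of _ "m - n + k"]) (simp add: algebra_simps)
  next
    fix k :: int assume "\<bar>t - \<theta> + 2 * pi * of_int k\<bar> < 1 - r"
    then show "\<exists>k::int. \<bar>Arg (of_real r * cis t) - Arg (cis \<theta>) + 2 * pi * of_int k\<bar> < 1 - r"
      unfolding m n by (intro exI[of _ "k + n - m"]) (simp add: algebra_simps)
  qed
  then show ?thesis using r by (simp add: tent_region_def norm_mult)
qed

lemma borel_measurable_Arg: "Arg \<in> borel_fun"
  unfolding Arg_def[abs_def] by measurable

text \<open>\<open>L_norm\<close> reads the weight on the real axis, a null set for area; hence the
  hypothesis on \<nu> concerns almost every radius. The function itself is read on all rays, and
  almost all of them respect the exceptional set of f = F.\<close>

lemma L_norm_eq:
  assumes pq: "0 < p" "0 < q" and F [measurable]: "F \<in> borel_fun" and fF: "AE z in dA. f z = F z"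
    and w [measurable]: "w \<in> borel_fun" and nu: "AE r in RM. \<nu> (of_real r) = w r"
  shows "L_norm p q \<nu> f = ennreal ((1 / (2 * pi)) powr (1 / q)) * Ln p q w (\<lambda>\<theta> r. ennreal (cmod (F (of_real r * cis \<theta>))))"
proof -
  let ?u = "\<lambda>\<theta> r. ennreal (cmod (f (of_real r * cis \<theta>)) powr p) * \<nu> (of_real r) * ennreal r"
  let ?G = "\<lambda>\<theta> r. ennreal (cmod (F (of_real r * cis \<theta>)))"
  let ?g = "\<lambda>\<theta> r. epowr (?G \<theta> r * epowr (w r) (1 / p)) p"
  let ?I = "\<lambda>\<theta>. \<integral>\<^sup>+r. ?g \<theta> r \<partial>RM"
  have [measurable]: "?I \<in> borel_fun" by measurable
  have inner: "AE \<theta> in TM. (\<integral>\<^sup>+r\<in>{0..<1}. ?u \<theta> r \<partial>lebesgue) = ?I \<theta>"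
    using AE_dA_polar[OF fF]
  proof eventually_elim
    case (elim \<theta>)
    have "(\<integral>\<^sup>+r\<in>{0..<1}. ?u \<theta> r \<partial>lebesgue) =
      (\<integral>\<^sup>+r\<in>{0..<1}. ?u \<theta> r \<partial>lborel)"
      by (rule nn_integral_completion)
    also have "\<dots> = (\<integral>\<^sup>+r. ?g \<theta> r * ennreal r * indicator {0..<1} r \<partial>lborel)"
    proof (rule nn_integral_cong_AE)
      show "AE r in lborel. ?u \<theta> r * indicator {0..<1} r =
         ?g \<theta> r * ennreal r * indicator {0..<1} r"
        using elim nu unfolding AE_RM
      proof eventually_elim
        case (elim r)
        then show ?case using pq
          by (cases "r \<in> {0<..<1}") (auto simp: epowr_mult epowr_inverse epowr_ennreal indicator_def)
      qed
    qed
    also have "\<dots> = ?I \<theta>" by (rule nn_integral_RM[symmetric]) measurable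
    finally show ?case .
  qed
  have "(\<integral>\<^sup>+\<theta>\<in>{0..2 * pi}. epowr (\<integral>\<^sup>+r\<in>{0..<1}. ?u \<theta> r \<partial>lebesgue) (q / p) \<partial>lebesgue)
     = (\<integral>\<^sup>+\<theta>\<in>{0..2 * pi}. epowr (\<integral>\<^sup>+r\<in>{0..<1}. ?u \<theta> r \<partial>lebesgue) (q / p) \<partial>lborel)"
    by (rule nn_integral_completion)
  also have "\<dots> = (\<integral>\<^sup>+\<theta>. epowr (?I \<theta>) (q / p) * indicator {0..2 * pi} \<theta> \<partial>lborel)"
  proof (rule nn_integral_cong_AE)
    show "AE \<theta> in lborel. epowr (\<integral>\<^sup>+r\<in>{0..<1}. ?u \<theta> r \<partial>lebesgue) (q / p) * indicator {0..2 * pi} \<theta>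
       = epowr (?I \<theta>) (q / p) * indicator {0..2 * pi} \<theta>"
      using inner unfolding AE_TM by eventually_elim (auto simp: indicator_def)
  qed
  also have "\<dots> = (\<integral>\<^sup>+\<theta>. epowr (?I \<theta>) (q / p) \<partial>TM)" by (rule nn_integral_TM[symmetric]) measurable
  finally have 1: "L_norm p q \<nu> f = epowr (ennreal (1 / (2 * pi)) * (\<integral>\<^sup>+\<theta>. epowr (?I \<theta>) (q / p) \<partial>TM)) (1 / q)"
    unfolding L_norm_def by simp
  have "Ln p q w ?G = epowr (\<integral>\<^sup>+\<theta>. epowr (?I \<theta>) (q / p) \<partial>TM) (1 / q)"
    unfolding Ln_def elp2_def elp_def by (simp add: epowr_epowr)
  then show ?thesis
    using epowr_ennreal[of "1 / (2 * pi)" "1 / q"] by (simp only: 1 epowr_mult) simp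
qed

text \<open>Here the weight is integrated over planar regions, so it has to agree with its radial
  profile almost everywhere in area.\<close>

lemma T_norm_eq:
  assumes pq: "0 < p" "0 < q" and F [measurable]: "F \<in> borel_fun" and fF: "AE z in dA. f z = F z"
    and w [measurable]: "w \<in> borel_fun" and nu: "AE z in dA. \<nu> z = w (cmod z)"
  shows "T_norm p q \<nu> f = ennreal ((1 / pi) powr (1 / p)) * Tn p q w (\<lambda>\<theta> r. ennreal (cmod (F (of_real r * cis \<theta>))))"
proof -
  let ?a = "\<lambda>\<theta> t r. ennreal (cmod (F (of_real r * cis t)) powr p) * w (cmod (of_real r * cis t)) / ennreal (1 - cmod (of_real r * cis t)) * indicator (tent_region (cis \<theta>)) (of_real r * cis t)"
  let ?J = "\<lambda>\<theta>. \<integral>\<^sup>+t. \<integral>\<^sup>+r. tind \<theta> t r * (epowr (ennreal (cmod (F (of_real r * cis t)))) p * (w r * ennreal (1 / (1 - r)))) \<partial>RM \<partial>TM"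
  have Jm [measurable]: "?J \<in> borel_fun" by measurable
  have inner: "(\<integral>\<^sup>+z\<in>tent_region (cis \<theta>). ennreal (cmod (f z) powr p) * \<nu> z / ennreal (1 - cmod z) \<partial>dA) = ennreal (1 / pi) * ?J \<theta>" for \<theta>
  proof -
    have sets: "tent_region (cis \<theta>) \<in> sets borel"
    proof -
      have [measurable]: "Arg \<in> borel_fun" by (rule borel_measurable_Arg)
      show ?thesis unfolding tent_region_def by measurable
    qed
    have "(\<integral>\<^sup>+z\<in>tent_region (cis \<theta>). ennreal (cmod (f z) powr p) * \<nu> z / ennreal (1 - cmod z) \<partial>dA) =
      (\<integral>\<^sup>+z. ennreal (cmod (F z) powr p) * w (cmod z) / ennreal (1 - cmod z) * indicator (tent_region (cis \<theta>)) z \<partial>dA)"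
      using fF nu by (intro nn_integral_cong_AE) (auto elim!: eventually_elim2)
    also have "\<dots> = ennreal (1 / pi) * polar_int (\<lambda>t r. ?a \<theta> t r)"
      by (rule nn_integral_dA) (use sets in measurable)
    also have "polar_int (\<lambda>t r. ?a \<theta> t r) = ?J \<theta>"
    proof (rule nn_integral_cong, rule nn_integral_cong_AE)
      fix t
      show "AE r in RM. ?a \<theta> t r =
        tind \<theta> t r * (epowr (ennreal (cmod (F (of_real r * cis t)))) p * (w r * ennreal (1 / (1 - r))))"
        using AE_RM_range
      proof eventually_elim
        case (elim r)
        have "x / ennreal (1 - r) = x * ennreal (1 / (1 - r))" for x
          using elim by (simp add: divide_ennreal_def inverse_ennreal inverse_eq_divide)
        then show ?case using elim polar_in_tent_region[OF elim, of t \<theta>]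
          by (auto simp: tind_def indicator_def norm_mult epowr_ennreal mult_ac)
      qed
    qed
    finally show ?thesis .
  qed
  have "T_norm p q \<nu> f = epowr (\<integral>\<^sup>+\<theta>. epowr (ennreal (1 / pi) * ?J \<theta>) (q / p) * indicator {0..2 * pi} \<theta> \<partial>lborel) (1 / q)"
    unfolding T_norm_def inner by (simp only: nn_integral_completion)
  also have "\<dots> = epowr (\<integral>\<^sup>+\<theta>. epowr (ennreal (1 / pi) * ?J \<theta>) (q / p) \<partial>TM) (1 / q)"
    by (subst nn_integral_TM) auto
  also have "\<dots> = elp TM q (\<lambda>\<theta>. ennreal ((1 / pi) powr (1 / p)) * epowr (?J \<theta>) (1 / p))"
  proof -
    have "epowr (ennreal (1 / pi) * ?J \<theta>) (q / p) = epowr (ennreal ((1 / pi) powr (1 / p)) * epowr (?J \<theta>) (1 / p)) q" for \<theta>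
      using epowr_ennreal[of "1 / pi" "1 / p"] by (simp add: epowr_mult epowr_epowr flip: epowr_ennreal)
    then show ?thesis by (simp only: elp_def)
  qed
  also have "\<dots> = ennreal ((1 / pi) powr (1 / p)) * Tn p q w (\<lambda>\<theta> r. ennreal (cmod (F (of_real r * cis \<theta>))))"
    unfolding Tn_def using pq by (intro elp_cmult) auto
  finally show ?thesis .
qed

text \<open>A shift of the angle by 2(1 - \<rho>) moves the point by at most 2(1 - \<rho>), and 1 -
  \<rho> is at most the distance from 1 of either point.\<close>

lemma norm_one_minus_shift:
  assumes \<rho>: "0 \<le> \<rho>" "\<rho> \<le> 1" and d: "\<bar>x - y + 2 * pi * of_int k\<bar> \<le> 2 * (1 - \<rho>)"
  shows "norm (1 - of_real \<rho> * cis x) \<le> 3 * norm (1 - of_real \<rho> * cis y)"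
proof -
  have "norm (of_real \<rho> * (cis y - cis x)) \<le> 1 * dist (cis x) (cis y)"
    using \<rho> by (simp add: norm_mult dist_norm norm_minus_commute mult_left_le_one_le)
  also have "\<dots> \<le> 2 * (1 - \<rho>)" using dist_cis_le_period[of x y k] d by simp
  also have "\<dots> \<le> 2 * norm (1 - of_real \<rho> * cis y)" using one_minus_le_norm[OF \<rho>(1), of y] by simp
  finally have "norm (of_real \<rho> * (cis y - cis x)) \<le> 2 * norm (1 - of_real \<rho> * cis y)" .
  moreover have "1 - of_real \<rho> * cis x = (1 - of_real \<rho> * cis y) + of_real \<rho> * (cis y - cis x)"
    by (simp add: algebra_simps)
  ultimately show ?thesis using norm_triangle_ineq[of "1 - of_real \<rho> * cis y" "of_real \<rho> * (cis y - cis x)"]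
    by (simp only:)
qed

text \<open>Inside tents the two angles move by less than 1 - r and 1 - s, in total by at most 2(1 -
  r s). Then the distance |1 - r s e^(ix)| changes at most by the factor 3.\<close>

lemma Pkernel_shift:
  assumes g: "-1 < \<gamma>" and r: "r \<in> {0<..<1}" and s: "s \<in> {0<..<1}"
    and "tind \<theta> t r \<noteq> 0" "tind u t' s \<noteq> 0"
  shows "Pkernel \<gamma> t r t' s \<le> 3 powr (2 + \<gamma>) * Pkernel \<gamma> \<theta> r u s"
proof -
  obtain k j :: int where k: "\<bar>t - \<theta> + 2 * pi * of_int k\<bar> < 1 - r" and j: "\<bar>t' - u + 2 * pi * of_int j\<bar> < 1 - s"
    using assms(4,5) unfolding tind_def by (auto split: if_splits)
  have rs: "0 < r * s" "r * s \<le> r" "r * s \<le> s" "r * s < 1"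
    using r s by (auto simp: mult_le_one mult_left_le mult_left_le_one_le intro: less_le_trans mult_strict_mono[of r 1 s 1, simplified])
  have "\<bar>(\<theta> - u) - (t - t') + 2 * pi * of_int (j - k)\<bar> \<le> 2 * (1 - r * s)"
    using k j rs by (simp add: algebra_simps abs_if split: if_splits)
  then have le: "norm (1 - of_real (r * s) * cis (\<theta> - u)) \<le> 3 * norm (1 - of_real (r * s) * cis (t - t'))"
    using rs by (intro norm_one_minus_shift[where k="j - k"]) auto
  have pos: "0 < norm (1 - of_real (r * s) * cis (\<theta> - u))"
    using one_minus_le_norm[of "r * s" "\<theta> - u"] rs by linarith
  have "(3 * norm (1 - of_real (r * s) * cis (t - t'))) powr - (2 + \<gamma>) \<le> norm (1 - of_real (r * s) * cis (\<theta> - u)) powr - (2 + \<gamma>)"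
    using le pos g by (intro powr_mono2') auto
  then have a: "3 powr (2 + \<gamma>) * (3 * norm (1 - of_real (r * s) * cis (t - t'))) powr - (2 + \<gamma>) \<le> 3 powr (2 + \<gamma>) * norm (1 - of_real (r * s) * cis (\<theta> - u)) powr - (2 + \<gamma>)"
    by (intro mult_left_mono) auto
  have b: "3 powr (2 + \<gamma>) * (3 * norm (1 - of_real (r * s) * cis (t - t'))) powr - (2 + \<gamma>) = norm (1 - of_real (r * s) * cis (t - t')) powr - (2 + \<gamma>)"
  proof -
    have "3 powr (2 + \<gamma>) * 3 powr - (2 + \<gamma>) = (1::real)" by (simp only: powr_add[symmetric]) simp
    then show ?thesis by (simp only: powr_mult mult.assoc[symmetric] mult_1)
  qed
  show ?thesis unfolding Pkernel_def by (rule a[unfolded b])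
qed

text \<open>The angular average over a section of the tent, whose length is comparable with 1 - r.
  It mediates between the two norms: the mixed norm of the average is controlled by the tent norm,
  and the maximal projection does not distinguish F from its average up to constants.\<close>

definition Av :: "(real \<Rightarrow> real \<Rightarrow> ennreal) \<Rightarrow> real \<Rightarrow> real \<Rightarrow> ennreal" where
  "Av F \<theta> r = (\<integral>\<^sup>+t. ennreal (1 / (1 - r)) * tind \<theta> t r * F t r \<partial>TM)"

lemma Av_measurable:
  assumes F: "polar_measurable F"
  shows "polar_measurable (Av F)"
proof -
  note polar_measurableD[OF F, measurable]
  have "(\<lambda>x. \<integral>\<^sup>+t. ennreal (1 / (1 - snd x)) * tind (fst x) t (snd x) * F t (snd x) \<partial>TM) \<in> borel_measurable (borel \<Otimes>\<^sub>M borel)"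
    by measurable
  then show ?thesis unfolding polar_measurable_iff by (simp add: Av_def case_prod_beta')
qed

lemma Pplus_tent_le:
  assumes g: "-1 < \<gamma>" and F: "polar_measurable F"
    and r: "r \<in> {0<..<1}" and t: "tind \<theta> t r \<noteq> 0"
  shows "Pplus \<gamma> F t r \<le> ennreal (3 powr (2 + \<gamma>)) * Pplus \<gamma> F \<theta> r"
proof -
  note polar_measurableD[OF F, measurable]
  have "Pplus \<gamma> F t r \<le> polar_int (\<lambda>t' s. ennreal (3 powr (2 + \<gamma>)) * (ennreal (Pkernel \<gamma> \<theta> r t' s) * (ennreal (vweight \<gamma> s) * F t' s)))"
    unfolding Pplus_def
  proof (rule nn_integral_mono, rule nn_integral_mono_AE)
    fix t'
    show "AE s in RM. ennreal (Pkernel \<gamma> t r t' s) * (ennreal (vweight \<gamma> s) * F t' s) \<le> ennreal (3 powr (2 + \<gamma>)) * (ennreal (Pkernel \<gamma> \<theta> r t' s) * (ennreal (vweight \<gamma> s) * F t' s))"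
      using AE_RM_range
    proof eventually_elim
      case (elim s)
      have "tind t' t' s \<noteq> 0" using elim tind_self[of s t'] by simp
      then have "ennreal (Pkernel \<gamma> t r t' s) \<le> ennreal (3 powr (2 + \<gamma>) * Pkernel \<gamma> \<theta> r t' s)"
        using Pkernel_shift[OF g r elim t] by (intro ennreal_leI) auto
      then have "ennreal (Pkernel \<gamma> t r t' s) \<le> ennreal (3 powr (2 + \<gamma>)) * ennreal (Pkernel \<gamma> \<theta> r t' s)"
        by (simp add: ennreal_mult)
      then show ?case by (simp only: mult.assoc[symmetric]) (intro mult_right_mono, auto)
    qed
  qed
  also have "\<dots> = ennreal (3 powr (2 + \<gamma>)) * Pplus \<gamma> F \<theta> r"
    unfolding Pplus_def by (simp add: nn_integral_cmult)
  finally show ?thesis .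
qed

text \<open>The factor 1 is bounded by the mean of the tent indicator over u, then the kernel is
  moved from the angle t' to u at the cost of a constant; exchanging the integrals over t' and u
  leaves the average of F.\<close>

lemma Pplus_tent_le_Av:
  assumes g: "-1 < \<gamma>" and F: "polar_measurable F"
    and r: "r \<in> {0<..<1}" and t: "tind \<theta> t r \<noteq> 0"
  shows "Pplus \<gamma> F t r \<le> ennreal (3 powr (2 + \<gamma>)) * Pplus \<gamma> (Av F) \<theta> r"
proof -
  note polar_measurableD[OF F, measurable]
  interpret TT: pair_sigma_finite TM TM ..
  let ?c = "ennreal (3 powr (2 + \<gamma>))"
  let ?V = "\<lambda>s. ennreal (vweight \<gamma> s)" and ?i = "\<lambda>s. ennreal (1 / (1 - s))"
  let ?G = "\<lambda>u t' s. ?c * (ennreal (Pkernel \<gamma> \<theta> r u s) * (?V s * (?i s * tind u t' s * F t' s)))"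
  have "Pplus \<gamma> F t r \<le> polar_int (\<lambda>t' s. \<integral>\<^sup>+u. ?G u t' s \<partial>TM)"
    unfolding Pplus_def
  proof (rule nn_integral_mono_AE)
    show "AE t' in TM. (\<integral>\<^sup>+s. ennreal (Pkernel \<gamma> t r t' s) * (?V s * F t' s) \<partial>RM) \<le> (\<integral>\<^sup>+s. \<integral>\<^sup>+u. ?G u t' s \<partial>TM \<partial>RM)"
      using AE_TM_range
    proof eventually_elim
      case (elim t')
      show ?case
      proof (rule nn_integral_mono_AE)
        show "AE s in RM. ennreal (Pkernel \<gamma> t r t' s) * (?V s * F t' s) \<le> (\<integral>\<^sup>+u. ?G u t' s \<partial>TM)"
          using AE_RM_range
        proof eventually_elim
          case s: (elim s)
          have "1 = ?i s * ennreal (1 - s)" using s by (simp flip: ennreal_mult)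
          also have "\<dots> \<le> ?i s * (\<integral>\<^sup>+u. tind u t' s \<partial>TM)"
            using tind_mass_ge[OF elim s] by (intro mult_left_mono) (auto simp: tind_commute)
          finally have one: "1 \<le> ?i s * (\<integral>\<^sup>+u. tind u t' s \<partial>TM)" .
          have "ennreal (Pkernel \<gamma> t r t' s) * (?V s * F t' s) \<le> ennreal (Pkernel \<gamma> t r t' s) * (?V s * F t' s) * (?i s * (\<integral>\<^sup>+u. tind u t' s \<partial>TM))"
            using mult_left_mono[OF one, of "ennreal (Pkernel \<gamma> t r t' s) * (?V s * F t' s)"] by simp
          also have "\<dots> = (\<integral>\<^sup>+u. ennreal (Pkernel \<gamma> t r t' s) * (?V s * F t' s) * ?i s * tind u t' s \<partial>TM)"
            by (simp add: nn_integral_cmult mult.assoc)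
          also have "\<dots> \<le> (\<integral>\<^sup>+u. ?G u t' s \<partial>TM)"
          proof (intro nn_integral_mono)
            fix u
            show "ennreal (Pkernel \<gamma> t r t' s) * (?V s * F t' s) * ?i s * tind u t' s \<le> ?G u t' s"
            proof (cases "tind u t' s = 0")
              case False
              then have "ennreal (Pkernel \<gamma> t r t' s) \<le> ennreal (3 powr (2 + \<gamma>) * Pkernel \<gamma> \<theta> r u s)"
                using Pkernel_shift[OF g r s t] by (intro ennreal_leI) auto
              then have "ennreal (Pkernel \<gamma> t r t' s) \<le> ?c * ennreal (Pkernel \<gamma> \<theta> r u s)"
                by (simp add: ennreal_mult)
              then have "ennreal (Pkernel \<gamma> t r t' s) * ((?V s * F t' s) * ?i s * tind u t' s) \<le> (?c * ennreal (Pkernel \<gamma> \<theta> r u s)) * ((?V s * F t' s) * ?i s * tind u t' s)"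
                by (rule mult_right_mono) simp
              then show ?thesis by (simp add: mult_ac)
            qed simp
          qed
          finally show ?case .
        qed
      qed
    qed
  qed
  also have "\<dots> = (\<integral>\<^sup>+t'. \<integral>\<^sup>+u. \<integral>\<^sup>+s. ?G u t' s \<partial>RM \<partial>TM \<partial>TM)"
    by (intro nn_integral_cong TR.Fubini') measurable
  also have "\<dots> = (\<integral>\<^sup>+u. \<integral>\<^sup>+t'. \<integral>\<^sup>+s. ?G u t' s \<partial>RM \<partial>TM \<partial>TM)"
    by (rule TT.Fubini') measurable
  also have "\<dots> = polar_int (\<lambda>u s. \<integral>\<^sup>+t'. ?G u t' s \<partial>TM)"
    by (intro nn_integral_cong TR.Fubini'[symmetric]) measurable
  also have "\<dots> = ?c * Pplus \<gamma> (Av F) \<theta> r"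
    unfolding Pplus_def Av_def by (simp add: nn_integral_cmult)
  finally show ?thesis .
qed

lemma tind_mean_le:
  assumes \<theta>: "\<theta> \<in> {0..2 * pi}" and r: "r \<in> {0<..<1}"
  shows "ennreal (1 / (1 - r)) * (\<integral>\<^sup>+t. tind \<theta> t r \<partial>TM) \<le> 6"
proof -
  have "ennreal (1 / (1 - r)) * (\<integral>\<^sup>+t. tind \<theta> t r \<partial>TM) \<le> ennreal (1 / (1 - r)) * ennreal (6 * (1 - r))"
    by (intro mult_left_mono tind_mass_le \<theta> r) simp
  also have "\<dots> = ennreal (1 / (1 - r) * (6 * (1 - r)))" using r by (intro ennreal_mult[symmetric]) auto
  also have "1 / (1 - r) * (6 * (1 - r)) = 6" using r by (simp add: field_simps)
  finally show ?thesis by simp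
qed

text \<open>H bounds G over each tent by values on the axis, so after Fubini the inner integral over
  the tent section is just its normalised length, at most 6.\<close>

lemma Tn_le_Ln:
  assumes p: "0 < p" and q: "0 < q" and w [measurable]: "w \<in> borel_fun"
    and G: "polar_measurable G" and H: "polar_measurable H"
    and c: "0 \<le> c" and le: "\<And>\<theta> t r. r \<in> {0<..<1} \<Longrightarrow> tind \<theta> t r \<noteq> 0 \<Longrightarrow> G t r \<le> ennreal c * H \<theta> r"
  shows "Tn p q w G \<le> ennreal (6 powr (1 / p) * c) * Ln p q w H"
proof -
  let ?T = "\<lambda>\<theta> t r. tind \<theta> t r * (epowr (G t r) p * (w r * ennreal (1 / (1 - r))))"
  let ?h = "\<lambda>\<theta> r. epowr (ennreal c * H \<theta> r * epowr (w r) (1 / p)) p"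
  let ?E = "\<lambda>\<theta>. elp RM p (\<lambda>r. H \<theta> r * epowr (w r) (1 / p))"
  note polar_measurableD[OF G, measurable] polar_measurableD[OF H, measurable]
  have "AE \<theta> in TM. (polar_int (\<lambda>t r. ?T \<theta> t r))
     \<le> 6 * (\<integral>\<^sup>+r. ?h \<theta> r \<partial>RM)"
    using AE_TM_range
  proof eventually_elim
    case (elim \<theta>)
    have "polar_int (\<lambda>t r. ?T \<theta> t r)
       \<le> polar_int (\<lambda>t r. ?h \<theta> r * ennreal (1 / (1 - r)) * tind \<theta> t r)"
    proof (rule nn_integral_mono, rule nn_integral_mono_AE)
      fix t
      show "AE r in RM. ?T \<theta> t r \<le> ?h \<theta> r * ennreal (1 / (1 - r)) * tind \<theta> t r"
        using AE_RM_range
      proof eventually_elim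
        case (elim r)
        show ?case
        proof (cases "tind \<theta> t r = 0")
          case False
          have "epowr (G t r) p \<le> epowr (ennreal c * H \<theta> r) p" using p by (intro epowr_mono le[OF elim False]) auto
          then have "epowr (G t r) p * (w r * ennreal (1 / (1 - r)) * tind \<theta> t r) \<le> epowr (ennreal c * H \<theta> r) p * (w r * ennreal (1 / (1 - r)) * tind \<theta> t r)"
            by (rule mult_right_mono) simp
          then show ?thesis using p by (simp add: epowr_mult epowr_inverse mult_ac)
        qed simp
      qed
    qed
    also have "\<dots> = (\<integral>\<^sup>+r. \<integral>\<^sup>+t. ?h \<theta> r * ennreal (1 / (1 - r)) * tind \<theta> t r \<partial>TM \<partial>RM)"
      by (rule TR.Fubini'[symmetric]) measurable
    also have "\<dots> \<le> (\<integral>\<^sup>+r. 6 * ?h \<theta> r \<partial>RM)"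
    proof (rule nn_integral_mono_AE)
      show "AE r in RM. (\<integral>\<^sup>+t. ?h \<theta> r * ennreal (1 / (1 - r)) * tind \<theta> t r \<partial>TM) \<le> 6 * ?h \<theta> r"
        using AE_RM_range
      proof eventually_elim
        case r: (elim r)
        have "(\<integral>\<^sup>+t. ?h \<theta> r * ennreal (1 / (1 - r)) * tind \<theta> t r \<partial>TM) = ?h \<theta> r * (ennreal (1 / (1 - r)) * (\<integral>\<^sup>+t. tind \<theta> t r \<partial>TM))"
          unfolding mult.assoc[symmetric] by (rule nn_integral_cmult) measurable
        also have "\<dots> \<le> ?h \<theta> r * 6" by (intro mult_left_mono tind_mean_le elim r) simp
        finally show ?case by (simp add: mult.commute)
      qed
    qed
    also have "\<dots> = 6 * (\<integral>\<^sup>+r. ?h \<theta> r \<partial>RM)" by (rule nn_integral_cmult) measurable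
    finally show ?case .
  qed
  then have "Tn p q w G \<le> elp TM q (\<lambda>\<theta>. epowr (6 * (\<integral>\<^sup>+r. ?h \<theta> r \<partial>RM)) (1 / p))"
    unfolding Tn_def using p q by (intro elp_mono_AE) (auto elim!: eventually_mono intro!: epowr_mono)
  also have "\<dots> = elp TM q (\<lambda>\<theta>. ennreal (6 powr (1 / p) * c) * ?E \<theta>)"
  proof (rule elp_cong)
    fix \<theta>
    have "epowr (6 * (\<integral>\<^sup>+r. ?h \<theta> r \<partial>RM)) (1 / p) = epowr 6 (1 / p) * elp RM p (\<lambda>r. ennreal c * (H \<theta> r * epowr (w r) (1 / p)))"
      by (simp only: epowr_mult elp_def mult.assoc)
    also have "elp RM p (\<lambda>r. ennreal c * (H \<theta> r * epowr (w r) (1 / p))) = ennreal c * ?E \<theta>"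
      using p by (intro elp_cmult) auto
    also have "epowr 6 (1 / p) = ennreal (6 powr (1 / p))" using epowr_ennreal[of 6 "1 / p"] by simp
    finally show "epowr (6 * (\<integral>\<^sup>+r. ?h \<theta> r \<partial>RM)) (1 / p) = ennreal (6 powr (1 / p) * c) * ?E \<theta>"
      using c by (simp add: ennreal_mult mult.assoc)
  qed
  also have "\<dots> = ennreal (6 powr (1 / p) * c) * Ln p q w H"
    unfolding Ln_def elp2_def using q by (intro elp_cmult) auto
  finally show ?thesis .
qed

text \<open>The averaging kernel has mass at most 6, so the p-th power of the average is at most
  6^(p-1) times the average of the p-th powers. Integrated in r against w, that average is exactly
  the integral over the tent.\<close>

lemma Ln_Av_le_Tn:
  assumes p: "1 < p" and q: "0 < q" and w [measurable]: "w \<in> borel_fun"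
    and F: "polar_measurable F"
  shows "Ln p q w (Av F) \<le> ennreal (6 powr ((p - 1) / p)) * Tn p q w F"
proof -
  let ?T = "\<lambda>\<theta> t r. tind \<theta> t r * (epowr (F t r) p * (w r * ennreal (1 / (1 - r))))"
  note polar_measurableD[OF F, measurable]
  have Avp: "AE \<theta> in TM. (\<integral>\<^sup>+r. epowr (Av F \<theta> r * epowr (w r) (1 / p)) p \<partial>RM) \<le>
      epowr 6 (p - 1) * polar_int (\<lambda>t r. ?T \<theta> t r)"
    using AE_TM_range
  proof eventually_elim
    case (elim \<theta>)
    have "(\<integral>\<^sup>+r. epowr (Av F \<theta> r * epowr (w r) (1 / p)) p \<partial>RM) \<le>
      (\<integral>\<^sup>+r. \<integral>\<^sup>+t. epowr 6 (p - 1) * (?T \<theta> t r) \<partial>TM \<partial>RM)"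
    proof (rule nn_integral_mono_AE)
      show "AE r in RM. epowr (Av F \<theta> r * epowr (w r) (1 / p)) p \<le> (\<integral>\<^sup>+t. epowr 6 (p - 1) * (?T \<theta> t r) \<partial>TM)"
        using AE_RM_range
      proof eventually_elim
        case r: (elim r)
        have "(\<integral>\<^sup>+t. ennreal (1 / (1 - r)) * tind \<theta> t r \<partial>TM) = ennreal (1 / (1 - r)) * (\<integral>\<^sup>+t. tind \<theta> t r \<partial>TM)"
          by (rule nn_integral_cmult) measurable
        also have "\<dots> \<le> 6" by (rule tind_mean_le[OF elim r])
        finally have "epowr (Av F \<theta> r) p \<le> epowr 6 (p - 1) * (\<integral>\<^sup>+t. ennreal (1 / (1 - r)) * tind \<theta> t r * epowr (F t r) p \<partial>TM)"
          unfolding Av_def by (intro nn_integral_kernel_power_le p) auto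
        then have "epowr (Av F \<theta> r) p * w r \<le> epowr 6 (p - 1) * (\<integral>\<^sup>+t. ennreal (1 / (1 - r)) * tind \<theta> t r * epowr (F t r) p \<partial>TM) * w r"
          by (rule mult_right_mono) simp
        also have "\<dots> = (\<integral>\<^sup>+t. epowr 6 (p - 1) * (?T \<theta> t r) \<partial>TM)"
          by (simp add: nn_integral_cmult[symmetric] nn_integral_multc[symmetric]) (simp add: mult_ac)
        finally show ?case using p by (simp add: epowr_mult epowr_inverse)
      qed
    qed
    also have "\<dots> = polar_int (\<lambda>t r. epowr 6 (p - 1) * (?T \<theta> t r))"
      by (rule TR.Fubini') measurable
    also have "\<dots> = epowr 6 (p - 1) * polar_int (\<lambda>t r. ?T \<theta> t r)"
      by (simp add: nn_integral_cmult)
    finally show ?case .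
  qed
  have "Ln p q w (Av F) \<le> elp TM q (\<lambda>\<theta>. epowr (epowr 6 (p - 1) * polar_int (\<lambda>t r. ?T \<theta> t r)) (1 / p))"
    unfolding Ln_def elp2_def elp_def[of RM] using p q Avp
    by (intro elp_mono_AE) (auto elim!: eventually_mono intro!: epowr_mono)
  also have "\<dots> = elp TM q (\<lambda>\<theta>. ennreal (6 powr ((p - 1) / p)) * epowr (polar_int (\<lambda>t r. ?T \<theta> t r)) (1 / p))"
    using epowr_ennreal[of 6 "(p - 1) / p"] by (simp add: epowr_mult epowr_epowr)
  also have "\<dots> = ennreal (6 powr ((p - 1) / p)) * Tn p q w F"
    unfolding Tn_def using q by (intro elp_cmult) auto
  finally show ?thesis .
qed

section \<open>Power series of the Bergman projection\<close>

text \<open>The Taylor coefficients of (1 - x)^-(2+\<gamma>), of order n^(1+\<gamma>). The odd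
  moments of the standard weight turn out to be 1/(2 \<open>bcoef \<gamma> n\<close>), which links
  the kernel with the denominators in the moment condition.\<close>

definition bcoef :: "real \<Rightarrow> nat \<Rightarrow> real" where
  "bcoef \<gamma> n = pochhammer (2 + \<gamma>) n / fact n"

lemma bcoef_pos: "-1 < \<gamma> \<Longrightarrow> 0 < bcoef \<gamma> n"
  by (simp add: bcoef_def pochhammer_pos)

lemma bcoef_0 [simp]: "bcoef \<gamma> 0 = 1"
  by (simp add: bcoef_def)

lemma bcoef_Suc: "bcoef \<gamma> (Suc n) = bcoef \<gamma> n * ((real n + 2 + \<gamma>) / (real n + 1))"
  by (simp add: bcoef_def pochhammer_Suc field_simps)

lemma bcoef_sums:
  assumes "cmod w < 1"
  shows "(\<lambda>n. of_real (bcoef \<gamma> n) * w ^ n) sums (1 - w) powr (- of_real (2 + \<gamma>))"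
proof -
  have "(\<lambda>n. (of_real (- (2 + \<gamma>)) gchoose n) * (- w) ^ n) sums (1 + (- w)) powr (of_real (- (2 + \<gamma>)))"
    by (rule gen_binomial_complex) (use assms in simp)
  moreover have "(of_real (- (2 + \<gamma>)) gchoose n) * (- w) ^ n = of_real (bcoef \<gamma> n) * w ^ n" for n
  proof -
    have "(of_real (- (2 + \<gamma>)) gchoose n :: complex) = of_real ((- 1) ^ n * bcoef \<gamma> n)"
    proof -
      have "(of_real (- (2 + \<gamma>)) gchoose n :: complex) = (- 1) ^ n * pochhammer (of_real (2 + \<gamma>)) n / fact n"
        by (simp add: gbinomial_pochhammer add.commute)
      then show ?thesis unfolding pochhammer_of_real bcoef_def
        by (simp only: of_real_mult of_real_divide of_real_power of_real_minus of_real_1 of_real_fact times_divide_eq_right)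
    qed
    moreover have "(- w) ^ n = (- 1) ^ n * w ^ n" by (rule power_minus)
    ultimately have "(of_real (- (2 + \<gamma>)) gchoose n) * (- w) ^ n = ((- 1) ^ n * (- 1) ^ n) * (of_real (bcoef \<gamma> n) * w ^ n)"
      by (simp only: of_real_mult of_real_power of_real_minus of_real_1 mult_ac)
    also have "(- 1) ^ n * (- 1) ^ n = (1 :: complex)" by (simp flip: power_mult_distrib)
    finally show ?thesis by simp
  qed
  ultimately show ?thesis by simp
qed

lemma bcoef_summable:
  assumes "0 \<le> x" "x < 1"
  shows "summable (\<lambda>n. bcoef \<gamma> n * x ^ n)"
proof -
  have "summable (\<lambda>n. of_real (bcoef \<gamma> n) * (of_real x :: complex) ^ n)"
    using bcoef_sums[of "of_real x" \<gamma>] assms by (auto simp: sums_iff)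
  then have "summable (\<lambda>n. of_real (bcoef \<gamma> n * x ^ n) :: complex)" by simp
  then show ?thesis by (subst (asm) summable_of_real_iff)
qed

text \<open>Induction through the antiderivative \<open>?F\<close>, which vanishes at both ends. Its
  derivative combines two consecutive integrands, so the integrals satisfy I(n+1) =
  (n+1)/(n+2+\<gamma>) I(n), the recursion of 1/\<open>bcoef\<close>.\<close>

lemma vweight_moment_has_integral:
  assumes g: "-1 < \<gamma>"
  shows "((\<lambda>r. r ^ (2 * n) * (vweight \<gamma> r * r)) has_integral (1 / (2 * bcoef \<gamma> n))) {0..1}"
proof (induction n)
  case 0
  have "((\<lambda>r. vweight \<gamma> r * r) has_integral ((- ((1 - 1\<^sup>2) powr (\<gamma> + 1)) / 2) - (- ((1 - 0\<^sup>2) powr (\<gamma> + 1)) / 2))) {0..1}"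
  proof (rule fundamental_theorem_of_calculus_interior)
    show "continuous_on {0..1} (\<lambda>r. - ((1 - r\<^sup>2) powr (\<gamma> + 1)) / 2)"
      using g by (intro continuous_intros continuous_on_powr') (auto simp: power_le_one)
    fix x :: real assume "x \<in> {0<..<1}"
    then have "0 < 1 - x\<^sup>2" by (simp add: abs_square_less_1)
    then have "((\<lambda>r. - ((1 - r\<^sup>2) powr (\<gamma> + 1)) / 2) has_real_derivative vweight \<gamma> x * x) (at x)"
      by (auto intro!: derivative_eq_intros simp: vweight_def powr_diff field_simps)
    then show "((\<lambda>r. - ((1 - r\<^sup>2) powr (\<gamma> + 1)) / 2) has_vector_derivative vweight \<gamma> x * x) (at x)"
      by (simp add: has_real_derivative_iff_has_vector_derivative)
  qed simp
  then show ?case by simp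
next
  case (Suc n)
  let ?m = "real n + 1"
  let ?J = "\<lambda>k r. r ^ (2 * k) * (vweight \<gamma> r * r)"
  let ?F = "\<lambda>r. - (r ^ (2 * Suc n) * (1 - r\<^sup>2) powr (\<gamma> + 1)) / 2"
  have "((\<lambda>r. (1 + ?m / (\<gamma> + 1)) * ?J (Suc n) r - ?m / (\<gamma> + 1) * ?J n r) has_integral (?F 1 - ?F 0)) {0..1}"
  proof (rule fundamental_theorem_of_calculus_interior)
    show "continuous_on {0..1} ?F"
      using g by (intro continuous_intros continuous_on_powr') (auto simp: power_le_one)
    fix x :: real assume x: "x \<in> {0<..<1}"
    then have pos: "0 < 1 - x\<^sup>2" by (simp add: abs_square_less_1)
    have p1: "(1 - x\<^sup>2) powr (\<gamma> + 1) = (1 - x\<^sup>2) powr \<gamma> * (1 - x\<^sup>2)"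
      using pos by (simp add: powr_add)
    define P where "P = (1 - x\<^sup>2) powr \<gamma>"
    have dp: "((\<lambda>r. r ^ (2 * Suc n)) has_real_derivative real (2 * Suc n) * x ^ (2 * n + 1)) (at x)"
      using DERIV_pow[of "2 * Suc n" x] by simp
    have dq: "((\<lambda>r. (1 - r\<^sup>2) powr (\<gamma> + 1)) has_real_derivative (\<gamma> + 1) * P * (- 2 * x)) (at x)"
      unfolding P_def using pos by (auto intro!: derivative_eq_intros simp: powr_diff field_simps)
    have d: "(?F has_real_derivative - (real (2 * Suc n) * x ^ (2 * n + 1) * (1 - x\<^sup>2) powr (\<gamma> + 1)
       + (\<gamma> + 1) * P * (- 2 * x) * x ^ (2 * Suc n)) / 2) (at x)"
      by (rule DERIV_cdivide[OF DERIV_minus[OF DERIV_mult[OF dp dq]]])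
    have e: "(c / a) * (z * (a * P * x)) = c * (z * P * x)" if "a \<noteq> 0" for a c z :: real
      using that by simp
    have "\<gamma> + 1 \<noteq> 0" using g by simp
    note e' = e[OF this]
    have "- (real (2 * Suc n) * x ^ (2 * n + 1) * (1 - x\<^sup>2) powr (\<gamma> + 1)
       + (\<gamma> + 1) * P * (- 2 * x) * x ^ (2 * Suc n)) / 2 =
       x ^ (2 * Suc n) * ((\<gamma> + 1) * P * x) + ?m * (x ^ (2 * Suc n) * P * x) - ?m * (x ^ (2 * n) * P * x)"
      unfolding p1 P_def[symmetric] by (simp add: field_simps power2_eq_square)
    also have "\<dots> = (1 + ?m / (\<gamma> + 1)) * ?J (Suc n) x - ?m / (\<gamma> + 1) * ?J n x"
      unfolding vweight_def P_def[symmetric] distrib_right[of 1 "?m / (\<gamma> + 1)"] e' by simp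
    finally have "(?F has_real_derivative (1 + ?m / (\<gamma> + 1)) * ?J (Suc n) x - ?m / (\<gamma> + 1) * ?J n x) (at x)"
      using d by (simp only:)
    then show "(?F has_vector_derivative (1 + ?m / (\<gamma> + 1)) * ?J (Suc n) x - ?m / (\<gamma> + 1) * ?J n x) (at x)"
      by (simp add: has_real_derivative_iff_has_vector_derivative)
  qed simp
  then have "((\<lambda>r. (1 + ?m / (\<gamma> + 1)) * ?J (Suc n) r - ?m / (\<gamma> + 1) * ?J n r) has_integral 0) {0..1}" by simp
  from has_integral_add[OF this has_integral_mult_right[OF Suc, of "?m / (\<gamma> + 1)"]]
  have "((\<lambda>r. (1 + ?m / (\<gamma> + 1)) * ?J (Suc n) r) has_integral (?m / (\<gamma> + 1) * (1 / (2 * bcoef \<gamma> n)))) {0..1}" by simp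
  from has_integral_mult_right[OF this, of "1 / (1 + ?m / (\<gamma> + 1))"]
  have "(?J (Suc n) has_integral (1 / (1 + ?m / (\<gamma> + 1)) * (?m / (\<gamma> + 1) * (1 / (2 * bcoef \<gamma> n))))) {0..1}"
    using g by (simp add: add_pos_pos pos_add_strict less_imp_neq[symmetric] add_nonneg_pos)
  also have "1 / (1 + ?m / (\<gamma> + 1)) * (?m / (\<gamma> + 1) * (1 / (2 * bcoef \<gamma> n))) = 1 / (2 * bcoef \<gamma> (Suc n))"
  proof -
    have "1 / (1 + m / a) * (m / a * (1 / (2 * b))) = 1 / (2 * (b * ((m + a) / m)))" if "0 < a" "0 < m" for a m b :: real
    proof -
      have "1 + m / a = (m + a) / a" using that by (simp add: field_simps)
      then show ?thesis using that by simp
    qed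
    from this[of "\<gamma> + 1" ?m "bcoef \<gamma> n"] show ?thesis using g by (simp add: bcoef_Suc add_ac)
  qed
  finally show ?case .
qed

lemma vweight_moment:
  assumes g: "-1 < \<gamma>"
  shows "(\<integral>\<^sup>+r. ennreal (r ^ (2 * n) * vweight \<gamma> r) \<partial>RM) = ennreal (1 / (2 * bcoef \<gamma> n))"
proof -
  have "(\<integral>\<^sup>+r. ennreal (r ^ (2 * n) * (vweight \<gamma> r * r)) * indicator {0..1} r \<partial>lborel) = ennreal (1 / (2 * bcoef \<gamma> n))"
    using g by (intro nn_integral_has_integral_lebesgue' vweight_moment_has_integral) (auto simp: vweight_nonneg)
  moreover have "(\<integral>\<^sup>+r. ennreal (r ^ (2 * n) * vweight \<gamma> r) \<partial>RM) =
     (\<integral>\<^sup>+r. ennreal (r ^ (2 * n) * vweight \<gamma> r) * ennreal r * indicator {0..<1} r \<partial>lborel)"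
    by (rule nn_integral_RM) measurable
  moreover have "\<dots> = (\<integral>\<^sup>+r. ennreal (r ^ (2 * n) * (vweight \<gamma> r * r)) * indicator {0..1} r \<partial>lborel)"
  proof (rule nn_integral_cong_AE)
    show "AE r in lborel. ennreal (r ^ (2 * n) * vweight \<gamma> r) * ennreal r * indicator {0..<1} r = ennreal (r ^ (2 * n) * (vweight \<gamma> r * r)) * indicator {0..1} r"
      using AE_lborel_singleton[of 1]
      by eventually_elim (use g in \<open>auto simp: indicator_def vweight_nonneg mult.assoc simp flip: ennreal_mult\<close>)
  qed
  ultimately show ?thesis by simp
qed

lemma vweight_moment_real:
  assumes g: "-1 < \<gamma>"
  shows "integrable RM (\<lambda>r. r ^ (2 * n) * vweight \<gamma> r)" "(\<integral>r. r ^ (2 * n) * vweight \<gamma> r \<partial>RM) = 1 / (2 * bcoef \<gamma> n)"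
proof -
  have nn: "AE r in RM. 0 \<le> r ^ (2 * n) * vweight \<gamma> r" using g by (auto simp: vweight_nonneg)
  have b: "0 \<le> 1 / (2 * bcoef \<gamma> n)" using bcoef_pos[OF g, of n] by simp
  show "integrable RM (\<lambda>r. r ^ (2 * n) * vweight \<gamma> r)"
    using nn by (intro integrableI_nonneg) (auto simp: vweight_moment[OF g])
  show "(\<integral>r. r ^ (2 * n) * vweight \<gamma> r \<partial>RM) = 1 / (2 * bcoef \<gamma> n)"
    using nn b by (subst integral_eq_nn_integral) (auto simp: vweight_moment[OF g])
qed

text \<open>The quotient n^(\<gamma>+1) / ((1+\<gamma>) \<open>bcoef \<gamma> n\<close>) is the n-th
  term of Euler's limit for the Gamma function at 1 + \<gamma>; being convergent, the sequence is
  bounded. For n > 0 the passage from n to n + 1 costs 2^(\<gamma>+1).\<close>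

lemma bcoef_lower_bound:
  assumes g: "-1 < \<gamma>"
  obtains K where "0 < K" "\<And>n. (real n + 1) powr (\<gamma> + 1) \<le> K * bcoef \<gamma> n"
proof -
  have "Gamma_series (1 + \<gamma>) \<longlonglongrightarrow> Gamma (1 + \<gamma>)" by (rule Gamma_series_LIMSEQ)
  then have "Bseq (Gamma_series (1 + \<gamma>))" by (intro convergent_imp_Bseq) (auto simp: convergent_def)
  then obtain K0 where K0: "0 < K0" "\<And>n. norm (Gamma_series (1 + \<gamma>) n) \<le> K0" by (auto simp: Bseq_def)
  have le: "real n powr (\<gamma> + 1) \<le> (K0 * (1 + \<gamma>)) * bcoef \<gamma> n" if n: "0 < n" for n
  proof -
    have "pochhammer (1 + \<gamma>) (Suc n) = (1 + \<gamma>) * pochhammer (2 + \<gamma>) n"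
      by (simp add: pochhammer_rec add.commute)
    then have "Gamma_series (1 + \<gamma>) n = real n powr (\<gamma> + 1) / ((1 + \<gamma>) * bcoef \<gamma> n)"
      using n by (simp add: Gamma_series_def bcoef_def powr_def add.commute mult.commute)
    moreover have "Gamma_series (1 + \<gamma>) n \<le> K0" using K0(2)[of n] by (simp add: abs_le_iff)
    ultimately have "real n powr (\<gamma> + 1) / ((1 + \<gamma>) * bcoef \<gamma> n) \<le> K0" by simp
    moreover have "0 < (1 + \<gamma>) * bcoef \<gamma> n" using g bcoef_pos[OF g, of n] by simp
    ultimately have "real n powr (\<gamma> + 1) \<le> K0 * ((1 + \<gamma>) * bcoef \<gamma> n)" by (simp only: pos_divide_le_eq)
    then show ?thesis by (simp only: mult.assoc)
  qed
  define K where "K = max 1 (2 powr (\<gamma> + 1) * (K0 * (1 + \<gamma>)))"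
  show thesis
  proof (rule that[of K])
    show "0 < K" by (simp add: K_def)
    fix n
    show "(real n + 1) powr (\<gamma> + 1) \<le> K * bcoef \<gamma> n"
    proof (cases "n = 0")
      case True then show ?thesis by (simp add: K_def)
    next
      case False
      then have "(real n + 1) powr (\<gamma> + 1) \<le> (2 * real n) powr (\<gamma> + 1)"
        using g by (intro powr_mono2) auto
      also have "\<dots> = 2 powr (\<gamma> + 1) * real n powr (\<gamma> + 1)" by (rule powr_mult)
      also have "\<dots> \<le> 2 powr (\<gamma> + 1) * ((K0 * (1 + \<gamma>)) * bcoef \<gamma> n)"
        using le[of n] False by (intro mult_left_mono) auto
      also have "\<dots> = (2 powr (\<gamma> + 1) * (K0 * (1 + \<gamma>))) * bcoef \<gamma> n" by (simp only: mult.assoc)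
      also have "\<dots> \<le> K * bcoef \<gamma> n"
        using bcoef_pos[OF g, of n] by (intro mult_right_mono) (auto simp: K_def)
      finally show ?thesis .
    qed
  qed
qed

section \<open>Coefficients of the projection and the reproducing formula\<close>

lemma std_weight_eq: "std_weight \<gamma> z = vweight \<gamma> (cmod z)"
  by (simp add: std_weight_def vweight_def)

lemma std_weight_measurable [measurable]: "std_weight \<gamma> \<in> borel_fun"
  unfolding std_weight_eq[abs_def] by measurable

lemma borel_measurable_dA: "f \<in> borel_fun \<Longrightarrow> f \<in> borel_measurable dA"
  by (simp add: measurable_dA_iff borel_measurable_lebesgue_on_borel)

text \<open>The pairing of f with z^n. It is a weighted moment and not a Taylor coefficient: the
  n-th Taylor coefficient of the projection is \<open>bcoef \<gamma> n\<close> times this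
  number.\<close>

definition coef :: "real \<Rightarrow> (complex \<Rightarrow> complex) \<Rightarrow> nat \<Rightarrow> complex" where
  "coef \<gamma> f n = (\<integral>z. f z * cnj z ^ n * of_real (std_weight \<gamma> z) \<partial>dA)"

lemma cmod_powr_of_real:
  assumes "w \<noteq> 0"
  shows "cmod (w powr of_real a) = cmod w powr a"
  using assms by (simp add: powr_def norm_exp_eq_Re mult.commute)

lemma kernel_nonzero:
  assumes "cmod z < 1" "cmod \<zeta> \<le> 1"
  shows "1 - cnj \<zeta> * z \<noteq> 0"
proof
  assume "1 - cnj \<zeta> * z = 0"
  then have "cmod (cnj \<zeta> * z) = 1" by simp
  moreover have "cmod \<zeta> * cmod z \<le> 1 * cmod z" using assms by (intro mult_right_mono) auto
  ultimately show False using assms by (simp add: norm_mult)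
qed

lemma kernel_cnj_measurable [measurable]:
  "cnj \<in> borel_fun"
  by (intro borel_measurable_continuous_onI continuous_intros)

lemma L1_spaceD:
  assumes "f \<in> L1_space \<gamma>" and g: "-1 < \<gamma>"
  shows "f \<in> borel_measurable dA" "integrable dA (\<lambda>z. f z * of_real (std_weight \<gamma> z))"
proof -
  show f: "f \<in> borel_measurable dA" using assms by (simp add: L1_space_def measurable_dA_iff)
  show "integrable dA (\<lambda>z. f z * of_real (std_weight \<gamma> z))"
  proof (rule integrableI_bounded)
    show "(\<lambda>z. f z * of_real (std_weight \<gamma> z)) \<in> borel_measurable dA"
      using f borel_measurable_dA[OF std_weight_measurable] by measurable
    have "(\<integral>\<^sup>+z. ennreal (cmod (f z * of_real (std_weight \<gamma> z))) \<partial>dA) = (\<integral>\<^sup>+z. ennreal (cmod (f z) * std_weight \<gamma> z) \<partial>dA)"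
      using g by (simp add: norm_mult std_weight_eq vweight_nonneg)
    then show "(\<integral>\<^sup>+z. ennreal (cmod (f z * of_real (std_weight \<gamma> z))) \<partial>dA) < \<infinity>"
      using assms by (simp add: L1_space_def)
  qed
qed

lemma L1_spaceI:
  assumes "f \<in> disc_measurable" "integrable dA (\<lambda>z. f z * of_real (std_weight \<gamma> z))" "-1 < \<gamma>"
  shows "f \<in> L1_space \<gamma>"
proof -
  have "(\<integral>\<^sup>+z. ennreal (cmod (f z * of_real (std_weight \<gamma> z))) \<partial>dA) < \<infinity>"
    using assms(2) by (simp add: integrable_iff_bounded)
  then show ?thesis using assms by (simp add: L1_space_def norm_mult std_weight_eq vweight_nonneg)
qed

lemma coef_integrable:
  assumes f: "f \<in> L1_space \<gamma>" and g: "-1 < \<gamma>"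
  shows "integrable dA (\<lambda>z. f z * cnj z ^ n * of_real (std_weight \<gamma> z))"
proof (rule Bochner_Integration.integrable_bound[OF L1_spaceD(2)[OF f g]])
  show "(\<lambda>z. f z * cnj z ^ n * of_real (std_weight \<gamma> z)) \<in> borel_measurable dA"
    using L1_spaceD(1)[OF f g] borel_measurable_dA[OF std_weight_measurable] borel_measurable_dA[OF kernel_cnj_measurable] by measurable
  show "AE z in dA. norm (f z * cnj z ^ n * of_real (std_weight \<gamma> z)) \<le> norm (f z * of_real (std_weight \<gamma> z))"
  proof (rule AE_I2)
    fix z assume "z \<in> space dA"
    then have "cmod z ^ n \<le> 1" by (simp add: space_dA power_le_one)
    then have "cmod (f z) * cmod z ^ n * \<bar>std_weight \<gamma> z\<bar> \<le> cmod (f z) * 1 * \<bar>std_weight \<gamma> z\<bar>"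
      by (intro mult_right_mono mult_left_mono) auto
    then show "norm (f z * cnj z ^ n * of_real (std_weight \<gamma> z)) \<le> norm (f z * of_real (std_weight \<gamma> z))"
      by (simp add: norm_mult norm_power)
  qed
qed

text \<open>The kernel is expanded in powers of cnj \<zeta> z and integrated term by term. Since
  |\<zeta>| < 1, the n-th term is dominated by \<open>bcoef \<gamma> n\<close> |z|^n |f| v, which is
  summable for fixed z.\<close>

lemma Bergman_sums:
  assumes f: "f \<in> L1_space \<gamma>" and g: "-1 < \<gamma>" and z: "cmod z < 1"
  shows "(\<lambda>n. of_real (bcoef \<gamma> n) * coef \<gamma> f n * z ^ n) sums Bergman_proj \<gamma> f z"
proof -
  let ?v = "\<lambda>\<zeta>. of_real (std_weight \<gamma> \<zeta>) :: complex"
  let ?h = "\<lambda>n \<zeta>. (of_real (bcoef \<gamma> n) * z ^ n) * (f \<zeta> * cnj \<zeta> ^ n * ?v \<zeta>)"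
  define N where "N = (\<integral>\<zeta>. norm (f \<zeta> * ?v \<zeta>) \<partial>dA)"
  have int: "integrable dA (?h n)" for n using coef_integrable[OF f g] by simp
  have bound: "norm (?h n \<zeta>) \<le> bcoef \<gamma> n * cmod z ^ n * norm (f \<zeta> * ?v \<zeta>)" if "\<zeta> \<in> space dA" for n \<zeta>
  proof -
    have "cmod \<zeta> ^ n \<le> 1" using that by (simp add: space_dA power_le_one)
    then have "cmod (f \<zeta>) * cmod \<zeta> ^ n * \<bar>std_weight \<gamma> \<zeta>\<bar> \<le> cmod (f \<zeta>) * 1 * \<bar>std_weight \<gamma> \<zeta>\<bar>"
      by (intro mult_right_mono mult_left_mono) auto
    then have "bcoef \<gamma> n * cmod z ^ n * (cmod (f \<zeta>) * cmod \<zeta> ^ n * \<bar>std_weight \<gamma> \<zeta>\<bar>) \<le> bcoef \<gamma> n * cmod z ^ n * (cmod (f \<zeta>) * 1 * \<bar>std_weight \<gamma> \<zeta>\<bar>)"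
      using bcoef_pos[OF g, of n] by (intro mult_left_mono) auto
    then show ?thesis using bcoef_pos[OF g, of n] by (simp add: norm_mult norm_power)
  qed
  have sm: "summable (\<lambda>n. bcoef \<gamma> n * cmod z ^ n)" using z by (intro bcoef_summable) auto
  have "(\<lambda>n. integral\<^sup>L dA (?h n)) sums (\<integral>\<zeta>. (\<Sum>n. ?h n \<zeta>) \<partial>dA)"
  proof (rule sums_integral[OF int])
    show "AE \<zeta> in dA. summable (\<lambda>n. norm (?h n \<zeta>))"
    proof (rule AE_I2)
      fix \<zeta> assume "\<zeta> \<in> space dA"
      then show "summable (\<lambda>n. norm (?h n \<zeta>))"
        using bound[of \<zeta>] by (intro summable_comparison_test'[OF summable_mult2[OF sm, of "norm (f \<zeta> * ?v \<zeta>)"]]) auto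
    qed
    show "summable (\<lambda>n. \<integral>\<zeta>. norm (?h n \<zeta>) \<partial>dA)"
    proof (rule summable_comparison_test'[OF summable_mult2[OF sm, of N]])
      fix n
      have "(\<integral>\<zeta>. norm (?h n \<zeta>) \<partial>dA) \<le> (\<integral>\<zeta>. bcoef \<gamma> n * cmod z ^ n * norm (f \<zeta> * ?v \<zeta>) \<partial>dA)"
        using int bound L1_spaceD(2)[OF f g]
        by (intro integral_mono) (auto intro!: integrable_norm integrable_mult_right)
      also have "\<dots> = bcoef \<gamma> n * cmod z ^ n * N" by (simp add: N_def)
      finally show "norm (\<integral>\<zeta>. norm (?h n \<zeta>) \<partial>dA) \<le> bcoef \<gamma> n * cmod z ^ n * N" by simp
    qed
  qed
  moreover have "integral\<^sup>L dA (?h n) = of_real (bcoef \<gamma> n) * coef \<gamma> f n * z ^ n" for n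
  proof -
    have "integral\<^sup>L dA (?h n) = of_real (bcoef \<gamma> n) * z ^ n * coef \<gamma> f n"
      unfolding coef_def by (rule integral_mult_right_zero)
    then show ?thesis by (simp only: mult_ac)
  qed
  moreover have "(\<integral>\<zeta>. (\<Sum>n. ?h n \<zeta>) \<partial>dA) = Bergman_proj \<gamma> f z"
  proof -
    have "(\<Sum>n. ?h n \<zeta>) = of_real (\<gamma> + 1) * (f \<zeta> / (1 - cnj \<zeta> * z) powr of_real (2 + \<gamma>) * of_real ((1 - (cmod \<zeta>)\<^sup>2) powr \<gamma>))"
      if "\<zeta> \<in> space dA" for \<zeta>
    proof -
      have "cmod (cnj \<zeta> * z) < 1"
        using that z mult_strict_mono'[of "cmod \<zeta>" 1 "cmod z" 1] by (simp add: space_dA norm_mult)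
      from sums_mult2[OF bcoef_sums[OF this, of \<gamma>], of "f \<zeta> * ?v \<zeta>"]
      have "(\<lambda>n. ?h n \<zeta>) sums ((1 - cnj \<zeta> * z) powr (- of_real (2 + \<gamma>)) * (f \<zeta> * ?v \<zeta>))"
        by (simp add: power_mult_distrib mult_ac)
      then have "(\<Sum>n. ?h n \<zeta>) = (1 - cnj \<zeta> * z) powr (- of_real (2 + \<gamma>)) * (f \<zeta> * ?v \<zeta>)"
        by (simp add: sums_iff)
      also have "(1 - cnj \<zeta> * z) powr (- of_real (2 + \<gamma>)) = inverse ((1 - cnj \<zeta> * z) powr of_real (2 + \<gamma>))"
        by (rule powr_minus)
      finally show ?thesis by (simp add: std_weight_def divide_inverse mult_ac)
    qed
    then have "(\<integral>\<zeta>. (\<Sum>n. ?h n \<zeta>) \<partial>dA) = (\<integral>\<zeta>. of_real (\<gamma> + 1) * (f \<zeta> / (1 - cnj \<zeta> * z) powr of_real (2 + \<gamma>) * of_real ((1 - (cmod \<zeta>)\<^sup>2) powr \<gamma>)) \<partial>dA)"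
      by (intro Bochner_Integration.integral_cong) auto
    then show ?thesis by (simp only: Bergman_proj_def integral_mult_right_zero)
  qed
  ultimately show ?thesis by (simp only:)
qed

lemma Bergman_holomorphic:
  assumes f: "f \<in> L1_space \<gamma>" and g: "-1 < \<gamma>"
  shows "Bergman_proj \<gamma> f holomorphic_on unit_disc"
  by (rule power_series_holomorphic[of 0 1 "\<lambda>n. of_real (bcoef \<gamma> n) * coef \<gamma> f n"])
    (use Bergman_sums[OF f g] in simp)

lemma integral_TM_cis: "(\<integral>t. cis (of_int k * t) \<partial>TM) = (if k = 0 then of_real (2 * pi) else 0)"
proof -
  have TM: "(\<integral>t. f t \<partial>TM) = (\<integral>t. indicator {0..2 * pi} t *\<^sub>R f t \<partial>lborel)" if "f \<in> borel_fun" for f :: "real \<Rightarrow> complex"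
  proof -
    have "TM = density lborel (\<lambda>t. ennreal (indicator {0..2 * pi} t))"
      unfolding TM_def by (intro arg_cong[where f="density lborel"]) (auto simp: indicator_def)
    then have "(\<integral>t. f t \<partial>TM) = (\<integral>t. f t \<partial>density lborel (\<lambda>t. ennreal (indicator {0..2 * pi} t)))"
      by (rule arg_cong)
    also have "\<dots> = (\<integral>t. indicator {0..2 * pi} t *\<^sub>R f t \<partial>lborel)"
      by (rule integral_density) (use that in auto)
    finally show ?thesis .
  qed
  show ?thesis
  proof (cases "k = 0")
    case True
    have "measure TM UNIV = 2 * pi" by (simp add: measure_def emeasure_TM)
    then show ?thesis by (simp add: True scaleR_conv_of_real)
  next
    case False
    have "(\<integral>t. indicator {0..2 * pi} t *\<^sub>R cis (of_int k * t) \<partial>lborel) =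
       cis (of_int k * (2 * pi)) / (\<i> * of_int k) - cis (of_int k * 0) / (\<i> * of_int k)"
    proof (rule integral_FTC_Icc)
      fix x
      have "((\<lambda>z. exp (\<i> * of_int k * z) / (\<i> * of_int k)) has_field_derivative exp (\<i> * of_int k * of_real x)) (at (of_real x))"
        using False by (auto intro!: derivative_eq_intros)
      from has_vector_derivative_real_field[OF this, of "{0..2 * pi}"]
      show "((\<lambda>t. cis (of_int k * t) / (\<i> * of_int k)) has_vector_derivative cis (of_int k * x)) (at x within {0..2 * pi})"
        by (simp add: cis_conv_exp mult.assoc)
    qed (auto intro!: continuous_intros)
    also have "cis (of_int k * (2 * pi)) = 1"
      using cis_multiple_2pi[of "of_int k"] by (simp add: mult_ac)
    finally show ?thesis using False by (subst TM) auto
  qed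
qed

lemma holomorphic_circle_coef:
  assumes f: "f holomorphic_on unit_disc" and r: "0 \<le> r" "r < 1"
  defines "b \<equiv> \<lambda>n. (deriv ^^ n) f 0 / fact n"
  shows "(\<integral>t. f (of_real r * cis t) * cis (- (real n * t)) \<partial>TM) = of_real (2 * pi) * b n * of_real (r ^ n)"
proof -
  have sums: "(\<lambda>n. b n * z ^ n) sums f z" if "cmod z < 1" for z
    using holomorphic_power_series[OF f, of z] that by (simp add: b_def)
  \<comment> \<open>Convergence at a point of modulus \<rho> > r makes the series absolutely
    convergent on the circle of radius r, as needed for termwise integration.\<close>
  define \<rho> where "\<rho> = (1 + r) / 2"
  have \<rho>: "r < \<rho>" "\<rho> < 1" "0 < \<rho>" using r by (auto simp: \<rho>_def)
  have sm: "summable (\<lambda>n. norm (b n * of_real r ^ n))"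
    using sums[of "of_real \<rho>"] \<rho> r by (intro powser_insidea[of b "of_real \<rho>" "of_real r"]) (auto simp: sums_iff)
  let ?h = "\<lambda>m t. b m * of_real r ^ m * cis (of_int (int m - int n) * t)"
  have int: "integrable TM (?h m)" for m
  proof (rule TM.integrable_const_bound[where B="norm (b m * of_real r ^ m)"])
    show "AE t in TM. norm (?h m t) \<le> norm (b m * of_real r ^ m)" by (simp add: norm_mult)
    show "?h m \<in> borel_measurable TM" by measurable
  qed
  have "(\<lambda>m. integral\<^sup>L TM (?h m)) sums (\<integral>t. (\<Sum>m. ?h m t) \<partial>TM)"
  proof (rule sums_integral[OF int])
    show "AE t in TM. summable (\<lambda>m. norm (?h m t))" using sm by (simp add: norm_mult)
    have "summable (\<lambda>m. norm (b m * of_real r ^ m) * measure TM UNIV)" by (rule summable_mult2[OF sm])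
    then show "summable (\<lambda>m. \<integral>t. norm (?h m t) \<partial>TM)"
      by (simp add: norm_mult mult_ac)
  qed
  moreover have "integral\<^sup>L TM (?h m) = (if m = n then of_real (2 * pi) * b n * of_real (r ^ n) else 0)" for m
    using integral_TM_cis[of "int m - int n"] by (auto simp: integral_mult_right_zero)
  ultimately have s: "(\<lambda>m. if m = n then of_real (2 * pi) * b n * of_real (r ^ n) else 0) sums (\<integral>t. (\<Sum>m. ?h m t) \<partial>TM)"
    by (simp only:)
  have "(\<integral>t. (\<Sum>m. ?h m t) \<partial>TM) = of_real (2 * pi) * b n * of_real (r ^ n)"
    by (rule sums_unique2[OF s sums_single])
  moreover have "(\<Sum>m. ?h m t) = f (of_real r * cis t) * cis (- (real n * t))" for t
  proof -
    have "(\<lambda>m. b m * (of_real r * cis t) ^ m * cis (- (real n * t))) sums (f (of_real r * cis t) * cis (- (real n * t)))"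
      using r by (intro sums_mult2 sums) (simp add: norm_mult)
    moreover have "b m * (of_real r * cis t) ^ m * cis (- (real n * t)) = ?h m t" for m
      by (simp add: power_mult_distrib Complex.DeMoivre cis_mult left_diff_distrib mult.assoc)
    ultimately show ?thesis by (simp add: sums_iff)
  qed
  ultimately show ?thesis by simp
qed

lemma cis_power_cnj: "cnj (of_real r * cis t) ^ n = of_real (r ^ n) * cis (- (real n * t))"
  by (simp add: power_mult_distrib cis_cnj Complex.DeMoivre)

text \<open>Fubini with the angle integrated first: c(r) is 2\<pi> times the n-th Fourier
  coefficient on the circle of radius r. Choosing functions with one frequency, or power series,
  makes it explicit.\<close>

lemma coef_polar:
  assumes f: "f \<in> L1_space \<gamma>" and fm: "f \<in> borel_fun" and g: "-1 < \<gamma>"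
    and cm [measurable]: "c \<in> borel_fun"
    and c: "\<And>r. r \<in> {0<..<1} \<Longrightarrow> (\<integral>t. f (of_real r * cis t) * cis (- (real n * t)) \<partial>TM) = c r"
  shows "coef \<gamma> f n = (\<integral>r. of_real (r ^ n * vweight \<gamma> r) * c r \<partial>RM) / of_real pi"
proof -
  note [measurable] = fm
  let ?G = "\<lambda>z. f z * cnj z ^ n * of_real (std_weight \<gamma> z)"
  have [measurable]: "?G \<in> borel_fun" by measurable
  have int: "integrable (TM \<Otimes>\<^sub>M RM) (\<lambda>x. ?G (pol x))"
    using coef_integrable[OF f g, of n] by (subst (asm) integrable_dA_iff) auto
  have "coef \<gamma> f n = (\<integral>x. ?G (pol x) \<partial>(TM \<Otimes>\<^sub>M RM)) / of_real pi"
    unfolding coef_def by (rule integral_dA) measurable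
  also have "(\<integral>x. ?G (pol x) \<partial>(TM \<Otimes>\<^sub>M RM)) = (\<integral>r. \<integral>t. ?G (pol (t, r)) \<partial>TM \<partial>RM)"
    using TR.integral_snd[of "\<lambda>t r. ?G (pol (t, r))"] int by (simp add: case_prod_beta')
  also have "\<dots> = (\<integral>r. of_real (r ^ n * vweight \<gamma> r) * c r \<partial>RM)"
  proof (rule integral_cong_AE)
    show "(\<lambda>r. \<integral>t. ?G (pol (t, r)) \<partial>TM) \<in> borel_measurable RM"
      by (intro TM.borel_measurable_lebesgue_integral) (simp add: pol_def)
    show "(\<lambda>r. of_real (r ^ n * vweight \<gamma> r) * c r) \<in> borel_measurable RM"
      by measurable
    show "AE r in RM. (\<integral>t. ?G (pol (t, r)) \<partial>TM) = of_real (r ^ n * vweight \<gamma> r) * c r"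
      using AE_RM_range
    proof eventually_elim
      case (elim r)
      have "(\<integral>t. ?G (pol (t, r)) \<partial>TM) = (\<integral>t. of_real (r ^ n * vweight \<gamma> r) * (f (of_real r * cis t) * cis (- (real n * t))) \<partial>TM)"
        using elim by (intro Bochner_Integration.integral_cong)
          (auto simp: pol_def std_weight_eq norm_mult cis_power_cnj simp del: complex_cnj_mult)
      then show ?case using c[OF elim] by (simp only: integral_mult_right_zero)
    qed
  qed
  finally show ?thesis .
qed

text \<open>A function holomorphic on the disc is arbitrary outside it and need not be Borel on the
  plane; its extension by 0 is.\<close>

definition disc_cut :: "(complex \<Rightarrow> complex) \<Rightarrow> complex \<Rightarrow> complex" where
  "disc_cut f z = (if z \<in> unit_disc then f z else 0)"

lemma disc_cut_measurable: "f holomorphic_on unit_disc \<Longrightarrow> disc_cut f \<in> borel_fun"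
  unfolding disc_cut_def[abs_def]
  by (intro borel_measurable_continuous_on_if continuous_intros holomorphic_on_imp_continuous_on) auto

lemma holomorphic_measurable_disc:
  assumes "f holomorphic_on unit_disc"
  shows "f \<in> disc_measurable"
proof -
  have "disc_cut f \<in> disc_measurable"
    by (intro borel_measurable_lebesgue_on_borel disc_cut_measurable assms)
  then show ?thesis
    by (subst measurable_cong[where g="disc_cut f"]) (auto simp: disc_cut_def space_restrict_space)
qed

lemma L1_space_disc_cut: "disc_cut f \<in> L1_space \<gamma>" if "f \<in> L1_space \<gamma>"
proof -
  have "disc_cut f \<in> disc_measurable"
    using that by (subst measurable_cong[where g=f]) (auto simp: disc_cut_def space_restrict_space L1_space_def)
  moreover have "(\<integral>\<^sup>+z. ennreal (cmod (disc_cut f z) * std_weight \<gamma> z) \<partial>dA) = (\<integral>\<^sup>+z. ennreal (cmod (f z) * std_weight \<gamma> z) \<partial>dA)"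
    by (intro nn_integral_cong) (auto simp: disc_cut_def space_dA)
  ultimately show ?thesis using that by (simp add: L1_space_def)
qed

lemma coef_disc_cut: "coef \<gamma> (disc_cut f) n = coef \<gamma> f n"
  unfolding coef_def by (intro Bochner_Integration.integral_cong) (auto simp: disc_cut_def space_dA)

text \<open>On the circle of radius r the n-th frequency contributes 2\<pi> r^n times the Taylor
  coefficient, and the remaining radial integral is the moment 1/(2
  \<open>bcoef \<gamma> n\<close>).\<close>

lemma coef_holomorphic:
  assumes f: "f \<in> L1_space \<gamma>" and h: "f holomorphic_on unit_disc" and g: "-1 < \<gamma>"
  shows "coef \<gamma> f n = (deriv ^^ n) f 0 / fact n / of_real (bcoef \<gamma> n)"
proof -
  define b where "b = (deriv ^^ n) f 0 / fact n"
  have "coef \<gamma> (disc_cut f) n = (\<integral>r. of_real (r ^ n * vweight \<gamma> r) * (of_real (2 * pi) * b * of_real (r ^ n)) \<partial>RM) / of_real pi"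
  proof (rule coef_polar[OF L1_space_disc_cut[OF f] disc_cut_measurable[OF h] g])
    fix r :: real assume r: "r \<in> {0<..<1}"
    have "(\<integral>t. disc_cut f (of_real r * cis t) * cis (- (real n * t)) \<partial>TM) = (\<integral>t. f (of_real r * cis t) * cis (- (real n * t)) \<partial>TM)"
      using r by (intro Bochner_Integration.integral_cong) (auto simp: disc_cut_def norm_mult)
    then show "(\<integral>t. disc_cut f (of_real r * cis t) * cis (- (real n * t)) \<partial>TM) = of_real (2 * pi) * b * of_real (r ^ n)"
      using holomorphic_circle_coef[OF h, of r n] r by (simp add: b_def)
  qed measurable
  also have "(\<integral>r. of_real (r ^ n * vweight \<gamma> r) * (of_real (2 * pi) * b * of_real (r ^ n)) \<partial>RM) =
      (\<integral>r. (of_real (2 * pi) * b) * of_real (r ^ (2 * n) * vweight \<gamma> r) \<partial>RM)"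
  proof (rule Bochner_Integration.integral_cong[OF refl])
    fix r :: real
    have "r ^ (2 * n) = r ^ n * r ^ n" by (simp add: mult_2 power_add)
    then show "of_real (r ^ n * vweight \<gamma> r) * (of_real (2 * pi) * b * of_real (r ^ n)) = (of_real (2 * pi) * b) * of_real (r ^ (2 * n) * vweight \<gamma> r)"
      by (simp only: of_real_mult mult_ac)
  qed
  also have "\<dots> = (of_real (2 * pi) * b) * of_real (1 / (2 * bcoef \<gamma> n))"
    by (simp only: integral_mult_right_zero integral_complex_of_real vweight_moment_real(2)[OF g])
  also have "\<dots> / of_real pi = b / of_real (bcoef \<gamma> n)" by simp
  finally show ?thesis by (simp add: coef_disc_cut b_def)
qed

text \<open>The factor \<open>bcoef \<gamma> n\<close> from the kernel cancels the one from the
  radial moment, so projecting leaves every Taylor coefficient unchanged.\<close>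

lemma Bergman_reproducing:
  assumes f: "f \<in> L1_space \<gamma>" and h: "f holomorphic_on unit_disc" and g: "-1 < \<gamma>" and z: "cmod z < 1"
  shows "Bergman_proj \<gamma> f z = f z"
proof -
  have "of_real (bcoef \<gamma> n) * coef \<gamma> f n * z ^ n = (deriv ^^ n) f 0 / fact n * (z - 0) ^ n" for n
    using bcoef_pos[OF g, of n] by (simp add: coef_holomorphic[OF f h g])
  then have "(\<lambda>n. (deriv ^^ n) f 0 / fact n * (z - 0) ^ n) sums Bergman_proj \<gamma> f z"
    using Bergman_sums[OF f g z] by simp
  moreover have "(\<lambda>n. (deriv ^^ n) f 0 / fact n * (z - 0) ^ n) sums f z"
    using z by (intro holomorphic_power_series[OF h]) simp
  ultimately show ?thesis by (rule sums_unique2)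
qed

text \<open>Without integrability the Bochner integral is 0, so the bound holds for every measurable
  integrand. This allows pointwise estimates of the projections before integrability is
  known.\<close>

lemma dA_norm_bound:
  fixes \<Phi> :: "complex \<Rightarrow> complex"
  assumes "\<Phi> \<in> borel_measurable dA"
  shows "ennreal (cmod (\<integral>z. \<Phi> z \<partial>dA)) \<le> (\<integral>\<^sup>+z. ennreal (cmod (\<Phi> z)) \<partial>dA)"
  by (cases "integrable dA \<Phi>") (auto intro: integral_norm_bound_ennreal simp: not_integrable_integral_eq)

text \<open>\<open>\<Phi>\<close> stands for the integrand of either projection: the two integrands
  have the same modulus and differ only in the phase of the kernel.\<close>

lemma kernel_integral_le_Pplus:
  assumes F [measurable]: "F \<in> borel_fun" and fF: "AE z in dA. f z = F z"
    and g: "-1 < \<gamma>" and r: "r \<in> {0<..<1}"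
    and k: "\<And>\<zeta>. \<zeta> \<in> unit_disc \<Longrightarrow> cmod (\<Phi> \<zeta>) = cmod (f \<zeta>) * (cmod (1 - cnj \<zeta> * (of_real r * cis \<theta>)) powr - (2 + \<gamma>) * std_weight \<gamma> \<zeta>)"
  shows "(\<integral>\<^sup>+\<zeta>. ennreal (cmod (\<Phi> \<zeta>)) \<partial>dA) =
    ennreal (1 / pi) * Pplus \<gamma> (\<lambda>t s. ennreal (cmod (F (of_real s * cis t)))) \<theta> r"
proof -
  have "(\<integral>\<^sup>+\<zeta>. ennreal (cmod (\<Phi> \<zeta>)) \<partial>dA) =
     (\<integral>\<^sup>+\<zeta>. ennreal (cmod (F \<zeta>) * (cmod (1 - cnj \<zeta> * (of_real r * cis \<theta>)) powr - (2 + \<gamma>) * std_weight \<gamma> \<zeta>)) \<partial>dA)"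
  proof (rule nn_integral_cong_AE)
    have "AE \<zeta> in dA. \<zeta> \<in> unit_disc" by (rule AE_I2) (simp add: space_dA)
    with fF show "AE \<zeta> in dA. ennreal (cmod (\<Phi> \<zeta>)) = ennreal (cmod (F \<zeta>) * (cmod (1 - cnj \<zeta> * (of_real r * cis \<theta>)) powr - (2 + \<gamma>) * std_weight \<gamma> \<zeta>))"
      by eventually_elim (simp add: k)
  qed
  also have "\<dots> = ennreal (1 / pi) * polar_int (\<lambda>t s. ennreal (cmod (F (of_real s * cis t)) * (cmod (1 - cnj (of_real s * cis t) * (of_real r * cis \<theta>)) powr - (2 + \<gamma>) * std_weight \<gamma> (of_real s * cis t))))"
    by (rule nn_integral_dA) measurable
  also have "polar_int (\<lambda>t s. ennreal (cmod (F (of_real s * cis t)) * (cmod (1 - cnj (of_real s * cis t) * (of_real r * cis \<theta>)) powr - (2 + \<gamma>) * std_weight \<gamma> (of_real s * cis t))))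
     = Pplus \<gamma> (\<lambda>t s. ennreal (cmod (F (of_real s * cis t)))) \<theta> r"
    unfolding Pplus_def
  proof (rule nn_integral_cong, rule nn_integral_cong_AE)
    fix t
    show "AE s in RM. ennreal (cmod (F (of_real s * cis t)) * (cmod (1 - cnj (of_real s * cis t) * (of_real r * cis \<theta>)) powr - (2 + \<gamma>) * std_weight \<gamma> (of_real s * cis t)))
      = ennreal (Pkernel \<gamma> \<theta> r t s) * (ennreal (vweight \<gamma> s) * ennreal (cmod (F (of_real s * cis t))))"
      using AE_RM_range
    proof eventually_elim
      case (elim s)
      have c: "cnj (cis t) * cis \<theta> = cis (\<theta> - t)" by (simp add: cis_cnj cis_mult)
      have "cnj (of_real s * cis t) * (of_real r * cis \<theta>) = of_real (r * s) * (cnj (cis t) * cis \<theta>)"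
        by simp
      then have eq: "cnj (of_real s * cis t) * (of_real r * cis \<theta>) = of_real (r * s) * cis (\<theta> - t)"
        by (simp only: c)
      have n: "cmod (of_real s * cis t) = s" using elim by (simp add: norm_mult)
      show ?case
        unfolding eq std_weight_eq n Pkernel_def
        using g by (simp add: vweight_nonneg mult_ac flip: ennreal_mult)
    qed
  qed
  finally show ?thesis .
qed

lemma max_Bergman_norm:
  assumes r: "r \<in> {0<..<1}" and g: "-1 < \<gamma>" and \<zeta>: "\<zeta> \<in> unit_disc"
  shows "cmod (of_real (\<gamma> + 1) * (f \<zeta> / of_real (cmod (1 - cnj \<zeta> * (of_real r * cis \<theta>)) powr (2 + \<gamma>)) * of_real ((1 - (cmod \<zeta>)\<^sup>2) powr \<gamma>)))
    = cmod (f \<zeta>) * (cmod (1 - cnj \<zeta> * (of_real r * cis \<theta>)) powr - (2 + \<gamma>) * std_weight \<gamma> \<zeta>)"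
  using g by (simp add: norm_mult norm_divide norm_inverse std_weight_def powr_minus divide_inverse mult_ac del: minus_add_distrib of_real_add)

lemma Bergman_norm:
  assumes r: "r \<in> {0<..<1}" and g: "-1 < \<gamma>" and \<zeta>: "\<zeta> \<in> unit_disc"
  shows "cmod (of_real (\<gamma> + 1) * (f \<zeta> / (1 - cnj \<zeta> * (of_real r * cis \<theta>)) powr of_real (2 + \<gamma>) * of_real ((1 - (cmod \<zeta>)\<^sup>2) powr \<gamma>)))
    = cmod (f \<zeta>) * (cmod (1 - cnj \<zeta> * (of_real r * cis \<theta>)) powr - (2 + \<gamma>) * std_weight \<gamma> \<zeta>)"
proof -
  have "1 - cnj \<zeta> * (of_real r * cis \<theta>) \<noteq> 0"
    using r \<zeta> by (intro kernel_nonzero) (auto simp: norm_mult)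
  then have "cmod ((1 - cnj \<zeta> * (of_real r * cis \<theta>)) powr of_real (2 + \<gamma>)) = cmod (1 - cnj \<zeta> * (of_real r * cis \<theta>)) powr (2 + \<gamma>)"
    by (rule cmod_powr_of_real)
  then show ?thesis
    using g by (simp only: norm_mult norm_divide) (simp add: std_weight_def powr_minus divide_inverse mult_ac del: minus_add_distrib of_real_add)
qed

lemma Bergman_le_Pplus:
  assumes f: "f \<in> disc_measurable"
    and F: "F \<in> borel_fun" and fF: "AE z in dA. f z = F z"
    and g: "-1 < \<gamma>" and r: "r \<in> {0<..<1}"
  shows "ennreal (cmod (Bergman_proj \<gamma> f (of_real r * cis \<theta>))) \<le> ennreal (1 / pi) * Pplus \<gamma> (\<lambda>t s. ennreal (cmod (F (of_real s * cis t)))) \<theta> r"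
    and "ennreal (cmod (max_Bergman_proj \<gamma> f (of_real r * cis \<theta>))) \<le> ennreal (1 / pi) * Pplus \<gamma> (\<lambda>t s. ennreal (cmod (F (of_real s * cis t)))) \<theta> r"
proof -
  let ?z = "of_real r * cis \<theta>"
  have fm [measurable]: "f \<in> borel_measurable dA" using f by (simp add: measurable_dA_iff)
  have m1: "(\<lambda>\<zeta>. of_real (\<gamma> + 1) * (f \<zeta> / (1 - cnj \<zeta> * ?z) powr of_real (2 + \<gamma>) * of_real ((1 - (cmod \<zeta>)\<^sup>2) powr \<gamma>))) \<in> borel_measurable dA"
  proof -
    have [measurable]: "(\<lambda>\<zeta>. 1 / (1 - cnj \<zeta> * ?z) powr of_real (2 + \<gamma>) * complex_of_real ((1 - (cmod \<zeta>)\<^sup>2) powr \<gamma>)) \<in> borel_measurable dA"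
      by (rule borel_measurable_dA) measurable
    have "(\<lambda>\<zeta>. of_real (\<gamma> + 1) * (f \<zeta> * (1 / (1 - cnj \<zeta> * ?z) powr of_real (2 + \<gamma>) * complex_of_real ((1 - (cmod \<zeta>)\<^sup>2) powr \<gamma>)))) \<in> borel_measurable dA"
      by measurable
    then show ?thesis by simp
  qed
  have m2: "(\<lambda>\<zeta>. of_real (\<gamma> + 1) * (f \<zeta> / of_real (cmod (1 - cnj \<zeta> * ?z) powr (2 + \<gamma>)) * of_real ((1 - (cmod \<zeta>)\<^sup>2) powr \<gamma>))) \<in> borel_measurable dA"
  proof -
    have [measurable]: "(\<lambda>\<zeta>. 1 / of_real (cmod (1 - cnj \<zeta> * ?z) powr (2 + \<gamma>)) * complex_of_real ((1 - (cmod \<zeta>)\<^sup>2) powr \<gamma>)) \<in> borel_measurable dA"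
      by (rule borel_measurable_dA) measurable
    have "(\<lambda>\<zeta>. of_real (\<gamma> + 1) * (f \<zeta> * (1 / of_real (cmod (1 - cnj \<zeta> * ?z) powr (2 + \<gamma>)) * complex_of_real ((1 - (cmod \<zeta>)\<^sup>2) powr \<gamma>)))) \<in> borel_measurable dA"
      by measurable
    then show ?thesis by simp
  qed
  show "ennreal (cmod (Bergman_proj \<gamma> f ?z)) \<le> ennreal (1 / pi) * Pplus \<gamma> (\<lambda>t s. ennreal (cmod (F (of_real s * cis t)))) \<theta> r"
    using dA_norm_bound[OF m1] kernel_integral_le_Pplus[OF F fF g r Bergman_norm[OF r g, of _ f]]
    by (simp only: Bergman_proj_def integral_mult_right_zero)
  show "ennreal (cmod (max_Bergman_proj \<gamma> f ?z)) \<le> ennreal (1 / pi) * Pplus \<gamma> (\<lambda>t s. ennreal (cmod (F (of_real s * cis t)))) \<theta> r"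
    using dA_norm_bound[OF m2] kernel_integral_le_Pplus[OF F fF g r max_Bergman_norm[OF r g, of _ f]]
    by (simp only: max_Bergman_proj_def integral_mult_right_zero)
qed

lemma max_Bergman_measurable:
  assumes f: "f \<in> disc_measurable"
  shows "max_Bergman_proj \<gamma> f \<in> borel_fun"
proof -
  obtain F where F [measurable]: "F \<in> borel_fun" and fF: "AE z in dA. f z = F z"
    using lebesgue_on_disc_borel_version[OF f] by blast
  let ?k = "\<lambda>z \<zeta>. 1 / of_real (cmod (1 - cnj \<zeta> * z) powr (2 + \<gamma>)) * complex_of_real ((1 - (cmod \<zeta>)\<^sup>2) powr \<gamma>)"
  have fm [measurable]: "f \<in> borel_measurable dA" using f by (simp add: measurable_dA_iff)
  have "max_Bergman_proj \<gamma> f z = of_real (\<gamma> + 1) * ((\<integral>x. F (pol x) * ?k z (pol x) \<partial>(TM \<Otimes>\<^sub>M RM)) / of_real pi)" for z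
  proof -
    have [measurable]: "?k z \<in> borel_measurable dA" by (rule borel_measurable_dA) measurable
    have Fd [measurable]: "F \<in> borel_measurable dA" by (rule borel_measurable_dA) fact
    have "(\<integral>\<zeta>. f \<zeta> / of_real (cmod (1 - cnj \<zeta> * z) powr (2 + \<gamma>)) * of_real ((1 - (cmod \<zeta>)\<^sup>2) powr \<gamma>) \<partial>dA) = (\<integral>\<zeta>. f \<zeta> * ?k z \<zeta> \<partial>dA)"
      by simp
    also have "\<dots> = (\<integral>\<zeta>. F \<zeta> * ?k z \<zeta> \<partial>dA)"
    proof (rule integral_cong_AE)
      show "AE \<zeta> in dA. f \<zeta> * ?k z \<zeta> = F \<zeta> * ?k z \<zeta>" using fF by eventually_elim simp
    qed measurable
    also have "\<dots> = (\<integral>x. F (pol x) * ?k z (pol x) \<partial>(TM \<Otimes>\<^sub>M RM)) / of_real pi"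
      by (rule integral_dA) measurable
    finally show ?thesis by (simp only: max_Bergman_proj_def)
  qed
  moreover have "(\<lambda>z. of_real (\<gamma> + 1) * ((\<integral>x. F (pol x) * ?k z (pol x) \<partial>(TM \<Otimes>\<^sub>M RM)) / of_real pi)) \<in> borel_fun"
  proof -
    have [measurable]: "(\<lambda>z. \<integral>x. F (pol x) * ?k z (pol x) \<partial>(TM \<Otimes>\<^sub>M RM)) \<in> borel_fun"
      by (rule sigma_finite_measure.borel_measurable_lebesgue_integral[OF TR.sigma_finite_measure_axioms]) measurable
    show ?thesis by measurable
  qed
  ultimately show ?thesis by (simp add: fun_eq_iff cong: measurable_cong)
qed

text \<open>The integrand of the maximal projection of |f| is the modulus of the integrand of the
  projection of f.\<close>

lemma Bergman_le_max_Bergman: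
  assumes f: "f \<in> L1_space \<gamma>" and g: "-1 < \<gamma>" and z: "cmod z < 1"
  shows "cmod (Bergman_proj \<gamma> f z) \<le> cmod (max_Bergman_proj \<gamma> (\<lambda>z. of_real (cmod (f z))) z)"
proof -
  let ?v = "\<lambda>\<zeta>. of_real ((1 - (cmod \<zeta>)\<^sup>2) powr \<gamma>) :: complex"
  let ?h = "\<lambda>\<zeta>. f \<zeta> / (1 - cnj \<zeta> * z) powr of_real (2 + \<gamma>) * ?v \<zeta>"
  have "cmod (\<integral>\<zeta>. ?h \<zeta> \<partial>dA) \<le> (\<integral>\<zeta>. cmod (?h \<zeta>) \<partial>dA)" by (rule integral_norm_bound)
  also have "\<dots> = cmod (\<integral>\<zeta>. of_real (cmod (?h \<zeta>)) \<partial>dA)"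
    by (subst integral_complex_of_real) (simp add: integral_nonneg_AE)
  also have "(\<integral>\<zeta>. complex_of_real (cmod (?h \<zeta>)) \<partial>dA) =
     (\<integral>\<zeta>. of_real (cmod (f \<zeta>)) / of_real (cmod (1 - cnj \<zeta> * z) powr (2 + \<gamma>)) * ?v \<zeta> \<partial>dA)"
  proof (rule Bochner_Integration.integral_cong[OF refl])
    fix \<zeta> assume "\<zeta> \<in> space dA"
    then have "1 - cnj \<zeta> * z \<noteq> 0" using z by (intro kernel_nonzero) (auto simp: space_dA)
    from cmod_powr_of_real[OF this, of "2 + \<gamma>"]
    show "complex_of_real (cmod (?h \<zeta>)) = of_real (cmod (f \<zeta>)) / of_real (cmod (1 - cnj \<zeta> * z) powr (2 + \<gamma>)) * ?v \<zeta>"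
      by (simp only: norm_mult norm_divide of_real_mult of_real_divide) simp
  qed
  finally show ?thesis
    unfolding Bergman_proj_def max_Bergman_proj_def norm_mult by (intro mult_left_mono) auto
qed

section \<open>Necessity of the moment condition\<close>

text \<open>On functions of radial modulus the mixed norm and the tent norm both reduce, up to
  constants, to a weighted L^p norm in r. The necessity arguments use nothing else about the size of
  their test functions, so one proof serves both kinds of norm.\<close>

definition comparable_with :: "real \<Rightarrow> real \<Rightarrow> ((complex \<Rightarrow> complex) \<Rightarrow> ennreal) \<Rightarrow> real \<Rightarrow> (real \<Rightarrow> ennreal) \<Rightarrow> bool" where
  "comparable_with a b X p w \<longleftrightarrow>
     (\<forall>f F h. F \<in> borel_fun \<longrightarrow> h \<in> borel_fun \<longrightarrow> (AE z in dA. f z = F z) \<longrightarrow>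
        (\<forall>r\<in>{0<..<1}. \<forall>\<theta>. ennreal (cmod (F (of_real r * cis \<theta>))) = h r) \<longrightarrow>
        ennreal a * elp RM p (\<lambda>r. h r * epowr (w r) (1 / p)) \<le> X f \<and>
        X f \<le> ennreal b * elp RM p (\<lambda>r. h r * epowr (w r) (1 / p)))"

definition radial_comparable :: "((complex \<Rightarrow> complex) \<Rightarrow> ennreal) \<Rightarrow> real \<Rightarrow> (real \<Rightarrow> ennreal) \<Rightarrow> bool" where
  "radial_comparable X p w \<longleftrightarrow> (\<exists>a b. 0 < a \<and> 0 < b \<and> comparable_with a b X p w)"

lemma comparable_withD:
  assumes "comparable_with a b X p w" "F \<in> borel_fun" "h \<in> borel_fun" "AE z in dA. f z = F z"
    and "\<And>r \<theta>. r\<in>{0<..<1} \<Longrightarrow> ennreal (cmod (F (of_real r * cis \<theta>))) = h r"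
  shows "ennreal a * elp RM p (\<lambda>r. h r * epowr (w r) (1 / p)) \<le> X f \<and>
        X f \<le> ennreal b * elp RM p (\<lambda>r. h r * epowr (w r) (1 / p))"
  using assms unfolding comparable_with_def by blast

lemma polar_abs_measurable:
  assumes [measurable]: "F \<in> borel_fun"
  shows "case_prod (\<lambda>\<theta> r. ennreal (cmod (F (of_real r * cis \<theta>)))) \<in> borel_measurable (TM \<Otimes>\<^sub>M RM)"
proof -
  have "(\<lambda>x. ennreal (cmod (F (of_real (snd x) * cis (fst x))))) \<in> borel_measurable (borel \<Otimes>\<^sub>M borel)" by measurable
  then show ?thesis unfolding polar_measurable_iff by (simp add: case_prod_beta')
qed

lemma elp_TM_const: "0 < q \<Longrightarrow> elp TM q (\<lambda>_. c) = ennreal ((2 * pi) powr (1 / q)) * c"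
  by (simp add: elp_def emeasure_TM epowr_mult epowr_inverse epowr_ennreal mult.commute)

lemma Ln_radial:
  assumes "0 < p" "0 < q" "\<And>r \<theta>. r \<in> {0<..<1} \<Longrightarrow> F \<theta> r = h r"
  shows "Ln p q w F = ennreal ((2 * pi) powr (1 / q)) * elp RM p (\<lambda>r. h r * epowr (w r) (1 / p))"
proof -
  have "Ln p q w F = elp TM q (\<lambda>_. elp RM p (\<lambda>r. h r * epowr (w r) (1 / p)))"
    unfolding Ln_def elp2_def
  proof (rule elp_cong, rule elp_cong_AE)
    fix \<theta>
    show "AE r in RM. F \<theta> r * epowr (w r) (1 / p) = h r * epowr (w r) (1 / p)"
      using AE_RM_range by eventually_elim (simp add: assms(3))
  qed
  then show ?thesis using elp_TM_const[OF assms(2)] by simp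
qed

lemma radial_comparable_L:
  assumes pq: "0 < p" "0 < q" and w: "w \<in> borel_fun" and nu: "AE r in RM. \<nu> (of_real r) = w r"
  shows "radial_comparable (L_norm p q \<nu>) p w"
  unfolding radial_comparable_def comparable_with_def
proof (intro exI conjI allI impI)
  let ?c = "(1 / (2 * pi)) powr (1 / q) * (2 * pi) powr (1 / q)"
  show "0 < ?c" "0 < ?c" by simp_all
  fix f F :: "complex \<Rightarrow> complex" and h :: "real \<Rightarrow> ennreal"
  assume F: "F \<in> borel_fun" and f: "AE z in dA. f z = F z"
    and h: "\<forall>r\<in>{0<..<1}. \<forall>\<theta>. ennreal (cmod (F (of_real r * cis \<theta>))) = h r"
  have "L_norm p q \<nu> f = ennreal ?c * elp RM p (\<lambda>r. h r * epowr (w r) (1 / p))"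
    using Ln_radial[OF pq, of "\<lambda>\<theta> r. ennreal (cmod (F (of_real r * cis \<theta>)))" h w] h
    by (simp add: L_norm_eq[OF pq F f w nu] ennreal_mult mult.assoc)
  then show "ennreal ?c * elp RM p (\<lambda>r. h r * epowr (w r) (1 / p)) \<le> L_norm p q \<nu> f"
    "L_norm p q \<nu> f \<le> ennreal ?c * elp RM p (\<lambda>r. h r * epowr (w r) (1 / p))" by simp_all
qed

lemma Av_ge_radial:
  assumes "\<theta> \<in> {0..2 * pi}" and r: "r \<in> {0<..<1}" and "\<And>t. F t r = h"
  shows "h \<le> Av F \<theta> r"
proof -
  have "h = (ennreal (1 / (1 - r)) * ennreal (1 - r)) * h" using r by (simp flip: ennreal_mult)
  also have "\<dots> \<le> (ennreal (1 / (1 - r)) * (\<integral>\<^sup>+t. tind \<theta> t r \<partial>TM)) * h"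
    by (intro mult_right_mono mult_left_mono tind_mass_ge assms(1) r) auto
  also have "\<dots> = Av F \<theta> r"
    unfolding Av_def assms(3) by (simp add: nn_integral_cmult nn_integral_multc)
  finally show ?thesis .
qed

text \<open>Fubini and the symmetry of the tent indicator put the average on the constant 1, and
  tent sections have normalised length at least 1.\<close>

lemma nn_integral_le_Av:
  assumes F: "polar_measurable F" and r: "r \<in> {0<..<1}"
  shows "(\<integral>\<^sup>+\<theta>. F \<theta> r \<partial>TM) \<le> (\<integral>\<^sup>+\<theta>. Av F \<theta> r \<partial>TM)"
proof -
  note polar_measurableD[OF F, measurable]
  interpret TT: pair_sigma_finite TM TM ..
  have "(\<integral>\<^sup>+\<theta>. F \<theta> r \<partial>TM) \<le> (\<integral>\<^sup>+t. \<integral>\<^sup>+\<theta>. ennreal (1 / (1 - r)) * tind \<theta> t r * F t r \<partial>TM \<partial>TM)"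
  proof (rule nn_integral_mono_AE)
    show "AE t in TM. F t r \<le> (\<integral>\<^sup>+\<theta>. ennreal (1 / (1 - r)) * tind \<theta> t r * F t r \<partial>TM)"
      using AE_TM_range
    proof eventually_elim
      case (elim t)
      have "F t r \<le> Av (\<lambda>_ _. F t r) t r" by (rule Av_ge_radial[OF elim r]) simp
      also have "\<dots> = (\<integral>\<^sup>+\<theta>. ennreal (1 / (1 - r)) * tind \<theta> t r * F t r \<partial>TM)"
        unfolding Av_def by (simp add: tind_commute)
      finally show ?case .
    qed
  qed
  also have "\<dots> = (\<integral>\<^sup>+\<theta>. Av F \<theta> r \<partial>TM)"
    unfolding Av_def by (rule TT.Fubini') measurable
  finally show ?thesis .
qed

text \<open>For radial modulus G = H is admissible in \<open>Tn_le_Ln\<close> with constant 1, which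
  gives the upper bound. For the lower bound a radial function is at most its own tent average, to
  which \<open>Ln_Av_le_Tn\<close> applies.\<close>

lemma radial_comparable_T:
  assumes p: "1 < p" and q: "0 < q" and w: "w \<in> borel_fun" and nu: "AE z in dA. \<nu> z = w (cmod z)"
  shows "radial_comparable (T_norm p q \<nu>) p w"
  unfolding radial_comparable_def comparable_with_def
proof (intro exI conjI allI impI)
  have p0: "0 < p" using p by simp
  let ?c = "(1 / pi) powr (1 / p)" and ?d = "(2 * pi) powr (1 / q)"
  let ?a = "?c * ((1 / 6 powr ((p - 1) / p)) * ?d)" and ?b = "?c * ((6 powr (1 / p) * 1) * ?d)"
  show "0 < ?a" "0 < ?b" by simp_all
  fix f F :: "complex \<Rightarrow> complex" and h :: "real \<Rightarrow> ennreal"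
  assume F: "F \<in> borel_fun" and f: "AE z in dA. f z = F z" and hm: "h \<in> borel_fun"
    and h: "\<forall>r\<in>{0<..<1}. \<forall>\<theta>. ennreal (cmod (F (of_real r * cis \<theta>))) = h r"
  let ?F = "\<lambda>\<theta> r. ennreal (cmod (F (of_real r * cis \<theta>)))" and ?E = "elp RM p (\<lambda>r. h r * epowr (w r) (1 / p))"
  note Fm = polar_abs_measurable[OF F]
  have L: "Ln p q w ?F = ennreal ?d * ?E" using Ln_radial[OF p0 q, of ?F h w] h by simp
  have "Tn p q w ?F \<le> ennreal (6 powr (1 / p) * 1) * Ln p q w ?F"
    by (rule Tn_le_Ln[OF p0 q w Fm Fm]) (use h in auto)
  then have "ennreal ?c * Tn p q w ?F \<le> ennreal ?c * (ennreal (6 powr (1 / p) * 1) * (ennreal ?d * ?E))"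
    unfolding L by (rule mult_left_mono) simp
  also have "\<dots> = ennreal ?b * ?E" by (simp only: mult.assoc[symmetric] ennreal_mult powr_ge_zero mult_nonneg_nonneg zero_le_one)
  finally show "T_norm p q \<nu> f \<le> ennreal ?b * ?E"
    unfolding T_norm_eq[OF p0 q F f w nu] .
  have "ennreal ?d * ?E = Ln p q w (\<lambda>_. h)" using Ln_radial[OF p0 q, of "\<lambda>_. h" h w] by simp
  also have "\<dots> \<le> Ln p q w (Av ?F)"
    unfolding Ln_def
  proof (rule elp2_mono_AE[OF p0 q])
    show "AE \<theta> in TM. AE r in RM. h r * epowr (w r) (1 / p) \<le> Av ?F \<theta> r * epowr (w r) (1 / p)"
      using AE_TM_range
    proof eventually_elim
      case (elim \<theta>)
      show ?case using AE_RM_range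
        by eventually_elim (intro mult_right_mono Av_ge_radial elim, use h in auto)
    qed
  qed
  also have "\<dots> \<le> ennreal (6 powr ((p - 1) / p)) * Tn p q w ?F" by (rule Ln_Av_le_Tn[OF p q w Fm])
  finally have "ennreal (?c * (1 / 6 powr ((p - 1) / p))) * (ennreal ?d * ?E) \<le> ennreal (?c * (1 / 6 powr ((p - 1) / p))) * (ennreal (6 powr ((p - 1) / p)) * Tn p q w ?F)"
    by (rule mult_left_mono) simp
  also have "\<dots> = ennreal (?c * (1 / 6 powr ((p - 1) / p)) * 6 powr ((p - 1) / p)) * Tn p q w ?F"
    by (subst ennreal_mult[of "?c * (1 / 6 powr ((p - 1) / p))" "6 powr ((p - 1) / p)"]) (simp, simp, simp only: mult.assoc)
  also have "?c * (1 / 6 powr ((p - 1) / p)) * 6 powr ((p - 1) / p) = ?c" by simp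
  also have "ennreal (?c * (1 / 6 powr ((p - 1) / p))) * (ennreal ?d * ?E) = ennreal ?a * ?E"
    by (simp only: mult.assoc[symmetric]) (subst (2) ennreal_mult, auto simp: mult.assoc)
  finally show "ennreal ?a * ?E \<le> T_norm p q \<nu> f"
    unfolding T_norm_eq[OF p0 q F f w nu] .
qed

text \<open>The factor r is part of \<open>RM\<close>, so \<open>mo w x\<close> is the moment of
  order x + 1.\<close>

definition mo :: "(real \<Rightarrow> ennreal) \<Rightarrow> real \<Rightarrow> ennreal" where
  "mo w x = (\<integral>\<^sup>+r. ennreal (r powr x) * w r \<partial>RM)"

lemma elp_monomial:
  assumes "0 < p" and [measurable]: "w \<in> borel_fun"
  shows "elp RM p (\<lambda>r. ennreal (r ^ n) * epowr (w r) (1 / p)) = epowr (mo w (real n * p)) (1 / p)"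
proof -
  have "(\<integral>\<^sup>+r. epowr (ennreal (r ^ n) * epowr (w r) (1 / p)) p \<partial>RM) = mo w (real n * p)"
    unfolding mo_def
  proof (rule nn_integral_cong_AE)
    show "AE r in RM. epowr (ennreal (r ^ n) * epowr (w r) (1 / p)) p = ennreal (r powr (real n * p)) * w r"
      using AE_RM_range
      by eventually_elim (use assms(1) in \<open>simp add: epowr_mult epowr_inverse epowr_ennreal powr_powr flip: powr_realpow\<close>)
  qed
  then show ?thesis by (simp add: elp_def)
qed

lemma moment_eq:
  assumes [measurable]: "w \<in> borel_fun" and nu: "AE r in RM. \<nu> (of_real r) = w r"
  shows "moment \<nu> (x + 1) = mo w x"
proof -
  have "moment \<nu> (x + 1) = (\<integral>\<^sup>+r\<in>{0..<1}. ennreal (r powr (x + 1)) * \<nu> (of_real r) \<partial>lborel)"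
    unfolding moment_def by (rule nn_integral_completion)
  also have "\<dots> = (\<integral>\<^sup>+r. ennreal (r powr x) * w r * ennreal r * indicator {0..<1} r \<partial>lborel)"
  proof (rule nn_integral_cong_AE)
    show "AE r in lborel. ennreal (r powr (x + 1)) * \<nu> (of_real r) * indicator {0..<1} r = ennreal (r powr x) * w r * ennreal r * indicator {0..<1} r"
      using nu unfolding AE_RM
    proof eventually_elim
      case (elim r)
      show ?case
      proof (cases "r \<in> {0<..<1}")
        case True
        then have "ennreal (r powr (x + 1)) = ennreal (r powr x) * ennreal r" by (simp add: powr_add ennreal_mult)
        then show ?thesis using elim True by (simp add: mult_ac)
      qed (auto simp: indicator_def)
    qed
  qed
  also have "\<dots> = mo w x" unfolding mo_def by (rule nn_integral_RM[symmetric]) measurable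
  finally show ?thesis .
qed

lemma radial_tail_eq:
  assumes [measurable]: "w \<in> borel_fun" and nu: "AE r in RM. \<nu> (of_real r) = w r" and r: "0 \<le> r"
  shows "radial_tail \<nu> r = wtail w r"
proof -
  have "radial_tail \<nu> r = (\<integral>\<^sup>+t\<in>{r..<1}. \<nu> (of_real t) * ennreal t \<partial>lborel)"
    unfolding radial_tail_def by (rule nn_integral_completion)
  also have "\<dots> = (\<integral>\<^sup>+t. w t * indicator {r..<1} t * ennreal t * indicator {0..<1} t \<partial>lborel)"
  proof (rule nn_integral_cong_AE)
    show "AE t in lborel. \<nu> (of_real t) * ennreal t * indicator {r..<1} t = w t * indicator {r..<1} t * ennreal t * indicator {0..<1} t"
      using nu unfolding AE_RM
    proof eventually_elim
      case (elim t)
      then show ?case using r by (cases "t = 0") (auto simp: indicator_def)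
    qed
  qed
  also have "\<dots> = wtail w r" unfolding wtail_def by (rule nn_integral_RM[symmetric]) measurable
  finally show ?thesis .
qed

lemma SUP_divide_finite_iff:
  fixes X :: "'a \<Rightarrow> ennreal" and d :: "'a \<Rightarrow> real"
  assumes d: "\<And>i. i \<in> I \<Longrightarrow> 0 < d i"
  shows "(SUP i\<in>I. X i / ennreal (d i)) < \<infinity> \<longleftrightarrow> (\<exists>K>0. \<forall>i\<in>I. X i \<le> ennreal (K * d i))"
proof
  assume "(SUP i\<in>I. X i / ennreal (d i)) < \<infinity>"
  then obtain S where S: "0 \<le> S" "(SUP i\<in>I. X i / ennreal (d i)) = ennreal S"
    by (cases "SUP i\<in>I. X i / ennreal (d i)") auto
  show "\<exists>K>0. \<forall>i\<in>I. X i \<le> ennreal (K * d i)"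
  proof (intro exI[of _ "S + 1"] conjI ballI)
    fix i assume i: "i \<in> I"
    have "X i / ennreal (d i) \<le> ennreal (S + 1)"
    proof -
      have "X i / ennreal (d i) \<le> ennreal S" unfolding S(2)[symmetric] using i by (rule SUP_upper)
      also have "\<dots> \<le> ennreal (S + 1)" by (intro ennreal_leI) simp
      finally show ?thesis .
    qed
    then have "X i / ennreal (d i) * ennreal (d i) \<le> ennreal (S + 1) * ennreal (d i)" by (rule mult_right_mono) simp
    moreover have "X i / ennreal (d i) * ennreal (d i) = X i"
      using d[OF i] by (simp add: ennreal_divide_times ennreal_divide_self ennreal_times_divide[symmetric] mult.commute[of _ "X i"])
    ultimately show "X i \<le> ennreal ((S + 1) * d i)" using S d[OF i] by (simp add: ennreal_mult)
  qed (use S in simp)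
next
  assume "\<exists>K>0. \<forall>i\<in>I. X i \<le> ennreal (K * d i)"
  then obtain K where K: "0 < K" "\<And>i. i \<in> I \<Longrightarrow> X i \<le> ennreal (K * d i)" by blast
  have "(SUP i\<in>I. X i / ennreal (d i)) \<le> ennreal K"
  proof (rule SUP_least)
    fix i assume i: "i \<in> I"
    have "X i / ennreal (d i) \<le> ennreal (K * d i) / ennreal (d i)" by (intro divide_right_mono_ennreal K i)
    also have "\<dots> = ennreal K" using d[OF i] K(1) by (simp add: divide_ennreal)
    finally show "X i / ennreal (d i) \<le> ennreal K" .
  qed
  then show "(SUP i\<in>I. X i / ennreal (d i)) < \<infinity>" by (simp add: order_le_less_trans)
qed

text \<open>A nonnegative integrand loses nothing when the modulus is taken outside. It is applied
  where the phase of a test function has been chosen to cancel that of the other factor.\<close>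

lemma integral_eq_of_norm:
  fixes \<phi> :: "'a \<Rightarrow> complex"
  assumes int: "integrable M \<phi>" and eq: "AE x in M. \<phi> x = of_real (cmod (\<phi> x))"
  shows "(\<integral>\<^sup>+x. ennreal (cmod (\<phi> x)) \<partial>M) = ennreal (cmod (\<integral>x. \<phi> x \<partial>M))"
proof -
  have "(\<integral>x. \<phi> x \<partial>M) = (\<integral>x. of_real (cmod (\<phi> x)) \<partial>M)"
    using int eq by (intro integral_cong_AE) auto
  also have "\<dots> = of_real (\<integral>x. cmod (\<phi> x) \<partial>M)" by simp
  finally have "cmod (\<integral>x. \<phi> x \<partial>M) = (\<integral>x. cmod (\<phi> x) \<partial>M)" by (simp add: Bochner_Integration.integral_nonneg)
  then show ?thesis using int by (simp add: nn_integral_eq_integral)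
qed

lemma sgn_mult_cnj: "sgn a * cnj a = of_real (cmod a)" for a :: complex
  by (cases "a = 0") (simp_all add: sgn_div_norm complex_norm_square[symmetric] scaleR_conv_of_real power2_eq_square field_simps)

text \<open>Here \<open>w\<close> and \<open>s\<close> are Borel versions of the radial profiles of \<open>\<omega>\<close> and of its dual weight. Where
  \<open>\<omega>\<close> vanishes, \<open>s\<close> is infinite and \<open>0 * \<infinity> = 0\<close>, hence the restriction in \<open>ws_eq\<close>.\<close>

locale radial_setting =
  fixes p q \<gamma> :: real and \<omega> :: "complex \<Rightarrow> real" and w s :: "real \<Rightarrow> ennreal"
  assumes p: "1 < p" and q: "1 < q" and g: "-1 < \<gamma>"
    and w [measurable]: "w \<in> borel_fun" and s [measurable]: "s \<in> borel_fun"
    and w_integrable: "(\<integral>\<^sup>+r. w r \<partial>RM) < top"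
    and w_tail: "\<And>r. r \<in> {0..<1} \<Longrightarrow> 0 < wtail w r"
    and ws_le: "\<And>r. r \<in> {0<..<1} \<Longrightarrow> epowr (w r) (1 / p) * epowr (s r) (1 / conj_exponent p) \<le> ennreal (vweight \<gamma> r)"
    and ws_eq: "\<And>r. r \<in> {0<..<1} \<Longrightarrow> s r < top \<Longrightarrow> epowr (w r) (1 / p) * epowr (s r) (1 / conj_exponent p) = ennreal (vweight \<gamma> r)"
    and \<omega>w: "AE r in RM. ennreal (\<omega> (of_real r)) = w r" "AE z in dA. ennreal (\<omega> z) = w (cmod z)"
    and \<sigma>s: "AE r in RM. dual_weight \<gamma> \<omega> p (of_real r) = s r" "AE z in dA. dual_weight \<gamma> \<omega> p z = s (cmod z)"
begin

abbreviation "\<omega>e \<equiv> \<lambda>z. ennreal (\<omega> z)"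
abbreviation "\<sigma> \<equiv> dual_weight \<gamma> \<omega> p"
abbreviation "p' \<equiv> conj_exponent p"
abbreviation "q' \<equiv> conj_exponent q"
lemmas pp = conj_exponent[OF p]
lemmas qq = conj_exponent[OF q]

text \<open>The moment condition with the denominator evaluated as 1/(2
  \<open>bcoef \<gamma> n\<close>) and the factor 2 absorbed in K. In product form it makes sense
  before the moments of s are known to be finite.\<close>

definition Dcond :: bool where
  "Dcond \<longleftrightarrow> (\<exists>K>0. \<forall>n::nat. epowr (mo w (real n * p)) (1 / p) * epowr (mo s (real n * p')) (1 / p') \<le> ennreal (K * (1 / bcoef \<gamma> n)))"

lemma D_const_iff: "D_const p \<gamma> \<omega> < \<infinity> \<longleftrightarrow> Dcond"
proof -
  have v: "moment (\<lambda>z. ennreal (std_weight \<gamma> z)) (2 * real n + 1) = ennreal (1 / (2 * bcoef \<gamma> n))" for n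
  proof -
    have "AE r in RM. ennreal (std_weight \<gamma> (of_real r)) = ennreal (vweight \<gamma> r)"
      by (rule AE_I2) (simp add: std_weight_eq vweight_def)
    then have "moment (\<lambda>z. ennreal (std_weight \<gamma> z)) (2 * real n + 1) = mo (\<lambda>r. ennreal (vweight \<gamma> r)) (2 * real n)"
      by (intro moment_eq) auto
    also have "\<dots> = (\<integral>\<^sup>+r. ennreal (r ^ (2 * n) * vweight \<gamma> r) \<partial>RM)"
      unfolding mo_def
    proof (rule nn_integral_cong_AE)
      show "AE r in RM. ennreal (r powr (2 * real n)) * ennreal (vweight \<gamma> r) = ennreal (r ^ (2 * n) * vweight \<gamma> r)"
        using AE_RM_range
      proof eventually_elim
        case (elim r)
        then have "r powr (2 * real n) = r ^ (2 * n)" using powr_realpow[of r "2 * n"] by simp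
        then show ?case using g by (simp add: vweight_nonneg ennreal_mult)
      qed
    qed
    finally show ?thesis by (simp add: vweight_moment[OF g])
  qed
  have "D_const p \<gamma> \<omega> < \<infinity> \<longleftrightarrow> (\<exists>K>0. \<forall>n\<in>UNIV. epowr (mo w (real n * p)) (1 / p) * epowr (mo s (real n * p')) (1 / p') \<le> ennreal (K * (1 / (2 * bcoef \<gamma> n))))"
    unfolding D_const_def v moment_eq[OF w \<omega>w(1)] moment_eq[OF s \<sigma>s(1)]
    using bcoef_pos[OF g] by (intro SUP_divide_finite_iff) simp
  also have "\<dots> \<longleftrightarrow> Dcond"
    unfolding Dcond_def
  proof safe
    fix K :: real assume "0 < K" "\<forall>n\<in>UNIV. epowr (mo w (real n * p)) (1 / p) * epowr (mo s (real n * p')) (1 / p') \<le> ennreal (K * (1 / (2 * bcoef \<gamma> n)))"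
    then show "\<exists>K>0. \<forall>n. epowr (mo w (real n * p)) (1 / p) * epowr (mo s (real n * p')) (1 / p') \<le> ennreal (K * (1 / bcoef \<gamma> n))"
      by (intro exI[of _ "K / 2"]) auto
  next
    fix K :: real assume "0 < K" "\<forall>n. epowr (mo w (real n * p)) (1 / p) * epowr (mo s (real n * p')) (1 / p') \<le> ennreal (K * (1 / bcoef \<gamma> n))"
    then show "\<exists>K>0. \<forall>n\<in>UNIV. epowr (mo w (real n * p)) (1 / p) * epowr (mo s (real n * p')) (1 / p') \<le> ennreal (K * (1 / (2 * bcoef \<gamma> n)))"
      by (intro exI[of _ "2 * K"]) auto
  qed
  finally show ?thesis .
qed

text \<open>The Bekolle-Bonami condition with the tail (1 - r^2)^(\<gamma>+1)/2 of the standard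
  weight inserted; the factor 1/2 goes into B.\<close>

definition Bcond :: "real \<Rightarrow> bool" where
  "Bcond B \<longleftrightarrow> 0 < B \<and> (\<forall>r\<in>{0..<1}. epowr (wtail w r) (1 / p) * epowr (wtail s r) (1 / p') \<le> ennreal (B * (1 - r\<^sup>2) powr (\<gamma> + 1)))"

lemma B_const_iff: "B_const p \<gamma> \<omega> < \<infinity> \<longleftrightarrow> (\<exists>B. Bcond B)"
proof -
  have v: "radial_tail (\<lambda>z. ennreal (std_weight \<gamma> z)) r = ennreal ((1 - r\<^sup>2) powr (\<gamma> + 1) / 2)" if r: "r \<in> {0..<1}" for r
  proof -
    have "AE r in RM. ennreal (std_weight \<gamma> (of_real r)) = ennreal (vweight \<gamma> r)"
      by (rule AE_I2) (simp add: std_weight_eq vweight_def)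
    then have "radial_tail (\<lambda>z. ennreal (std_weight \<gamma> z)) r = wtail (\<lambda>r. ennreal (vweight \<gamma> r)) r"
      using r by (intro radial_tail_eq) auto
    also have "\<dots> = ennreal ((1 - r\<^sup>2) powr (\<gamma> + 1) / 2)"
      unfolding wtail_def using r g by (subst vweight_integral) auto
    finally show ?thesis .
  qed
  have pos: "0 < (1 - r\<^sup>2) powr (\<gamma> + 1) / 2" if "r \<in> {0..<1}" for r :: real
  proof -
    have "r\<^sup>2 < 1" using that by (simp add: abs_square_less_1)
    then show ?thesis by simp
  qed
  have "B_const p \<gamma> \<omega> = (SUP r\<in>{0..<1}. epowr (wtail w r) (1 / p) * epowr (wtail s r) (1 / p') / ennreal ((1 - r\<^sup>2) powr (\<gamma> + 1) / 2))"
    unfolding B_const_def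
    by (intro SUP_cong refl) (simp add: v radial_tail_eq[OF w \<omega>w(1)] radial_tail_eq[OF s \<sigma>s(1)])
  then have "B_const p \<gamma> \<omega> < \<infinity> \<longleftrightarrow> (\<exists>K>0. \<forall>r\<in>{0..<1}. epowr (wtail w r) (1 / p) * epowr (wtail s r) (1 / p') \<le> ennreal (K * ((1 - r\<^sup>2) powr (\<gamma> + 1) / 2)))"
    using SUP_divide_finite_iff[of "{0..<1}" "\<lambda>r. (1 - r\<^sup>2) powr (\<gamma> + 1) / 2" "\<lambda>r. epowr (wtail w r) (1 / p) * epowr (wtail s r) (1 / p')"] pos
    by simp
  also have "\<dots> \<longleftrightarrow> (\<exists>B. Bcond B)"
    unfolding Bcond_def
  proof safe
    fix K :: real assume "0 < K" "\<forall>r\<in>{0..<1}. epowr (wtail w r) (1 / p) * epowr (wtail s r) (1 / p') \<le> ennreal (K * ((1 - r\<^sup>2) powr (\<gamma> + 1) / 2))"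
    then show "\<exists>B>0. \<forall>r\<in>{0..<1}. epowr (wtail w r) (1 / p) * epowr (wtail s r) (1 / p') \<le> ennreal (B * (1 - r\<^sup>2) powr (\<gamma> + 1))"
      by (intro exI[of _ "K / 2"]) (simp add: mult.commute)
  next
    fix K :: real assume "0 < K" "\<forall>r\<in>{0..<1}. epowr (wtail w r) (1 / p) * epowr (wtail s r) (1 / p') \<le> ennreal (K * (1 - r\<^sup>2) powr (\<gamma> + 1))"
    then show "\<exists>K>0. \<forall>r\<in>{0..<1}. epowr (wtail w r) (1 / p) * epowr (wtail s r) (1 / p') \<le> ennreal (K * ((1 - r\<^sup>2) powr (\<gamma> + 1) / 2))"
      by (intro exI[of _ "2 * K"]) (simp add: mult.commute)
  qed
  finally show ?thesis .
qed

section \<open>From moments to tails\<close>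

lemma wtail_le_mo:
  assumes v: "v \<in> borel_fun" and r: "r \<in> {0..<1}" "1 / 2 \<le> r ^ n" and a: "1 < a"
  shows "epowr (wtail v r) (1 / a) \<le> 2 * epowr (mo v (real n * a)) (1 / a)"
proof -
  note v[measurable]
  have "wtail v r \<le> (\<integral>\<^sup>+t. ennreal (2 powr a) * (ennreal (t powr (real n * a)) * v t) \<partial>RM)"
    unfolding wtail_def
  proof (rule nn_integral_mono_AE)
    show "AE t in RM. v t * indicator {r..<1} t \<le> ennreal (2 powr a) * (ennreal (t powr (real n * a)) * v t)"
      using AE_RM_range
    proof eventually_elim
      case (elim t)
      show ?case
      proof (cases "t \<in> {r..<1}")
        case True
        have "1 / 2 \<le> t ^ n" using r True power_mono[of r t n] by auto
        then have "1 \<le> (2 * t ^ n) powr a" using a by (intro ge_one_powr_ge_zero) auto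
        also have "\<dots> = 2 powr a * t powr (real n * a)" using elim by (simp add: powr_mult powr_powr flip: powr_realpow)
        finally have "1 * v t \<le> ennreal (2 powr a * t powr (real n * a)) * v t"
          by (intro mult_right_mono) auto
        then show ?thesis using True by (simp add: ennreal_mult mult.assoc)
      qed simp
    qed
  qed
  also have "\<dots> = ennreal (2 powr a) * mo v (real n * a)"
    unfolding mo_def by (rule nn_integral_cmult) measurable
  finally have "epowr (wtail v r) (1 / a) \<le> epowr (ennreal (2 powr a) * mo v (real n * a)) (1 / a)"
    using a by (intro epowr_mono) auto
  also have "\<dots> = 2 * epowr (mo v (real n * a)) (1 / a)"
    using a by (simp add: epowr_mult epowr_ennreal powr_powr)
  finally show ?thesis .
qed

lemma Dcond_imp_Bcond:
  assumes Dcond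
  shows "\<exists>B. Bcond B"
proof -
  obtain K where K: "0 < K" "\<And>n::nat. epowr (mo w (real n * p)) (1 / p) * epowr (mo s (real n * p')) (1 / p') \<le> ennreal (K * (1 / bcoef \<gamma> n))"
    using assms unfolding Dcond_def by blast
  obtain K2 where K2: "0 < K2" "\<And>n. (real n + 1) powr (\<gamma> + 1) \<le> K2 * bcoef \<gamma> n"
    using bcoef_lower_bound[OF g] by blast
  define B where "B = 4 * K * K2 * 2 powr (\<gamma> + 1)"
  have B: "0 < B" using K K2 by (simp add: B_def)
  have "epowr (wtail w r) (1 / p) * epowr (wtail s r) (1 / p') \<le> ennreal (B * (1 - r\<^sup>2) powr (\<gamma> + 1))" if r: "r \<in> {0..<1}" for r
  proof -
    define x where "x = 1 - r"
    have x: "0 < x" "x \<le> 1" using r by (auto simp: x_def)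
    \<comment> \<open>Writing x = 1 - r, this n satisfies both demands: n x \<le> 1/2 gives r^n
      \<ge> 1/2 by Bernoulli's inequality, so tails are dominated by moments, while n + 1 > 1/(2x)
      gives 1/\<open>bcoef \<gamma> n\<close> at most a constant times (2x)^(\<gamma>+1).\<close>
    define n where "n = nat \<lfloor>1 / (2 * x)\<rfloor>"
    have n: "real n \<le> 1 / (2 * x)" "1 / (2 * x) < real n + 1"
      using x unfolding n_def by (auto simp: of_nat_nat)
    have nx: "real n * x \<le> 1 / 2"
      using mult_right_mono[OF n(1), of x] x by simp
    have "1 + real n * (- x) \<le> (1 + (- x)) ^ n" using x by (intro Bernoulli_inequality) simp
    moreover have "1 + (- x) = r" by (simp add: x_def)
    ultimately have "1 - real n * x \<le> r ^ n" by simp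
    then have half: "1 / 2 \<le> r ^ n" using nx by linarith
    have "epowr (wtail w r) (1 / p) * epowr (wtail s r) (1 / p') \<le> (2 * epowr (mo w (real n * p)) (1 / p)) * (2 * epowr (mo s (real n * p')) (1 / p'))"
      by (intro mult_mono wtail_le_mo w s r half p pp) auto
    also have "\<dots> = 4 * (epowr (mo w (real n * p)) (1 / p) * epowr (mo s (real n * p')) (1 / p'))"
      by (simp add: mult_ac)
    also have "\<dots> \<le> 4 * ennreal (K * (1 / bcoef \<gamma> n))" by (intro mult_left_mono K) auto
    also have "\<dots> = ennreal (4 * (K * (1 / bcoef \<gamma> n)))" using K(1) bcoef_pos[OF g, of n] by (subst ennreal_mult) auto
    also have "\<dots> \<le> ennreal (B * (1 - r\<^sup>2) powr (\<gamma> + 1))"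
    proof (rule ennreal_leI)
      have b: "0 < bcoef \<gamma> n" by (rule bcoef_pos[OF g])
      have "1 = (1 / (2 * x)) powr (\<gamma> + 1) * (2 * x) powr (\<gamma> + 1)" using x by (simp flip: powr_mult)
      also have "\<dots> \<le> (real n + 1) powr (\<gamma> + 1) * (2 * x) powr (\<gamma> + 1)"
        using n x g by (intro mult_right_mono powr_mono2) auto
      also have "\<dots> \<le> (K2 * bcoef \<gamma> n) * (2 * x) powr (\<gamma> + 1)" by (intro mult_right_mono K2) simp
      also have "(2 * x) powr (\<gamma> + 1) = 2 powr (\<gamma> + 1) * x powr (\<gamma> + 1)" by (rule powr_mult)
      also have "x powr (\<gamma> + 1) \<le> (1 - r\<^sup>2) powr (\<gamma> + 1)"
      proof (rule powr_mono2)
        have "r * r \<le> r" using r by (simp add: mult_left_le_one_le)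
        then show "x \<le> 1 - r\<^sup>2" by (simp add: x_def power2_eq_square)
      qed (use g x in auto)
      finally have "1 \<le> K2 * bcoef \<gamma> n * (2 powr (\<gamma> + 1) * (1 - r\<^sup>2) powr (\<gamma> + 1))"
        using K2 b by (simp add: mult_left_mono)
      then have "4 * K / bcoef \<gamma> n * 1 \<le> 4 * K / bcoef \<gamma> n * (K2 * bcoef \<gamma> n * (2 powr (\<gamma> + 1) * (1 - r\<^sup>2) powr (\<gamma> + 1)))"
        using K b by (intro mult_left_mono) auto
      then show "4 * (K * (1 / bcoef \<gamma> n)) \<le> B * (1 - r\<^sup>2) powr (\<gamma> + 1)"
        using b by (simp add: B_def mult_ac)
    qed
    finally show ?thesis .
  qed
  then show ?thesis using B unfolding Bcond_def by blast
qed

lemma mo_w_bounds: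
  shows mo_w_finite: "mo w (real n * p) < top" and mo_w_pos: "0 < mo w (real n * p)"
proof -
  have "mo w (real n * p) \<le> (\<integral>\<^sup>+r. w r \<partial>RM)"
    unfolding mo_def
  proof (rule nn_integral_mono_AE)
    show "AE r in RM. ennreal (r powr (real n * p)) * w r \<le> w r"
      using AE_RM_range
    proof eventually_elim
      case (elim r)
      have "ennreal (r powr (real n * p)) * w r \<le> 1 * w r"
        using elim p by (intro mult_right_mono) (auto simp: powr_le1)
      then show ?case by simp
    qed
  qed
  then show "mo w (real n * p) < top" using w_integrable by (rule order_le_less_trans)
  show "0 < mo w (real n * p)"
  proof -
    have "mo w (real n * p) \<noteq> 0"
    proof
      assume "mo w (real n * p) = 0"
      then have "AE r in RM. ennreal (r powr (real n * p)) * w r = 0"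
        unfolding mo_def by (subst (asm) nn_integral_0_iff_AE) auto
      with AE_RM_range have "AE r in RM. w r * indicator {0..<1} r = 0"
        by eventually_elim (auto simp: ennreal_eq_0_iff)
      then have "wtail w 0 = 0" unfolding wtail_def by (subst nn_integral_0_iff_AE) auto
      then show False using w_tail[of 0] by simp
    qed
    then show ?thesis by (simp add: zero_less_iff_neq_zero)
  qed
qed

lemma moment_root_real:
  obtains W where "0 < W" "epowr (mo w (real n * p)) (1 / p) = ennreal W"
proof -
  obtain m where m: "0 \<le> m" "mo w (real n * p) = ennreal m" using mo_w_finite[of n] by (cases "mo w (real n * p)") auto
  then have "0 < m" using mo_w_pos[of n] by auto
  then show thesis using m by (intro that[of "m powr (1 / p)"]) (auto simp: epowr_ennreal)
qed

text \<open>The truncation of s gives the left side a finite norm, so the converse of Hoelder's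
  inequality applies. Its test functions may be assumed finite everywhere: a function of finite norm
  is finite almost everywhere, and for infinite norm the bound is trivial.\<close>

lemma s_moment_le_if_tested:
  assumes C: "0 < C"
    and tst: "\<And>H. H \<in> borel_fun \<Longrightarrow> (\<And>r. H r < top) \<Longrightarrow> elp RM p H < top \<Longrightarrow>
      (\<integral>\<^sup>+r. ennreal (r ^ n) * epowr (min (s r) (of_nat N)) (1 / p') * H r \<partial>RM) \<le> ennreal C * elp RM p H"
  shows "elp RM p' (\<lambda>r. ennreal (r ^ n) * epowr (min (s r) (of_nat N)) (1 / p')) \<le> ennreal C"
proof (rule elp_converse_Holder_finite)
  let ?\<Phi> = "\<lambda>r. ennreal (r ^ n) * epowr (min (s r) (of_nat N)) (1 / p')"
  have "elp RM p' ?\<Phi> \<le> elp RM p' (\<lambda>r. epowr (of_nat N) (1 / p'))"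
  proof (rule elp_mono_AE)
    show "AE r in RM. ?\<Phi> r \<le> epowr (of_nat N) (1 / p')"
      using AE_RM_range
    proof eventually_elim
      case (elim r)
      have "?\<Phi> r \<le> 1 * epowr (of_nat N) (1 / p')"
        using elim pp by (intro mult_mono epowr_mono) (auto simp: power_le_one)
      then show ?case by simp
    qed
  qed (use pp in auto)
  also have "\<dots> < top" using pp by (intro elp_bounded_finite[OF finite_measure_RM]) (auto simp: of_nat_less_top)
  finally show "elp RM p' ?\<Phi> < top" .
  fix H :: "real \<Rightarrow> ennreal" assume H': "H \<in> borel_measurable RM"
  then have H [measurable]: "H \<in> borel_fun" by simp
  show "(\<integral>\<^sup>+r. ?\<Phi> r * H r \<partial>RM) \<le> ennreal C * elp RM (conj_exponent p') H"
  proof (cases "elp RM p H < top")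
    case False
    then show ?thesis using C pp by (simp add: ennreal_mult_top less_top[symmetric])
  next
    case True
    let ?H = "\<lambda>r. ennreal (enn2real (H r))"
    have "AE r in RM. epowr (H r) p \<noteq> \<infinity>"
      using True p by (intro nn_integral_PInf_AE) (auto simp: elp_def)
    then have fin: "AE r in RM. H r = ?H r" by eventually_elim (simp add: less_top)
    then have e: "elp RM p H = elp RM p ?H" by (rule elp_cong_AE)
    have "(\<integral>\<^sup>+r. ?\<Phi> r * H r \<partial>RM) = (\<integral>\<^sup>+r. ?\<Phi> r * ?H r \<partial>RM)"
      using fin by (intro nn_integral_cong_AE) (auto elim!: eventually_mono)
    also have "\<dots> \<le> ennreal C * elp RM p ?H" using True by (intro tst) (auto simp: e)
    finally show ?thesis by (simp add: pp e)
  qed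
qed (use pp in auto)

text \<open>On f = h(r) e^(in\<theta>) the projection has rank one: it returns a multiple of z^n
  whose factor is proportional to the integral of r^n h v. Boundedness controls this integral by the
  weighted norm of h divided by that of z^n. The supremum over h is the p'-norm of r^n with respect
  to \<sigma>, so the product of the two moment roots is bounded.\<close>

lemma bounded_imp_Dcond:
  assumes rc: "radial_comparable X p w"
    and bd: "bounded_operator \<gamma> (Bergman_proj \<gamma>) {f \<in> disc_measurable. X f < \<infinity>} X Y X"
  shows Dcond
proof -
  obtain a b where ab: "0 < a" "0 < b" and rc0: "comparable_with a b X p w"
    using rc unfolding radial_comparable_def by blast
  note rc' = comparable_withD[OF rc0]
  obtain C0 where L1: "\<And>f. f \<in> disc_measurable \<Longrightarrow> X f < \<infinity> \<Longrightarrow> f \<in> L1_space \<gamma>"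
    and C0: "\<And>f. f \<in> disc_measurable \<Longrightarrow> X f < \<infinity> \<Longrightarrow> X (Bergman_proj \<gamma> f) \<le> ennreal C0 * X f"
    using bd unfolding bounded_operator_def by auto
  define C where "C = max 1 C0"
  have C: "0 < C" "\<And>f. f \<in> disc_measurable \<Longrightarrow> X f < \<infinity> \<Longrightarrow> X (Bergman_proj \<gamma> f) \<le> ennreal C * X f"
  proof -
    show "0 < C" by (simp add: C_def)
    fix f assume "f \<in> disc_measurable" "X f < \<infinity>"
    from C0[OF this] show "X (Bergman_proj \<gamma> f) \<le> ennreal C * X f"
      by (rule order_trans) (auto simp: C_def intro!: mult_right_mono ennreal_leI)
  qed
  show ?thesis unfolding Dcond_def
  proof (intro exI[of _ "C * b / (2 * a)"] conjI allI)
    show "0 < C * b / (2 * a)" using C(1) ab by simp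
    fix n :: nat
    have bn: "0 < bcoef \<gamma> n" by (rule bcoef_pos[OF g])
    obtain W where W: "0 < W" "epowr (mo w (real n * p)) (1 / p) = ennreal W" by (rule moment_root_real)
    \<comment> \<open>Boundedness will read a * 2 \<open>bcoef \<gamma> n\<close> Y * W \<le> C b
      times the norm of H, where Y is the tested integral; D is the constant obtained by solving for
      Y.\<close>
    define D where "D = C * b / (2 * a * bcoef \<gamma> n * W)"
    have D: "0 < D" using C(1) ab bn W by (simp add: D_def)
    have key: "elp RM p' (\<lambda>r. ennreal (r ^ n) * epowr (min (s r) (of_nat N)) (1 / p')) \<le> ennreal D" for N
    proof (rule s_moment_le_if_tested[OF D])
      fix H :: "real \<Rightarrow> ennreal"
      assume H [measurable]: "H \<in> borel_fun" and Hfin: "\<And>r. H r < top" and Hn: "elp RM p H < top"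
      let ?S = "\<lambda>r. epowr (min (s r) (of_nat N)) (1 / p')"
      have Sfin: "?S r < top" for r
        by (simp add: min_less_iff_disj of_nat_less_top)
      \<comment> \<open>The division by v serves two purposes: the pairing with z^n becomes the
        integral of r^n S H, where S is the root of the truncated s, and w^(1/p) s^(1/p') \<le> v
        gives h w^(1/p) \<le> H.\<close>
      define h where "h = (\<lambda>r. enn2real (H r) * enn2real (?S r) / vweight \<gamma> r)"
      have hm [measurable]: "h \<in> borel_fun" unfolding h_def by measurable
      have h0: "0 \<le> h r" for r using vweight_nonneg[OF g, of r] by (simp add: h_def)
      define f where "f = (\<lambda>z. of_real (h (cmod z)) * sgn z ^ n)"
      have fm [measurable]: "f \<in> borel_fun"
        unfolding f_def sgn_div_norm by measurable
      have fpol: "f (of_real r * cis t) = of_real (h r) * cis (real n * t)" if "r \<in> {0<..<1}" for r t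
        using that by (simp add: f_def norm_mult sgn_mult sgn_of_real Complex.DeMoivre)
      have fabs: "ennreal (cmod (f (of_real r * cis t))) = ennreal (h r)" if "r \<in> {0<..<1}" for r t
        using that h0[of r] by (simp add: fpol norm_mult)
      have fle: "f \<in> disc_measurable" by (rule borel_measurable_lebesgue_on_borel[OF fm])
      have hw: "AE r in RM. ennreal (h r) * epowr (w r) (1 / p) \<le> H r"
        using AE_RM_range
      proof eventually_elim
        case (elim r)
        have v: "0 < vweight \<gamma> r" using vweight_pos[OF g elim] .
        have "ennreal (h r) = H r * (?S r * ennreal (1 / vweight \<gamma> r))"
        proof -
          have "ennreal (h r) = ennreal (enn2real (H r)) * (ennreal (enn2real (?S r)) * ennreal (1 / vweight \<gamma> r))"
            using v by (simp add: h_def flip: ennreal_mult)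
          then show ?thesis using Hfin[of r] Sfin[of r] by simp
        qed
        then have "ennreal (h r) * epowr (w r) (1 / p) = H r * (ennreal (1 / vweight \<gamma> r) * (epowr (w r) (1 / p) * ?S r))"
          by (simp only: mult_ac)
        also have "\<dots> \<le> H r * (ennreal (1 / vweight \<gamma> r) * (epowr (w r) (1 / p) * epowr (s r) (1 / p')))"
          using pp by (intro mult_left_mono epowr_mono) auto
        also have "\<dots> \<le> H r * (ennreal (1 / vweight \<gamma> r) * ennreal (vweight \<gamma> r))"
          by (intro mult_left_mono ws_le elim) auto
        also have "\<dots> = H r" using v by (simp flip: ennreal_mult)
        finally show ?case .
      qed
      have Xf: "X f \<le> ennreal b * elp RM p H"
      proof -
        have "X f \<le> ennreal b * elp RM p (\<lambda>r. ennreal (h r) * epowr (w r) (1 / p))"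
          using rc'[of f "\<lambda>r. ennreal (h r)" f] fabs by auto
        also have "\<dots> \<le> ennreal b * elp RM p H" using p hw by (intro mult_left_mono elp_mono_AE) auto
        finally show ?thesis .
      qed
      then have Xfin: "X f < \<infinity>" using Hn by (auto simp: ennreal_mult_less_top intro: order_le_less_trans)
      note fL1 = L1[OF fle Xfin]
      let ?Y = "\<integral>\<^sup>+r. ennreal (r ^ n) * ?S r * H r \<partial>RM"
      define J where "J = cmod (coef \<gamma> f n)"
      \<comment> \<open>The phases of f and of cnj z^n cancel, so the pairing has a nonnegative
        integrand. The factor 2 is the full angle 2\<pi> over the normalisation \<pi> of the
        area.\<close>
      have J: "2 * ?Y = ennreal J"
      proof -
        let ?\<phi> = "\<lambda>z. f z * cnj z ^ n * of_real (std_weight \<gamma> z)" and ?u = "\<lambda>r. h r * r ^ n * vweight \<gamma> r"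
        have \<phi>: "?\<phi> z = of_real (?u (cmod z))" for z
        proof -
          have "?\<phi> z = of_real (h (cmod z)) * (sgn z * cnj z) ^ n * of_real (vweight \<gamma> (cmod z))"
            by (simp add: f_def std_weight_eq power_mult_distrib)
          then show ?thesis by (simp only: sgn_mult_cnj of_real_mult of_real_power)
        qed
        have u0: "0 \<le> ?u (cmod z)" for z :: complex using h0 vweight_nonneg[OF g] by simp
        have "ennreal J = (\<integral>\<^sup>+z. ennreal (cmod (?\<phi> z)) \<partial>dA)"
          unfolding J_def coef_def
          by (rule integral_eq_of_norm[symmetric, OF coef_integrable[OF fL1 g] AE_I2]) (simp only: \<phi> norm_of_real abs_of_nonneg u0)
        also have "\<dots> = (\<integral>\<^sup>+z. ennreal (?u (cmod z)) \<partial>dA)" by (simp only: \<phi> norm_of_real abs_of_nonneg u0)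
        also have "\<dots> = ennreal (1 / pi) * polar_int (\<lambda>t r. ennreal (?u (cmod (of_real r * cis t))))"
          by (rule nn_integral_dA) measurable
        also have "polar_int (\<lambda>t r. ennreal (?u (cmod (of_real r * cis t)))) = polar_int (\<lambda>t r. ennreal (r ^ n) * ?S r * H r)"
        proof (rule nn_integral_cong, rule nn_integral_cong_AE, rule eventually_mono[OF AE_RM_range])
          fix t r :: real assume r: "r \<in> {0<..<1}"
          have "?u (cmod (of_real r * cis t)) = r ^ n * enn2real (?S r) * enn2real (H r)"
            using vweight_pos[OF g r] r by (simp add: h_def norm_mult)
          then show "ennreal (?u (cmod (of_real r * cis t))) = ennreal (r ^ n) * ?S r * H r"
            using r Hfin[of r] Sfin[of r] by (simp add: ennreal_mult)
        qed
        also have "\<dots> = ennreal (2 * pi) * ?Y" by (simp add: emeasure_TM mult.commute)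
        also have "ennreal (1 / pi) * \<dots> = (ennreal (1 / pi) * ennreal (2 * pi)) * ?Y"
          by (simp only: mult.assoc)
        also have "ennreal (1 / pi) * ennreal (2 * pi) = 2" by (simp flip: ennreal_mult)
        finally show ?thesis ..
      qed
      have cf: "coef \<gamma> f m = 0" if "m \<noteq> n" for m
      proof -
        have "coef \<gamma> f m = (\<integral>r. of_real (r ^ m * vweight \<gamma> r) * 0 \<partial>RM) / of_real pi"
        proof (rule coef_polar[OF fL1 fm g])
          fix r :: real assume r: "r \<in> {0<..<1}"
          have "(\<integral>t. f (of_real r * cis t) * cis (- (real m * t)) \<partial>TM) = (\<integral>t. of_real (h r) * cis (of_int (int n - int m) * t) \<partial>TM)"
            using r by (intro Bochner_Integration.integral_cong) (auto simp: fpol cis_mult left_diff_distrib)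
          also have "\<dots> = 0"
            using that by (simp only: integral_mult_right_zero integral_TM_cis) simp
          finally show "(\<integral>t. f (of_real r * cis t) * cis (- (real m * t)) \<partial>TM) = 0" .
        qed measurable
        then show ?thesis by simp
      qed
      define k where "k = of_real (bcoef \<gamma> n) * coef \<gamma> f n"
      define c where "c = bcoef \<gamma> n * J"
      have c0: "0 \<le> c" and ck: "cmod k = c" using bn by (simp_all add: c_def J_def k_def norm_mult)
      have Pf: "Bergman_proj \<gamma> f z = k * z ^ n" if "cmod z < 1" for z
      proof -
        have "of_real (bcoef \<gamma> m) * coef \<gamma> f m * z ^ m = (if m = n then k * z ^ n else 0)" for m
          by (simp add: cf k_def)
        with Bergman_sums[OF fL1 g that] have "(\<lambda>m. if m = n then k * z ^ n else 0) sums Bergman_proj \<gamma> f z" by simp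
        from sums_unique2[OF this sums_single] show ?thesis by simp
      qed
      have "ennreal a * elp RM p (\<lambda>r. ennreal (c * r ^ n) * epowr (w r) (1 / p)) \<le> X (Bergman_proj \<gamma> f)"
      proof -
        have "AE z in dA. Bergman_proj \<gamma> f z = k * z ^ n"
          by (rule AE_I2) (simp add: space_dA Pf)
        then show ?thesis
          using rc'[of "\<lambda>z. k * z ^ n" "\<lambda>r. ennreal (c * r ^ n)" "Bergman_proj \<gamma> f"]
          by (auto simp: norm_mult norm_power power_mult_distrib ck)
      qed
      also have "X (Bergman_proj \<gamma> f) \<le> ennreal C * X f" by (rule C(2)[OF fle Xfin])
      also have "\<dots> \<le> ennreal C * (ennreal b * elp RM p H)" by (intro mult_left_mono Xf) simp
      also have "elp RM p (\<lambda>r. ennreal (c * r ^ n) * epowr (w r) (1 / p)) = ennreal c * ennreal W"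
      proof -
        have "elp RM p (\<lambda>r. ennreal (c * r ^ n) * epowr (w r) (1 / p)) = elp RM p (\<lambda>r. ennreal c * (ennreal (r ^ n) * epowr (w r) (1 / p)))"
          using AE_RM_range c0
          by (intro elp_cong_AE) (auto elim!: eventually_mono simp: ennreal_mult mult.assoc)
        also have "\<dots> = ennreal c * epowr (mo w (real n * p)) (1 / p)"
          using p by (subst elp_cmult) (auto simp: elp_monomial)
        finally show ?thesis by (simp add: W)
      qed
      finally have le: "ennreal a * (ennreal c * ennreal W) \<le> ennreal C * (ennreal b * elp RM p H)" .
      obtain e where e: "0 \<le> e" "elp RM p H = ennreal e" using Hn by (cases "elp RM p H") auto
      have "a * (c * W) \<le> C * (b * e)"
        using le ab C(1) c0 W e by (simp flip: ennreal_mult)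
      then have "J \<le> 2 * D * e"
        using ab bn W by (simp add: c_def D_def pos_le_divide_eq mult_ac)
      then have "2 * ?Y \<le> 2 * (ennreal D * elp RM p H)"
        using J e D by (simp add: ennreal_leI flip: ennreal_mult ennreal_numeral)
      then show "?Y \<le> ennreal D * elp RM p H"
        by (simp add: ennreal_mult_le_mult_iff)
    qed
    \<comment> \<open>D is independent of the truncation, which monotone convergence removes.
      Finiteness of the moment of s is obtained only here.\<close>
    have "elp RM p' (\<lambda>r. SUP N. ennreal (r ^ n) * epowr (min (s r) (of_nat N)) (1 / p')) \<le> ennreal D"
    proof (subst elp_SUP)
      show "incseq (\<lambda>N r. ennreal (r ^ n) * epowr (min (s r) (of_nat N)) (1 / p'))"
        using pp by (auto simp: incseq_def le_fun_def simp del: min.bounded_iff intro!: mult_left_mono epowr_mono min_of_nat_mono)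
    qed (use pp key in \<open>auto intro!: SUP_least\<close>)
    moreover have "(SUP N. ennreal (r ^ n) * epowr (min (s r) (of_nat N)) (1 / p')) = ennreal (r ^ n) * epowr (s r) (1 / p')" for r
      using pp SUP_truncate[of 0 r "\<lambda>_. UNIV" "s r"]
      by (simp add: SUP_mult_left_ennreal[symmetric] epowr_SUP[symmetric])
    ultimately have "epowr (mo s (real n * p')) (1 / p') \<le> ennreal D"
      using elp_monomial[of p' s n] pp by simp
    then have "ennreal W * epowr (mo s (real n * p')) (1 / p') \<le> ennreal W * ennreal D"
      by (rule mult_left_mono) simp
    also have "\<dots> = ennreal (C * b / (2 * a) * (1 / bcoef \<gamma> n))"
      using W D by (simp add: D_def flip: ennreal_mult)
    finally show "epowr (mo w (real n * p)) (1 / p) * epowr (mo s (real n * p')) (1 / p') \<le> ennreal (C * b / (2 * a) * (1 / bcoef \<gamma> n))"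
      by (simp only: W)
  qed
qed

text \<open>Minkowski's inequality in dual form: test functions of r alone, regarded as functions on
  the disc, have angular norm (2\<pi>)^(1/q'), and Hoelder for the mixed norm does the rest.\<close>

lemma radial_mean_le_Ln:
  assumes F: "polar_measurable F" and G [measurable]: "G \<in> borel_fun"
    and le: "AE r in RM. G r \<le> (\<integral>\<^sup>+\<theta>. F \<theta> r \<partial>TM)" and fin: "elp RM p (\<lambda>r. G r * epowr (w r) (1 / p)) < top"
  shows "elp RM p (\<lambda>r. G r * epowr (w r) (1 / p)) \<le> ennreal ((2 * pi) powr (1 / q')) * Ln p q w F"
proof (rule elp_converse_Holder_finite[OF p _ fin])
  note polar_measurableD[OF F, measurable]
  show "(\<lambda>r. G r * epowr (w r) (1 / p)) \<in> borel_measurable RM" by measurable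
  fix h :: "real \<Rightarrow> ennreal" assume h': "h \<in> borel_measurable RM"
  then have h [measurable]: "h \<in> borel_fun" by simp
  have "(\<integral>\<^sup>+r. G r * epowr (w r) (1 / p) * h r \<partial>RM) \<le> (\<integral>\<^sup>+r. (\<integral>\<^sup>+\<theta>. F \<theta> r \<partial>TM) * (epowr (w r) (1 / p) * h r) \<partial>RM)"
  proof (rule nn_integral_mono_AE)
    show "AE r in RM. G r * epowr (w r) (1 / p) * h r \<le> (\<integral>\<^sup>+\<theta>. F \<theta> r \<partial>TM) * (epowr (w r) (1 / p) * h r)"
      using le by eventually_elim (simp add: mult.assoc mult_right_mono)
  qed
  also have "\<dots> = (\<integral>\<^sup>+r. \<integral>\<^sup>+\<theta>. F \<theta> r * (epowr (w r) (1 / p) * h r) \<partial>TM \<partial>RM)"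
    by (intro nn_integral_cong nn_integral_multc[symmetric]) measurable
  also have "\<dots> = polar_int (\<lambda>\<theta> r. F \<theta> r * (epowr (w r) (1 / p) * h r))"
    by (rule TR.Fubini') measurable
  also have "\<dots> = polar_int (\<lambda>\<theta> r. (F \<theta> r * epowr (w r) (1 / p)) * h r)" by (simp only: mult.assoc)
  also have "\<dots> \<le> elp2 TM RM p q (\<lambda>\<theta> r. F \<theta> r * epowr (w r) (1 / p)) * elp2 TM RM p' q' (\<lambda>\<theta> r. h r)"
    by (rule RM.elp2_Holder[OF p q]) measurable
  also have "elp2 TM RM p' q' (\<lambda>\<theta> r. h r) = ennreal ((2 * pi) powr (1 / q')) * elp RM p' h"
    unfolding elp2_def using qq by (simp add: elp_TM_const)
  finally show "(\<integral>\<^sup>+r. G r * epowr (w r) (1 / p) * h r \<partial>RM) \<le> ennreal ((2 * pi) powr (1 / q')) * Ln p q w F * elp RM p' h"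
    by (simp add: Ln_def mult_ac)
qed

text \<open>The functional taking the n-th Taylor coefficient has norm at most a constant over the
  size of z^n. This is what the duality argument needs to know about the norm X besides its radial
  behaviour.\<close>

definition coef_bounded :: "((complex \<Rightarrow> complex) \<Rightarrow> ennreal) \<Rightarrow> bool" where
  "coef_bounded X \<longleftrightarrow> (\<exists>C>0. \<forall>f n. f holomorphic_on unit_disc \<longrightarrow>
     ennreal (cmod ((deriv ^^ n) f 0 / fact n)) * epowr (mo w (real n * p)) (1 / p) \<le> ennreal C * X f)"

text \<open>A Taylor coefficient times r^n is bounded by the mean of |f| over the circle of radius
  r, whatever r is. F is |f| itself for the mixed norm and its tent average for the tent
  norm.\<close>

lemma coef_bound_aux:
  assumes f: "f holomorphic_on unit_disc" and F: "polar_measurable F"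
    and le: "AE r in RM. (\<integral>\<^sup>+\<theta>. ennreal (cmod (f (of_real r * cis \<theta>))) \<partial>TM) \<le> (\<integral>\<^sup>+\<theta>. F \<theta> r \<partial>TM)"
  shows "ennreal (cmod ((deriv ^^ n) f 0 / fact n)) * epowr (mo w (real n * p)) (1 / p) \<le> ennreal ((2 * pi) powr (1 / q') / (2 * pi)) * Ln p q w F"
proof -
  define b where "b = cmod ((deriv ^^ n) f 0 / fact n)"
  have b: "0 \<le> b" by (simp add: b_def)
  let ?G = "\<lambda>r. ennreal (2 * pi * b) * ennreal (r ^ n)"
  have e: "elp RM p (\<lambda>r. ?G r * epowr (w r) (1 / p)) = ennreal (2 * pi * b) * epowr (mo w (real n * p)) (1 / p)"
    using p by (simp only: mult.assoc) (subst elp_cmult, auto simp: elp_monomial)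
  obtain W where W: "0 < W" "epowr (mo w (real n * p)) (1 / p) = ennreal W" by (rule moment_root_real)
  have "elp RM p (\<lambda>r. ?G r * epowr (w r) (1 / p)) \<le> ennreal ((2 * pi) powr (1 / q')) * Ln p q w F"
  proof (rule radial_mean_le_Ln[OF F])
    show "AE r in RM. ?G r \<le> (\<integral>\<^sup>+\<theta>. F \<theta> r \<partial>TM)"
      using AE_RM_range le
    proof eventually_elim
      case (elim r)
      let ?h = "\<lambda>t. f (of_real r * cis t) * cis (- (real n * t))"
      have "?G r = ennreal (2 * pi * b * r ^ n)" using elim b by (simp add: ennreal_mult)
      also have "2 * pi * b * r ^ n = cmod (\<integral>t. ?h t \<partial>TM)"
        using elim holomorphic_circle_coef[OF f, of r n] by (simp add: b_def norm_mult norm_divide norm_power)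
      also have "\<dots> \<le> (\<integral>\<^sup>+t. ennreal (cmod (?h t)) \<partial>TM)"
        by (cases "integrable TM ?h") (auto intro: integral_norm_bound_ennreal simp: not_integrable_integral_eq)
      also have "\<dots> = (\<integral>\<^sup>+\<theta>. ennreal (cmod (f (of_real r * cis \<theta>))) \<partial>TM)" by (simp add: norm_mult)
      also have "\<dots> \<le> (\<integral>\<^sup>+\<theta>. F \<theta> r \<partial>TM)" using elim by simp
      finally show ?case .
    qed
    show "elp RM p (\<lambda>r. ?G r * epowr (w r) (1 / p)) < top" unfolding e W by (simp add: ennreal_mult_less_top)
  qed measurable
  then have "ennreal (1 / (2 * pi)) * (ennreal (2 * pi * b) * ennreal W) \<le> ennreal (1 / (2 * pi)) * (ennreal ((2 * pi) powr (1 / q')) * Ln p q w F)"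
    unfolding e W by (rule mult_left_mono) simp
  also have "ennreal (1 / (2 * pi)) * (ennreal (2 * pi * b) * ennreal W) = ennreal b * ennreal W"
    using b W by (simp flip: ennreal_mult)
  also have "ennreal (1 / (2 * pi)) * (ennreal ((2 * pi) powr (1 / q')) * Ln p q w F) = ennreal ((2 * pi) powr (1 / q') / (2 * pi)) * Ln p q w F"
    by (simp add: mult.assoc[symmetric] flip: ennreal_mult)
  finally show ?thesis by (simp add: b_def W)
qed

lemma coef_bounded_L: "coef_bounded (L_norm p q \<omega>e)"
proof -
  let ?c = "(1 / (2 * pi)) powr (1 / q)" and ?K = "(2 * pi) powr (1 / q') / (2 * pi)"
  have "ennreal (cmod ((deriv ^^ n) f 0 / fact n)) * epowr (mo w (real n * p)) (1 / p) \<le> ennreal (?K / ?c) * L_norm p q \<omega>e f"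
    if f: "f holomorphic_on unit_disc" for f n
  proof -
    note Fm = disc_cut_measurable[OF f]
    let ?F = "\<lambda>\<theta> r. ennreal (cmod (disc_cut f (of_real r * cis \<theta>)))"
    have "AE z in dA. f z = disc_cut f z" by (rule AE_I2) (simp add: disc_cut_def space_dA)
    then have L: "L_norm p q \<omega>e f = ennreal ?c * Ln p q w ?F"
      using p q by (intro L_norm_eq Fm w \<omega>w(1)) auto
    have "ennreal (cmod ((deriv ^^ n) f 0 / fact n)) * epowr (mo w (real n * p)) (1 / p) \<le> ennreal ?K * Ln p q w ?F"
    proof (rule coef_bound_aux[OF f polar_abs_measurable[OF Fm]])
      show "AE r in RM. (\<integral>\<^sup>+\<theta>. ennreal (cmod (f (of_real r * cis \<theta>))) \<partial>TM) \<le> (\<integral>\<^sup>+\<theta>. ?F \<theta> r \<partial>TM)"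
        using AE_RM_range by eventually_elim (auto intro!: nn_integral_mono simp: disc_cut_def norm_mult)
    qed
    also have "ennreal ?K = ennreal (?K / ?c) * ennreal ?c" by (simp flip: ennreal_mult)
    finally show ?thesis by (simp only: L mult.assoc)
  qed
  then show ?thesis unfolding coef_bounded_def by (intro exI[of _ "?K / ?c"]) auto
qed

lemma coef_bounded_T: "coef_bounded (T_norm p q \<omega>e)"
proof -
  let ?c = "(1 / pi) powr (1 / p)" and ?K = "(2 * pi) powr (1 / q') / (2 * pi)" and ?d = "6 powr ((p - 1) / p)"
  have "ennreal (cmod ((deriv ^^ n) f 0 / fact n)) * epowr (mo w (real n * p)) (1 / p) \<le> ennreal (?K * ?d / ?c) * T_norm p q \<omega>e f"
    if f: "f holomorphic_on unit_disc" for f n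
  proof -
    note Fm = disc_cut_measurable[OF f]
    let ?F = "\<lambda>\<theta> r. ennreal (cmod (disc_cut f (of_real r * cis \<theta>)))"
    have Fp: "case_prod ?F \<in> borel_measurable (TM \<Otimes>\<^sub>M RM)" by (rule polar_abs_measurable[OF Fm])
    have "AE z in dA. f z = disc_cut f z" by (rule AE_I2) (simp add: disc_cut_def space_dA)
    then have T: "T_norm p q \<omega>e f = ennreal ?c * Tn p q w ?F"
      using p q by (intro T_norm_eq Fm w \<omega>w(2)) auto
    have "ennreal (cmod ((deriv ^^ n) f 0 / fact n)) * epowr (mo w (real n * p)) (1 / p) \<le> ennreal ?K * Ln p q w (Av ?F)"
    proof (rule coef_bound_aux[OF f Av_measurable[OF Fp]])
      show "AE r in RM. (\<integral>\<^sup>+\<theta>. ennreal (cmod (f (of_real r * cis \<theta>))) \<partial>TM) \<le> (\<integral>\<^sup>+\<theta>. Av ?F \<theta> r \<partial>TM)"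
        using AE_RM_range
      proof eventually_elim
        case (elim r)
        have "(\<integral>\<^sup>+\<theta>. ennreal (cmod (f (of_real r * cis \<theta>))) \<partial>TM) = (\<integral>\<^sup>+\<theta>. ?F \<theta> r \<partial>TM)"
          using elim by (simp add: disc_cut_def norm_mult)
        also have "\<dots> \<le> (\<integral>\<^sup>+\<theta>. Av ?F \<theta> r \<partial>TM)" by (rule nn_integral_le_Av[OF Fp elim])
        finally show ?case .
      qed
    qed
    also have "\<dots> \<le> ennreal ?K * (ennreal ?d * Tn p q w ?F)"
      using q by (intro mult_left_mono Ln_Av_le_Tn p w Fp) auto
    also have "\<dots> = ennreal (?K * ?d / ?c) * (ennreal ?c * Tn p q w ?F)"
      by (simp add: mult.assoc[symmetric] flip: ennreal_mult)
    finally show ?thesis by (simp only: T)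
  qed
  then show ?thesis unfolding coef_bounded_def by (intro exI[of _ "?K * ?d / ?c"]) auto
qed

lemma higher_deriv_monomial_0: "(deriv ^^ n) (\<lambda>z. z ^ m) (0::complex) / fact n = (if m = n then 1 else 0)"
proof -
  have "(deriv ^^ n) (\<lambda>z. (z - 0) ^ m) (0::complex) = pochhammer (of_nat (Suc m - n)) n * (0 - 0) ^ (m - n)"
    by (rule higher_deriv_power)
  then show ?thesis
    by (cases m n rule: linorder_cases) (auto simp: pochhammer_fact[symmetric] pochhammer_0_left)
qed

text \<open>The n-th Taylor coefficient is a bounded functional. Its representing function g pairs
  to 0 with every monomial except z^n, so g must be \<open>bcoef \<gamma> n\<close> z^n. The assumed
  equivalence bounds the norm of g, a multiple of the \<sigma>-moment root, by the norm of the
  functional, which is at most a constant over the \<omega>-moment root.\<close>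

lemma dual_imp_Dcond:
  assumes rcX: "radial_comparable X p w" and rcY: "radial_comparable Y p' s" and cb: "coef_bounded X"
    and dual: "dual_via_pairing \<gamma> ({f \<in> disc_measurable. X f < \<infinity>} \<inter> {f. f holomorphic_on unit_disc}) X
       ({f \<in> disc_measurable. Y f < \<infinity>} \<inter> {f. f holomorphic_on unit_disc}) Y"
  shows Dcond
proof -
  let ?X = "{f \<in> disc_measurable. X f < \<infinity>} \<inter> {f. f holomorphic_on unit_disc}"
  let ?Y = "{f \<in> disc_measurable. Y f < \<infinity>} \<inter> {f. f holomorphic_on unit_disc}"
  obtain aX bX where X0: "0 < aX" "0 < bX" "comparable_with aX bX X p w"
    using rcX unfolding radial_comparable_def by blast
  note X = X0(1,2) comparable_withD[OF X0(3)]
  obtain aY bY where Y0: "0 < aY" "0 < bY" "comparable_with aY bY Y p' s"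
    using rcY unfolding radial_comparable_def by blast
  note Y = Y0(1,2) comparable_withD[OF Y0(3)]
  obtain C1 where C1: "0 < C1" "\<And>f n. f holomorphic_on unit_disc \<Longrightarrow>
     ennreal (cmod ((deriv ^^ n) f 0 / fact n)) * epowr (mo w (real n * p)) (1 / p) \<le> ennreal C1 * X f"
    using cb unfolding coef_bounded_def by blast
  have mon: "(\<lambda>z. z ^ m) \<in> ?X" for m
  proof -
    have h: "(\<lambda>z. z ^ m) holomorphic_on unit_disc" by (intro holomorphic_intros)
    have "X (\<lambda>z. z ^ m) \<le> ennreal bX * elp RM p (\<lambda>r. ennreal (\<bar>r\<bar> ^ m) * epowr (w r) (1 / p))"
      using X(3)[of "\<lambda>z. z ^ m" "\<lambda>r. ennreal (\<bar>r\<bar> ^ m)" "\<lambda>z. z ^ m"] by (auto simp: norm_mult norm_power power_mult_distrib)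
    also have "elp RM p (\<lambda>r. ennreal (\<bar>r\<bar> ^ m) * epowr (w r) (1 / p)) = elp RM p (\<lambda>r. ennreal (r ^ m) * epowr (w r) (1 / p))"
      using AE_RM_range by (intro elp_cong_AE) (auto elim!: eventually_mono)
    also have "\<dots> = epowr (mo w (real m * p)) (1 / p)" using p by (simp add: elp_monomial)
    also have "ennreal bX * \<dots> < top" using mo_w_finite[of m] by (simp add: ennreal_mult_less_top)
    finally show ?thesis using h holomorphic_measurable_disc[OF h] by simp
  qed
  have int: "\<And>f g. f \<in> ?X \<Longrightarrow> g \<in> ?Y \<Longrightarrow> integrable dA (\<lambda>z. f z * cnj (g z) * of_real (std_weight \<gamma> z))"
    and rep: "\<And>L. bounded_functional ?X X L \<Longrightarrow> \<exists>g\<in>?Y. \<forall>f\<in>?X. L f = pairing \<gamma> f g"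
    using dual unfolding dual_via_pairing_def by blast+
  obtain C20 where C20: "\<And>g. g \<in> ?Y \<Longrightarrow> Y g \<le> ennreal C20 * functional_norm ?X X (\<lambda>f. pairing \<gamma> f g)"
    using dual unfolding dual_via_pairing_def by blast
  define C2 where "C2 = max 1 C20"
  have C2: "0 < C2" "\<And>g. g \<in> ?Y \<Longrightarrow> Y g \<le> ennreal C2 * functional_norm ?X X (\<lambda>f. pairing \<gamma> f g)"
  proof -
    show "0 < C2" by (simp add: C2_def)
    fix g assume "g \<in> ?Y"
    from C20[OF this] show "Y g \<le> ennreal C2 * functional_norm ?X X (\<lambda>f. pairing \<gamma> f g)"
      by (rule order_trans) (auto simp: C2_def intro!: mult_right_mono ennreal_leI)
  qed
  show ?thesis unfolding Dcond_def
  proof (intro exI[of _ "C1 * C2 / aY"] conjI allI)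
    show "0 < C1 * C2 / aY" using C1 C2 Y by simp
    fix n :: nat
    have bn: "0 < bcoef \<gamma> n" by (rule bcoef_pos[OF g])
    obtain W where W: "0 < W" "epowr (mo w (real n * p)) (1 / p) = ennreal W" by (rule moment_root_real)
    define L where "L = (\<lambda>f. (deriv ^^ n) f 0 / fact n :: complex)"
    have Lb: "ennreal (cmod (L f)) \<le> ennreal (C1 / W) * X f" if "f \<in> ?X" for f
    proof -
      have "ennreal (1 / W) * (ennreal (cmod (L f)) * ennreal W) \<le> ennreal (1 / W) * (ennreal C1 * X f)"
        using C1(2)[of f n] that by (intro mult_left_mono) (auto simp: L_def W)
      moreover have "ennreal (1 / W) * (ennreal (cmod (L f)) * ennreal W) = ennreal (cmod (L f))"
        using W by (simp flip: ennreal_mult)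
      moreover have "ennreal (1 / W) * (ennreal C1 * X f) = ennreal (C1 / W) * X f"
        using W C1 by (simp add: mult.assoc[symmetric] flip: ennreal_mult)
      ultimately show ?thesis by simp
    qed
    have "bounded_functional ?X X L"
      unfolding bounded_functional_def
    proof (intro conjI ballI allI exI[of _ "C1 / W"])
      fix f g assume "f \<in> ?X" "g \<in> ?X"
      then show "L (\<lambda>z. f z + g z) = L f + L g"
        unfolding L_def by (subst higher_deriv_add[of f unit_disc g]) (auto simp: add_divide_distrib)
    next
      fix c f assume "f \<in> ?X"
      then show "L (\<lambda>z. c * f z) = c * L f"
        unfolding L_def by (subst higher_deriv_cmult[of f unit_disc]) auto
    qed (rule Lb)
    then obtain gg where gg: "gg \<in> ?Y" "\<And>f. f \<in> ?X \<Longrightarrow> L f = pairing \<gamma> f gg" using rep by blast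
    have gh: "gg holomorphic_on unit_disc" and gm: "gg \<in> disc_measurable" using gg(1) by auto
    \<comment> \<open>Absolute convergence of the pairing with the constant function 1 = z^0 is
      integrability against the standard weight.\<close>
    have gL1: "gg \<in> L1_space \<gamma>"
    proof (rule L1_spaceI[OF gm _ g])
      have "integrable dA (\<lambda>z. 1 * cnj (gg z) * of_real (std_weight \<gamma> z))"
        using int[OF mon[of 0] gg(1)] by simp
      then have "integrable dA (\<lambda>z. cnj (1 * cnj (gg z) * of_real (std_weight \<gamma> z)))" by (rule Bochner_Integration.integrable_cnj)
      then show "integrable dA (\<lambda>z. gg z * of_real (std_weight \<gamma> z))" by simp
    qed
    have gcoef: "(deriv ^^ m) gg 0 / fact m = (if m = n then of_real (bcoef \<gamma> n) else 0)" for m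
    proof -
      have bm: "bcoef \<gamma> m \<noteq> 0" using bcoef_pos[OF g, of m] by simp
      have "cnj (coef \<gamma> gg m) = (\<integral>z. cnj (gg z * cnj z ^ m * of_real (std_weight \<gamma> z)) \<partial>dA)"
        unfolding coef_def by (rule Bochner_Integration.integral_cnj[symmetric])
      also have "\<dots> = pairing \<gamma> (\<lambda>z. z ^ m) gg"
        unfolding pairing_def by (intro Bochner_Integration.integral_cong) (auto simp: mult_ac)
      also have "\<dots> = L (\<lambda>z. z ^ m)" by (rule gg(2)[OF mon, symmetric])
      also have "\<dots> = (if m = n then 1 else 0)" unfolding L_def by (rule higher_deriv_monomial_0)
      finally have "cnj (coef \<gamma> gg m) = (if m = n then 1 else 0)" .
      then have "coef \<gamma> gg m = (if m = n then 1 else 0)" by (metis complex_cnj_cnj complex_cnj_one complex_cnj_zero)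
      then show ?thesis using bm by (simp add: coef_holomorphic[OF gL1 gh g] split: if_splits)
    qed
    have gz: "gg z = of_real (bcoef \<gamma> n) * z ^ n" if "z \<in> unit_disc" for z
    proof -
      have "(\<lambda>m. (deriv ^^ m) gg 0 / fact m * (z - 0) ^ m) sums gg z"
        by (rule holomorphic_power_series[OF gh that])
      moreover have "(deriv ^^ m) gg 0 / fact m * (z - 0) ^ m = (if m = n then of_real (bcoef \<gamma> n) * z ^ n else 0)" for m
        by (simp add: gcoef)
      ultimately have "(\<lambda>m. if m = n then of_real (bcoef \<gamma> n) * z ^ n else 0) sums gg z" by simp
      from sums_unique2[OF this sums_single] show ?thesis by simp
    qed
    have "ennreal aY * elp RM p' (\<lambda>r. ennreal (bcoef \<gamma> n * \<bar>r\<bar> ^ n) * epowr (s r) (1 / p')) \<le> Y gg"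
    proof -
      have "AE z in dA. gg z = of_real (bcoef \<gamma> n) * z ^ n" by (rule AE_I2) (simp add: space_dA gz)
      then show ?thesis
        using Y(3)[of "\<lambda>z. of_real (bcoef \<gamma> n) * z ^ n" "\<lambda>r. ennreal (bcoef \<gamma> n * \<bar>r\<bar> ^ n)" gg] bn
        by (auto simp: norm_mult norm_power power_mult_distrib)
    qed
    also have "elp RM p' (\<lambda>r. ennreal (bcoef \<gamma> n * \<bar>r\<bar> ^ n) * epowr (s r) (1 / p')) = ennreal (bcoef \<gamma> n) * epowr (mo s (real n * p')) (1 / p')"
    proof -
      have "elp RM p' (\<lambda>r. ennreal (bcoef \<gamma> n * \<bar>r\<bar> ^ n) * epowr (s r) (1 / p')) = elp RM p' (\<lambda>r. ennreal (bcoef \<gamma> n) * (ennreal (r ^ n) * epowr (s r) (1 / p')))"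
        using AE_RM_range bn by (intro elp_cong_AE) (auto elim!: eventually_mono simp: ennreal_mult mult.assoc)
      then show ?thesis using pp by (subst (asm) elp_cmult) (auto simp: elp_monomial)
    qed
    also have "Y gg \<le> ennreal C2 * functional_norm ?X X (\<lambda>f. pairing \<gamma> f gg)" by (rule C2(2)[OF gg(1)])
    also have "functional_norm ?X X (\<lambda>f. pairing \<gamma> f gg) \<le> ennreal (C1 / W)"
      unfolding functional_norm_def
    proof (rule SUP_least)
      fix f assume f: "f \<in> {f \<in> ?X. X f \<le> 1}"
      then have "ennreal (cmod (pairing \<gamma> f gg)) \<le> ennreal (C1 / W) * X f" using Lb[of f] gg(2)[of f] by auto
      also have "\<dots> \<le> ennreal (C1 / W) * 1" using f by (intro mult_left_mono) auto
      finally show "ennreal (cmod (pairing \<gamma> f gg)) \<le> ennreal (C1 / W)" by simp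
    qed
    finally have "ennreal aY * (ennreal (bcoef \<gamma> n) * epowr (mo s (real n * p')) (1 / p')) \<le> ennreal C2 * ennreal (C1 / W)"
      by (simp add: mult_left_mono)
    then have "ennreal (W / (aY * bcoef \<gamma> n)) * (ennreal aY * (ennreal (bcoef \<gamma> n) * epowr (mo s (real n * p')) (1 / p'))) \<le> ennreal (W / (aY * bcoef \<gamma> n)) * (ennreal C2 * ennreal (C1 / W))"
      by (rule mult_left_mono) simp
    also have "ennreal (W / (aY * bcoef \<gamma> n)) * (ennreal aY * (ennreal (bcoef \<gamma> n) * epowr (mo s (real n * p')) (1 / p'))) = ennreal W * epowr (mo s (real n * p')) (1 / p')"
      using W Y(1) bn by (simp add: mult.assoc[symmetric] flip: ennreal_mult)
    also have "ennreal (W / (aY * bcoef \<gamma> n)) * (ennreal C2 * ennreal (C1 / W)) = ennreal (C1 * C2 / aY * (1 / bcoef \<gamma> n))"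
      using W Y(1) bn C1(1) C2(1) by (simp flip: ennreal_mult)
    finally show "epowr (mo w (real n * p)) (1 / p) * epowr (mo s (real n * p')) (1 / p') \<le> ennreal (C1 * C2 / aY * (1 / bcoef \<gamma> n))"
      by (simp only: W)
  qed
qed

end

section \<open>Boundedness under the Bekolle-Bonami condition\<close>

definition absp :: "(complex \<Rightarrow> complex) \<Rightarrow> real \<Rightarrow> real \<Rightarrow> ennreal" where
  "absp F \<theta> r = ennreal (cmod (F (of_real r * cis \<theta>)))"

lemma absp_measurable: "F \<in> borel_fun \<Longrightarrow> polar_measurable (absp F)"
  unfolding absp_def[abs_def] by (rule polar_abs_measurable)

lemma disc_cut_AE: "AE z in dA. f z = disc_cut f z"
  by (rule AE_I2) (simp add: disc_cut_def space_dA)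

lemma Ln_mono_AE:
  "0 < p \<Longrightarrow> 0 < q \<Longrightarrow> AE \<theta> in TM. AE r in RM. F \<theta> r \<le> G \<theta> r \<Longrightarrow> Ln p q w F \<le> Ln p q w G"
  unfolding Ln_def by (rule elp2_mono_AE) (auto elim!: eventually_mono intro: mult_right_mono)

lemma Ln_cmult:
  assumes "0 < p" "0 < q" and F: "polar_measurable F" and [measurable]: "w \<in> borel_fun"
  shows "Ln p q w (\<lambda>\<theta> r. c * F \<theta> r) = c * Ln p q w F"
proof -
  note polar_measurableD[OF F, measurable]
  show ?thesis unfolding Ln_def mult.assoc
    by (rule RM.elp2_cmult) (use assms in measurable)
qed

text \<open>The weights on the disc are joined to their radial profiles, on the real axis for the
  mixed norm and in area for the tent norm. As both weights enter in the same way, exchanging them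
  together with the exponents gives an instance again.\<close>

locale dual_norms = dual_weights p \<gamma> B w s for p \<gamma> B :: real and w s :: "real \<Rightarrow> ennreal" +
  fixes q :: real and \<nu> \<nu>' :: "complex \<Rightarrow> ennreal"
  assumes q: "1 < q"
    and \<nu>: "AE r in RM. \<nu> (of_real r) = w r" "AE z in dA. \<nu> z = w (cmod z)"
    and \<nu>': "AE r in RM. \<nu>' (of_real r) = s r" "AE z in dA. \<nu>' z = s (cmod z)"

lemma dual_norms_commute:
  assumes "dual_norms p \<gamma> B w s q \<nu> \<nu>'"
  shows "dual_norms (conj_exponent p) \<gamma> B s w (conj_exponent q) \<nu>' \<nu>"
proof -
  interpret dual_norms p \<gamma> B w s q \<nu> \<nu>' by (rule assms)
  interpret D': dual_weights "conj_exponent p" \<gamma> B s w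
    by (rule dual_weights_commute) unfold_locales
  show ?thesis using \<nu> \<nu>' conj_exponent(1)[OF q] by unfold_locales
qed

context dual_norms begin

abbreviation "q' \<equiv> conj_exponent q"
lemmas qq = conj_exponent[OF q]
abbreviation "LN \<equiv> L_norm p q \<nu>"
abbreviation "LN' \<equiv> L_norm p' q' \<nu>'"
abbreviation "TN \<equiv> T_norm p q \<nu>"
abbreviation "cL \<equiv> ennreal ((1 / (2 * pi)) powr (1 / q))"
abbreviation "cL' \<equiv> ennreal ((1 / (2 * pi)) powr (1 / q'))"
abbreviation "cT \<equiv> ennreal ((1 / pi) powr (1 / p))"

lemma pq0: "0 < p" "0 < q" "0 < p'" "0 < q'" using p q pp qq by auto

lemma LN_eq: "F \<in> borel_fun \<Longrightarrow> AE z in dA. f z = F z \<Longrightarrow> LN f = cL * Ln p q w (absp F)"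
  using L_norm_eq[OF pq0(1,2) _ _ w \<nu>(1)] unfolding absp_def[abs_def] by blast

lemma LN'_eq: "F \<in> borel_fun \<Longrightarrow> AE z in dA. f z = F z \<Longrightarrow> LN' f = cL' * Ln p' q' s (absp F)"
  using L_norm_eq[OF pq0(3,4) _ _ s \<nu>'(1)] unfolding absp_def[abs_def] by blast

lemma TN_eq: "F \<in> borel_fun \<Longrightarrow> AE z in dA. f z = F z \<Longrightarrow> TN f = cT * Tn p q w (absp F)"
  using T_norm_eq[OF pq0(1,2) _ _ w \<nu>(2)] unfolding absp_def[abs_def] by blast

lemma LN_le:
  assumes F: "F \<in> borel_fun" "AE z in dA. f z = F z" and H: "H \<in> borel_fun" "AE z in dA. h z = H z"
    and le: "AE \<theta> in TM. AE r in RM. absp H \<theta> r \<le> c * absp F \<theta> r"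
  shows "LN h \<le> c * LN f"
proof -
  have "Ln p q w (absp H) \<le> Ln p q w (\<lambda>\<theta> r. c * absp F \<theta> r)" by (rule Ln_mono_AE[OF pq0(1,2) le])
  also have "\<dots> = c * Ln p q w (absp F)" by (rule Ln_cmult[OF pq0(1,2) absp_measurable[OF F(1)] w])
  finally show ?thesis unfolding LN_eq[OF F] LN_eq[OF H] by (subst mult.left_commute) (rule mult_left_mono, auto)
qed

lemma LN_scale_le:
  assumes "f \<in> disc_measurable"
  shows "LN (\<lambda>z. c * f z) \<le> ennreal (cmod c) * LN f"
proof -
  obtain F where F: "F \<in> borel_fun" "AE z in dA. f z = F z" using lebesgue_on_disc_borel_version[OF assms] .
  show ?thesis
    by (rule LN_le[OF F, of "\<lambda>z. c * F z"]) (use F in \<open>auto simp: absp_def norm_mult ennreal_mult\<close>)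
qed

lemma LN_cong:
  assumes f: "f \<in> disc_measurable" and "\<And>z. z \<in> unit_disc \<Longrightarrow> h z = f z"
  shows "LN h = LN f"
proof -
  obtain F where F: "F \<in> borel_fun" "AE z in dA. f z = F z" using lebesgue_on_disc_borel_version[OF f] .
  have "AE z in dA. h z = f z" by (rule AE_I2) (simp add: assms(2) space_dA)
  with F(2) have H: "AE z in dA. h z = F z" by eventually_elim simp
  show ?thesis unfolding LN_eq[OF F] LN_eq[OF F(1) H] ..
qed

lemma v_integral_le:
  assumes F: "polar_measurable F" and G: "polar_measurable G"
  shows "polar_int (\<lambda>\<theta> r. ennreal (vweight \<gamma> r) * (F \<theta> r * G \<theta> r)) \<le> Ln p q w F * Ln p' q' s G"
proof -
  note polar_measurableD[OF F, measurable] polar_measurableD[OF G, measurable]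
  have "polar_int (\<lambda>\<theta> r. ennreal (vweight \<gamma> r) * (F \<theta> r * G \<theta> r))
      = polar_int (\<lambda>\<theta> r. (F \<theta> r * epowr (w r) (1 / p)) * (G \<theta> r * epowr (s r) (1 / p')))"
  proof (rule nn_integral_cong, rule nn_integral_cong_AE)
    fix \<theta>
    show "AE r in RM. ennreal (vweight \<gamma> r) * (F \<theta> r * G \<theta> r) = (F \<theta> r * epowr (w r) (1 / p)) * (G \<theta> r * epowr (s r) (1 / p'))"
      using ws by eventually_elim (simp add: mult_ac flip: epowr_mult)
  qed
  also have "\<dots> \<le> Ln p q w F * Ln p' q' s G"
    unfolding Ln_def by (rule RM.elp2_Holder[OF p q]) measurable
  finally show ?thesis .
qed

lemma Ln_one_finite: "Ln p q w (\<lambda>_ _. 1) < top"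
proof -
  have "Ln p q w (\<lambda>_ _. 1) = ennreal ((2 * pi) powr (1 / q)) * elp RM p (\<lambda>r. 1 * epowr (w r) (1 / p))"
    by (rule Ln_radial) (use pq0 in auto)
  also have "elp RM p (\<lambda>r. 1 * epowr (w r) (1 / p)) = epowr (wtail w 0) (1 / p)"
  proof -
    have "(\<integral>\<^sup>+r. w r \<partial>RM) = wtail w 0"
      unfolding wtail_def by (rule nn_integral_cong_AE, rule eventually_mono[OF AE_RM_range]) simp
    then show ?thesis using pq0 by (simp add: elp_def epowr_inverse)
  qed
  finally show ?thesis using wtail_finite by (auto simp: epowr_def ennreal_mult_less_top)
qed

end

context dual_norms begin

lemma Ln'_one_finite: "Ln p' q' s (\<lambda>_ _. 1) < top"
  by (rule dual_norms.Ln_one_finite[OF dual_norms_commute]) unfold_locales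

lemma LN_bounded:
  assumes f: "f \<in> disc_measurable" and b: "\<And>z. z \<in> unit_disc \<Longrightarrow> cmod (f z) \<le> b"
  shows "LN f \<le> ennreal b * LN (\<lambda>_. 1)"
proof -
  obtain F where F: "F \<in> borel_fun" "AE z in dA. f z = F z" using lebesgue_on_disc_borel_version[OF f] .
  have "AE z in dA. z \<in> unit_disc" by (rule AE_I2) (simp add: space_dA)
  with F(2) have "AE z in dA. cmod (F z) \<le> b" by eventually_elim (metis b)
  then have "AE \<theta> in TM. AE r in RM. cmod (F (of_real r * cis \<theta>)) \<le> b" by (rule AE_dA_polar)
  then show ?thesis
    by (intro LN_le[OF _ _ F, of "\<lambda>_. 1"]) (auto simp: absp_def elim!: eventually_mono intro: ennreal_leI)
qed

lemma LN_one: "LN (\<lambda>_. 1) < top"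
proof -
  have "LN (\<lambda>_. 1) = cL * Ln p q w (\<lambda>_ _. 1)" using LN_eq[of "\<lambda>_. 1" "\<lambda>_. 1"] by (simp add: absp_def[abs_def])
  then show ?thesis using Ln_one_finite by (simp add: ennreal_mult_less_top)
qed

lemma nn_pairing_polar:
  assumes F: "F \<in> borel_fun" "AE z in dA. f z = F z" and G: "G \<in> borel_fun" "AE z in dA. g z = G z"
  shows "(\<integral>\<^sup>+z. ennreal (cmod (f z * cnj (g z) * of_real (std_weight \<gamma> z))) \<partial>dA)
     = ennreal (1 / pi) * polar_int (\<lambda>\<theta> r. ennreal (vweight \<gamma> r) * (absp F \<theta> r * absp G \<theta> r))"
proof -
  note F(1)[measurable] G(1)[measurable]
  have v0: "0 \<le> vweight \<gamma> r" for r using vweight_nonneg[OF g] .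
  have "(\<integral>\<^sup>+z. ennreal (cmod (f z * cnj (g z) * of_real (std_weight \<gamma> z))) \<partial>dA) = (\<integral>\<^sup>+z. ennreal (cmod (F z) * cmod (G z) * vweight \<gamma> (cmod z)) \<partial>dA)"
  proof (rule nn_integral_cong_AE)
    show "AE z in dA. ennreal (cmod (f z * cnj (g z) * of_real (std_weight \<gamma> z))) = ennreal (cmod (F z) * cmod (G z) * vweight \<gamma> (cmod z))"
      using F(2) G(2) by eventually_elim (simp add: norm_mult std_weight_eq v0)
  qed
  also have "\<dots> = ennreal (1 / pi) * polar_int (\<lambda>t r. ennreal (cmod (F (of_real r * cis t)) * cmod (G (of_real r * cis t)) * vweight \<gamma> (cmod (of_real r * cis t))))"
    by (rule nn_integral_dA) (simp add: vweight_def)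
  also have "polar_int (\<lambda>t r. ennreal (cmod (F (of_real r * cis t)) * cmod (G (of_real r * cis t)) * vweight \<gamma> (cmod (of_real r * cis t))))
    = polar_int (\<lambda>\<theta> r. ennreal (vweight \<gamma> r) * (absp F \<theta> r * absp G \<theta> r))"
  proof (rule nn_integral_cong, rule nn_integral_cong)
    fix t r :: real
    have "vweight \<gamma> (cmod (of_real r * cis t)) = vweight \<gamma> r" by (simp add: vweight_def norm_mult)
    then show "ennreal (cmod (F (of_real r * cis t)) * cmod (G (of_real r * cis t)) * vweight \<gamma> (cmod (of_real r * cis t))) = ennreal (vweight \<gamma> r) * (absp F t r * absp G t r)"
      by (simp only: absp_def ennreal_mult v0 norm_ge_zero mult_nonneg_nonneg mult_ac)
  qed
  finally show ?thesis .
qed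

text \<open>The first factor is the normalisation of the area measure; the other two undo the
  factors 1/(2\<pi>) inside the two mixed norms.\<close>

definition KH :: ennreal where "KH = ennreal (1 / pi) * ennreal ((2 * pi) powr (1 / q)) * ennreal ((2 * pi) powr (1 / q'))"

lemma KH_finite: "KH < top" by (simp add: KH_def ennreal_mult_less_top)

lemma pairing_Holder:
  assumes f: "f \<in> disc_measurable" and g: "g \<in> disc_measurable"
  shows "(\<integral>\<^sup>+z. ennreal (cmod (f z * cnj (g z) * of_real (std_weight \<gamma> z))) \<partial>dA) \<le> KH * (LN f * LN' g)"
proof -
  obtain F where F: "F \<in> borel_fun" "AE z in dA. f z = F z" using lebesgue_on_disc_borel_version[OF f] .
  obtain G where G: "G \<in> borel_fun" "AE z in dA. g z = G z" using lebesgue_on_disc_borel_version[OF g] .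
  have "(\<integral>\<^sup>+z. ennreal (cmod (f z * cnj (g z) * of_real (std_weight \<gamma> z))) \<partial>dA) \<le> ennreal (1 / pi) * (Ln p q w (absp F) * Ln p' q' s (absp G))"
    unfolding nn_pairing_polar[OF F G] by (intro mult_left_mono v_integral_le absp_measurable F G) simp
  also have "Ln p q w (absp F) = ennreal ((2 * pi) powr (1 / q)) * LN f"
    unfolding LN_eq[OF F] by (simp add: mult.assoc[symmetric] flip: ennreal_mult powr_mult)
  also have "Ln p' q' s (absp G) = ennreal ((2 * pi) powr (1 / q')) * LN' g"
    unfolding LN'_eq[OF G] by (simp add: mult.assoc[symmetric] flip: ennreal_mult powr_mult)
  also have "ennreal (1 / pi) * (ennreal ((2 * pi) powr (1 / q)) * LN f * (ennreal ((2 * pi) powr (1 / q')) * LN' g)) = KH * (LN f * LN' g)"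
    by (simp only: KH_def mult_ac)
  finally show ?thesis .
qed

lemma polar_finite_imp_L1:
  assumes f: "f \<in> disc_measurable" and F: "F \<in> borel_fun" "AE z in dA. f z = F z"
    and fin: "polar_int (\<lambda>\<theta> r. ennreal (vweight \<gamma> r) * (absp F \<theta> r * 1)) < top"
  shows "f \<in> L1_space \<gamma>"
proof -
  have "(\<integral>\<^sup>+z. ennreal (cmod (f z) * std_weight \<gamma> z) \<partial>dA) = (\<integral>\<^sup>+z. ennreal (cmod (f z * cnj 1 * of_real (std_weight \<gamma> z))) \<partial>dA)"
    using vweight_nonneg[OF g] by (intro nn_integral_cong) (simp add: norm_mult std_weight_eq)
  also have "\<dots> = ennreal (1 / pi) * polar_int (\<lambda>\<theta> r. ennreal (vweight \<gamma> r) * (absp F \<theta> r * absp (\<lambda>_. 1) \<theta> r))"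
    by (rule nn_pairing_polar[OF F]) auto
  also have "\<dots> < \<infinity>" using fin by (simp add: absp_def ennreal_mult_less_top)
  finally show ?thesis using f by (simp add: L1_space_def)
qed

text \<open>Hoelder against the constant 1, which has finite dual norm because the tail of s at 0 is
  finite.\<close>

lemma L_sub_L1:
  assumes f: "f \<in> disc_measurable" and fin: "LN f < top"
  shows "f \<in> L1_space \<gamma>"
proof -
  obtain F where F: "F \<in> borel_fun" "AE z in dA. f z = F z" using lebesgue_on_disc_borel_version[OF f] .
  have "Ln p q w (absp F) < top" using fin unfolding LN_eq[OF F] by (auto simp: ennreal_mult_less_top)
  then have "Ln p q w (absp F) * Ln p' q' s (\<lambda>_ _. 1) < top" using Ln'_one_finite by (simp add: ennreal_mult_less_top)
  with v_integral_le[OF absp_measurable[OF F(1)], of "\<lambda>_ _. 1"] show ?thesis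
    by (intro polar_finite_imp_L1[OF f F]) (auto intro: order_le_less_trans)
qed

text \<open>The tent norm controls the mixed norm of the tent average of |f|, which is thus
  integrable against v; its circular means dominate those of |f|.\<close>

lemma T_sub_L1:
  assumes f: "f \<in> disc_measurable" and fin: "TN f < top"
  shows "f \<in> L1_space \<gamma>"
proof -
  obtain F where F: "F \<in> borel_fun" "AE z in dA. f z = F z" using lebesgue_on_disc_borel_version[OF f] .
  note Fm = absp_measurable[OF F(1)]
  note Am = Av_measurable[OF Fm]
  note polar_measurableD[OF Fm, measurable] polar_measurableD[OF Am, measurable]
  have "Tn p q w (absp F) < top" using fin unfolding TN_eq[OF F] by (auto simp: ennreal_mult_less_top)
  then have "ennreal (6 powr ((p - 1) / p)) * Tn p q w (absp F) < top" by (simp add: ennreal_mult_less_top)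
  with Ln_Av_le_Tn[OF p pq0(2) w Fm] have "Ln p q w (Av (absp F)) < top" by (rule order_le_less_trans)
  then have "Ln p q w (Av (absp F)) * Ln p' q' s (\<lambda>_ _. 1) < top" using Ln'_one_finite by (simp add: ennreal_mult_less_top)
  with v_integral_le[OF Am, of "\<lambda>_ _. 1"] have A: "polar_int (\<lambda>\<theta> r. ennreal (vweight \<gamma> r) * (Av (absp F) \<theta> r * 1)) < top"
    by (auto intro: order_le_less_trans)
  have "polar_int (\<lambda>\<theta> r. ennreal (vweight \<gamma> r) * (absp F \<theta> r * 1)) = (\<integral>\<^sup>+r. \<integral>\<^sup>+\<theta>. ennreal (vweight \<gamma> r) * absp F \<theta> r \<partial>TM \<partial>RM)"
    unfolding mult_1_right by (rule TR.Fubini'[symmetric]) measurable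
  also have "\<dots> \<le> (\<integral>\<^sup>+r. \<integral>\<^sup>+\<theta>. ennreal (vweight \<gamma> r) * Av (absp F) \<theta> r \<partial>TM \<partial>RM)"
  proof (rule nn_integral_mono_AE)
    show "AE r in RM. (\<integral>\<^sup>+\<theta>. ennreal (vweight \<gamma> r) * absp F \<theta> r \<partial>TM) \<le> (\<integral>\<^sup>+\<theta>. ennreal (vweight \<gamma> r) * Av (absp F) \<theta> r \<partial>TM)"
      using AE_RM_range
    proof eventually_elim
      case (elim r)
      show ?case
        by (subst nn_integral_cmult, simp, subst nn_integral_cmult, simp) (rule mult_left_mono[OF nn_integral_le_Av[OF Fm elim]], simp)
    qed
  qed
  also have "\<dots> = polar_int (\<lambda>\<theta> r. ennreal (vweight \<gamma> r) * (Av (absp F) \<theta> r * 1))"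
    unfolding mult_1_right by (rule TR.Fubini') measurable
  also note A
  finally show ?thesis by (rule polar_finite_imp_L1[OF f F])
qed

text \<open>A pointwise bound by the maximal projection of |f|. It holds for both projections of f
  and, through the reproducing formula, for a holomorphic f itself, so the norm estimates are needed
  only once.\<close>

definition dominated :: "(complex \<Rightarrow> complex) \<Rightarrow> (complex \<Rightarrow> complex) \<Rightarrow> bool" where
  "dominated f h \<longleftrightarrow> (\<exists>F H. F \<in> borel_fun \<and> H \<in> borel_fun \<and>
     (AE z in dA. f z = F z) \<and> (AE z in dA. h z = H z) \<and>
     (\<forall>\<theta>. \<forall>r\<in>{0<..<1}. absp H \<theta> r \<le> ennreal (1 / pi) * Pplus \<gamma> (absp F) \<theta> r))"

text \<open>All three estimates rest on the bound for the maximal projection in the mixed norm. Its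
  near-constancy on tents raises the conclusion to the tent norm, and replacing F by its tent
  average weakens the hypothesis to the tent norm.\<close>

lemma dominated_bounds:
  obtains C :: real where "0 < C"
    "\<And>f h. dominated f h \<Longrightarrow> LN h \<le> ennreal C * LN f"
    "\<And>f h. dominated f h \<Longrightarrow> TN h \<le> ennreal C * LN f"
    "\<And>f h. dominated f h \<Longrightarrow> LN h \<le> ennreal C * TN f"
proof -
  obtain C1 where C1: "0 \<le> C1" "\<And>F. polar_measurable F \<Longrightarrow> Ln p q w (Pplus \<gamma> F) \<le> ennreal C1 * Ln p q w F"
    using Pplus_bounded[OF q] unfolding Ln_def by blast
  define d1 where "d1 = 3 powr (2 + \<gamma>)"
  define d2 where "d2 = 1 / pi"
  define d3 where "d3 = 6 powr ((p - 1) / p)"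
  define d4 where "d4 = 6 powr (1 / p)"
  define c1 where "c1 = (1 / (2 * pi)) powr (1 / q)"
  define c2 where "c2 = (1 / pi) powr (1 / p)"
  have d: "0 < d1" "0 < d2" "0 < d3" "0 < d4" "0 < c1" "0 < c2" by (auto simp: d1_def d2_def d3_def d4_def c1_def c2_def)
  \<comment> \<open>The three summands are the constants of the three estimates; divisions by c1 and
    c2 pass from polar norms back to the normalised ones.\<close>
  define C where "C = 1 + (d2 * C1 + c2 * (d4 * (d2 * d1)) * C1 / c1 + c1 * (d2 * d1) * C1 * d3 / c2)"
  have parts: "0 \<le> d2 * C1" "0 \<le> c2 * (d4 * (d2 * d1)) * C1 / c1" "0 \<le> c1 * (d2 * d1) * C1 * d3 / c2"
    using d C1 by auto
  show thesis
  proof (rule that[of C])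
    show "0 < C" using parts by (simp add: C_def)
    fix f h assume "dominated f h"
    then obtain F H where F: "F \<in> borel_fun" "AE z in dA. f z = F z" and H: "H \<in> borel_fun" "AE z in dA. h z = H z"
      and le: "\<And>\<theta> r. r \<in> {0<..<1} \<Longrightarrow> absp H \<theta> r \<le> ennreal d2 * Pplus \<gamma> (absp F) \<theta> r"
      unfolding dominated_def d2_def by blast
    note Fm = absp_measurable[OF F(1)] and Hm = absp_measurable[OF H(1)]
    note Am = Av_measurable[OF Fm]
    have LE: "LN h = ennreal c1 * Ln p q w (absp H)" "LN f = ennreal c1 * Ln p q w (absp F)"
      "TN h = ennreal c2 * Tn p q w (absp H)" "TN f = ennreal c2 * Tn p q w (absp F)"
      unfolding c1_def c2_def by (intro LN_eq TN_eq F H)+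
    have tent: "absp H t r \<le> ennreal (d2 * d1) * Pplus \<gamma> (absp F) \<theta> r" "absp H t r \<le> ennreal (d2 * d1) * Pplus \<gamma> (Av (absp F)) \<theta> r"
      if r: "r \<in> {0<..<1}" "tind \<theta> t r \<noteq> 0" for \<theta> t r
    proof -
      have "absp H t r \<le> ennreal d2 * (ennreal d1 * Pplus \<gamma> (absp F) \<theta> r)"
        unfolding d1_def by (rule order_trans[OF le[OF r(1)] mult_left_mono[OF Pplus_tent_le[OF g Fm r]]]) simp
      then show "absp H t r \<le> ennreal (d2 * d1) * Pplus \<gamma> (absp F) \<theta> r" using d by (simp add: ennreal_mult mult.assoc)
      have "absp H t r \<le> ennreal d2 * (ennreal d1 * Pplus \<gamma> (Av (absp F)) \<theta> r)"
        unfolding d1_def by (rule order_trans[OF le[OF r(1)] mult_left_mono[OF Pplus_tent_le_Av[OF g Fm r]]]) simp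
      then show "absp H t r \<le> ennreal (d2 * d1) * Pplus \<gamma> (Av (absp F)) \<theta> r" using d by (simp add: ennreal_mult mult.assoc)
    qed
    have LT: "Ln p q w (Av (absp F)) \<le> ennreal d3 * Tn p q w (absp F)"
      unfolding d3_def by (rule Ln_Av_le_Tn[OF p pq0(2) w Fm])
    have weaken: "x \<le> ennreal C * y" if "x \<le> ennreal c * y" "c \<le> C" for x y c
      using that mult_right_mono[OF ennreal_leI[OF that(2)], of y] by (auto intro: order_trans)
    have "LN h \<le> ennreal c1 * (ennreal d2 * (ennreal C1 * Ln p q w (absp F)))"
    proof -
      have "Ln p q w (absp H) \<le> Ln p q w (\<lambda>\<theta> r. ennreal d2 * Pplus \<gamma> (absp F) \<theta> r)"
        by (rule Ln_mono_AE[OF pq0(1,2)], rule AE_I2, rule eventually_mono[OF AE_RM_range]) (rule le)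
      also have "\<dots> = ennreal d2 * Ln p q w (Pplus \<gamma> (absp F))"
        by (rule Ln_cmult[OF pq0(1,2) Pplus_measurable[OF Fm] w])
      finally show ?thesis unfolding LE using C1(2)[OF Fm] by (meson mult_left_mono order_trans zero_le)
    qed
    also have "\<dots> = ennreal (d2 * C1) * LN f" unfolding LE using d C1 by (simp add: ennreal_mult mult_ac)
    finally show "LN h \<le> ennreal C * LN f" by (rule weaken) (use parts in \<open>simp add: C_def\<close>)
    have "TN h \<le> ennreal c2 * (ennreal (d4 * (d2 * d1)) * (ennreal C1 * Ln p q w (absp F)))"
    proof -
      have "Tn p q w (absp H) \<le> ennreal (d4 * (d2 * d1)) * Ln p q w (Pplus \<gamma> (absp F))"
        unfolding d4_def by (rule Tn_le_Ln[OF pq0(1,2) w Hm Pplus_measurable[OF Fm]]) (use d tent in auto)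
      then show ?thesis unfolding LE using C1(2)[OF Fm] by (meson mult_left_mono order_trans zero_le)
    qed
    also have "\<dots> = ennreal (c2 * (d4 * (d2 * d1)) * C1 / c1 * c1) * Ln p q w (absp F)"
      using d C1 by (simp add: ennreal_mult mult_ac)
    also have "\<dots> = ennreal (c2 * (d4 * (d2 * d1)) * C1 / c1) * LN f"
      unfolding LE using d C1 by (subst ennreal_mult) (auto simp: mult.assoc)
    finally show "TN h \<le> ennreal C * LN f" by (rule weaken) (use parts in \<open>simp add: C_def\<close>)
    have "LN h \<le> ennreal c1 * (ennreal (d2 * d1) * (ennreal C1 * (ennreal d3 * Tn p q w (absp F))))"
    proof -
      have "Ln p q w (absp H) \<le> Ln p q w (\<lambda>\<theta> r. ennreal (d2 * d1) * Pplus \<gamma> (Av (absp F)) \<theta> r)"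
        by (rule Ln_mono_AE[OF pq0(1,2)], rule AE_I2, rule eventually_mono[OF AE_RM_range], rule tent) (simp_all add: tind_self)
      also have "\<dots> = ennreal (d2 * d1) * Ln p q w (Pplus \<gamma> (Av (absp F)))"
        by (rule Ln_cmult[OF pq0(1,2) Pplus_measurable[OF Am] w])
      finally show ?thesis unfolding LE using C1(2)[OF Am] LT by (meson mult_left_mono order_trans zero_le)
    qed
    also have "\<dots> = ennreal (c1 * (d2 * d1) * C1 * d3 / c2 * c2) * Tn p q w (absp F)"
      using d C1 by (simp add: ennreal_mult mult_ac)
    also have "\<dots> = ennreal (c1 * (d2 * d1) * C1 * d3 / c2) * TN f"
      unfolding LE using d C1 by (subst ennreal_mult) (auto simp: mult.assoc)
    finally show "LN h \<le> ennreal C * TN f" by (rule weaken) (use parts in \<open>simp add: C_def\<close>)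
  qed
qed

lemma dominated_max_Bergman:
  assumes f: "f \<in> disc_measurable"
  shows "dominated f (max_Bergman_proj \<gamma> f)"
proof -
  obtain F where F: "F \<in> borel_fun" "AE z in dA. f z = F z" using lebesgue_on_disc_borel_version[OF f] .
  then show ?thesis
    unfolding dominated_def using Bergman_le_Pplus(2)[OF f F g] max_Bergman_measurable[OF f]
    by (intro exI[of _ F] exI[of _ "max_Bergman_proj \<gamma> f"]) (auto simp: absp_def[abs_def])
qed

lemma dominated_Bergman:
  assumes f: "f \<in> L1_space \<gamma>"
  shows "dominated f (Bergman_proj \<gamma> f)"
proof -
  have fm: "f \<in> disc_measurable" using f by (simp add: L1_space_def)
  obtain F where F: "F \<in> borel_fun" "AE z in dA. f z = F z" using lebesgue_on_disc_borel_version[OF fm] .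
  show ?thesis
    unfolding dominated_def
  proof (rule exI[of _ F], rule exI[of _ "disc_cut (Bergman_proj \<gamma> f)"], intro conjI F disc_cut_AE allI ballI)
    show "disc_cut (Bergman_proj \<gamma> f) \<in> borel_fun" by (rule disc_cut_measurable[OF Bergman_holomorphic[OF f g]])
    fix \<theta> r :: real assume r: "r \<in> {0<..<1}"
    then have "absp (disc_cut (Bergman_proj \<gamma> f)) \<theta> r = ennreal (cmod (Bergman_proj \<gamma> f (of_real r * cis \<theta>)))"
      by (simp add: absp_def disc_cut_def norm_mult)
    with Bergman_le_Pplus(1)[OF fm F g r] show "absp (disc_cut (Bergman_proj \<gamma> f)) \<theta> r \<le> ennreal (1 / pi) * Pplus \<gamma> (absp F) \<theta> r"
      by (simp add: absp_def[abs_def])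
  qed
qed

text \<open>A holomorphic function in the domain is its own projection, so it is dominated by the
  maximal projection of its modulus. This is how norms are compared on analytic functions.\<close>

lemma dominated_self:
  assumes f: "f \<in> L1_space \<gamma>" and h: "f holomorphic_on unit_disc"
  shows "dominated f f"
proof -
  obtain F H where F: "F \<in> borel_fun" "AE z in dA. f z = F z" and H: "H \<in> borel_fun" "AE z in dA. Bergman_proj \<gamma> f z = H z"
      and le: "\<And>\<theta> r. r \<in> {0<..<1} \<Longrightarrow> absp H \<theta> r \<le> ennreal (1 / pi) * Pplus \<gamma> (absp F) \<theta> r"
    using dominated_Bergman[OF f] unfolding dominated_def by blast
  have "AE z in dA. Bergman_proj \<gamma> f z = f z"
    by (rule AE_I2) (simp add: space_dA Bergman_reproducing[OF f h g])
  with H(2) have "AE z in dA. f z = H z" by eventually_elim simp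
  with F H le show ?thesis unfolding dominated_def by blast
qed

section \<open>Boundedness of the projections and comparison of the analytic spaces\<close>

lemma bounded_max_Bergman_L: "bounded_operator \<gamma> (max_Bergman_proj \<gamma>) (L_space p q \<nu>) LN (L_space p q \<nu>) LN"
proof -
  obtain C where C: "0 < C" "\<And>f h. dominated f h \<Longrightarrow> LN h \<le> ennreal C * LN f" by (rule dominated_bounds, rule that)
  have D: "LN (max_Bergman_proj \<gamma> f) \<le> ennreal C * LN f" if "f \<in> L_space p q \<nu>" for f
    using that by (intro C dominated_max_Bergman) (simp add: L_space_def)
  show ?thesis unfolding bounded_operator_def
  proof (intro conjI ballI exI[of _ C] D)
    show "L_space p q \<nu> \<subseteq> L1_space \<gamma>" using L_sub_L1 by (auto simp: L_space_def)
    fix f assume f: "f \<in> L_space p q \<nu>"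
    have "ennreal C * LN f < \<infinity>" using f by (simp add: L_space_def ennreal_mult_less_top)
    with D[OF f] have "LN (max_Bergman_proj \<gamma> f) < \<infinity>" by (rule order_le_less_trans)
    then show "max_Bergman_proj \<gamma> f \<in> L_space p q \<nu>"
      using f max_Bergman_measurable[of f \<gamma>] by (simp add: L_space_def borel_measurable_lebesgue_on_borel)
  qed
qed

text \<open>The estimate passes through the mixed norm: the projection of f has mixed norm
  controlled by the tent norm of f, and being holomorphic it is dominated by itself, which leads
  back to the tent norm. Two applications give the constant C * C.\<close>

lemma bounded_Bergman_T: "bounded_operator \<gamma> (Bergman_proj \<gamma>) (T_space p q \<nu>) TN (AT_space p q \<nu>) TN"
proof -
  obtain C where C: "0 < C" "\<And>f h. dominated f h \<Longrightarrow> TN h \<le> ennreal C * LN f" "\<And>f h. dominated f h \<Longrightarrow> LN h \<le> ennreal C * TN f"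
    by (rule dominated_bounds, rule that)
  have L1: "f \<in> L1_space \<gamma>" if "f \<in> T_space p q \<nu>" for f using that T_sub_L1[of f] by (simp add: T_space_def)
  have D: "TN (Bergman_proj \<gamma> f) \<le> ennreal (C * C) * TN f" if f: "f \<in> T_space p q \<nu>" for f
  proof -
    note hol = Bergman_holomorphic[OF L1[OF f] g]
    have le: "LN (Bergman_proj \<gamma> f) \<le> ennreal C * TN f" by (intro C dominated_Bergman L1 f)
    also have "\<dots> < top" using f by (simp add: T_space_def ennreal_mult_less_top)
    finally have "dominated (Bergman_proj \<gamma> f) (Bergman_proj \<gamma> f)"
      by (intro dominated_self L_sub_L1 holomorphic_measurable_disc hol)
    from order_trans[OF C(2)[OF this] mult_left_mono[OF le]] show ?thesis
      using C(1) by (simp add: ennreal_mult mult.assoc)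
  qed
  show ?thesis unfolding bounded_operator_def
  proof (intro conjI ballI exI[of _ "C * C"] D)
    show "T_space p q \<nu> \<subseteq> L1_space \<gamma>" using L1 by blast
    fix f assume f: "f \<in> T_space p q \<nu>"
    have "ennreal (C * C) * TN f < \<infinity>" using f by (simp add: T_space_def ennreal_mult_less_top)
    with D[OF f] have "TN (Bergman_proj \<gamma> f) < \<infinity>" by (rule order_le_less_trans)
    then show "Bergman_proj \<gamma> f \<in> AT_space p q \<nu>"
      using Bergman_holomorphic[OF L1[OF f] g] holomorphic_measurable_disc by (simp add: AT_space_def T_space_def)
  qed
qed

lemma AT_eq_AL:
  shows AT_space_eq: "AT_space p q \<nu> = AL_space p q \<nu>"
    and AT_norm_equiv: "\<exists>C>0. \<forall>f\<in>AL_space p q \<nu>. TN f \<le> ennreal C * LN f \<and> LN f \<le> ennreal C * TN f"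
proof -
  obtain C where C: "0 < C" "\<And>f h. dominated f h \<Longrightarrow> TN h \<le> ennreal C * LN f" "\<And>f h. dominated f h \<Longrightarrow> LN h \<le> ennreal C * TN f"
    by (rule dominated_bounds, rule that)
  have A: "TN f \<le> ennreal C * LN f \<and> LN f \<le> ennreal C * TN f" if "f \<in> L1_space \<gamma>" "f holomorphic_on unit_disc" for f
    using C(2,3) dominated_self[OF that] by blast
  have L1: "f \<in> AL_space p q \<nu> \<Longrightarrow> f \<in> L1_space \<gamma>" "f \<in> AT_space p q \<nu> \<Longrightarrow> f \<in> L1_space \<gamma>" for f
    using L_sub_L1[of f] T_sub_L1[of f] by (auto simp: AL_space_def AT_space_def L_space_def T_space_def)
  have fin: "ennreal C * x < \<infinity>" if "x < \<infinity>" for x using that by (simp add: ennreal_mult_less_top)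
  show "AT_space p q \<nu> = AL_space p q \<nu>"
  proof (intro equalityI subsetI)
    fix f assume f: "f \<in> AT_space p q \<nu>"
    then have "LN f \<le> ennreal C * TN f" using A[OF L1(2)[OF f]] by (simp add: AT_space_def)
    then show "f \<in> AL_space p q \<nu>" using f fin[of "TN f"] by (auto simp: AL_space_def AT_space_def L_space_def T_space_def intro: order_le_less_trans)
  next
    fix f assume f: "f \<in> AL_space p q \<nu>"
    then have "TN f \<le> ennreal C * LN f" using A[OF L1(1)[OF f]] by (simp add: AL_space_def)
    then show "f \<in> AT_space p q \<nu>" using f fin[of "LN f"] by (auto simp: AL_space_def AT_space_def L_space_def T_space_def intro: order_le_less_trans)
  qed
  show "\<exists>C>0. \<forall>f\<in>AL_space p q \<nu>. TN f \<le> ennreal C * LN f \<and> LN f \<le> ennreal C * TN f"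
    using A L1(1) C(1) by (auto simp: AL_space_def)
qed

end

lemma L_norm_mono:
  assumes "0 < p" "0 < q" "\<And>z. z \<in> unit_disc \<Longrightarrow> cmod (f z) \<le> cmod (g z)"
  shows "L_norm p q \<nu> f \<le> L_norm p q \<nu> g"
proof -
  have "(\<integral>\<^sup>+r\<in>{0..<1}. ennreal (cmod (f (of_real r * cis \<theta>)) powr p) * \<nu> (of_real r) * ennreal r \<partial>lebesgue)
    \<le> (\<integral>\<^sup>+r\<in>{0..<1}. ennreal (cmod (g (of_real r * cis \<theta>)) powr p) * \<nu> (of_real r) * ennreal r \<partial>lebesgue)" for \<theta>
  proof (rule nn_integral_mono)
    fix r :: real
    show "ennreal (cmod (f (of_real r * cis \<theta>)) powr p) * \<nu> (of_real r) * ennreal r * indicator {0..<1} r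
      \<le> ennreal (cmod (g (of_real r * cis \<theta>)) powr p) * \<nu> (of_real r) * ennreal r * indicator {0..<1} r"
    proof (cases "r \<in> {0..<1}")
      case True
      then show ?thesis using assms by (intro mult_right_mono ennreal_leI powr_mono2) (auto simp: norm_mult)
    qed simp
  qed
  then show ?thesis
    unfolding L_norm_def using assms(1,2)
    by (intro epowr_mono mult_left_mono, simp_all) (rule nn_integral_mono, rule mult_right_mono, rule epowr_mono, auto)
qed

text \<open>The modulus |f| has the same norm as f, and its maximal projection dominates the
  projection of f pointwise.\<close>

lemma bounded_max_imp_bounded_Bergman:
  assumes pq: "0 < p" "0 < q" and g: "-1 < \<gamma>"
    and bd: "bounded_operator \<gamma> (max_Bergman_proj \<gamma>) (L_space p q \<nu>) (L_norm p q \<nu>) (L_space p q \<nu>) (L_norm p q \<nu>)"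
  shows "bounded_operator \<gamma> (Bergman_proj \<gamma>) (L_space p q \<nu>) (L_norm p q \<nu>) (AL_space p q \<nu>) (L_norm p q \<nu>)"
proof -
  obtain C where L1: "L_space p q \<nu> \<subseteq> L1_space \<gamma>"
    and C: "\<And>f. f \<in> L_space p q \<nu> \<Longrightarrow> L_norm p q \<nu> (max_Bergman_proj \<gamma> f) \<le> ennreal C * L_norm p q \<nu> f"
    using bd unfolding bounded_operator_def by blast
  have D: "L_norm p q \<nu> (Bergman_proj \<gamma> f) \<le> ennreal C * L_norm p q \<nu> f" if f: "f \<in> L_space p q \<nu>" for f
  proof -
    let ?a = "\<lambda>z. of_real (cmod (f z)) :: complex"
    have n: "L_norm p q \<nu> ?a = L_norm p q \<nu> f" by (simp add: L_norm_def)
    have [measurable]: "f \<in> disc_measurable" using f by (simp add: L_space_def)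
    have a: "?a \<in> L_space p q \<nu>" using f n by (simp add: L_space_def)
    have "L_norm p q \<nu> (Bergman_proj \<gamma> f) \<le> L_norm p q \<nu> (max_Bergman_proj \<gamma> ?a)"
      using f L1 by (intro L_norm_mono pq Bergman_le_max_Bergman g) auto
    also have "\<dots> \<le> ennreal C * L_norm p q \<nu> f" using C[OF a] by (simp only: n)
    finally show ?thesis .
  qed
  show ?thesis unfolding bounded_operator_def
  proof (intro conjI ballI exI[of _ C] D L1)
    fix f assume f: "f \<in> L_space p q \<nu>"
    have "ennreal C * L_norm p q \<nu> f < \<infinity>" using f by (simp add: L_space_def ennreal_mult_less_top)
    with D[OF f] have "L_norm p q \<nu> (Bergman_proj \<gamma> f) < \<infinity>" by (rule order_le_less_trans)
    moreover have "Bergman_proj \<gamma> f holomorphic_on unit_disc" using f L1 by (intro Bergman_holomorphic g) auto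
    ultimately show "Bergman_proj \<gamma> f \<in> AL_space p q \<nu>"
      using holomorphic_measurable_disc by (simp add: AL_space_def L_space_def)
  qed
qed

section \<open>Duality\<close>

lemma epowr_tendsto_0:
  assumes a: "0 < a" and X: "(X \<longlongrightarrow> 0) F"
  shows "((\<lambda>i. epowr (X i) a) \<longlongrightarrow> 0) F"
proof (rule tendsto_zero_ennreal)
  fix e :: real assume e: "0 < e"
  have "0 < epowr (ennreal (e / 2)) (1 / a)" using e by (simp add: epowr_ennreal)
  with X have "\<forall>\<^sub>F i in F. X i < epowr (ennreal (e / 2)) (1 / a)" by (rule order_tendstoD)
  then show "\<forall>\<^sub>F i in F. epowr (X i) a < ennreal e"
  proof eventually_elim
    case (elim i)
    then have "epowr (X i) a \<le> ennreal (e / 2)" using a by (simp add: epowr_le_iff)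
    also have "\<dots> < ennreal e" using e by (simp add: ennreal_lessI)
    finally show ?case .
  qed
qed

lemma elp_tendsto_0:
  assumes p: "0 < p" and [measurable]: "\<And>i::nat. f i \<in> borel_measurable M" "g \<in> borel_measurable M"
    and le: "\<And>i. AE x in M. f i x \<le> g x" and lim: "AE x in M. (\<lambda>i. f i x) \<longlonglongrightarrow> 0" and fin: "elp M p g < top"
  shows "(\<lambda>i. elp M p (f i)) \<longlonglongrightarrow> 0"
proof -
  have "(\<lambda>i. \<integral>\<^sup>+x. epowr (f i x) p \<partial>M) \<longlonglongrightarrow> (\<integral>\<^sup>+x. 0 \<partial>M)"
  proof (rule nn_integral_dominated_convergence[where w="\<lambda>x. epowr (g x) p"])
    show "AE x in M. epowr (f i x) p \<le> epowr (g x) p" for i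
      using le[of i] p by (auto elim!: eventually_mono intro: epowr_mono)
    show "AE x in M. (\<lambda>i. epowr (f i x) p) \<longlonglongrightarrow> 0" using lim by eventually_elim (rule epowr_tendsto_0[OF p])
    show "(\<integral>\<^sup>+x. epowr (g x) p \<partial>M) < \<infinity>" using fin by (simp add: elp_def)
  qed measurable
  then show ?thesis unfolding elp_def using p by (intro epowr_tendsto_0) auto
qed

text \<open>Dominated convergence in the inner and then in the outer variable. The inner norm of the
  majorant is finite for almost every y, because the outer one is.\<close>

lemma (in sigma_finite_measure) elp2_tendsto_0:
  assumes p: "0 < p" and q: "0 < q" and f: "\<And>i::nat. case_prod (f i) \<in> borel_measurable (N \<Otimes>\<^sub>M M)"
    and g: "case_prod g \<in> borel_measurable (N \<Otimes>\<^sub>M M)"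
    and le: "\<And>i y x. f i y x \<le> g y x" and lim: "\<And>y. AE x in M. (\<lambda>i. f i y x) \<longlonglongrightarrow> 0" and fin: "elp2 N M p q g < top"
  shows "(\<lambda>i. elp2 N M p q (f i)) \<longlonglongrightarrow> 0"
  unfolding elp2_def
proof (rule elp_tendsto_0[OF q])
  note [measurable] = elp_measurable[OF f] elp_measurable[OF g]
  show "(\<lambda>y. elp M p (f i y)) \<in> borel_measurable N" for i by measurable
  show "(\<lambda>y. elp M p (g y)) \<in> borel_measurable N" by measurable
  show "AE y in N. elp M p (f i y) \<le> elp M p (g y)" for i
    by (rule AE_I2, rule elp_mono_AE[OF p], rule AE_I2, rule le)
  show fin': "elp N q (\<lambda>y. elp M p (g y)) < top" using fin by (simp add: elp2_def)
  have "(\<integral>\<^sup>+y. epowr (elp M p (g y)) q \<partial>N) \<noteq> \<infinity>" using fin' by (simp add: elp_def less_top)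
  then have "AE y in N. epowr (elp M p (g y)) q \<noteq> \<infinity>" by (intro nn_integral_PInf_AE) measurable
  then show "AE y in N. (\<lambda>i. elp M p (f i y)) \<longlonglongrightarrow> 0"
    using AE_space
  proof eventually_elim
    case (elim y)
    then have "elp M p (g y) < top" by (simp add: less_top)
    then show ?case
      by (intro elp_tendsto_0[OF p _ _ _ lim]) (use le borel_measurable_case_prodD(2)[OF f elim(2)] borel_measurable_case_prodD(2)[OF g elim(2)] in auto)
  qed
qed

lemma Arg2pi_measurable [measurable]: "Arg2pi \<in> borel_fun"
  by (rule borel_measurableI_greater) (use open_Arg2pi2pi_gt in auto)

lemma Arg2pi_polar: "0 < r \<Longrightarrow> \<theta> \<in> {0..<2 * pi} \<Longrightarrow> Arg2pi (of_real r * cis \<theta>) = \<theta>"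
  by (rule Arg2pi_unique[of r]) (auto simp: cis_conv_exp)

lemma AE_TM_less: "AE \<theta> in TM. \<theta> \<in> {0..<2 * pi}"
proof -
  have "AE \<theta> in TM. \<theta> \<noteq> 2 * pi"
    unfolding TM_def by (subst AE_density) (auto intro: eventually_mono[OF AE_lborel_singleton])
  with AE_TM_range show ?thesis by eventually_elim auto
qed

definition Rad :: "nat \<Rightarrow> real" where "Rad i = 1 - 1 / (real i + 2)"

lemma Rad: "0 \<le> Rad i" "Rad i < 1" "i \<le> j \<Longrightarrow> Rad i \<le> Rad j"
  by (auto simp: Rad_def field_simps)

lemma Rad_eventually:
  assumes "r < 1"
  shows "\<exists>n0. \<forall>n\<ge>n0. r \<le> Rad n"
proof -
  obtain n0 :: nat where n0: "1 / (1 - r) < real n0" using reals_Archimedean2 by blast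
  have "r \<le> Rad n" if "n \<ge> n0" for n
  proof -
    have "1 / (1 - r) \<le> real n + 2" using n0 that by simp
    then have "1 / (real n + 2) \<le> 1 - r" using assms by (simp add: field_simps)
    then show ?thesis by (simp add: Rad_def)
  qed
  then show ?thesis by blast
qed

context dual_norms begin

section \<open>The analytic spaces and the pairing between them\<close>

abbreviation "AX \<equiv> AL_space p q \<nu>"
abbreviation "AY \<equiv> AL_space p' q' \<nu>'"

lemma AX_iff: "f \<in> AX \<longleftrightarrow> f holomorphic_on unit_disc \<and> LN f < top"
  using holomorphic_measurable_disc[of f] by (auto simp: AL_space_def L_space_def)

lemma AY_iff: "f \<in> AY \<longleftrightarrow> f holomorphic_on unit_disc \<and> LN' f < top"
  using holomorphic_measurable_disc[of f] by (auto simp: AL_space_def L_space_def)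

lemma AX_L1: "f \<in> AX \<Longrightarrow> f \<in> L1_space \<gamma>"
  using L_sub_L1[of f] by (simp add: AL_space_def L_space_def)

lemma AY_L1: "f \<in> AY \<Longrightarrow> f \<in> L1_space \<gamma>"
  by (rule dual_norms.AX_L1[OF dual_norms_commute]) unfold_locales

lemma bounded_holomorphic_AX:
  assumes f: "f holomorphic_on unit_disc" and b: "\<And>z. z \<in> unit_disc \<Longrightarrow> cmod (f z) \<le> b"
  shows "f \<in> AX"
proof -
  have "LN f \<le> ennreal b * LN (\<lambda>_. 1)" by (rule LN_bounded[OF holomorphic_measurable_disc[OF f] b])
  also have "\<dots> < top" using LN_one by (simp add: ennreal_mult_less_top)
  finally show ?thesis using f by (simp add: AX_iff)
qed

lemma monomial_AX: "(\<lambda>z. z ^ n) \<in> AX"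
  by (rule bounded_holomorphic_AX[of _ 1]) (auto intro!: holomorphic_intros simp: norm_power power_le_one)

lemma scale_AX:
  assumes f: "f \<in> AX"
  shows "(\<lambda>z. c * f z) \<in> AX"
proof -
  have "LN (\<lambda>z. c * f z) \<le> ennreal (cmod c) * LN f"
    by (rule LN_scale_le) (use f in \<open>simp add: AX_iff holomorphic_measurable_disc\<close>)
  also have "\<dots> < top" using f by (simp add: AX_iff ennreal_mult_less_top)
  finally show ?thesis using f by (auto simp: AX_iff intro!: holomorphic_intros)
qed

lemma pairing_integrable:
  assumes f: "f \<in> disc_measurable" "LN f < top" and g: "g \<in> disc_measurable" "LN' g < top"
  shows "integrable dA (\<lambda>z. f z * cnj (g z) * of_real (std_weight \<gamma> z))"
proof (rule integrableI_bounded)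
  have [measurable]: "f \<in> borel_measurable dA" "g \<in> borel_measurable dA" using f(1) g(1) by (simp_all add: measurable_dA_iff)
  have [measurable]: "std_weight \<gamma> \<in> borel_measurable dA" by (rule borel_measurable_dA) measurable
  show "(\<lambda>z. f z * cnj (g z) * of_real (std_weight \<gamma> z)) \<in> borel_measurable dA" by measurable
  have "KH * (LN f * LN' g) < \<infinity>" using f(2) g(2) KH_finite by (simp add: ennreal_mult_less_top)
  with pairing_Holder[OF f(1) g(1)] show "(\<integral>\<^sup>+z. ennreal (norm (f z * cnj (g z) * of_real (std_weight \<gamma> z))) \<partial>dA) < \<infinity>"
    by (rule order_le_less_trans)
qed

lemma pairing_le:
  assumes f: "f \<in> disc_measurable" and g: "g \<in> disc_measurable"
  shows "ennreal (cmod (pairing \<gamma> f g)) \<le> KH * (LN f * LN' g)"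
proof -
  have [measurable]: "f \<in> borel_measurable dA" "g \<in> borel_measurable dA" using f g by (simp_all add: measurable_dA_iff)
  have [measurable]: "std_weight \<gamma> \<in> borel_measurable dA" by (rule borel_measurable_dA) measurable
  have "ennreal (cmod (pairing \<gamma> f g)) \<le> (\<integral>\<^sup>+z. ennreal (cmod (f z * cnj (g z) * of_real (std_weight \<gamma> z))) \<partial>dA)"
    unfolding pairing_def by (rule dA_norm_bound) measurable
  also note pairing_Holder[OF f g]
  finally show ?thesis .
qed

text \<open>Every point of the disc is eventually inside the cut, and |f| is a majorant of finite
  norm. This convergence takes the place of density of polynomials when a functional is
  represented.\<close>

lemma LN_cut_tendsto:
  assumes f: "f \<in> disc_measurable" and fin: "LN f < top"
  shows "(\<lambda>i. LN (\<lambda>z. if cmod z \<le> Rad i then 0 else f z)) \<longlonglongrightarrow> 0"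
proof -
  obtain F where F: "F \<in> borel_fun" "AE z in dA. f z = F z" using lebesgue_on_disc_borel_version[OF f] .
  note F(1)[measurable]
  note Fm = absp_measurable[OF F(1)]
  note polar_measurableD[OF Fm, measurable]
  let ?d = "\<lambda>i z. if cmod z \<le> Rad i then 0 else F z"
  have dm: "?d i \<in> borel_fun" for i by measurable
  note polar_measurableD[OF absp_measurable[OF dm], measurable]
  have "AE z in dA. (if cmod z \<le> Rad i then 0 else f z) = ?d i z" for i
    using F(2) by eventually_elim simp
  then have L: "LN (\<lambda>z. if cmod z \<le> Rad i then 0 else f z) = cL * Ln p q w (absp (?d i))" for i
    by (rule LN_eq[OF dm])
  have "(\<lambda>i. Ln p q w (absp (?d i))) \<longlonglongrightarrow> 0"
    unfolding Ln_def
  proof (rule RM.elp2_tendsto_0[OF pq0(1,2)])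
    show "polar_measurable (\<lambda>\<theta> r. absp (?d i) \<theta> r * epowr (w r) (1 / p))" for i by measurable
    show "polar_measurable (\<lambda>\<theta> r. absp F \<theta> r * epowr (w r) (1 / p))" by measurable
    show "absp (?d i) \<theta> r * epowr (w r) (1 / p) \<le> absp F \<theta> r * epowr (w r) (1 / p)" for i \<theta> r
      by (rule mult_right_mono) (auto simp: absp_def)
    show "elp2 TM RM p q (\<lambda>\<theta> r. absp F \<theta> r * epowr (w r) (1 / p)) < top"
      using fin unfolding LN_eq[OF F] Ln_def by (auto simp: ennreal_mult_less_top)
    show "AE r in RM. (\<lambda>i. absp (?d i) \<theta> r * epowr (w r) (1 / p)) \<longlonglongrightarrow> 0" for \<theta>
      using AE_RM_range
    proof eventually_elim
      case (elim r)
      obtain n0 where n0: "\<And>n. n \<ge> n0 \<Longrightarrow> r \<le> Rad n" using Rad_eventually[of r] elim by auto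
      have "\<forall>\<^sub>F i in sequentially. absp (?d i) \<theta> r * epowr (w r) (1 / p) = 0"
        using eventually_ge_at_top[of n0]
      proof eventually_elim
        case (elim i)
        with n0[of i] \<open>r \<in> {0<..<1}\<close> show ?case by (simp add: absp_def norm_mult)
      qed
      then show ?case by (rule tendsto_eventually)
    qed
  qed
  then have "(\<lambda>i. cL * Ln p q w (absp (?d i))) \<longlonglongrightarrow> cL * 0" by (intro ennreal_tendsto_cmult) auto
  then show ?thesis by (simp only: L) simp
qed

end

text \<open>On the support |z| \<le> R the monomial in the pairing is at most R^n. The decay makes
  the power series of the projection converge uniformly on the whole disc.\<close>

lemma coef_support_bound:
  assumes h: "h \<in> L1_space \<gamma>" and g: "-1 < \<gamma>" and R: "0 \<le> R" and supp: "\<And>z. cmod z > R \<Longrightarrow> h z = 0"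
  shows "cmod (coef \<gamma> h n) \<le> R ^ n * (\<integral>z. cmod (h z * of_real (std_weight \<gamma> z)) \<partial>dA)"
proof -
  have "cmod (coef \<gamma> h n) \<le> (\<integral>z. cmod (h z * cnj z ^ n * of_real (std_weight \<gamma> z)) \<partial>dA)"
    unfolding coef_def by (rule integral_norm_bound)
  also have "\<dots> \<le> (\<integral>z. R ^ n * cmod (h z * of_real (std_weight \<gamma> z)) \<partial>dA)"
  proof (rule integral_mono)
    show "integrable dA (\<lambda>z. cmod (h z * cnj z ^ n * of_real (std_weight \<gamma> z)))" by (rule integrable_norm[OF coef_integrable[OF h g]])
    show "integrable dA (\<lambda>z. R ^ n * cmod (h z * of_real (std_weight \<gamma> z)))" using L1_spaceD(2)[OF h g] by simp
    fix z
    show "cmod (h z * cnj z ^ n * of_real (std_weight \<gamma> z)) \<le> R ^ n * cmod (h z * of_real (std_weight \<gamma> z))"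
    proof (cases "cmod z \<le> R")
      case True
      then have "cmod z ^ n * cmod (h z * of_real (std_weight \<gamma> z)) \<le> R ^ n * cmod (h z * of_real (std_weight \<gamma> z))"
        by (intro mult_right_mono power_mono) auto
      then show ?thesis by (simp add: norm_mult norm_power mult_ac)
    qed (use supp[of z] in simp)
  qed
  finally show ?thesis by simp
qed

text \<open>The bound K lives in [0,\<infinity>] so that the functional norm itself, a supremum of
  extended numbers, can be inserted for it in the proof of equivalence of norms.\<close>

locale bounded_on_AX = dual_norms +
  fixes \<Lambda> :: "(complex \<Rightarrow> complex) \<Rightarrow> complex" and K :: ennreal
  assumes add: "\<And>f h. f \<in> AX \<Longrightarrow> h \<in> AX \<Longrightarrow> \<Lambda> (\<lambda>z. f z + h z) = \<Lambda> f + \<Lambda> h"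
    and scale: "\<And>c f. f \<in> AX \<Longrightarrow> \<Lambda> (\<lambda>z. c * f z) = c * \<Lambda> f"
    and bound: "\<And>f. f \<in> AX \<Longrightarrow> ennreal (cmod (\<Lambda> f)) \<le> K * LN f"
    and K: "K < top"
begin

text \<open>Bounded holomorphic functions belong to the space, and on them \<Lambda> is bounded by
  k0 times the supremum norm. In particular all monomials have values of modulus at most k0.\<close>

definition k0 :: real where "k0 = enn2real (K * LN (\<lambda>_. 1))"

lemma k0: "0 \<le> k0" "ennreal k0 = K * LN (\<lambda>_. 1)"
  using K LN_one by (simp_all add: k0_def ennreal_mult_less_top ennreal_enn2real)

lemma \<Lambda>_bounded:
  assumes f: "f holomorphic_on unit_disc" and b: "\<And>z. z \<in> unit_disc \<Longrightarrow> cmod (f z) \<le> b" and b0: "0 \<le> b"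
  shows "cmod (\<Lambda> f) \<le> b * k0"
proof -
  have "ennreal (cmod (\<Lambda> f)) \<le> K * LN f" by (rule bound[OF bounded_holomorphic_AX[OF f b]])
  also have "\<dots> \<le> K * (ennreal b * LN (\<lambda>_. 1))"
    by (intro mult_left_mono LN_bounded holomorphic_measurable_disc f b) auto
  also have "\<dots> = ennreal b * ennreal k0" by (simp add: k0(2) mult_ac)
  also have "\<dots> = ennreal (b * k0)" using b0 k0(1) by (simp add: ennreal_mult)
  finally show ?thesis using b0 k0(1) by (simp add: ennreal_le_iff)
qed

definition ell :: "nat \<Rightarrow> complex" where "ell n = \<Lambda> (\<lambda>z. z ^ n)"

lemma ell_bound: "cmod (ell n) \<le> k0"
proof -
  have "cmod (\<Lambda> (\<lambda>z. z ^ n)) \<le> 1 * k0"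
    by (rule \<Lambda>_bounded) (auto simp: norm_power power_le_one intro!: holomorphic_intros)
  then show ?thesis by (simp add: ell_def)
qed

text \<open>The formula is forced: if \<Lambda> is the pairing with g, then \<Lambda>(z^n) is the
  conjugate of \<open>coef \<gamma> g n\<close>, and the n-th Taylor coefficient of g = P g is
  \<open>bcoef \<gamma> n\<close> times that coefficient.\<close>

definition rep :: "complex \<Rightarrow> complex" where "rep z = (\<Sum>n. of_real (bcoef \<gamma> n) * cnj (ell n) * z ^ n)"

lemma rep_sums:
  assumes "z \<in> unit_disc"
  shows "(\<lambda>n. of_real (bcoef \<gamma> n) * cnj (ell n) * z ^ n) sums rep z"
proof -
  have "summable (\<lambda>n. of_real (bcoef \<gamma> n) * cnj (ell n) * z ^ n)"
  proof (rule summable_comparison_test'[OF summable_mult2[OF bcoef_summable[of "cmod z" \<gamma>], of k0]])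
    fix n :: nat
    have "bcoef \<gamma> n * cmod z ^ n * cmod (ell n) \<le> bcoef \<gamma> n * cmod z ^ n * k0"
      using bcoef_pos[OF g, of n] by (intro mult_left_mono ell_bound) auto
    then show "norm (of_real (bcoef \<gamma> n) * cnj (ell n) * z ^ n) \<le> bcoef \<gamma> n * cmod z ^ n * k0"
      using bcoef_pos[OF g, of n] by (simp add: norm_mult norm_power mult_ac)
  qed (use assms in auto)
  then show ?thesis unfolding rep_def by (rule summable_sums)
qed

lemma rep_holomorphic: "rep holomorphic_on unit_disc"
  by (rule power_series_holomorphic[where a="\<lambda>n. of_real (bcoef \<gamma> n) * cnj (ell n)"]) (use rep_sums in simp)

lemma poly_AX: "(\<lambda>z. \<Sum>n<N. a n * z ^ n) \<in> AX"
proof (rule bounded_holomorphic_AX[of _ "\<Sum>n<N. cmod (a n)"])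
  show "cmod (\<Sum>n<N. a n * z ^ n) \<le> (\<Sum>n<N. cmod (a n))" if "z \<in> unit_disc" for z
    by (rule order_trans[OF norm_sum], rule sum_mono) (use that in \<open>simp add: norm_mult norm_power mult_left_le power_le_one\<close>)
qed (intro holomorphic_intros)

lemma \<Lambda>_poly: "\<Lambda> (\<lambda>z. \<Sum>n<N. a n * z ^ n) = (\<Sum>n<N. a n * ell n)"
proof (induction N)
  case 0
  have "\<Lambda> (\<lambda>z. 0 * z ^ 0) = 0 * \<Lambda> (\<lambda>z. z ^ 0)" by (rule scale[OF monomial_AX])
  then show ?case by simp
next
  case (Suc N)
  have "\<Lambda> (\<lambda>z. (\<Sum>n<N. a n * z ^ n) + a N * z ^ N) = \<Lambda> (\<lambda>z. \<Sum>n<N. a n * z ^ n) + \<Lambda> (\<lambda>z. a N * z ^ N)"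
    by (rule add[OF poly_AX scale_AX[OF monomial_AX]])
  then show ?case by (simp add: Suc scale[OF monomial_AX] ell_def)
qed

context
  fixes h :: "complex \<Rightarrow> complex" and R :: real
  assumes h: "h \<in> L1_space \<gamma>" and R: "0 \<le> R" "R < 1" and supp: "\<And>z. cmod z > R \<Longrightarrow> h z = 0"
begin

definition hb :: real where "hb = (\<integral>z. cmod (h z * of_real (std_weight \<gamma> z)) \<partial>dA)"

lemma hb_nonneg: "0 \<le> hb" by (simp add: hb_def Bochner_Integration.integral_nonneg)

lemma summable_R: "summable (\<lambda>n. bcoef \<gamma> n * R ^ n * c)"
  using R by (intro summable_mult2 bcoef_summable)

lemma Bergman_coef_bound: "cmod (of_real (bcoef \<gamma> n) * coef \<gamma> h n) \<le> bcoef \<gamma> n * R ^ n * hb"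
  using mult_left_mono[OF coef_support_bound[OF h g R(1) supp, of n], of "bcoef \<gamma> n"] bcoef_pos[OF g, of n]
  by (simp add: norm_mult hb_def mult_ac)

text \<open>The Taylor polynomials of P h differ from it on the disc by at most the tail
  \<open>e N\<close> of a convergent series, and \<Lambda> is bounded by the supremum norm. Hence
  \<Lambda> may be applied to the power series term by term.\<close>

lemma \<Lambda>_Bergman_sums:
  shows Bergman_AX: "Bergman_proj \<gamma> h \<in> AX"
    and \<Lambda>_Bergman: "(\<lambda>n. of_real (bcoef \<gamma> n) * coef \<gamma> h n * ell n) sums \<Lambda> (Bergman_proj \<gamma> h)"
proof -
  let ?a = "\<lambda>n. of_real (bcoef \<gamma> n) * coef \<gamma> h n" and ?c = "\<lambda>n. bcoef \<gamma> n * R ^ n * hb"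
  define e where "e N = suminf ?c - sum ?c {..<N}" for N
  have c0: "0 \<le> ?c n" for n using R hb_nonneg bcoef_pos[OF g, of n] by simp
  have e0: "0 \<le> e N" for N
    using sum_le_suminf[OF summable_R, of "{..<N}"] c0 by (simp add: e_def)
  have hol: "(\<lambda>z. Bergman_proj \<gamma> h z - (\<Sum>n<N. ?a n * z ^ n)) holomorphic_on unit_disc" for N
    by (intro holomorphic_intros Bergman_holomorphic h g)
  have tail: "cmod (Bergman_proj \<gamma> h z - (\<Sum>n<N. ?a n * z ^ n)) \<le> e N" if z: "z \<in> unit_disc" for z N
  proof -
    have s: "(\<lambda>n. ?a n * z ^ n) sums Bergman_proj \<gamma> h z" using z by (intro Bergman_sums h g) simp
    then have "Bergman_proj \<gamma> h z - (\<Sum>n<N. ?a n * z ^ n) = (\<Sum>n. ?a (n + N) * z ^ (n + N))"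
      using suminf_minus_initial_segment[of "\<lambda>n. ?a n * z ^ n" N] by (simp add: sums_iff)
    also have "cmod \<dots> \<le> (\<Sum>n. ?c (n + N))"
    proof (rule norm_suminf_le)
      fix n
      have "cmod (?a (n + N)) * cmod z ^ (n + N) \<le> cmod (?a (n + N)) * 1"
        using z by (intro mult_left_mono power_le_one) auto
      also have "\<dots> \<le> ?c (n + N)" using Bergman_coef_bound[of "n + N"] by simp
      finally show "norm (?a (n + N) * z ^ (n + N)) \<le> ?c (n + N)" by (simp add: norm_mult norm_power)
    next
      show "summable (\<lambda>n. ?c (n + N))" using summable_R[of hb] by (subst summable_iff_shift)
    qed
    also have "\<dots> = e N" unfolding e_def by (rule suminf_minus_initial_segment[OF summable_R])
    finally show ?thesis .
  qed
  show AX: "Bergman_proj \<gamma> h \<in> AX"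
    by (rule bounded_holomorphic_AX[of _ "e 0"]) (use hol[of 0] tail[of _ 0] in auto)
  have D: "cmod (\<Lambda> (Bergman_proj \<gamma> h) - (\<Sum>n<N. ?a n * ell n)) \<le> e N * k0" for N
  proof -
    have "\<Lambda> (Bergman_proj \<gamma> h) = \<Lambda> (\<lambda>z. (Bergman_proj \<gamma> h z - (\<Sum>n<N. ?a n * z ^ n)) + (\<Sum>n<N. ?a n * z ^ n))" by simp
    also have "\<dots> = \<Lambda> (\<lambda>z. Bergman_proj \<gamma> h z - (\<Sum>n<N. ?a n * z ^ n)) + (\<Sum>n<N. ?a n * ell n)"
      unfolding \<Lambda>_poly[symmetric] by (rule add[OF bounded_holomorphic_AX[OF hol tail] poly_AX])
    finally show ?thesis using \<Lambda>_bounded[OF hol tail e0] by simp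
  qed
  have "e \<longlonglongrightarrow> suminf ?c - suminf ?c"
    unfolding e_def[abs_def] by (intro tendsto_intros summable_LIMSEQ summable_R)
  then have lim: "(\<lambda>N. e N * k0) \<longlonglongrightarrow> 0" by (auto intro: tendsto_mult_left_zero)
  have "(\<lambda>N. \<Lambda> (Bergman_proj \<gamma> h) - (\<Sum>n<N. ?a n * ell n)) \<longlonglongrightarrow> 0"
    by (rule Lim_null_comparison[OF _ lim]) (use D in simp)
  from tendsto_diff[OF tendsto_const[of "\<Lambda> (Bergman_proj \<gamma> h)"] this]
  show "(\<lambda>n. ?a n * ell n) sums \<Lambda> (Bergman_proj \<gamma> h)" by (simp add: sums_def)
qed

text \<open>Because h vanishes beyond radius R, the series of \<open>rep\<close> can be integrated
  term by term against it, with the majorant \<open>bcoef \<gamma> n\<close> R^n k0 |h| v. The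
  resulting series is the one for \<Lambda>(P h).\<close>

lemma pairing_rep:
  shows pairing_rep_integrable: "integrable dA (\<lambda>z. h z * cnj (rep z) * of_real (std_weight \<gamma> z))"
    and pairing_rep_sums: "(\<lambda>n. of_real (bcoef \<gamma> n) * coef \<gamma> h n * ell n) sums pairing \<gamma> h rep"
proof -
  let ?f = "\<lambda>n z. (of_real (bcoef \<gamma> n) * ell n) * (h z * cnj z ^ n * of_real (std_weight \<gamma> z))"
  have int: "integrable dA (?f n)" for n using coef_integrable[OF h g] by simp
  have bd: "norm (?f n z) \<le> bcoef \<gamma> n * R ^ n * (k0 * cmod (h z * of_real (std_weight \<gamma> z)))" for n z
  proof (cases "cmod z \<le> R")
    case True
    have "bcoef \<gamma> n * (cmod z ^ n * (cmod (ell n) * cmod (h z * of_real (std_weight \<gamma> z)))) \<le> bcoef \<gamma> n * (R ^ n * (k0 * cmod (h z * of_real (std_weight \<gamma> z))))"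
      using bcoef_pos[OF g, of n] True R k0 by (intro mult_left_mono mult_mono power_mono mult_right_mono ell_bound) auto
    then show ?thesis using bcoef_pos[OF g, of n] by (simp add: norm_mult norm_power mult_ac)
  next
    case False
    then show ?thesis using supp[of z] by simp
  qed
  have sm: "AE z in dA. summable (\<lambda>n. norm (?f n z))"
    by (rule AE_I2, rule summable_comparison_test'[OF summable_R]) (use bd in simp)
  have sI: "summable (\<lambda>n. \<integral>z. norm (?f n z) \<partial>dA)"
  proof (rule summable_comparison_test'[OF summable_R[of "k0 * hb"]])
    fix n
    have "(\<integral>z. norm (?f n z) \<partial>dA) \<le> (\<integral>z. bcoef \<gamma> n * R ^ n * (k0 * cmod (h z * of_real (std_weight \<gamma> z))) \<partial>dA)"
      by (rule integral_mono[OF integrable_norm[OF int] _ bd])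
         (use L1_spaceD(2)[OF h g] in \<open>intro integrable_mult_right integrable_norm\<close>)
    also have "\<dots> = bcoef \<gamma> n * R ^ n * (k0 * hb)" by (simp add: hb_def)
    finally show "norm (\<integral>z. norm (?f n z) \<partial>dA) \<le> bcoef \<gamma> n * R ^ n * (k0 * hb)" by simp
  qed
  have S: "(\<Sum>n. ?f n z) = h z * cnj (rep z) * of_real (std_weight \<gamma> z)" if z: "z \<in> space dA" for z
  proof -
    have "(\<lambda>n. cnj (of_real (bcoef \<gamma> n) * cnj (ell n) * z ^ n)) sums cnj (rep z)"
      unfolding sums_cnj using z by (intro rep_sums) (simp add: space_dA)
    from sums_mult2[OF this, of "h z * of_real (std_weight \<gamma> z)"]
    have "(\<lambda>n. ?f n z) sums (cnj (rep z) * (h z * of_real (std_weight \<gamma> z)))" by (simp add: mult_ac)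
    then show ?thesis by (simp add: sums_iff mult_ac)
  qed
  have "integrable dA (\<lambda>z. \<Sum>n. ?f n z)" by (rule integrable_suminf[OF int sm sI])
  then show "integrable dA (\<lambda>z. h z * cnj (rep z) * of_real (std_weight \<gamma> z))"
    by (subst (asm) Bochner_Integration.integrable_cong[OF refl S]) auto
  have "(\<lambda>n. integral\<^sup>L dA (?f n)) sums (\<integral>z. (\<Sum>n. ?f n z) \<partial>dA)" by (rule sums_integral[OF int sm sI])
  moreover have "(\<integral>z. (\<Sum>n. ?f n z) \<partial>dA) = pairing \<gamma> h rep"
    unfolding pairing_def by (rule Bochner_Integration.integral_cong[OF refl S])
  moreover have "integral\<^sup>L dA (?f n) = of_real (bcoef \<gamma> n) * coef \<gamma> h n * ell n" for n
  proof -
    have "integral\<^sup>L dA (?f n) = of_real (bcoef \<gamma> n) * ell n * coef \<gamma> h n"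
      unfolding coef_def by (rule integral_mult_right_zero)
    then show ?thesis by (simp only: mult_ac)
  qed
  ultimately show "(\<lambda>n. of_real (bcoef \<gamma> n) * coef \<gamma> h n * ell n) sums pairing \<gamma> h rep" by (simp only:)
qed

lemma \<Lambda>_eq_pairing: "\<Lambda> (Bergman_proj \<gamma> h) = pairing \<gamma> h rep"
  by (rule sums_unique2[OF \<Lambda>_Bergman pairing_rep_sums])

end

end

context bounded_on_AX begin

text \<open>The left side is turned into \<pi> |\<Lambda>(P h)| for a suitable h, where P is bounded
  and the norm of h is at most that of H. The weight m is a finite part of s vanishing beyond R: it
  makes h compactly supported, and m \<le> s keeps |h| w^(1/p) below H.\<close>

lemma rep_tested:
  assumes R: "0 \<le> R" "R < 1" and C: "\<And>f h. dominated f h \<Longrightarrow> LN h \<le> ennreal C * LN f"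
    and m: "m \<in> borel_fun" "\<And>r. m r \<le> s r" "\<And>r. m r < top" "\<And>r. r > R \<Longrightarrow> m r = 0"
    and H: "polar_measurable H" "\<And>\<theta> r. H \<theta> r \<le> of_nat j"
  shows "polar_int (\<lambda>\<theta> r. absp rep \<theta> r * epowr (m r) (1 / p') * H \<theta> r)
    \<le> ennreal pi * (K * (ennreal C * cL)) * elp2 TM RM p q H"
proof -
  note m(1)[measurable]
  note polar_measurableD[OF H(1), measurable]
  \<comment> \<open>The test function is given in polar coordinates; \<open>Arg2pi\<close> and the
    modulus turn it into a Borel function of z, which is faithful for angles in [0, 2\<pi>).\<close>
  define x where "x z = enn2real (H (Arg2pi z) (cmod z))" for z
  define y where "y r = enn2real (epowr (m r) (1 / p'))" for r
  let ?G = "disc_cut rep"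
  have Gm [measurable]: "?G \<in> borel_fun" by (rule disc_cut_measurable[OF rep_holomorphic])
  \<comment> \<open>The sign of \<open>rep\<close> makes the integrand of the pairing nonnegative,
    so that its absolute integral equals the modulus of the pairing; dividing by v removes the
    standard weight.\<close>
  define h where "h z = (if cmod z < 1 then sgn (?G z) * of_real (x z * y (cmod z) / vweight \<gamma> (cmod z)) else 0)" for z
  have [measurable]: "x \<in> borel_fun" unfolding x_def by measurable
  have [measurable]: "y \<in> borel_fun" unfolding y_def by measurable
  have hm [measurable]: "h \<in> borel_fun" unfolding h_def vweight_def by measurable
  have fin: "H \<theta> r < top" for \<theta> r using H(2) by (rule order_le_less_trans) (rule of_nat_less_top)
  have x0: "0 \<le> x z" and y0: "0 \<le> y r" for z r by (simp_all add: x_def y_def)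
  have vpos: "0 < vweight \<gamma> r" if "0 \<le> r" "r < 1" for r
  proof -
    have "r\<^sup>2 < 1" using that by (simp add: abs_square_less_1)
    then show ?thesis using g by (simp add: vweight_def)
  qed
  have xH: "ennreal (x (of_real r * cis \<theta>)) = H \<theta> r" if "r \<in> {0<..<1}" "\<theta> \<in> {0..<2 * pi}" for r \<theta>
    unfolding x_def by (subst Arg2pi_polar) (use that fin in \<open>auto simp: norm_mult ennreal_enn2real\<close>)
  have ym: "ennreal (y r) = epowr (m r) (1 / p')" for r using m(3) by (simp add: y_def ennreal_enn2real)
  have hz: "cmod (h (of_real r * cis \<theta>)) = cmod (sgn (?G (of_real r * cis \<theta>))) * (x (of_real r * cis \<theta>) * y r / vweight \<gamma> r)"
    if r: "r \<in> {0<..<1}" for r \<theta>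
  proof -
    have t: "cmod (sgn a * of_real t) = cmod (sgn a) * t" if "0 \<le> t" for a t using that by (simp add: norm_mult)
    have "h (of_real r * cis \<theta>) = sgn (?G (of_real r * cis \<theta>)) * of_real (x (of_real r * cis \<theta>) * y r / vweight \<gamma> r)"
      using r by (simp add: h_def norm_mult)
    moreover have "0 \<le> x (of_real r * cis \<theta>) * y r / vweight \<gamma> r" using x0 y0 vpos[of r] r by (auto intro!: divide_nonneg_pos)
    ultimately show ?thesis by (simp only: t)
  qed
  have hw: "absp h \<theta> r * epowr (w r) (1 / p) \<le> H \<theta> r"
    if r: "r \<in> {0<..<1}" and \<theta>: "\<theta> \<in> {0..<2 * pi}" and e: "epowr (w r) (1 / p) * epowr (s r) (1 / p') = ennreal (vweight \<gamma> r)" for r \<theta>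
  proof -
    let ?z = "of_real r * cis \<theta> :: complex"
    have v: "0 < vweight \<gamma> r" using r by (intro vpos) auto
    have "absp h \<theta> r = ennreal (cmod (sgn (?G ?z)) * (x ?z * y r / vweight \<gamma> r))"
      by (simp only: absp_def hz[OF r])
    also have "\<dots> \<le> ennreal (x ?z / vweight \<gamma> r * y r)"
      using v x0[of ?z] y0[of r] by (intro ennreal_leI) (simp add: norm_sgn)
    also have "\<dots> = ennreal (x ?z / vweight \<gamma> r) * ennreal (y r)" by (rule ennreal_mult) (use v x0 y0 in auto)
    finally have "absp h \<theta> r * epowr (w r) (1 / p) \<le> ennreal (x ?z / vweight \<gamma> r) * (epowr (w r) (1 / p) * ennreal (y r))"
      by (metis mult.assoc mult.commute mult_right_mono zero_le)
    also have "\<dots> \<le> ennreal (x ?z / vweight \<gamma> r) * (epowr (w r) (1 / p) * epowr (s r) (1 / p'))"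
      unfolding ym using pq0 by (intro mult_left_mono epowr_mono m(2)) auto
    also have "\<dots> = ennreal (x ?z / vweight \<gamma> r * vweight \<gamma> r)" unfolding e by (rule ennreal_mult[symmetric]) (use v x0 in auto)
    also have "x ?z / vweight \<gamma> r * vweight \<gamma> r = x ?z" using v by simp
    finally show ?thesis using xH[OF r \<theta>] by simp
  qed
  have Ln: "Ln p q w (absp h) \<le> elp2 TM RM p q H"
    unfolding Ln_def
  proof (rule elp2_mono_AE[OF pq0(1,2)])
    show "AE \<theta> in TM. AE r in RM. absp h \<theta> r * epowr (w r) (1 / p) \<le> H \<theta> r"
      using AE_TM_less
    proof eventually_elim
      case \<theta>: (elim \<theta>)
      show ?case using AE_RM_range ws by eventually_elim (rule hw[OF _ \<theta>])
    qed
  qed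
  have "elp2 TM RM p q H < top"
    by (rule elp2_bounded_finite[OF finite_measure_RM finite_measure_TM pq0(1,2) H(2)]) (rule of_nat_less_top)
  with Ln have "Ln p q w (absp h) < top" by (rule order_le_less_trans)
  then have hfin: "LN h < top" by (simp add: LN_eq[OF hm] ennreal_mult_less_top)
  have hml: "h \<in> disc_measurable" by (rule borel_measurable_lebesgue_on_borel[OF hm])
  have h1: "h \<in> L1_space \<gamma>" by (rule L_sub_L1[OF hml hfin])
  have supp: "h z = 0" if "cmod z > R" for z
    using m(4)[OF that] by (simp add: h_def y_def)
  note ctx = h1 R supp
  let ?\<phi> = "\<lambda>z. h z * cnj (rep z) * of_real (std_weight \<gamma> z)"
  have "?\<phi> z = of_real (cmod (?\<phi> z))" if z: "z \<in> space dA" for z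
  proof -
    have z1: "cmod z < 1" using z by (simp add: space_dA)
    have "h z = sgn (rep z) * of_real (x z * y (cmod z) / vweight \<gamma> (cmod z))"
      using z1 by (simp add: h_def disc_cut_def)
    then have "?\<phi> z = of_real (cmod (rep z)) * of_real (x z * y (cmod z) / vweight \<gamma> (cmod z)) * of_real (vweight \<gamma> (cmod z))"
      by (simp only: std_weight_eq sgn_mult_cnj[symmetric] mult_ac)
    also have "\<dots> = of_real (cmod (rep z) * (x z * y (cmod z)))"
      using vpos[OF norm_ge_zero z1] by simp
    finally have e: "?\<phi> z = of_real (cmod (rep z) * (x z * y (cmod z)))" .
    show ?thesis unfolding e by (simp only: norm_of_real abs_of_nonneg mult_nonneg_nonneg norm_ge_zero x0 y0)
  qed
  then have nrm: "(\<integral>\<^sup>+z. ennreal (cmod (?\<phi> z)) \<partial>dA) = ennreal (cmod (pairing \<gamma> h rep))"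
    unfolding pairing_def by (intro integral_eq_of_norm pairing_rep_integrable[OF ctx] AE_I2)
  have "polar_int (\<lambda>\<theta> r. absp rep \<theta> r * epowr (m r) (1 / p') * H \<theta> r)
      = polar_int (\<lambda>\<theta> r. ennreal (vweight \<gamma> r) * (absp h \<theta> r * absp ?G \<theta> r))"
  proof (rule nn_integral_cong_AE)
    show "AE \<theta> in TM. (\<integral>\<^sup>+r. absp rep \<theta> r * epowr (m r) (1 / p') * H \<theta> r \<partial>RM) = (\<integral>\<^sup>+r. ennreal (vweight \<gamma> r) * (absp h \<theta> r * absp ?G \<theta> r) \<partial>RM)"
      using AE_TM_less
    proof eventually_elim
      case \<theta>: (elim \<theta>)
      show ?case
      proof (rule nn_integral_cong_AE)
        show "AE r in RM. absp rep \<theta> r * epowr (m r) (1 / p') * H \<theta> r = ennreal (vweight \<gamma> r) * (absp h \<theta> r * absp ?G \<theta> r)"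
          using AE_RM_range
        proof eventually_elim
          case (elim r)
          let ?z = "of_real r * cis \<theta> :: complex"
          have v: "0 < vweight \<gamma> r" using elim by (intro vpos) auto
          have G: "?G ?z = rep ?z" using elim by (simp add: disc_cut_def norm_mult)
          have "cmod (h ?z) = cmod (sgn (rep ?z)) * (x ?z * y r / vweight \<gamma> r)"
            unfolding hz[OF elim] G ..
          then have "vweight \<gamma> r * (cmod (h ?z) * cmod (?G ?z)) = cmod (rep ?z) * y r * x ?z"
            using v G by (simp add: norm_sgn)
          then have "ennreal (vweight \<gamma> r * (cmod (h ?z) * cmod (?G ?z))) = ennreal (cmod (rep ?z) * y r * x ?z)" by simp
          then have "ennreal (vweight \<gamma> r) * (ennreal (cmod (h ?z)) * ennreal (cmod (?G ?z))) = ennreal (cmod (rep ?z)) * ennreal (y r) * ennreal (x ?z)"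
            using v x0 y0 by (simp only: ennreal_mult norm_ge_zero mult_nonneg_nonneg less_imp_le)
          then show ?case using xH[OF elim \<theta>] ym by (simp add: absp_def)
        qed
      qed
    qed
  qed
  also have "\<dots> = ennreal pi * (\<integral>\<^sup>+z. ennreal (cmod (?\<phi> z)) \<partial>dA)"
    unfolding nn_pairing_polar[OF hm _ Gm, of h rep, simplified, OF disc_cut_AE]
    by (simp add: mult.assoc[symmetric] flip: ennreal_mult)
  also have "\<dots> = ennreal pi * ennreal (cmod (\<Lambda> (Bergman_proj \<gamma> h)))"
    by (simp only: nrm \<Lambda>_eq_pairing[OF ctx])
  also have "\<dots> \<le> ennreal pi * (K * (ennreal C * (cL * elp2 TM RM p q H)))"
  proof (rule mult_left_mono)
    have "ennreal (cmod (\<Lambda> (Bergman_proj \<gamma> h))) \<le> K * LN (Bergman_proj \<gamma> h)" by (rule bound[OF Bergman_AX[OF ctx]])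
    also have "\<dots> \<le> K * (ennreal C * LN h)" by (intro mult_left_mono C dominated_Bergman h1) auto
    also have "\<dots> \<le> K * (ennreal C * (cL * elp2 TM RM p q H))"
      unfolding LN_eq[OF hm AE_I2[OF refl]] by (intro mult_left_mono Ln) auto
    finally show "ennreal (cmod (\<Lambda> (Bergman_proj \<gamma> h))) \<le> K * (ennreal C * (cL * elp2 TM RM p q H))" .
  qed simp
  finally show ?thesis by (simp only: mult.assoc)
qed

text \<open>The converse of Hoelder's inequality is applied to |\<open>rep\<close>| with s truncated
  both in height and at the radius \<open>Rad i\<close>. On that closed disc \<open>rep\<close> is
  bounded, so all norms are finite. The test functions are truncated as well, since
  \<open>rep_tested\<close> wants them bounded, and both truncations disappear by monotone
  convergence.\<close>

lemma rep_norm: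
  assumes C: "\<And>f h. dominated f h \<Longrightarrow> LN h \<le> ennreal C * LN f"
  shows "LN' rep \<le> cL' * (ennreal pi * (K * (ennreal C * cL)))"
proof -
  let ?G = "disc_cut rep" and ?K = "ennreal pi * (K * (ennreal C * cL))"
  have Gm: "?G \<in> borel_fun" by (rule disc_cut_measurable[OF rep_holomorphic])
  note polar_measurableD[OF absp_measurable[OF Gm], measurable]
  let ?m = "\<lambda>i r. min (s r) (of_nat i) * indicator {0..Rad i} r :: ennreal"
  have ms: "?m i r \<le> s r" for i r by (auto simp: indicator_def)
  have mi: "?m i r \<le> of_nat i" for i r by (auto simp: indicator_def)
  have mt: "?m i r < top" for i r using mi by (rule order_le_less_trans) (rule of_nat_less_top)
  have mR: "?m i r = 0" if "r > Rad i" for i r using that by simp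
  have mm: "?m i r \<le> ?m j r" if "i \<le> j" for i j r
    using Rad(3)[OF that] by (intro mult_mono min_of_nat_mono that) (auto simp: indicator_def)
  let ?F = "\<lambda>i \<theta> r. absp ?G \<theta> r * epowr (?m i r) (1 / p')"
  have Fm: "polar_measurable (?F i)" for i by measurable
  have "elp2 TM RM p' q' (\<lambda>\<theta> r. SUP i. ?F i \<theta> r) \<le> ?K"
  proof (rule RM.elp2_converse_Holder[OF pp(1) qq(1) _ Fm])
    show "incseq ?F"
      using pq0 by (intro incseq_SucI le_funI mult_left_mono epowr_mono mm) auto
    show "elp2 TM RM p' q' (?F i) < top" for i
    proof -
      have "compact (rep ` cball 0 (Rad i))"
      proof (rule compact_continuous_image[OF _ compact_cball])
        show "continuous_on (cball 0 (Rad i)) rep"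
          by (rule continuous_on_subset[OF holomorphic_on_imp_continuous_on[OF rep_holomorphic]]) (use Rad(2)[of i] in auto)
      qed
      then obtain b where b: "\<And>z. cmod z \<le> Rad i \<Longrightarrow> cmod (rep z) \<le> b"
        using compact_imp_bounded[THEN bounded_normE] by (metis image_eqI mem_cball_0)
      show ?thesis
      proof (rule elp2_bounded_finite[OF finite_measure_RM finite_measure_TM pq0(3,4)])
        fix \<theta> r :: real
        show "?F i \<theta> r \<le> ennreal b * epowr (of_nat i) (1 / p')"
        proof (cases "r \<in> {0..Rad i}")
          case True
          then have "absp ?G \<theta> r \<le> ennreal b" using Rad(2)[of i] b[of "of_real r * cis \<theta>"]
            by (auto simp: absp_def disc_cut_def norm_mult intro: ennreal_leI)
          then show ?thesis using pq0 by (intro mult_mono epowr_mono mi) auto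
        qed simp
      qed (simp add: ennreal_mult_less_top of_nat_less_top)
    qed
    fix i and H :: "real \<Rightarrow> real \<Rightarrow> ennreal" assume Hm: "polar_measurable H"
    note polar_measurableD[OF Hm, measurable]
    have tst: "polar_int (\<lambda>\<theta> r. ?F i \<theta> r * min (H \<theta> r) (of_nat j)) \<le> ?K * elp2 TM RM p q H" for j
    proof -
      have "polar_int (\<lambda>\<theta> r. ?F i \<theta> r * min (H \<theta> r) (of_nat j)) = polar_int (\<lambda>\<theta> r. absp rep \<theta> r * epowr (?m i r) (1 / p') * min (H \<theta> r) (of_nat j))"
        by (rule nn_integral_cong, rule nn_integral_cong_AE, rule eventually_mono[OF AE_RM_range]) (simp add: absp_def disc_cut_def norm_mult)
      also have "\<dots> \<le> ?K * elp2 TM RM p q (\<lambda>\<theta> r. min (H \<theta> r) (of_nat j))"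
      proof (rule rep_tested[OF Rad(1,2) C _ ms mt mR])
        show "?m i \<in> borel_fun" by measurable
        show "polar_measurable (\<lambda>\<theta> r. min (H \<theta> r) (of_nat j))" by measurable
        show "min (H \<theta> r) (of_nat j) \<le> of_nat j" for \<theta> r by simp
      qed
      also have "\<dots> \<le> ?K * elp2 TM RM p q H"
        by (rule mult_left_mono[OF elp2_mono[OF pq0(1,2)]]) auto
      finally show ?thesis .
    qed
    have minSUP: "(SUP j. min a (of_nat j)) = a" for a :: ennreal
      using SUP_truncate[of 0 "()" "\<lambda>_. UNIV" a] by simp
    have "polar_int (\<lambda>\<theta> r. ?F i \<theta> r * H \<theta> r) = polar_int (\<lambda>\<theta> r. (SUP j. ?F i \<theta> r * min (H \<theta> r) (of_nat j)))"
      by (simp only: SUP_mult_left_ennreal[symmetric] minSUP)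
    also have "\<dots> = (\<integral>\<^sup>+\<theta>. (SUP j. \<integral>\<^sup>+r. ?F i \<theta> r * min (H \<theta> r) (of_nat j) \<partial>RM) \<partial>TM)"
      by (rule nn_integral_cong, rule nn_integral_monotone_convergence_SUP)
         (auto intro!: incseq_SucI le_funI mult_left_mono min_of_nat_mono)
    also have "\<dots> = (SUP j. \<integral>\<^sup>+\<theta>. \<integral>\<^sup>+r. ?F i \<theta> r * min (H \<theta> r) (of_nat j) \<partial>RM \<partial>TM)"
    proof (rule nn_integral_monotone_convergence_SUP)
      show "incseq (\<lambda>j \<theta>. \<integral>\<^sup>+r. ?F i \<theta> r * min (H \<theta> r) (of_nat j) \<partial>RM)"
        by (rule incseq_SucI, rule le_funI, rule nn_integral_mono, rule mult_left_mono[OF min_of_nat_mono]) auto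
    qed measurable
    also have "\<dots> \<le> ?K * elp2 TM RM p q H" by (rule SUP_least[OF tst])
    finally show "polar_int (\<lambda>\<theta> r. ?F i \<theta> r * H \<theta> r) \<le> ?K * elp2 TM RM (conj_exponent p') (conj_exponent q') H"
      by (simp only: pp(3) qq(3))
  qed
  moreover have "Ln p' q' s (absp ?G) = elp2 TM RM p' q' (\<lambda>\<theta> r. SUP i. ?F i \<theta> r)"
    unfolding Ln_def
  proof (rule elp2_cong_AE, rule AE_I2, rule eventually_mono[OF AE_RM_range])
    fix \<theta> r :: real assume r: "r \<in> {0<..<1}"
    obtain n0 where n0: "\<And>n. n \<ge> n0 \<Longrightarrow> r \<le> Rad n" using Rad_eventually[of r] r by auto
    have "(SUP i. ?m i r) = s r"
      by (rule SUP_truncate[of n0]) (use n0 r in auto)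
    then show "absp ?G \<theta> r * epowr (s r) (1 / p') = (SUP i. ?F i \<theta> r)"
      using epowr_SUP[of "1 / p'" "\<lambda>i. ?m i r" UNIV] pq0 by (simp add: SUP_mult_left_ennreal[symmetric])
  qed
  ultimately have "Ln p' q' s (absp ?G) \<le> ?K" by simp
  then show ?thesis unfolding LN'_eq[OF Gm disc_cut_AE] by (rule mult_left_mono) simp
qed

lemma rep_AY: "rep \<in> AY"
proof -
  obtain C where "\<And>f h. dominated f h \<Longrightarrow> LN h \<le> ennreal C * LN f"
    by (rule dominated_bounds, rule that)
  from rep_norm[OF this] have "LN' rep \<le> cL' * (ennreal pi * (K * (ennreal C * cL)))" .
  also have "\<dots> < top" using K by (simp add: ennreal_mult_less_top)
  finally show ?thesis using rep_holomorphic by (simp add: AY_iff)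
qed

text \<open>Cut f at radius \<open>Rad i\<close> into an inner part c and an outer part d. For P c
  the representation is known, and f - P c = P d because f = P f. So the error is \<Lambda>(P d)
  minus the pairing of d with \<open>rep\<close>; both are bounded by the norm of d, which tends to
  0.\<close>

lemma \<Lambda>_representation:
  assumes f: "f \<in> AX"
  shows "\<Lambda> f = pairing \<gamma> f rep"
proof -
  obtain C where C: "\<And>f h. dominated f h \<Longrightarrow> LN h \<le> ennreal C * LN f"
    by (rule dominated_bounds, rule that)
  have fh: "f holomorphic_on unit_disc" and ff: "LN f < top" using f by (auto simp: AX_iff)
  have f1: "f \<in> L1_space \<gamma>" by (rule AX_L1[OF f])
  have fm [measurable]: "f \<in> disc_measurable" by (rule holomorphic_measurable_disc[OF fh])
  have gm: "rep \<in> disc_measurable" by (rule holomorphic_measurable_disc[OF rep_holomorphic])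
  have gf: "LN' rep < top" using rep_AY by (simp add: AY_iff)
  let ?d = "\<lambda>i z. if cmod z \<le> Rad i then 0 else f z" and ?c = "\<lambda>i z. if cmod z \<le> Rad i then f z else 0"
  let ?L = "K * ennreal C + KH * LN' rep"
  have [measurable]: "(\<lambda>z. cmod z) \<in> disc_measurable"
    by (rule borel_measurable_lebesgue_on_borel) measurable
  have bd: "ennreal (cmod (\<Lambda> f - pairing \<gamma> f rep)) \<le> ?L * LN (?d i)" for i
  proof -
    have cm: "?c i \<in> disc_measurable" and dm: "?d i \<in> disc_measurable" by measurable
    have "LN (?c i) \<le> LN f" "LN (?d i) \<le> LN f" using pq0 by (intro L_norm_mono; simp)+
    then have cf: "LN (?c i) < top" and df: "LN (?d i) < top" using ff by (auto intro: order_le_less_trans)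
    have c1: "?c i \<in> L1_space \<gamma>" and d1: "?d i \<in> L1_space \<gamma>" by (intro L_sub_L1 cm dm cf df)+
    have supp: "?c i z = 0" if "cmod z > Rad i" for z using that by simp
    note ctx = c1 Rad(1,2)[of i] supp
    have split: "f z - Bergman_proj \<gamma> (?c i) z = Bergman_proj \<gamma> (?d i) z" if z: "z \<in> unit_disc" for z
    proof -
      have z1: "cmod z < 1" using z by simp
      have "coef \<gamma> f n = coef \<gamma> (?c i) n + coef \<gamma> (?d i) n" for n
      proof -
        have "coef \<gamma> (?c i) n + coef \<gamma> (?d i) n = (\<integral>z. ?c i z * cnj z ^ n * of_real (std_weight \<gamma> z) + ?d i z * cnj z ^ n * of_real (std_weight \<gamma> z) \<partial>dA)"
          unfolding coef_def by (rule Bochner_Integration.integral_add[symmetric]) (intro coef_integrable c1 d1 g)+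
        also have "\<dots> = coef \<gamma> f n" unfolding coef_def by (rule Bochner_Integration.integral_cong) auto
        finally show ?thesis by simp
      qed
      then have "(\<lambda>n. of_real (bcoef \<gamma> n) * coef \<gamma> f n * z ^ n) sums (Bergman_proj \<gamma> (?c i) z + Bergman_proj \<gamma> (?d i) z)"
        using sums_add[OF Bergman_sums[OF c1 g z1] Bergman_sums[OF d1 g z1]] by (simp add: algebra_simps)
      from sums_unique2[OF this Bergman_sums[OF f1 g z1]] show ?thesis
        using Bergman_reproducing[OF f1 fh g z1] by (simp add: algebra_simps)
    qed
    let ?e = "\<lambda>z. f z - Bergman_proj \<gamma> (?c i) z"
    have "LN ?e = LN (Bergman_proj \<gamma> (?d i))"
      by (rule LN_cong[OF holomorphic_measurable_disc[OF Bergman_holomorphic[OF d1 g]] split])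
    also have "\<dots> \<le> ennreal C * LN (?d i)" by (intro C dominated_Bergman d1)
    finally have e: "LN ?e \<le> ennreal C * LN (?d i)" .
    also have "\<dots> < top" using df by (simp add: ennreal_mult_less_top)
    finally have eX: "?e \<in> AX"
      using fh Bergman_holomorphic[OF c1 g] by (auto simp: AX_iff intro!: holomorphic_intros)
    have "\<Lambda> f = \<Lambda> (\<lambda>z. ?e z + Bergman_proj \<gamma> (?c i) z)" by simp
    also have "\<dots> = \<Lambda> ?e + \<Lambda> (Bergman_proj \<gamma> (?c i))" by (rule add[OF eX Bergman_AX[OF ctx]])
    also have "\<Lambda> (Bergman_proj \<gamma> (?c i)) = pairing \<gamma> (?c i) rep" by (rule \<Lambda>_eq_pairing[OF ctx])
    also have "pairing \<gamma> (?c i) rep = pairing \<gamma> f rep - pairing \<gamma> (?d i) rep"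
    proof -
      have "pairing \<gamma> (?c i) rep + pairing \<gamma> (?d i) rep = (\<integral>z. ?c i z * cnj (rep z) * of_real (std_weight \<gamma> z) + ?d i z * cnj (rep z) * of_real (std_weight \<gamma> z) \<partial>dA)"
        unfolding pairing_def by (rule Bochner_Integration.integral_add[symmetric]) (intro pairing_integrable cm dm cf df gm gf)+
      also have "\<dots> = pairing \<gamma> f rep" unfolding pairing_def by (rule Bochner_Integration.integral_cong) auto
      finally show ?thesis by (simp add: algebra_simps)
    qed
    finally have "\<Lambda> f - pairing \<gamma> f rep = \<Lambda> ?e - pairing \<gamma> (?d i) rep" by simp
    then have "cmod (\<Lambda> f - pairing \<gamma> f rep) \<le> cmod (\<Lambda> ?e) + cmod (pairing \<gamma> (?d i) rep)" by (simp add: norm_triangle_ineq4)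
    from ennreal_leI[OF this] have "ennreal (cmod (\<Lambda> f - pairing \<gamma> f rep)) \<le> ennreal (cmod (\<Lambda> ?e)) + ennreal (cmod (pairing \<gamma> (?d i) rep))"
      by (simp only: ennreal_plus norm_ge_zero)
    also have "\<dots> \<le> K * (ennreal C * LN (?d i)) + KH * (LN (?d i) * LN' rep)"
      by (intro add_mono order_trans[OF bound[OF eX] mult_left_mono[OF e]] pairing_le dm gm) auto
    also have "\<dots> = ?L * LN (?d i)" by (simp add: algebra_simps)
    finally show ?thesis .
  qed
  have "?L < top" using K KH_finite gf by (simp add: ennreal_mult_less_top)
  from ennreal_tendsto_cmult[OF this LN_cut_tendsto[OF fm ff]]
  have "(\<lambda>i. ?L * LN (?d i)) \<longlonglongrightarrow> 0" by simp
  then have "ennreal (cmod (\<Lambda> f - pairing \<gamma> f rep)) \<le> 0"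
    by (rule LIMSEQ_le_const) (use bd in blast)
  then show ?thesis by (simp add: ennreal_eq_0_iff)
qed

end

context dual_norms begin

text \<open>Pairings with monomials are the conjugated coefficients, and the power series of the
  projection recovers a function of the space from them.\<close>

lemma pairing_determines:
  assumes f: "f \<in> AY" and h: "h \<in> AY" and eq: "\<And>n. pairing \<gamma> (\<lambda>z. z ^ n) f = pairing \<gamma> (\<lambda>z. z ^ n) h" and z: "z \<in> unit_disc"
  shows "f z = h z"
proof -
  have c: "coef \<gamma> k n = cnj (pairing \<gamma> (\<lambda>z. z ^ n) k)" for k n
    unfolding coef_def pairing_def Bochner_Integration.integral_cnj[symmetric] by (simp add: mult_ac)
  have fz: "(\<lambda>n. of_real (bcoef \<gamma> n) * coef \<gamma> k n * z ^ n) sums k z" if "k \<in> AY" for k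
    using Bergman_sums[OF AY_L1[OF that] g, of z] Bergman_reproducing[OF AY_L1[OF that] _ g, of z] that z by (simp add: AY_iff)
  show ?thesis using sums_unique2[OF fz[OF f]] fz[OF h] by (simp add: c eq)
qed

text \<open>N and M are any functionals comparable with the two mixed norms on the analytic spaces,
  so that the mixed norms and the tent norms are treated at once.\<close>

theorem dual_theorem:
  assumes KN: "0 < KN" "\<And>f. f \<in> AX \<Longrightarrow> N f \<le> ennreal KN * LN f" "\<And>f. f \<in> AX \<Longrightarrow> LN f \<le> ennreal KN * N f"
    and KM: "0 < KM" "\<And>h. h \<in> AY \<Longrightarrow> M h \<le> ennreal KM * LN' h" "\<And>h. h \<in> AY \<Longrightarrow> LN' h \<le> ennreal KM * M h"
  shows "dual_via_pairing \<gamma> AX N AY M"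
proof -
  obtain C where C0: "0 < C" and C: "\<And>f h. dominated f h \<Longrightarrow> LN h \<le> ennreal C * LN f"
    by (rule dominated_bounds, rule that)
  have Xm: "f \<in> disc_measurable" "LN f < top" if "f \<in> AX" for f
    using that holomorphic_measurable_disc by (auto simp: AX_iff)
  have Ym: "f \<in> disc_measurable" "LN' f < top" if "f \<in> AY" for f
    using that holomorphic_measurable_disc by (auto simp: AY_iff)
  have int: "integrable dA (\<lambda>z. f z * cnj (h z) * of_real (std_weight \<gamma> z))" if "f \<in> AX" "h \<in> AY" for f h
    by (rule pairing_integrable[OF Xm[OF that(1)] Ym[OF that(2)]])
  have p_add: "pairing \<gamma> (\<lambda>z. f1 z + f2 z) h = pairing \<gamma> f1 h + pairing \<gamma> f2 h" if "f1 \<in> AX" "f2 \<in> AX" "h \<in> AY" for f1 f2 h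
    using Bochner_Integration.integral_add[OF int[OF that(1,3)] int[OF that(2,3)]] unfolding pairing_def by (simp only: distrib_right)
  have p_scale: "pairing \<gamma> (\<lambda>z. c * f z) h = c * pairing \<gamma> f h" for c f h
    unfolding pairing_def by (simp add: mult.assoc)
  define D where "D = enn2real KH * KN * KM"
  have D0: "0 \<le> D" using KN(1) KM(1) by (simp add: D_def)
  have p_le: "ennreal (cmod (pairing \<gamma> f h)) \<le> ennreal D * M h * N f" if f: "f \<in> AX" and h: "h \<in> AY" for f h
  proof -
    have "ennreal (cmod (pairing \<gamma> f h)) \<le> KH * (LN f * LN' h)" by (rule pairing_le[OF Xm(1)[OF f] Ym(1)[OF h]])
    also have "\<dots> \<le> KH * ((ennreal KN * N f) * (ennreal KM * M h))"
      by (intro mult_left_mono mult_mono KN(3) KM(3) f h) auto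
    also have "\<dots> = ennreal D * M h * N f"
      using KH_finite KN(1) KM(1) by (simp add: D_def ennreal_mult ennreal_enn2real less_imp_le mult_ac)
    finally show ?thesis .
  qed
  have Mfin: "M h < top" if "h \<in> AY" for h
  proof -
    have "M h \<le> ennreal KM * LN' h" by (rule KM(2)[OF that])
    also have "\<dots> < top" using Ym(2)[OF that] by (simp add: ennreal_mult_less_top)
    finally show ?thesis .
  qed
  \<comment> \<open>The norm estimate is kept beside the representation, with the bound K still
    free: for the equivalence of norms K will be a multiple of the functional norm.\<close>
  have repr: "\<exists>h\<in>AY. (\<forall>f\<in>AX. L f = pairing \<gamma> f h) \<and> LN' h \<le> cL' * (ennreal pi * (K * (ennreal C * cL)))"
    if L: "\<And>f h. f \<in> AX \<Longrightarrow> h \<in> AX \<Longrightarrow> L (\<lambda>z. f z + h z) = L f + L h" "\<And>c f. f \<in> AX \<Longrightarrow> L (\<lambda>z. c * f z) = c * L f"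
      "\<And>f. f \<in> AX \<Longrightarrow> ennreal (cmod (L f)) \<le> K * LN f" "K < top" for L K
  proof -
    interpret bounded_on_AX p \<gamma> B w s q \<nu> \<nu>' L K
      using L by unfold_locales
    show ?thesis using rep_AY \<Lambda>_representation rep_norm[OF C] by (intro bexI[of _ rep]) auto
  qed
  define E where "E = max D (KM * ((1 / (2 * pi)) powr (1 / q') * (pi * (KN * (C * (1 / (2 * pi)) powr (1 / q))))))"
  show ?thesis
    unfolding dual_via_pairing_def
  proof (intro conjI ballI allI impI exI[of _ E])
    fix h assume h: "h \<in> AY"
    show "bounded_functional AX N (\<lambda>f. pairing \<gamma> f h)"
      unfolding bounded_functional_def
    proof (intro conjI ballI allI exI[of _ "D * enn2real (M h)"])
      fix f assume f: "f \<in> AX"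
      show "ennreal (cmod (pairing \<gamma> f h)) \<le> ennreal (D * enn2real (M h)) * N f"
        using p_le[OF f h] Mfin[OF h] D0 by (simp add: ennreal_mult ennreal_enn2real)
    qed (auto intro: p_add p_scale h)
  next
    fix L assume L: "bounded_functional AX N L"
    then obtain c where c: "\<And>f. f \<in> AX \<Longrightarrow> ennreal (cmod (L f)) \<le> ennreal c * N f" unfolding bounded_functional_def by blast
    have "\<exists>h\<in>AY. (\<forall>f\<in>AX. L f = pairing \<gamma> f h) \<and> LN' h \<le> cL' * (ennreal pi * ((ennreal c * ennreal KN) * (ennreal C * cL)))"
    proof (rule repr)
      fix f assume f: "f \<in> AX"
      show "ennreal (cmod (L f)) \<le> ennreal c * ennreal KN * LN f"
        using c[OF f] mult_left_mono[OF KN(2)[OF f], of "ennreal c"] by (simp add: mult.assoc)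
    qed (use L in \<open>auto simp: bounded_functional_def ennreal_mult_less_top\<close>)
    then show "\<exists>h\<in>AY. \<forall>f\<in>AX. L f = pairing \<gamma> f h" by blast
  next
    fix h assume h: "h \<in> AY"
    have "functional_norm AX N (\<lambda>f. pairing \<gamma> f h) \<le> ennreal D * M h"
      unfolding functional_norm_def
    proof (rule SUP_least)
      fix f assume f: "f \<in> {f \<in> AX. N f \<le> 1}"
      then have "ennreal (cmod (pairing \<gamma> f h)) \<le> ennreal D * M h * N f" using p_le h by blast
      also have "\<dots> \<le> ennreal D * M h * 1" using f by (intro mult_left_mono) auto
      finally show "ennreal (cmod (pairing \<gamma> f h)) \<le> ennreal D * M h" by simp
    qed
    also have "\<dots> \<le> ennreal E * M h" by (intro mult_right_mono ennreal_leI) (auto simp: E_def)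
    finally show "functional_norm AX N (\<lambda>f. pairing \<gamma> f h) \<le> ennreal E * M h" .
    define \<phi> where "\<phi> = functional_norm AX N (\<lambda>f. pairing \<gamma> f h)"
    have \<phi>: "\<phi> < top"
      using \<open>functional_norm AX N (\<lambda>f. pairing \<gamma> f h) \<le> ennreal D * M h\<close> Mfin[OF h]
      unfolding \<phi>_def by (auto intro: order_le_less_trans simp: ennreal_mult_less_top)
    have le: "ennreal (cmod (pairing \<gamma> f h)) \<le> \<phi> * ennreal KN * LN f" if f: "f \<in> AX" for f
    proof -
      obtain a where a: "0 \<le> a" "LN f = ennreal a" using Xm(2)[OF f] by (cases "LN f") auto
      show ?thesis
      proof (cases "a = 0")
        case True
        then show ?thesis using pairing_le[OF Xm(1)[OF f] Ym(1)[OF h]] a by simp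
      next
        case False
        \<comment> \<open>N is only comparable with a norm and is not assumed homogeneous. Dividing
          f by KN times its mixed norm ensures N \<le> 1, so the scaled function competes in the
          supremum defining the functional norm.\<close>
        define t where "t = KN * a"
        have t: "0 < t" using False a KN(1) by (simp add: t_def)
        let ?f = "\<lambda>z. of_real (1 / t) * f z"
        have fX: "?f \<in> AX" by (rule scale_AX[OF f])
        have "N ?f \<le> ennreal KN * (ennreal (cmod (of_real (1 / t))) * LN f)"
          by (rule order_trans[OF KN(2)[OF fX] mult_left_mono[OF LN_scale_le[OF Xm(1)[OF f]]]]) simp
        also have "cmod (of_real (1 / t)) = 1 / t" using t by (simp add: norm_divide)
        also have "ennreal KN * (ennreal (1 / t) * LN f) = ennreal (KN * (1 / t * a))"
          using t a KN(1) by (simp only: a(2) ennreal_mult less_imp_le zero_le_divide_1_iff mult_nonneg_nonneg)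
        also have "KN * (1 / t * a) = 1" using False KN(1) by (simp add: t_def)
        finally have "ennreal (cmod (pairing \<gamma> ?f h)) \<le> \<phi>"
          unfolding \<phi>_def functional_norm_def using fX by (intro SUP_upper) auto
        then have "ennreal t * ennreal (1 / t * cmod (pairing \<gamma> f h)) \<le> ennreal t * \<phi>"
          unfolding p_scale using t by (intro mult_left_mono) (auto simp: norm_mult norm_divide)
        also have "ennreal t * ennreal (1 / t * cmod (pairing \<gamma> f h)) = ennreal (cmod (pairing \<gamma> f h))"
          using t by (subst ennreal_mult[symmetric]) auto
        also have "ennreal t * \<phi> = \<phi> * ennreal KN * LN f"
          using a KN(1) by (simp only: t_def a(2) ennreal_mult less_imp_le mult_ac)
        finally show ?thesis .
      qed
    qed
    \<comment> \<open>The functional given by h is represented afresh, this time with control of the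
      norm. The new representative k has the same pairings with monomials, hence equals h on the
      disc, and h inherits the estimate.\<close>
    obtain k where k: "k \<in> AY" "\<And>f. f \<in> AX \<Longrightarrow> pairing \<gamma> f h = pairing \<gamma> f k"
      "LN' k \<le> cL' * (ennreal pi * ((\<phi> * ennreal KN) * (ennreal C * cL)))"
      using repr[of "\<lambda>f. pairing \<gamma> f h" "\<phi> * ennreal KN"] p_add[OF _ _ h] p_scale le \<phi> by (auto simp: ennreal_mult_less_top)
    have "h z = k z" if "z \<in> unit_disc" for z
      by (rule pairing_determines[OF h k(1) k(2)[OF monomial_AX] that])
    then have "LN' h = LN' k"
      by (intro dual_norms.LN_cong[OF dual_norms_commute Ym(1)[OF k(1)]]) (unfold_locales, auto)
    with KM(2)[OF h] k(3) have "M h \<le> ennreal KM * (cL' * (ennreal pi * ((\<phi> * ennreal KN) * (ennreal C * cL))))"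
      by (metis mult_left_mono order_trans zero_le)
    also have "\<dots> = ennreal (KM * ((1 / (2 * pi)) powr (1 / q') * (pi * (KN * (C * (1 / (2 * pi)) powr (1 / q)))))) * \<phi>"
      using KM(1) KN(1) C0 by (simp only: ennreal_mult less_imp_le mult_nonneg_nonneg powr_ge_zero pi_ge_zero mult_ac)
    also have "\<dots> \<le> ennreal E * \<phi>" by (intro mult_right_mono ennreal_leI) (auto simp: E_def)
    finally show "M h \<le> ennreal E * functional_norm AX N (\<lambda>f. pairing \<gamma> f h)" by (simp only: \<phi>_def)
  qed (rule int)
qed

end

section \<open>The equivalences\<close>

lemma all_equivalentI:
  assumes "P2 \<Longrightarrow> P1" "P1 \<Longrightarrow> P3" "P7 \<Longrightarrow> P3" "P5 \<Longrightarrow> P3" "P6 \<Longrightarrow> P3" "P3 \<Longrightarrow> P4" "P4 \<Longrightarrow> P2 \<and> P5 \<and> P6 \<and> P7"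
  shows "all_equivalent [P1, P2, P3, P4, P5, P6, P7]"
  using assms unfolding all_equivalent_def by (cases P4) auto

context radial_setting begin

text \<open>The tail of w at 0 is positive, so the condition forces the tail of s at 0 to be finite.
  Then s is finite almost everywhere, \<omega> vanishes only on a null set, and the relation between
  the profiles holds almost everywhere.\<close>

lemma Bcond_dual_norms:
  assumes B: "Bcond B"
  shows "dual_norms p \<gamma> B w s q \<omega>e \<sigma>"
proof -
  have pos: "0 < B" and bk: "\<And>r. r \<in> {0..<1} \<Longrightarrow> epowr (wtail w r) (1 / p) * epowr (wtail s r) (1 / p') \<le> ennreal (B * (1 - r\<^sup>2) powr (\<gamma> + 1))"
    using B by (auto simp: Bcond_def)
  have "wtail s 0 \<noteq> top"
  proof
    assume "wtail s 0 = top"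
    moreover have "epowr (wtail w 0) (1 / p) \<noteq> 0" using w_tail[of 0] by simp
    ultimately show False using bk[of 0] by (simp add: ennreal_mult_top top_unique)
  qed
  then have "AE r in RM. s r * indicator {0..<1} r \<noteq> \<infinity>"
    unfolding wtail_def by (intro nn_integral_PInf_AE) auto
  with AE_RM_range have ws: "AE r in RM. epowr (w r) (1 / p) * epowr (s r) (1 / p') = ennreal (vweight \<gamma> r)"
    by eventually_elim (auto intro!: ws_eq simp: less_top)
  show ?thesis
    using p q g pos w s ws bk \<omega>w \<sigma>s by unfold_locales auto
qed

lemma comparable_norms:
  shows "radial_comparable (L_norm p q \<omega>e) p w" "radial_comparable (T_norm p q \<omega>e) p w"
    and "radial_comparable (L_norm p' q' \<sigma>) p' s" "radial_comparable (T_norm p' q' \<sigma>) p' s"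
  using p q pp qq by (intro radial_comparable_L radial_comparable_T w s \<omega>w \<sigma>s; simp)+

theorem equivalences:
  "all_equivalent
    [bounded_operator \<gamma> (Bergman_proj \<gamma>) (L_space p q \<omega>e) (L_norm p q \<omega>e) (AL_space p q \<omega>e) (L_norm p q \<omega>e),
     bounded_operator \<gamma> (max_Bergman_proj \<gamma>) (L_space p q \<omega>e) (L_norm p q \<omega>e) (L_space p q \<omega>e) (L_norm p q \<omega>e),
     D_const p \<gamma> \<omega> < \<infinity>,
     B_const p \<gamma> \<omega> < \<infinity>,
     dual_via_pairing \<gamma> (AL_space p q \<omega>e) (L_norm p q \<omega>e) (AL_space p' q' \<sigma>) (L_norm p' q' \<sigma>),
     dual_via_pairing \<gamma> (AT_space p q \<omega>e) (T_norm p q \<omega>e) (AT_space p' q' \<sigma>) (T_norm p' q' \<sigma>),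
     bounded_operator \<gamma> (Bergman_proj \<gamma>) (T_space p q \<omega>e) (T_norm p q \<omega>e) (AT_space p q \<omega>e) (T_norm p q \<omega>e)]"
    (is "all_equivalent [?i, ?ii, ?iii, ?iv, ?v, ?vi, ?vii]")
proof -
  have pq: "0 < p" "0 < q" using p q by auto
  have "?i" if "?ii" by (rule bounded_max_imp_bounded_Bergman[OF pq g that])
  moreover have "?iii" if "?i"
    using that bounded_imp_Dcond[OF comparable_norms(1)] unfolding D_const_iff L_space_def by blast
  moreover have "?iii" if "?vii"
    using that bounded_imp_Dcond[OF comparable_norms(2)] unfolding D_const_iff T_space_def by blast
  moreover have "?iii" if "?v"
    using that dual_imp_Dcond[OF comparable_norms(1,3) coef_bounded_L] unfolding D_const_iff AL_space_def L_space_def by blast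
  moreover have "?iii" if "?vi"
    using that dual_imp_Dcond[OF comparable_norms(2,4) coef_bounded_T] unfolding D_const_iff AT_space_def T_space_def by blast
  moreover have "?iv" if "?iii" using that Dcond_imp_Bcond unfolding D_const_iff B_const_iff by blast
  moreover have "?ii \<and> ?v \<and> ?vi \<and> ?vii" if iv: "?iv"
  proof -
    obtain B where B: "Bcond B" using iv unfolding B_const_iff by blast
    interpret N: dual_norms p \<gamma> B w s q \<omega>e \<sigma> by (rule Bcond_dual_norms[OF B])
    interpret N': dual_norms p' \<gamma> B s w q' \<sigma> \<omega>e by (rule dual_norms_commute) unfold_locales
    obtain KN where KN: "0 < KN" "\<And>f. f \<in> AL_space p q \<omega>e \<Longrightarrow> T_norm p q \<omega>e f \<le> ennreal KN * L_norm p q \<omega>e f"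
      "\<And>f. f \<in> AL_space p q \<omega>e \<Longrightarrow> L_norm p q \<omega>e f \<le> ennreal KN * T_norm p q \<omega>e f" using N.AT_norm_equiv by blast
    obtain KM where KM: "0 < KM" "\<And>f. f \<in> AL_space p' q' \<sigma> \<Longrightarrow> T_norm p' q' \<sigma> f \<le> ennreal KM * L_norm p' q' \<sigma> f"
      "\<And>f. f \<in> AL_space p' q' \<sigma> \<Longrightarrow> L_norm p' q' \<sigma> f \<le> ennreal KM * T_norm p' q' \<sigma> f" using N'.AT_norm_equiv by blast
    have "?v" by (rule N.dual_theorem[of 1 _ 1]) auto
    moreover have "?vi" unfolding N.AT_space_eq N'.AT_space_eq by (rule N.dual_theorem[OF KN KM])
    ultimately show ?thesis using N.bounded_max_Bergman_L N.bounded_Bergman_T by blast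
  qed
  ultimately show ?thesis by (rule all_equivalentI)
qed

end

text \<open>The weight is Lebesgue measurable in the plane, which says nothing about its restriction
  to the real axis. A Borel version agrees with it on almost every point of almost every ray;
  radiality lets one such ray define the profile W for all directions.\<close>

lemma radial_setting_exists:
  assumes p: "1 < p" and q: "1 < q" and g: "-1 < \<gamma>"
    and wt: "weight \<omega>" and rad: "radial \<omega>" and tl: "\<forall>z\<in>unit_disc. 0 < weight_tail \<omega> z"
  shows "\<exists>w s. radial_setting p q \<gamma> \<omega> w s"
proof -
  have int: "integrable dA \<omega>" and nonneg: "\<And>z. z \<in> unit_disc \<Longrightarrow> 0 \<le> \<omega> z"
    and radial: "\<And>z. z \<in> unit_disc \<Longrightarrow> \<omega> z = \<omega> (of_real (cmod z))"
    using wt rad unfolding weight_def radial_def by blast+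
  have [measurable]: "\<omega> \<in> borel_measurable dA" using int by auto
  have "(\<lambda>z. complex_of_real (\<omega> z)) \<in> borel_measurable dA" by measurable
  then have "(\<lambda>z. complex_of_real (\<omega> z)) \<in> disc_measurable" by (simp only: measurable_dA_iff)
  then obtain F where F [measurable]: "F \<in> borel_fun" and \<omega>F: "AE z in dA. complex_of_real (\<omega> z) = F z"
    by (rule lebesgue_on_disc_borel_version)
  have "ae_filter TM \<noteq> bot"
  proof -
    have "emeasure TM (space TM) \<noteq> 0" by (simp add: emeasure_TM)
    then show ?thesis by (simp add: ae_filter_eq_bot_iff)
  qed
  from eventually_happens'[OF this AE_dA_polar[OF \<omega>F]]
  obtain t where t: "AE r in RM. complex_of_real (\<omega> (of_real r * cis t)) = F (of_real r * cis t)" by blast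
  define W where "W r = cmod (F (of_real r * cis t))" for r
  have [measurable]: "W \<in> borel_fun" unfolding W_def by measurable
  have W: "AE r in RM. \<omega> (of_real r) = W r"
    using t AE_RM_range
  proof eventually_elim
    case (elim r)
    then have z: "of_real r * cis t \<in> unit_disc" by (simp add: norm_mult)
    have "\<omega> (of_real r) = \<omega> (of_real r * cis t)" using radial[OF z] elim by (simp add: norm_mult)
    also have "\<dots> = cmod (complex_of_real (\<omega> (of_real r * cis t)))" using nonneg[OF z] by simp
    finally show ?case using elim by (simp add: W_def)
  qed
  have Wz: "AE z in dA. \<omega> z = W (cmod z)"
    using AE_RM_imp_AE_dA[OF W] AE_space by eventually_elim (simp add: space_dA radial[symmetric])
  define w where "w r = ennreal (W r)" for r
  define s where "s r = epowr (ennreal (vweight \<gamma> r) / ennreal (W r powr (1 / p))) (conj_exponent p)" for r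
  have wm [measurable]: "w \<in> borel_fun" unfolding w_def by measurable
  have [measurable]: "vweight \<gamma> \<in> borel_fun" unfolding vweight_def[abs_def] by measurable
  have sm [measurable]: "s \<in> borel_fun" unfolding s_def by measurable
  have W0: "0 \<le> W r" for r by (simp add: W_def)
  have cp: "conj_exponent p \<noteq> 0" using conj_exponent(1)[OF p] by simp
  have ew: "epowr (w r) (1 / p) = ennreal (W r powr (1 / p))" for r by (simp add: w_def epowr_ennreal W0)
  have es: "epowr (s r) (1 / conj_exponent p) = ennreal (vweight \<gamma> r) / ennreal (W r powr (1 / p))" for r
    unfolding s_def by (rule epowr_inverse(1)[OF cp])
  have prod: "epowr (w r) (1 / p) * epowr (s r) (1 / conj_exponent p) = (if W r = 0 then 0 else ennreal (vweight \<gamma> r))" for r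
  proof (cases "W r = 0")
    case False
    then have x: "0 < W r powr (1 / p)" by simp
    then have "ennreal (W r powr (1 / p)) * (ennreal (vweight \<gamma> r) / ennreal (W r powr (1 / p))) = ennreal (vweight \<gamma> r)"
      using vweight_nonneg[OF g, of r] by (simp add: divide_ennreal flip: ennreal_mult)
    then show ?thesis using False by (simp add: ew es)
  qed (simp add: ew)
  have "radial_setting p q \<gamma> \<omega> w s"
  proof
    show "1 < p" "1 < q" "-1 < \<gamma>" by fact+
    show "w \<in> borel_fun" "s \<in> borel_fun" by fact+
    show "(\<integral>\<^sup>+r. w r \<partial>RM) < top"
    proof -
      have "(\<integral>\<^sup>+z. ennreal (\<omega> z) \<partial>dA) = (\<integral>\<^sup>+z. w (cmod z) \<partial>dA)"
        using Wz by (intro nn_integral_cong_AE) (auto elim!: eventually_mono simp: w_def)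
      also have "\<dots> = ennreal (1 / pi) * polar_int (\<lambda>t r. w (cmod (of_real r * cis t)))"
        by (rule nn_integral_dA) measurable
      also have "polar_int (\<lambda>t r. w (cmod (of_real r * cis t))) = polar_int (\<lambda>t r. w r)"
        by (rule nn_integral_cong, rule nn_integral_cong_AE, rule eventually_mono[OF AE_RM_range]) (simp add: norm_mult)
      also have "\<dots> = (\<integral>\<^sup>+r. w r \<partial>RM) * ennreal (2 * pi)" by (simp add: emeasure_TM)
      finally have e: "(\<integral>\<^sup>+z. ennreal (\<omega> z) \<partial>dA) = ennreal (1 / pi) * ((\<integral>\<^sup>+r. w r \<partial>RM) * ennreal (2 * pi))" .
      have "AE z in dA. 0 \<le> \<omega> z" using AE_space by eventually_elim (rule nonneg, simp add: space_dA)
      then have "(\<integral>\<^sup>+z. ennreal (\<omega> z) \<partial>dA) < top" using int by (simp add: nn_integral_eq_integral)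
      then show ?thesis unfolding e by (auto simp: ennreal_mult_less_top)
    qed
    show "0 < wtail w r" if r: "r \<in> {0..<1}" for r
    proof (rule ccontr)
      assume "\<not> 0 < wtail w r"
      then have "AE t in RM. w t * indicator {r..<1} t = 0"
        unfolding wtail_def by (subst (asm) not_gr_zero, subst (asm) nn_integral_0_iff_AE) auto
      with W have "AE t in RM. ennreal (\<omega> (of_real t)) * indicator {r..<1} t = 0" by eventually_elim (simp add: w_def)
      then have "AE t in lborel. t \<in> {0<..<1} \<longrightarrow> ennreal (\<omega> (of_real t)) * indicator {r..<1} t = 0" by (simp only: AE_RM)
      \<comment> \<open>\<open>RM\<close> carries no mass at the origin and its density vanishes
        there, whereas \<open>weight_tail\<close> integrates with respect to dr; the single point 0
        is discarded separately.\<close>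
      with AE_lborel_singleton[of 0] have "AE t in lborel. ennreal (\<omega> (of_real t)) * indicator {r..<1} t = 0"
        by eventually_elim (use r in \<open>auto simp: indicator_def\<close>)
      then have "(\<integral>\<^sup>+t\<in>{r..<1}. ennreal (\<omega> (of_real t)) \<partial>lborel) = (\<integral>\<^sup>+t. 0 \<partial>(lborel :: real measure))" by (rule nn_integral_cong_AE)
      moreover have "weight_tail \<omega> (of_real r) = (\<integral>\<^sup>+t\<in>{r..<1}. ennreal (\<omega> (of_real t)) \<partial>lborel)"
        using r unfolding weight_tail_def by (simp add: nn_integral_completion)
      ultimately show False using tl[rule_format, of "of_real r"] r by simp
    qed
    show "epowr (w r) (1 / p) * epowr (s r) (1 / conj_exponent p) \<le> ennreal (vweight \<gamma> r)" for r
      by (simp add: prod)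
    show "epowr (w r) (1 / p) * epowr (s r) (1 / conj_exponent p) = ennreal (vweight \<gamma> r)" if r: "r \<in> {0<..<1}" "s r < top" for r
    proof -
      have "W r \<noteq> 0"
      proof
        assume "W r = 0"
        then have "s r = top" using vweight_pos[OF g r(1)] by (simp add: s_def ennreal_divide_zero)
        then show False using r(2) by simp
      qed
      then show ?thesis by (simp add: prod)
    qed
    show "AE r in RM. ennreal (\<omega> (of_real r)) = w r" using W by eventually_elim (simp add: w_def)
    show "AE z in dA. ennreal (\<omega> z) = w (cmod z)" using Wz by eventually_elim (simp add: w_def)
    show "AE r in RM. dual_weight \<gamma> \<omega> p (of_real r) = s r"
      using W by eventually_elim (simp add: dual_weight_def s_def std_weight_eq vweight_def)
    show "AE z in dA. dual_weight \<gamma> \<omega> p z = s (cmod z)"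
      using Wz by eventually_elim (simp add: dual_weight_def s_def std_weight_eq)
  qed
  then show ?thesis by blast
qed

theorem theorem1p9:
  fixes p q \<gamma> :: real and \<omega> :: "complex \<Rightarrow> real"
  defines "p' \<equiv> conj_exponent p" and "q' \<equiv> conj_exponent q"
    and "\<sigma> \<equiv> dual_weight \<gamma> \<omega> p" and "\<omega>e \<equiv> (\<lambda>z. ennreal (\<omega> z))"
  assumes "1 < p" and "1 < q" and "-1 < \<gamma>"
    and "weight \<omega>" and "radial \<omega>" and "\<forall>z\<in>unit_disc. 0 < weight_tail \<omega> z"
  shows "all_equivalent
    [bounded_operator \<gamma> (Bergman_proj \<gamma>)
       (L_space p q \<omega>e) (L_norm p q \<omega>e) (AL_space p q \<omega>e) (L_norm p q \<omega>e),
     bounded_operator \<gamma> (max_Bergman_proj \<gamma>)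
       (L_space p q \<omega>e) (L_norm p q \<omega>e) (L_space p q \<omega>e) (L_norm p q \<omega>e),
     D_const p \<gamma> \<omega> < \<infinity>,
     B_const p \<gamma> \<omega> < \<infinity>,
     dual_via_pairing \<gamma>
       (AL_space p q \<omega>e) (L_norm p q \<omega>e) (AL_space p' q' \<sigma>) (L_norm p' q' \<sigma>),
     dual_via_pairing \<gamma>
       (AT_space p q \<omega>e) (T_norm p q \<omega>e) (AT_space p' q' \<sigma>) (T_norm p' q' \<sigma>),
     bounded_operator \<gamma> (Bergman_proj \<gamma>)
       (T_space p q \<omega>e) (T_norm p q \<omega>e) (AT_space p q \<omega>e) (T_norm p q \<omega>e)]"
proof -
  obtain w s where "radial_setting p q \<gamma> \<omega> w s"
    using radial_setting_exists assms by blast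
  then show ?thesis
    unfolding assms(1-4) by (rule radial_setting.equivalences)
qed

end
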